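(* Let $k,\ell$ be integers with $k\geq 3$ and $k/2\leq\ell\leq k-1$, and let $\epsilon>0$. Then there exists $n_0$ such that the following holds. Let $\mathcal{H}_1,\ldots,\mathcal{H}_{n/k}$ be $k$-graphs on a vertex set $V$ with $|V|=n\geq n_0$ and $n\in k\mathbb{N}$, and let $\mathcal{T}=\mathcal{T}(\mathcal{H}_1,\ldots,\mathcal{H}_{n/k})$. If $\mathcal{T}$ is not $\epsilon$-close to $\mathcal{T}_{ext}$ and $\delta_\ell(\mathcal{H}_i)>\delta(n,k,\ell)$ for every $1\leq i\leq n/k$, then $\mathcal{T}$ contains a perfect matching.
   Context: A $k$-graph on $V$ is a family $\mathcal{H}\subseteq\binom{V}{k}$. For $S\in\binom{V}{\ell}$, $\deg_{\mathcal{H}}(S)=|\{T: S\cup T\in\mathcal{H}\}|$ and $\delta_\ell(\mathcal{H})=\min_{S\in\binom{V}{\ell}}\deg_{\mathcal{H}}(S)$. For a partition $V=A\cup B$, $\mathcal{H}^0(A,B)$ (resp. $\mathcal{H}^1(A,B)$) is the $k$-graph of all $k$-subsets of $V$ meeting $A$ in an even (resp. odd) number of vertices. For $n=|V|\in k\mathbb{N}$, $ext(n,k)=\{\mathcal{H}^i(A,B): i\in\{0,1\}, A\cup B=V \text{ a partition}, in/k \text{ and } |A| \text{ of different parity}\}$ and $\delta(n,k,\ell)=\max_{\mathcal{H}\in ext(n,k)}\delta_\ell(\mathcal{H})$. $\mathcal{H}_{ext}$ denotes a fixed member $\mathcal{H}^i(A,B)$ of $ext(n,k)$ attaining $\delta_\ell(\mathcal{H}_{ext})=\delta(n,k,\ell)$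 with $-1\leq|A|-|B|\leq 1$ (such a member exists). Given $k$-graphs $\mathcal{H}_1,\ldots,\mathcal{H}_{n/k}$ on $V$, $\mathcal{T}(\mathcal{H}_1,\ldots,\mathcal{H}_{n/k})$ is the $(k+1)$-graph with vertex set $X\cup V$, where $X=\{x_1,\ldots,x_{n/k}\}$ is a set of new vertices, and edge set $\bigcup_{i}\{\{x_i\}\cup E: E\in\mathcal{H}_i\}$; and $\mathcal{T}_{ext}=\mathcal{T}(\mathcal{H}_{ext},\ldots,\mathcal{H}_{ext})$ ($n/k$ copies). An $r$-graph $\mathcal{H}$ is $\epsilon$-close to an $r$-graph $\mathcal{H}'$ on the same vertex set if $\mathcal{H}$ can be made into a copy of $\mathcal{H}'$ by adding and deleting at most $\epsilon|V(\mathcal{H})|^r$ edges.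
   Formalization: A member of ext(n,k) attaining δ(n,k,ℓ) with -1≤|A|-|B|≤1 need not exist (k=3, 12|n forces |A| odd, but balance needs |A|=n/2, even); so H_ext is any maximiser, required to be balanced whenever some maximiser is balanced, and the result holds for every such choice. *)

theory Defs
  imports Complex_Main "HOL-Library.Ramsey"
begin

text \<open>Hypergraphs are given by their edge sets; the vertex set is passed separately where it
  matters. The set of \<open>k\<close>-subsets of \<open>V\<close> is \<open>[V]\<^bsup>k\<^esup>\<close> (\<^const>\<open>nsets\<close>).\<close>

definition kgraph_on :: "'a set \<Rightarrow> nat \<Rightarrow> 'a set set \<Rightarrow> bool" where
  "kgraph_on V k H \<longleftrightarrow> H \<subseteq> [V]\<^bsup>k\<^esup>"

text \<open>\<open>T\<close> is required to be disjoint from \<open>S\<close>, so that every edge containing \<open>S\<close> is counted once.\<close>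

definition hdeg :: "'a set set \<Rightarrow> 'a set \<Rightarrow> nat" where
  "hdeg H S = card {T. S \<inter> T = {} \<and> S \<union> T \<in> H}"

definition min_deg :: "'a set \<Rightarrow> nat \<Rightarrow> 'a set set \<Rightarrow> nat" where
  "min_deg V l H = Min (hdeg H ` [V]\<^bsup>l\<^esup>)"

definition parity_graph :: "nat \<Rightarrow> nat \<Rightarrow> 'a set \<Rightarrow> 'a set \<Rightarrow> 'a set set" where
  "parity_graph k i A B = {e \<in> [A \<union> B]\<^bsup>k\<^esup>. card (e \<inter> A) mod 2 = i}"

definition ext_triple :: "'a set \<Rightarrow> nat \<Rightarrow> nat \<Rightarrow> 'a set \<Rightarrow> 'a set \<Rightarrow> bool" where
  "ext_triple V k i A B \<longleftrightarrow>
     i \<in> {0, 1} \<and> A \<union> B = V \<and> A \<inter> B = {} \<and>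
     (i * (card V div k)) mod 2 \<noteq> card A mod 2"

definition ext_graphs :: "'a set \<Rightarrow> nat \<Rightarrow> 'a set set set" where
  "ext_graphs V k = {parity_graph k i A B | i A B. ext_triple V k i A B}"

text \<open>This is \<open>\<delta>(n,k,l)\<close> for \<open>n = card V\<close>; its value depends on \<open>V\<close> only through \<open>n\<close>.\<close>

definition ext_delta :: "'a set \<Rightarrow> nat \<Rightarrow> nat \<Rightarrow> nat" where
  "ext_delta V k l = Max (min_deg V l ` ext_graphs V k)"

definition max_triple :: "'a set \<Rightarrow> nat \<Rightarrow> nat \<Rightarrow> nat \<Rightarrow> 'a set \<Rightarrow> 'a set \<Rightarrow> bool" where
  "max_triple V k l i A B \<longleftrightarrow>
     ext_triple V k i A B \<and> min_deg V l (parity_graph k i A B) = ext_delta V k l"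

definition balanced :: "'a set \<Rightarrow> 'a set \<Rightarrow> bool" where
  "balanced A B \<longleftrightarrow>
     -1 \<le> int (card A) - int (card B) \<and> int (card A) - int (card B) \<le> 1"

text \<open>The admissible choices of \<open>H\<^sub>e\<^sub>x\<^sub>t\<close>: members of \<^const>\<open>ext_graphs\<close> of maximum minimum
  \<open>l\<close>-degree, coming from a balanced partition. A balanced maximiser need not exist
  (for \<open>k = 4\<close>, \<open>l = 2\<close>, \<open>n = 40\<close> every maximiser has part sizes 17 and 23), so balancedness is
  demanded whenever some maximiser has it.\<close>

definition is_Hext :: "'a set \<Rightarrow> nat \<Rightarrow> nat \<Rightarrow> 'a set set \<Rightarrow> bool" where
  "is_Hext V k l H \<longleftrightarrow>
     (\<exists>i A B. H = parity_graph k i A B \<and> max_triple V k l i A B \<and>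
        ((\<exists>i' A' B'. max_triple V k l i' A' B' \<and> balanced A' B') \<longrightarrow> balanced A B))"

text \<open>The new vertices \<open>x\<^sub>1, \<dots>, x\<^sub>m\<close> are \<open>Inl 1, \<dots>, Inl m\<close>.\<close>

definition T_verts :: "nat \<Rightarrow> 'a set \<Rightarrow> (nat + 'a) set" where
  "T_verts m V = Inl ` {1..m} \<union> Inr ` V"

definition T_graph :: "nat \<Rightarrow> (nat \<Rightarrow> 'a set set) \<Rightarrow> (nat + 'a) set set" where
  "T_graph m H = (\<Union>i\<in>{1..m}. {{Inl i} \<union> Inr ` e | e. e \<in> H i})"

definition hcopy_on :: "'b set \<Rightarrow> 'b set set \<Rightarrow> 'b set set \<Rightarrow> bool" where
  "hcopy_on W H K \<longleftrightarrow> (\<exists>\<phi>. bij_betw \<phi> W W \<and> K = (`) \<phi> ` H)"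

definition eps_close :: "nat \<Rightarrow> real \<Rightarrow> 'b set \<Rightarrow> 'b set set \<Rightarrow> 'b set set \<Rightarrow> bool" where
  "eps_close r \<epsilon> W H H' \<longleftrightarrow>
     (\<exists>K. hcopy_on W H' K \<and> real (card (sym_diff H K)) \<le> \<epsilon> * real (card W) ^ r)"

definition has_perfect_matching :: "'b set \<Rightarrow> 'b set set \<Rightarrow> bool" where
  "has_perfect_matching W H \<longleftrightarrow> (\<exists>M \<subseteq> H. pairwise disjnt M \<and> \<Union>M = W)"

end

theory Submission
  imports Defs "HOL-Library.Multiset" "HOL-Library.Disjoint_Sets"
begin

text \<open>Write \<open>m = n / k\<close> and \<open>r = k - l\<close>. A partition with two almost equal parts shows that \<open>\<delta>(n,k,l)\<close>
  is at least about half of all \<open>r\<close>-sets, so every \<open>l\<close>-set has at least about half of all possible neighbours in every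
  colour. Under this condition a partition of \<open>V\<close> into coloured \<open>k\<close>-sets with the largest number of
  edges has at most \<open>k\<close> non-edges: given \<open>k + 1\<close> of them, an exchange with \<open>r\<close> random blocks increases
  the number of edges, unless \<open>2 r = k\<close> and nearly all \<open>r\<close>-tuples of blocks behave as a dictator
  function, in which case two such tuples sharing all but the dictating block can be exchanged.

  Call two vertices exchangeable if a positive proportion of all bounded-size tuples of colours and
  vertices can be perfectly matched together with either one of them. If all pairs are exchangeable,
  then every set of one colour and \<open>k\<close> vertices has many absorbers. As there are only polynomially many
  such sets, \<open>O(log n)\<close> absorbers chosen greedily suffice, and the almost perfect matching can be
  completed. Otherwise consider the links of vertices: since each has density about one half, among any
  three some two intersect substantially. Hence \<open>V\<close> splits into parts \<open>A\<close> and \<open>V - A\<close> of almost equal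
  size such that links agree within a part and are complementary across, which means that every colour
  is close to one of the two parity graphs of \<open>A\<close>.

  In that case, correct the few atypical vertices and colours and cover them greedily. A partition into
  sets of the right parities that maximises the number of edges has no non-edge, by another exchange.
  The only obstruction is a wrong total parity. It is removed by one edge of the wrong parity, which
  exists because the degrees exceed \<open>\<delta>(n,k,l)\<close>: if there is none, then the colours lie in parity graphs
  of a partition that is either extremal itself or becomes extremal, with no smaller minimum degree, on
  moving one vertex.\<close>

subsection \<open>Counting lists\<close>

text \<open>Everything is counted over ordered tuples with repetition: their numbers are exact
  powers, sums over concatenations factor, and tuples with a repetition or hitting a bounded set
  make up only O(1/n) of all. Why \<open>k + 1\<close> non-edges and \<open>r\<close> blocks: cut
  the \<open>r\<close> blocks into \<open>k\<close> disjoint transversals and combine these with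
  \<open>l\<close>-subsets of \<open>k\<close> of the bad blocks. About half of such combinations
  are edges, so \<open>k / 2\<close> on average, whereas maximality permits at most
  \<open>r\<close>, because \<open>r\<close> blocks are given up. Since \<open>l\<close> is at least
  \<open>k / 2\<close>, \<open>r\<close> is at most \<open>k / 2\<close>, and only
  \<open>2 r = k\<close> survives. There the bound is attained almost everywhere; the spare bad
  colour shows that the colours agree, and the constant sum leaves only a dictator. The other
  obstacle is parity: if the edges of each colour \<open>x\<close> meet \<open>A\<close> in a number
  of vertices of parity \<open>t x\<close>, then the parity of \<open>A\<close> must be that of the
  number of odd colours. No exchange within the parity graphs changes this, so the correcting edge
  is set aside before the completion starts.\<close>

definition nlists :: "'a set \<Rightarrow> nat \<Rightarrow> 'a list set" where
  "nlists V j = {xs. set xs \<subseteq> V \<and> length xs = j}"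

lemma finite_nlists [simp]: "finite V \<Longrightarrow> finite (nlists V j)"
  unfolding nlists_def by (rule finite_lists_length_eq)

lemma card_nlists: "finite V \<Longrightarrow> card (nlists V j) = card V ^ j"
  unfolding nlists_def by (rule card_lists_length_eq)

lemma nlists_0 [simp]: "nlists V 0 = {[]}"
  by (auto simp: nlists_def)

lemma nlists_Suc: "nlists V (Suc j) = (\<lambda>(v, S). v # S) ` (V \<times> nlists V j)"
proof -
  have "xs \<in> (\<lambda>(v, S). v # S) ` (V \<times> nlists V j)" if "xs \<in> nlists V (Suc j)" for xs
    using that by (cases xs) (auto simp: nlists_def)
  then show ?thesis by (auto simp: nlists_def)
qed

lemma length_nlists: "xs \<in> nlists V j \<Longrightarrow> length xs = j"
  by (simp add: nlists_def)

lemma set_nlists: "xs \<in> nlists V j \<Longrightarrow> set xs \<subseteq> V"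
  by (simp add: nlists_def)

lemma nlists_mono: "A \<subseteq> B \<Longrightarrow> nlists A j \<subseteq> nlists B j"
  by (auto simp: nlists_def)

lemma append_in_nlists: "xs \<in> nlists V i \<Longrightarrow> ys \<in> nlists V j \<Longrightarrow> xs @ ys \<in> nlists V (i + j)"
  by (auto simp: nlists_def)

lemma sum_nlists_Suc:
  "sum f (nlists V (Suc j)) = (\<Sum>v\<in>V. \<Sum>S\<in>nlists V j. f (v # S))"
proof -
  have "inj_on (\<lambda>(v, S). v # S) (V \<times> nlists V j)" by (auto simp: inj_on_def)
  then show ?thesis
    by (simp add: nlists_Suc sum.reindex sum.cartesian_product case_prod_unfold)
qed

lemma nlists_append: "nlists V (i + j) = (\<lambda>(xs, ys). xs @ ys) ` (nlists V i \<times> nlists V j)"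
proof -
  have "xs \<in> (\<lambda>(xs, ys). xs @ ys) ` (nlists V i \<times> nlists V j)" if "xs \<in> nlists V (i + j)" for xs
  proof -
    have "(take i xs, drop i xs) \<in> nlists V i \<times> nlists V j"
      using that by (auto simp: nlists_def dest: in_set_takeD in_set_dropD)
    moreover have "xs = (\<lambda>(xs, ys). xs @ ys) (take i xs, drop i xs)" by simp
    ultimately show ?thesis by blast
  qed
  then show ?thesis by (auto simp: append_in_nlists)
qed

lemma sum_nlists_append:
  "sum f (nlists V (i + j)) = (\<Sum>S\<in>nlists V i. \<Sum>T\<in>nlists V j. f (S @ T))"
proof -
  have "inj_on (\<lambda>(S, T). S @ T) (nlists V i \<times> nlists V j)"
    by (auto simp: inj_on_def nlists_def)
  then show ?thesis
    by (simp add: nlists_append sum.reindex sum.cartesian_product case_prod_unfold)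
qed

lemma card_nlists_Suc_filter:
  assumes "finite V"
  shows "card {e \<in> nlists V (Suc j). P e} = (\<Sum>v\<in>V. card {S \<in> nlists V j. P (v # S)})"
proof -
  have "card {e \<in> nlists V (Suc j). P e} = (\<Sum>e\<in>nlists V (Suc j). of_bool (P e))"
    using assms by (simp add: sum.If_cases Int_def of_bool_def)
  also have "\<dots> = (\<Sum>v\<in>V. \<Sum>S\<in>nlists V j. of_bool (P (v # S)))"
    by (rule sum_nlists_Suc)
  also have "\<dots> = (\<Sum>v\<in>V. card {S \<in> nlists V j. P (v # S)})"
    using assms by (simp add: sum.If_cases Int_def of_bool_def)
  finally show ?thesis .
qed

lemma card_nlists_append_filter:
  assumes "finite V"
  shows "card {e \<in> nlists V (i + j). P e} = (\<Sum>S\<in>nlists V i. card {T \<in> nlists V j. P (S @ T)})"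
proof -
  have "card {e \<in> nlists V (i + j). P e} = (\<Sum>e\<in>nlists V (i + j). of_bool (P e))"
    using assms by (simp add: sum.If_cases Int_def of_bool_def)
  also have "\<dots> = (\<Sum>v\<in>nlists V i. \<Sum>S\<in>nlists V j. of_bool (P (v @ S)))"
    by (rule sum_nlists_append)
  also have "\<dots> = (\<Sum>v\<in>nlists V i. card {S \<in> nlists V j. P (v @ S)})"
    using assms by (simp add: sum.If_cases Int_def of_bool_def)
  finally show ?thesis .
qed

text \<open>Union bound over the position of an entry in \<open>F\<close>. The extra factor
  \<open>card V\<close> keeps the estimate inside the natural numbers.\<close>

lemma card_nlists_meeting:
  assumes "finite V" "finite F"
  shows "card {e \<in> nlists V j. set e \<inter> F \<noteq> {}} * card V \<le> j * card F * card V ^ j"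
proof (induction j)
  case 0
  then show ?case by (simp add: card_eq_0_iff)
next
  case (Suc j)
  let ?n = "card V"
  have "{e \<in> nlists V (Suc j). set e \<inter> F \<noteq> {}}
     \<subseteq> (\<lambda>(v, S). v # S) ` (F \<times> nlists V j) \<union> (\<lambda>(v, S). v # S) ` (V \<times> {e \<in> nlists V j. set e \<inter> F \<noteq> {}})"
    (is "_ \<subseteq> ?A \<union> ?B") by (auto simp: nlists_Suc image_iff)
  then have "card {e \<in> nlists V (Suc j). set e \<inter> F \<noteq> {}} \<le> card (?A \<union> ?B)"
    using assms by (intro card_mono) auto
  also have "\<dots> \<le> card ?A + card ?B" by (rule card_Un_le)
  also have "card ?A \<le> card F * ?n ^ j"
    using card_image_le[of "F \<times> nlists V j" "\<lambda>(v, S). v # S"] assms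
    by (simp add: card_cartesian_product card_nlists)
  also have "card ?B \<le> ?n * card {e \<in> nlists V j. set e \<inter> F \<noteq> {}}"
    using card_image_le[of "V \<times> {e \<in> nlists V j. set e \<inter> F \<noteq> {}}" "\<lambda>(v, S). v # S"] assms
    by (simp add: card_cartesian_product)
  finally have "card {e \<in> nlists V (Suc j). set e \<inter> F \<noteq> {}} * ?n
      \<le> (card F * ?n ^ j + ?n * card {e \<in> nlists V j. set e \<inter> F \<noteq> {}}) * ?n" by simp
  also have "\<dots> = card F * ?n ^ Suc j + ?n * (card {e \<in> nlists V j. set e \<inter> F \<noteq> {}} * ?n)"
    by (simp add: algebra_simps)
  also have "\<dots> \<le> card F * ?n ^ Suc j + ?n * (j * card F * ?n ^ j)"
    by (rule add_left_mono[OF mult_le_mono2[OF Suc.IH]])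
  also have "\<dots> = Suc j * card F * ?n ^ Suc j" by (simp add: algebra_simps)
  finally show ?case .
qed

lemma card_nlists_meeting_real:
  assumes "finite V" "finite F" "V \<noteq> {}"
  shows "real (card {e \<in> nlists V j. set e \<inter> F \<noteq> {}}) \<le> real j * real (card F) / real (card V) * real (card V) ^ j"
proof -
  have "card V > 0" using assms by (simp add: card_gt_0_iff)
  moreover have "real (card {e \<in> nlists V j. set e \<inter> F \<noteq> {}} * card V) \<le> real (j * card F * card V ^ j)"
    using card_nlists_meeting[OF assms(1,2)] by (rule of_nat_mono)
  ultimately show ?thesis by (simp add: field_simps)
qed

lemma card_nlists_not_distinct:
  assumes "finite V"
  shows "card {e \<in> nlists V j. \<not> distinct e} * card V \<le> j * j * card V ^ j"
proof (induction j)
  case 0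
  then show ?case by (simp add: card_eq_0_iff)
next
  case (Suc j)
  let ?n = "card V"
  have "{e \<in> nlists V (Suc j). \<not> distinct e}
     \<subseteq> (\<lambda>(S, v). v # S) ` (SIGMA S : nlists V j. set S) \<union> (\<lambda>(v, S). v # S) ` (V \<times> {e \<in> nlists V j. \<not> distinct e})"
    (is "_ \<subseteq> ?A \<union> ?B") by (auto simp: nlists_Suc image_iff)
  then have "card {e \<in> nlists V (Suc j). \<not> distinct e} \<le> card (?A \<union> ?B)"
    using assms by (intro card_mono) auto
  also have "\<dots> \<le> card ?A + card ?B" by (rule card_Un_le)
  also have "card ?A \<le> card (SIGMA S : nlists V j. set S)"
    using assms by (intro card_image_le) auto
  also have "\<dots> = (\<Sum>S\<in>nlists V j. card (set S))"
    using assms by simp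
  also have "\<dots> \<le> (\<Sum>S\<in>nlists V j. j)"
    by (intro sum_mono) (metis card_length length_nlists)
  also have "\<dots> = j * ?n ^ j" using assms by (simp add: card_nlists)
  also have "card ?B \<le> ?n * card {e \<in> nlists V j. \<not> distinct e}"
    using card_image_le[of "V \<times> {e \<in> nlists V j. \<not> distinct e}" "\<lambda>(v, S). v # S"] assms
    by (simp add: card_cartesian_product)
  finally have "card {e \<in> nlists V (Suc j). \<not> distinct e} * ?n
      \<le> (j * ?n ^ j + ?n * card {e \<in> nlists V j. \<not> distinct e}) * ?n" by simp
  also have "\<dots> = j * ?n ^ Suc j + ?n * (card {e \<in> nlists V j. \<not> distinct e} * ?n)"
    by (simp add: algebra_simps)
  also have "\<dots> \<le> j * ?n ^ Suc j + ?n * (j * j * ?n ^ j)"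
    by (rule add_left_mono[OF mult_le_mono2[OF Suc.IH]])
  also have "\<dots> = (j + j * j) * ?n ^ Suc j" by (simp only: power_Suc algebra_simps)
  also have "\<dots> \<le> Suc j * Suc j * ?n ^ Suc j" by (intro mult_le_mono1) simp
  finally show ?case .
qed

lemma card_nlists_not_distinct_real:
  assumes "finite V" "V \<noteq> {}"
  shows "real (card {e \<in> nlists V j. \<not> distinct e}) \<le> real (j * j) / real (card V) * real (card V) ^ j"
proof -
  have "card V > 0" using assms by (simp add: card_gt_0_iff)
  moreover have "real (card {e \<in> nlists V j. \<not> distinct e} * card V) \<le> real (j * j * card V ^ j)"
    using card_nlists_not_distinct[OF assms(1)] by (rule of_nat_mono)
  ultimately show ?thesis by (simp add: field_simps)
qed

text \<open>Counting with multiplicity makes the parity additive under concatenation; on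
  repetition-free lists it is the parity of the intersection with \<open>A\<close>.\<close>

definition npar :: "'a set \<Rightarrow> 'a list \<Rightarrow> bool" where
  "npar A e \<longleftrightarrow> odd (length (filter (\<lambda>v. v \<in> A) e))"

lemma npar_Nil [simp]: "\<not> npar A []"
  by (simp add: npar_def)

lemma npar_Cons [simp]: "npar A (v # e) \<longleftrightarrow> (v \<in> A) \<noteq> npar A e"
  by (auto simp: npar_def)

lemma npar_append [simp]: "npar A (e @ f) \<longleftrightarrow> npar A e \<noteq> npar A f"
  by (induction e) auto

lemma npar_distinct: "distinct e \<Longrightarrow> npar A e \<longleftrightarrow> odd (card (set e \<inter> A))"
  unfolding npar_def by (metis Int_commute distinct_card distinct_filter inter_set_filter)

lemma npar_cong: "(\<And>v. v \<in> set e \<Longrightarrow> v \<in> A \<longleftrightarrow> v \<in> B) \<Longrightarrow> npar A e \<longleftrightarrow> npar B e"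
  by (induction e) auto

text \<open>The sign is a product over the entries, so the sum is the \<open>j\<close>-th power of
  the sum over a single entry.\<close>

lemma sum_sign_npar:
  assumes "finite V" "A \<subseteq> V"
  shows "(\<Sum>e\<in>nlists V j. if npar A e then -1 else (1::real)) = (real (card (V - A)) - real (card A)) ^ j"
proof (induction j)
  case 0
  then show ?case by simp
next
  case (Suc j)
  let ?s = "\<lambda>e. if npar A e then -1 else (1::real)"
  have "(\<Sum>e\<in>nlists V (Suc j). ?s e) = (\<Sum>v\<in>V. \<Sum>S\<in>nlists V j. (if v \<in> A then -1 else 1) * ?s S)"
    unfolding sum_nlists_Suc by (intro sum.cong) auto
  also have "\<dots> = (\<Sum>v\<in>V. (if v \<in> A then -1 else 1)) * (\<Sum>S\<in>nlists V j. ?s S)"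
    by (simp add: sum_product)
  also have "(\<Sum>v\<in>V. (if v \<in> A then -1 else (1::real))) = real (card (V - A)) - real (card A)"
    using assms by (simp add: sum.If_cases Int_absorb1 Diff_eq)
  finally show ?case using Suc by simp
qed

text \<open>Used in both directions: a small imbalance gives density near one half, and a density
  near one half bounds the imbalance.\<close>

lemma card_npar:
  assumes "finite V" "A \<subseteq> V"
  shows "2 * real (card {e \<in> nlists V j. npar A e \<longleftrightarrow> b})
     = real (card V) ^ j + (if b then -1 else 1) * (real (card (V - A)) - real (card A)) ^ j"
proof -
  let ?p = "real (card {e \<in> nlists V j. npar A e})"
  let ?q = "real (card {e \<in> nlists V j. \<not> npar A e})"
  have "nlists V j = {e \<in> nlists V j. npar A e} \<union> {e \<in> nlists V j. \<not> npar A e}" by auto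
  then have "card (nlists V j) = card {e \<in> nlists V j. npar A e} + card {e \<in> nlists V j. \<not> npar A e}"
    using assms by (metis (no_types, lifting) Int_emptyI card_Un_disjoint finite_Un finite_nlists mem_Collect_eq)
  then have 1: "?p + ?q = real (card V) ^ j"
    using assms by (simp add: card_nlists flip: of_nat_add of_nat_power)
  have "(\<Sum>e\<in>nlists V j. if npar A e then -1 else (1::real)) = ?q - ?p"
    using assms by (simp add: sum.If_cases Int_def)
  then have 2: "?q - ?p = (real (card (V - A)) - real (card A)) ^ j"
    using sum_sign_npar[OF assms] by simp
  show ?thesis using 1 2 by (cases b) auto
qed

subsection \<open>Rainbow perfect matchings\<close>

text \<open>A perfect matching of the (k+1)-graph assigns to each colour the \<open>k\<close>-set of
  its edge. Being an edge is left out here, so that partitions with some non-edges can be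
  compared.\<close>

definition blocks :: "nat \<Rightarrow> 'c set \<Rightarrow> 'a set \<Rightarrow> ('c \<Rightarrow> 'a set) \<Rightarrow> bool" where
  "blocks k X V P \<longleftrightarrow>
     (\<forall>x\<in>X. P x \<subseteq> V \<and> card (P x) = k) \<and> disjoint_family_on P X \<and> (\<Union>x\<in>X. P x) = V"

definition rpm :: "nat \<Rightarrow> ('c \<Rightarrow> 'a set set) \<Rightarrow> 'c set \<Rightarrow> 'a set \<Rightarrow> bool" where
  "rpm k H X V \<longleftrightarrow> (\<exists>P. blocks k X V P \<and> (\<forall>x\<in>X. P x \<in> H x))"

lemma rpm_empty [simp]: "rpm k H {} {}"
  by (simp add: rpm_def blocks_def disjoint_family_on_def)

lemma rpm_single: "e \<in> H x \<Longrightarrow> card e = k \<Longrightarrow> rpm k H {x} e"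
  unfolding rpm_def blocks_def by (rule exI[of _ "\<lambda>_. e"]) (simp add: disjoint_family_on_def)

lemma rpm_Un:
  assumes "rpm k H X V" "rpm k H X' V'" "X \<inter> X' = {}" "V \<inter> V' = {}"
  shows "rpm k H (X \<union> X') (V \<union> V')"
proof -
  obtain P where P: "blocks k X V P" "\<forall>x\<in>X. P x \<in> H x" using assms(1) by (auto simp: rpm_def)
  obtain P' where P': "blocks k X' V' P'" "\<forall>x\<in>X'. P' x \<in> H x" using assms(2) by (auto simp: rpm_def)
  define Q where "Q x = (if x \<in> X then P x else P' x)" for x
  have Q: "\<And>x. x \<in> X \<Longrightarrow> Q x = P x" "\<And>x. x \<in> X' \<Longrightarrow> Q x = P' x"
    using assms(3) by (auto simp: Q_def)
  have "disjoint_family_on Q (X \<union> X')"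
    unfolding disjoint_family_on_def
  proof (intro ballI impI)
    fix x y assume xy: "x \<in> X \<union> X'" "y \<in> X \<union> X'" "x \<noteq> y"
    show "Q x \<inter> Q y = {}"
      using P(1) P'(1) xy assms(4) Q unfolding blocks_def disjoint_family_on_def
      by (smt (verit) Int_commute Un_iff disjoint_iff subsetD)
  qed
  moreover have "(\<Union>x\<in>X \<union> X'. Q x) = V \<union> V'"
    using P(1) P'(1) Q unfolding blocks_def by auto
  ultimately have "blocks k (X \<union> X') (V \<union> V') Q"
    using P(1) P'(1) Q unfolding blocks_def by auto
  moreover have "\<forall>x\<in>X \<union> X'. Q x \<in> H x" using P(2) P'(2) Q by auto
  ultimately show ?thesis unfolding rpm_def by blast
qed

text \<open>Multisets of colours and of vertices are used so that compositions of partial matchings need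
  no disjointness side conditions; disjointness is only required at the very end, in
  \<open>wpm_imp_rpm\<close>.\<close>

inductive wpm :: "nat \<Rightarrow> ('c \<Rightarrow> 'a set set) \<Rightarrow> 'c multiset \<Rightarrow> 'a multiset \<Rightarrow> bool" for k H where
  wpm_empty: "wpm k H {#} {#}"
| wpm_add: "e \<in> H x \<Longrightarrow> finite e \<Longrightarrow> card e = k \<Longrightarrow> wpm k H C U \<Longrightarrow>
    wpm k H (add_mset x C) (mset_set e + U)"

lemma wpm_Un: "wpm k H C U \<Longrightarrow> wpm k H C' U' \<Longrightarrow> wpm k H (C + C') (U + U')"
  by (induction rule: wpm.induct) (auto simp: add.assoc intro: wpm.intros)

lemma wpm_single: "e \<in> H x \<Longrightarrow> finite e \<Longrightarrow> card e = k \<Longrightarrow> wpm k H {#x#} (mset_set e)"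
  using wpm_add[OF _ _ _ wpm_empty] by fastforce

lemma wpm_imp_rpm:
  assumes "wpm k H C U" "\<And>x. count C x \<le> 1" "\<And>v. count U v \<le> 1"
  shows "rpm k H (set_mset C) (set_mset U)"
  using assms
proof (induction rule: wpm.induct)
  case wpm_empty
  then show ?case by simp
next
  case (wpm_add e x C U)
  have 1: "x \<notin># C"
    using wpm_add.prems(1)[of x] by (simp add: not_in_iff)
  have 2: "e \<inter> set_mset U = {}"
  proof (rule ccontr)
    assume "e \<inter> set_mset U \<noteq> {}"
    then obtain v where v: "v \<in> e" "v \<in># U" by auto
    then have "count (mset_set e) v = 1" "count U v > 0" using wpm_add.hyps by auto
    then show False using wpm_add.prems(2)[of v] by (simp add: count_eq_zero_iff)
  qed
  have "rpm k H (set_mset C) (set_mset U)"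
  proof (rule wpm_add.IH)
    fix y show "count C y \<le> 1" using wpm_add.prems(1)[of y] by (simp split: if_splits)
  next
    fix v show "count U v \<le> 1" using wpm_add.prems(2)[of v] by simp
  qed
  then have "rpm k H ({x} \<union> set_mset C) (e \<union> set_mset U)"
    using 1 2 wpm_add.hyps by (intro rpm_Un rpm_single) auto
  then show ?case using wpm_add.hyps by simp
qed

subsection \<open>Densities of tuples of colours and vertices\<close>

text \<open>\<open>\<Phi>\<close> sees multisets although lists are counted: what can be matched
  does not depend on the order, while the numbers of lists multiply.\<close>

definition dens :: "'c set \<Rightarrow> 'a set \<Rightarrow> nat \<Rightarrow> nat \<Rightarrow> real \<Rightarrow> ('c multiset \<Rightarrow> 'a multiset \<Rightarrow> bool) \<Rightarrow> bool" where
  "dens X V a b \<beta> \<Phi> \<longleftrightarrow> \<beta> * (real (card X) ^ a * real (card V) ^ b) \<le>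
     real (card {(cs, vs) \<in> nlists X a \<times> nlists V b. \<Phi> (mset cs) (mset vs)})"

lemma finite_nlists_prod [simp]:
  assumes "finite X" "finite V"
  shows "finite {(cs, vs) \<in> nlists X a \<times> nlists V b. Q cs vs}"
  by (rule finite_subset[of _ "nlists X a \<times> nlists V b"]) (use assms in auto)

lemma dens_mono:
  assumes "finite X" "finite V" "dens X V a b \<beta> \<Phi>" "\<beta>' \<le> \<beta>"
    and "\<And>C U. set_mset C \<subseteq> X \<Longrightarrow> set_mset U \<subseteq> V \<Longrightarrow> size C = a \<Longrightarrow> size U = b \<Longrightarrow> \<Phi> C U \<Longrightarrow> \<Psi> C U"
  shows "dens X V a b \<beta>' \<Psi>"
proof -
  have "{(cs, vs) \<in> nlists X a \<times> nlists V b. \<Phi> (mset cs) (mset vs)}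
      \<subseteq> {(cs, vs) \<in> nlists X a \<times> nlists V b. \<Psi> (mset cs) (mset vs)}"
    using assms(5) by (auto simp: nlists_def)
  then have "card {(cs, vs) \<in> nlists X a \<times> nlists V b. \<Phi> (mset cs) (mset vs)}
      \<le> card {(cs, vs) \<in> nlists X a \<times> nlists V b. \<Psi> (mset cs) (mset vs)}"
    by (intro card_mono finite_nlists_prod assms(1,2))
  moreover have "\<beta>' * (real (card X) ^ a * real (card V) ^ b) \<le> \<beta> * (real (card X) ^ a * real (card V) ^ b)"
    using assms(4) by (intro mult_right_mono) auto
  ultimately show ?thesis using assms(3) unfolding dens_def by linarith
qed

text \<open>Choose the first tuple, then the second, which may depend on it. As the lengths are
  fixed, concatenation is injective, so the densities multiply.\<close>

lemma dens_product:
  fixes X :: "'c set" and V :: "'a set"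
  assumes fin: "finite X" "finite V" and nn: "0 \<le> \<beta>"
    and 1: "dens X V a b \<alpha> \<Phi>"
    and 2: "\<And>C U. set_mset C \<subseteq> X \<Longrightarrow> set_mset U \<subseteq> V \<Longrightarrow> size C = a \<Longrightarrow> size U = b \<Longrightarrow> \<Phi> C U \<Longrightarrow>
              dens X V a' b' \<beta> (\<Psi> C U)"
    and 3: "\<And>C U C' U'. set_mset C \<subseteq> X \<Longrightarrow> set_mset U \<subseteq> V \<Longrightarrow> size C = a \<Longrightarrow> size U = b \<Longrightarrow> \<Phi> C U \<Longrightarrow>
        set_mset C' \<subseteq> X \<Longrightarrow> set_mset U' \<subseteq> V \<Longrightarrow> size C' = a' \<Longrightarrow> size U' = b' \<Longrightarrow> \<Psi> C U C' U' \<Longrightarrow> \<Theta> (C + C') (U + U')"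
  shows "dens X V (a + a') (b + b') (\<alpha> * \<beta>) \<Theta>"
proof -
  let ?m = "real (card X)" and ?n = "real (card V)"
  define A where "A = {(cs, vs) \<in> nlists X a \<times> nlists V b. \<Phi> (mset cs) (mset vs)}"
  define B where "B = (\<lambda>(cs, vs). {(cs', vs') \<in> nlists X a' \<times> nlists V b'. \<Psi> (mset cs) (mset vs) (mset cs') (mset vs')})"
  define F :: "('c list \<times> 'a list) \<times> ('c list \<times> 'a list) \<Rightarrow> 'c list \<times> 'a list"
    where "F = (\<lambda>((cs, vs), (cs', vs')). (cs @ cs', vs @ vs'))"
  have finA: "finite A" unfolding A_def
    by (rule finite_nlists_prod[OF fin])
  have finB: "finite (B z)" for z unfolding B_def
    by (cases z) (simp only: prod.case finite_nlists_prod[OF fin])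
  have inj: "inj_on F (Sigma A B)"
    by (auto simp: inj_on_def F_def A_def B_def nlists_def)
  have "F ` Sigma A B \<subseteq> {(cs, vs) \<in> nlists X (a + a') \<times> nlists V (b + b'). \<Theta> (mset cs) (mset vs)}"
  proof
    fix z assume "z \<in> F ` Sigma A B"
    then obtain cs vs cs' vs' where h: "(cs, vs) \<in> A" "(cs', vs') \<in> B (cs, vs)" "z = (cs @ cs', vs @ vs')"
      by (auto simp: F_def)
    then have "\<Theta> (mset cs + mset cs') (mset vs + mset vs')"
      by (intro 3) (auto simp: A_def B_def nlists_def)
    then show "z \<in> {(cs, vs) \<in> nlists X (a + a') \<times> nlists V (b + b'). \<Theta> (mset cs) (mset vs)}"
      using h by (auto simp: A_def B_def append_in_nlists)
  qed
  then have "card (F ` Sigma A B) \<le> card {(cs, vs) \<in> nlists X (a + a') \<times> nlists V (b + b'). \<Theta> (mset cs) (mset vs)}"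
    by (intro card_mono finite_nlists_prod fin)
  moreover have "real (card (F ` Sigma A B)) = (\<Sum>z\<in>A. real (card (B z)))"
    using inj finA finB by (simp add: card_image)
  moreover have "\<alpha> * \<beta> * (?m ^ (a + a') * ?n ^ (b + b')) \<le> (\<Sum>z\<in>A. real (card (B z)))"
  proof -
    have "\<alpha> * \<beta> * (?m ^ (a + a') * ?n ^ (b + b')) = (\<alpha> * (?m ^ a * ?n ^ b)) * (\<beta> * (?m ^ a' * ?n ^ b'))"
      by (simp add: power_add algebra_simps)
    also have "\<dots> \<le> real (card A) * (\<beta> * (?m ^ a' * ?n ^ b'))"
      using 1 nn unfolding dens_def A_def by (intro mult_right_mono) auto
    also have "\<dots> = (\<Sum>z\<in>A. \<beta> * (?m ^ a' * ?n ^ b'))" by simp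
    also have "\<dots> \<le> (\<Sum>z\<in>A. real (card (B z)))"
    proof (rule sum_mono)
      fix z assume "z \<in> A"
      then obtain cs vs where z: "z = (cs, vs)" "cs \<in> nlists X a" "vs \<in> nlists V b" "\<Phi> (mset cs) (mset vs)"
        by (auto simp: A_def)
      then have "dens X V a' b' \<beta> (\<Psi> (mset cs) (mset vs))"
        by (intro 2) (auto simp: nlists_def)
      then show "\<beta> * (?m ^ a' * ?n ^ b') \<le> real (card (B z))"
        by (simp add: dens_def B_def z)
    qed
    finally show ?thesis .
  qed
  ultimately show ?thesis unfolding dens_def by linarith
qed

lemma dens_vertex:
  fixes X :: "'c set" and V :: "'a set"
  assumes "W \<subseteq> V" "\<eta> * real (card V) \<le> real (card W)"
  shows "dens X V 0 (Suc 0) \<eta> (\<lambda>C U. C = {#} \<and> (\<exists>w\<in>W. U = {#w#}))"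
proof -
  have "{(cs, vs). (cs \<in> nlists X 0 \<and> vs \<in> nlists V (Suc 0)) \<and> mset cs = {#} \<and> (\<exists>w\<in>W. mset vs = {#w#})}
      = (\<lambda>w. ([], [w])) ` W"
    using assms(1) by (auto simp: nlists_Suc image_iff)
  moreover have "card ((\<lambda>w. ([] :: 'c list, [w])) ` W) = card W"
    by (rule card_image) (auto simp: inj_on_def)
  ultimately show ?thesis using assms(2) by (simp add: dens_def)
qed

lemma dens_colour:
  fixes X :: "'c set" and V :: "'a set"
  shows "dens X V (Suc 0) 0 1 (\<lambda>C U. U = {#} \<and> (\<exists>x\<in>X. C = {#x#}))"
proof -
  have "{(cs, vs). (cs \<in> nlists X (Suc 0) \<and> vs \<in> nlists V 0) \<and> mset vs = {#} \<and> (\<exists>w\<in>X. mset cs = {#w#})}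
      = (\<lambda>w. ([w], [])) ` X"
    by (auto simp: nlists_Suc image_iff)
  moreover have "card ((\<lambda>w. ([w], [] :: 'a list)) ` X) = card X"
    by (rule card_image) (auto simp: inj_on_def)
  ultimately show ?thesis by (simp add: dens_def)
qed

lemma dens_no_colour:
  "dens X V 0 b \<beta> \<Phi> \<longleftrightarrow> \<beta> * real (card V) ^ b \<le> real (card {vs \<in> nlists V b. \<Phi> {#} (mset vs)})"
proof -
  have "{(cs, vs) \<in> nlists X 0 \<times> nlists V b. \<Phi> (mset cs) (mset vs)} = (\<lambda>vs. ([], vs)) ` {vs \<in> nlists V b. \<Phi> {#} (mset vs)}"
    by auto
  moreover have "card \<dots> = card {vs \<in> nlists V b. \<Phi> {#} (mset vs)}"
    by (rule card_image) (auto simp: inj_on_def)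
  ultimately show ?thesis unfolding dens_def by simp
qed

subsection \<open>Exchanging vertices\<close>

definition sw :: "nat \<Rightarrow> ('c \<Rightarrow> 'a set set) \<Rightarrow> 'a multiset \<Rightarrow> 'a multiset \<Rightarrow> 'c multiset \<Rightarrow> 'a multiset \<Rightarrow> bool" where
  "sw k H A B C U \<longleftrightarrow> wpm k H C (U + A) \<and> wpm k H C (U + B)"

text \<open>\<open>s\<close> colours cover exactly \<open>k * s\<close> vertices, one of which is
  \<open>u\<close> or \<open>v\<close>.\<close>

definition reach :: "nat \<Rightarrow> ('c \<Rightarrow> 'a set set) \<Rightarrow> 'c set \<Rightarrow> 'a set \<Rightarrow> nat \<Rightarrow> real \<Rightarrow> 'a \<Rightarrow> 'a \<Rightarrow> bool" where
  "reach k H X V s \<beta> u v \<longleftrightarrow> dens X V s (k * s - 1) \<beta> (sw k H {#u#} {#v#})"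

lemma sw_sym: "sw k H A B C U \<longleftrightarrow> sw k H B A C U"
  by (auto simp: sw_def)

lemma reach_sym: "reach k H X V s \<beta> u v \<longleftrightarrow> reach k H X V s \<beta> v u"
  unfolding reach_def by (simp add: sw_sym[of k H "{#u#}" "{#v#}", abs_def] dens_def)

text \<open>At this stage only a link density bounded away from 0 matters. The value 2/5 lies below
  the true one, which is near 1/2, and leaves room for vertices that have to be avoided.\<close>

locale colgraphs =
  fixes X :: "'c set" and V :: "'a set" and H :: "'c \<Rightarrow> 'a set set" and k :: nat
  assumes finX [simp]: "finite X" and finV [simp]: "finite V" and cardV: "card V = k * card X"
    and V_ne: "V \<noteq> {}" and k_ge: "k \<ge> 2"
    and edges: "\<And>x e. x \<in> X \<Longrightarrow> e \<in> H x \<Longrightarrow> e \<subseteq> V \<and> card e = k"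
    and deg1: "\<And>x v. x \<in> X \<Longrightarrow> v \<in> V \<Longrightarrow>
       2 / 5 * real (card V) ^ (k - 1) \<le> real (card {S \<in> nlists V (k - 1). insert v (set S) \<in> H x})"
begin

abbreviation n where "n \<equiv> real (card V)"
abbreviation m where "m \<equiv> real (card X)"

lemma n_pos: "n > 0"
  using V_ne by (simp add: card_gt_0_iff)

lemma m_pos: "m > 0"
  using n_pos cardV by (cases "card X") auto

lemma wpm_list:
  assumes "x \<in> X" "set T \<in> H x" "length T = k"
  shows "wpm k H {#x#} (mset T)"
proof -
  have "distinct T" using assms edges[OF assms(1,2)] by (simp add: card_distinct)
  then have "mset T = mset_set (set T)" by (simp add: mset_set_set)
  then show ?thesis using assms edges[OF assms(1,2)] by (simp add: wpm_single)
qed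

text \<open>Tuples leaving \<open>D\<close> have density at most 1/10, and 2/5 - 1/10 is at least
  1/4.\<close>

lemma link_in:
  assumes "x \<in> X" "v \<in> V" "D \<subseteq> V" "10 * real k * real (card (V - D)) \<le> n"
  shows "1 / 4 * n ^ (k - 1) \<le> real (card {S \<in> nlists V (k - 1). insert v (set S) \<in> H x \<and> set S \<subseteq> D})"
proof -
  let ?A = "{S \<in> nlists V (k - 1). insert v (set S) \<in> H x}"
  let ?B = "{S \<in> nlists V (k - 1). set S \<inter> (V - D) \<noteq> {}}"
  let ?C = "{S \<in> nlists V (k - 1). insert v (set S) \<in> H x \<and> set S \<subseteq> D}"
  have "?A \<subseteq> ?B \<union> ?C" by (auto simp: nlists_def)
  then have "card ?A \<le> card (?B \<union> ?C)" by (intro card_mono) auto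
  also have "\<dots> \<le> card ?B + card ?C" by (rule card_Un_le)
  finally have "real (card ?A) \<le> real (card ?B) + real (card ?C)" by linarith
  moreover have "real (card ?B) \<le> real (k - 1) * real (card (V - D)) / n * n ^ (k - 1)"
    using V_ne by (intro card_nlists_meeting_real) auto
  moreover have "real (k - 1) * real (card (V - D)) / n * n ^ (k - 1) \<le> 1 / 10 * n ^ (k - 1)"
  proof (rule mult_right_mono)
    have "real (k - 1) * real (card (V - D)) \<le> real k * real (card (V - D))"
      by (intro mult_right_mono) auto
    then show "real (k - 1) * real (card (V - D)) / n \<le> 1 / 10"
      using assms(4) n_pos by (simp add: field_simps)
  qed simp
  moreover have "0 \<le> n ^ (k - 1)" by simp
  moreover have "2 / 5 * n ^ (k - 1) \<le> real (card ?A)" using deg1[OF assms(1,2)] .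
  ultimately show ?thesis by linarith
qed

lemma dens_link_colour:
  assumes "x \<in> X" "v \<in> V" "D \<subseteq> V" "10 * real k * real (card (V - D)) \<le> n"
  shows "dens X V 0 (k - 1) (1 / 4) (\<lambda>C U. C = {#} \<and> wpm k H {#x#} (U + {#v#}) \<and> set_mset U \<subseteq> D)"
proof -
  let ?C = "{S \<in> nlists V (k - 1). insert v (set S) \<in> H x \<and> set S \<subseteq> D}"
  have "?C \<subseteq> {S \<in> nlists V (k - 1). wpm k H {#x#} (mset S + {#v#}) \<and> set_mset (mset S) \<subseteq> D}"
  proof
    fix S assume S: "S \<in> ?C"
    then have "wpm k H {#x#} (add_mset v (mset S))"
      using wpm_list[OF assms(1), of "v # S"] k_ge by (auto simp: nlists_def)
    then show "S \<in> {S \<in> nlists V (k - 1). wpm k H {#x#} (mset S + {#v#}) \<and> set_mset (mset S) \<subseteq> D}"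
      using S by auto
  qed
  then have "card ?C \<le> card {S \<in> nlists V (k - 1). wpm k H {#x#} (mset S + {#v#}) \<and> set_mset (mset S) \<subseteq> D}"
    by (intro card_mono) auto
  then show ?thesis using link_in[OF assms] unfolding dens_no_colour simp_thms by linarith
qed

lemma dens_edge_colour:
  assumes "x \<in> X" "D \<subseteq> V" "10 * real k * real (card (V - D)) \<le> n"
  shows "dens X V 0 k (1 / 5) (\<lambda>C U. C = {#} \<and> wpm k H {#x#} U \<and> set_mset U \<subseteq> D)"
proof -
  \<comment> \<open>A vertex of \<open>D\<close> is chosen first, then its link inside
    \<open>D\<close>: 4/5 times 1/4 is 1/5.\<close>
  have "4 / 5 * n \<le> real (card D)"
  proof -
    have "real (card D) = n - real (card (V - D))"
      using assms(2) by (simp add: card_Diff_subset finite_subset[OF assms(2)] card_mono of_nat_diff)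
    moreover have "10 * 2 * real (card (V - D)) \<le> 10 * real k * real (card (V - D))"
      using k_ge by (intro mult_right_mono) auto
    ultimately show ?thesis using assms(3) by linarith
  qed
  then have 1: "dens X V 0 (Suc 0) (4 / 5) (\<lambda>C U. C = {#} \<and> (\<exists>w\<in>D. U = {#w#}))"
    by (rule dens_vertex[OF assms(2)])
  have "dens X V (0 + 0) (Suc 0 + (k - 1)) (4 / 5 * (1 / 4)) (\<lambda>C U. C = {#} \<and> wpm k H {#x#} U \<and> set_mset U \<subseteq> D)"
  proof (rule dens_product[where \<Psi> = "\<lambda>C U C' U'. C' = {#} \<and> wpm k H {#x#} (U' + U) \<and> set_mset U' \<subseteq> D"])
    show "dens X V 0 (k - 1) (1 / 4) (\<lambda>C' U'. C' = {#} \<and> wpm k H {#x#} (U' + U) \<and> set_mset U' \<subseteq> D)"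
      if "C = {#} \<and> (\<exists>w\<in>D. U = {#w#})" for C :: "'c multiset" and U
      using that dens_link_colour[OF assms(1) _ assms(2,3)] assms(2) by auto
  qed (use 1 in \<open>auto simp: union_commute\<close>)
  then show ?thesis using k_ge by simp
qed

lemma dens_edge:
  assumes "D \<subseteq> V" "10 * real k * real (card (V - D)) \<le> n"
  shows "dens X V 1 k (1 / 5) (\<lambda>C U. wpm k H C U \<and> set_mset U \<subseteq> D)"
proof -
  have "dens X V (Suc 0 + 0) (0 + k) (1 * (1 / 5)) (\<lambda>C U. wpm k H C U \<and> set_mset U \<subseteq> D)"
  proof (rule dens_product[OF _ _ _ dens_colour, where \<Psi> = "\<lambda>C U C' U'. C' = {#} \<and> wpm k H C U' \<and> set_mset U' \<subseteq> D"])
    show "dens X V 0 k (1 / 5) (\<lambda>C' U'. C' = {#} \<and> wpm k H C U' \<and> set_mset U' \<subseteq> D)"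
      if "U = {#} \<and> (\<exists>x\<in>X. C = {#x#})" for C and U :: "'a multiset"
      using that dens_edge_colour[OF _ assms] by auto
  qed auto
  then show ?thesis by simp
qed

lemma dens_link:
  assumes "v \<in> V" "D \<subseteq> V" "10 * real k * real (card (V - D)) \<le> n"
  shows "dens X V 1 (k - 1) (1 / 4) (\<lambda>C U. wpm k H C (U + {#v#}) \<and> set_mset U \<subseteq> D)"
proof -
  have "dens X V (Suc 0 + 0) (0 + (k - 1)) (1 * (1 / 4)) (\<lambda>C U. wpm k H C (U + {#v#}) \<and> set_mset U \<subseteq> D)"
  proof (rule dens_product[OF _ _ _ dens_colour, where \<Psi> = "\<lambda>C U C' U'. C' = {#} \<and> wpm k H C (U' + {#v#}) \<and> set_mset U' \<subseteq> D"])
    show "dens X V 0 (k - 1) (1 / 4) (\<lambda>C' U'. C' = {#} \<and> wpm k H C (U' + {#v#}) \<and> set_mset U' \<subseteq> D)"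
      if "U = {#} \<and> (\<exists>x\<in>X. C = {#x#})" for C and U :: "'a multiset"
      using that dens_link_colour[OF _ assms] by auto
  qed auto
  then show ?thesis by simp
qed

lemma sw_Un: "sw k H A B C U \<Longrightarrow> sw k H A' B' C' U' \<Longrightarrow> sw k H (A + A') (B + B') (C + C') (U + U')"
  unfolding sw_def
  using wpm_Un[of k H C "U + A" C' "U' + A'"] wpm_Un[of k H C "U + B" C' "U' + B'"]
  by (simp add: ac_simps)

text \<open>The intermediate \<open>B\<close> joins the tuple. Either \<open>C\<close> takes
  \<open>A\<close> and \<open>C'\<close> takes \<open>B\<close>, or \<open>C\<close> takes
  \<open>B\<close> and \<open>C'\<close> takes \<open>B'\<close>.\<close>

lemma sw_trans: "sw k H A B C U \<Longrightarrow> sw k H B B' C' U' \<Longrightarrow> sw k H A B' (C + C') (B + (U + U'))"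
  unfolding sw_def
  using wpm_Un[of k H C "U + A" C' "U' + B"] wpm_Un[of k H C "U + B" C' "U' + B'"]
  by (simp add: ac_simps)

lemma reach_concat:
  assumes "W \<subseteq> V" "\<eta> * n \<le> real (card W)" "\<beta> \<ge> 0" "\<beta>' \<ge> 0" "s \<ge> 1" "t \<ge> 1"
    and W: "\<And>w. w \<in> W \<Longrightarrow> reach k H X V s \<beta> u w \<and> reach k H X V t \<beta>' w v"
  shows "reach k H X V (s + t) (\<eta> * (\<beta> * \<beta>')) u v"
proof -
  have inner: "dens X V (s + t) ((k * s - 1) + (k * t - 1)) (\<beta> * \<beta>') (\<lambda>C U. sw k H {#u#} {#v#} C ({#w#} + U))"
    if "w \<in> W" for w
  proof (rule dens_product[where \<Phi> = "sw k H {#u#} {#w#}" and \<Psi> = "\<lambda>C U. sw k H {#w#} {#v#}"])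
    show "sw k H {#u#} {#v#} (C + C') ({#w#} + (U + U'))" if "sw k H {#u#} {#w#} C U" "sw k H {#w#} {#v#} C' U'" for C C' U U'
      using that by (rule sw_trans)
  qed (use W[OF that] assms in \<open>auto simp: reach_def\<close>)
  have "dens X V (0 + (s + t)) (Suc 0 + ((k * s - 1) + (k * t - 1))) (\<eta> * (\<beta> * \<beta>')) (sw k H {#u#} {#v#})"
    by (rule dens_product[OF _ _ _ dens_vertex[OF assms(1,2)],
          where \<Psi> = "\<lambda>C U C' U'. sw k H {#u#} {#v#} C' (U + U')"])
       (use inner assms in auto)
  moreover have "Suc 0 + ((k * s - 1) + (k * t - 1)) = k * (s + t) - 1"
  proof -
    obtain i j where "k * s = Suc i" "k * t = Suc j"
      using assms k_ge by (cases "k * s"; cases "k * t") auto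
    then show ?thesis by (simp add: distrib_left)
  qed
  ultimately show ?thesis by (simp add: reach_def)
qed

text \<open>An arbitrary further edge lengthens each witness by one colour; this brings exchanges
  obtained in different numbers of steps to a common length.\<close>

lemma reach_pad:
  assumes "reach k H X V s \<beta> u v" "\<beta> \<ge> 0" "s \<ge> 1"
  shows "reach k H X V (s + 1) (\<beta> * (1 / 5)) u v"
proof -
  have "dens X V (s + 1) ((k * s - 1) + k) (\<beta> * (1 / 5)) (sw k H {#u#} {#v#})"
  proof (rule dens_product[where \<Phi> = "sw k H {#u#} {#v#}" and \<Psi> = "\<lambda>C U C' U'. wpm k H C' U'"])
    show "dens X V 1 k (1 / 5) (wpm k H)"
      by (rule dens_mono[OF _ _ dens_edge[of V]]) auto
    show "sw k H {#u#} {#v#} (C + C') (U + U')" if "sw k H {#u#} {#v#} C U" "wpm k H C' U'" for C U C' U'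
      using sw_Un[OF that(1), of "{#}" "{#}" C' U'] that(2) by (simp add: sw_def)
  qed (use assms in \<open>auto simp: reach_def\<close>)
  moreover have "k * s \<ge> 1" using assms k_ge by (auto simp: Suc_le_eq)
  ultimately show ?thesis by (simp add: reach_def add.commute)
qed

lemma reach_mono: "reach k H X V s \<beta> u v \<Longrightarrow> \<beta>' \<le> \<beta> \<Longrightarrow> reach k H X V s \<beta>' u v"
  unfolding reach_def by (rule dens_mono) auto

section \<open>Exchanging whole tuples, and reachability from outside a closed set\<close>

lemma dens_sw_lists:
  assumes "list_all2 (reach k H X V s \<beta>) as bs" "\<beta> \<ge> 0"
  shows "dens X V (length as * s) (length as * (k * s - 1)) (\<beta> ^ length as) (sw k H (mset as) (mset bs))"
  using assms(1)
proof (induction rule: list_all2_induct)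
  case Nil
  have "{(cs :: 'c list, vs :: 'a list). cs = [] \<and> vs = [] \<and> sw k H {#} {#} (mset cs) (mset vs)} = {([], [])}"
    by (auto simp: sw_def wpm_empty)
  then show ?case by (simp add: dens_def)
next
  case (Cons a as b bs)
  have "dens X V (s + length as * s) ((k * s - 1) + length as * (k * s - 1)) (\<beta> * \<beta> ^ length as) (sw k H (mset (a # as)) (mset (b # bs)))"
  proof (rule dens_product[where \<Phi> = "sw k H {#a#} {#b#}" and \<Psi> = "\<lambda>C U. sw k H (mset as) (mset bs)"])
    show "sw k H (mset (a # as)) (mset (b # bs)) (C + C') (U + U')"
      if "sw k H {#a#} {#b#} C U" "sw k H (mset as) (mset bs) C' U'" for C U C' U'
      using sw_Un[OF that] by simp
  qed (use Cons assms in \<open>auto simp: reach_def\<close>)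
  then show ?case by simp
qed

lemma dens_sw_mset:
  assumes "\<And>u v. u \<in># A \<Longrightarrow> v \<in># B \<Longrightarrow> reach k H X V s \<beta> u v" "\<beta> \<ge> 0" "size A = size B"
  shows "dens X V (size A * s) (size A * (k * s - 1)) (\<beta> ^ size A) (sw k H A B)"
proof -
  obtain as bs where ab: "mset as = A" "mset bs = B" by (meson ex_mset)
  then have "length as = length bs" using assms(3) by auto
  then have "list_all2 (reach k H X V s \<beta>) as bs"
    using assms(1) ab by (auto simp: list_all2_conv_all_nth)
  from dens_sw_lists[OF this assms(2)] show ?thesis using ab by auto
qed

text \<open>Take an edge consisting of \<open>v\<close> and \<open>U1\<close>, and an edge
  \<open>E\<close> of the same colour, with \<open>U1\<close> and \<open>E\<close> inside
  \<open>D\<close>; then exchange \<open>U1 + {#u#}\<close> with \<open>E\<close> entry by entry. If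
  \<open>v\<close> is present, the colour takes \<open>v\<close> and \<open>U1\<close>, and the
  exchange tuples cover \<open>E\<close>; if \<open>u\<close> is present, the colour takes
  \<open>E\<close>, and they cover \<open>U1\<close> and \<open>u\<close>.\<close>

lemma reach_composite:
  assumes D: "D \<subseteq> V" "10 * real k * real (card (V - D)) \<le> n"
    and R: "\<And>u v. u \<in> D \<Longrightarrow> v \<in> D \<Longrightarrow> reach k H X V s \<beta> u v" and \<beta>: "\<beta> \<ge> 0" and s: "s \<ge> 1"
    and vu: "v \<in> V" "u \<in> D"
  shows "reach k H X V (1 + k * s) (1 / 20 * \<beta> ^ k) v u"
proof -
  define \<Theta> where "\<Theta> C U \<longleftrightarrow> (\<exists>U1 E. U = U1 + E \<and> wpm k H C (U1 + {#v#}) \<and> wpm k H C E \<and>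
      set_mset U1 \<subseteq> D \<and> set_mset E \<subseteq> D \<and> size U1 = k - 1 \<and> size E = k)" for C U
  have 1: "dens X V (1 + 0) ((k - 1) + k) (1 / 4 * (1 / 5)) \<Theta>"
  proof (rule dens_product[OF _ _ _ dens_link[OF vu(1) D], where \<Psi> = "\<lambda>C U C' E. C' = {#} \<and> wpm k H C E \<and> set_mset E \<subseteq> D"])
    fix C :: "'c multiset" assume "set_mset C \<subseteq> X" "size C = 1"
    then obtain x where "C = {#x#}" using size_1_singleton_mset by blast
    with \<open>set_mset C \<subseteq> X\<close> have "C = {#x#}" "x \<in> X" by auto
    then show "dens X V 0 k (1 / 5) (\<lambda>C' E. C' = {#} \<and> wpm k H C E \<and> set_mset E \<subseteq> D)"
      using dens_edge_colour[OF _ D] by auto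
  next
    fix C C' :: "'c multiset" and U E assume "wpm k H C (U + {#v#}) \<and> set_mset U \<subseteq> D" "C' = {#} \<and> wpm k H C E \<and> set_mset E \<subseteq> D"
      "size U = k - 1" "size E = k"
    then show "\<Theta> (C + C') (U + E)" unfolding \<Theta>_def
      by (intro exI[of _ U] exI[of _ E]) auto
  qed simp_all
  have "dens X V (1 + 0 + k * s) ((k - 1) + k + k * (k * s - 1)) (1 / 4 * (1 / 5) * \<beta> ^ k) (sw k H {#v#} {#u#})"
  proof (rule dens_product[OF _ _ _ 1, where \<Psi> = "\<lambda>C U C' U'. \<exists>U1 E. U = U1 + E \<and> wpm k H C (U1 + {#v#}) \<and> wpm k H C E \<and>
        sw k H (U1 + {#u#}) E C' U'"])
    fix C U assume "\<Theta> C U"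
    then obtain U1 E where UE: "U = U1 + E" "wpm k H C (U1 + {#v#})" "wpm k H C E"
      "set_mset U1 \<subseteq> D" "set_mset E \<subseteq> D" "size U1 = k - 1" "size E = k" unfolding \<Theta>_def by blast
    have sz: "size (U1 + {#u#}) = k" using UE k_ge by simp
    have "dens X V (size (U1 + {#u#}) * s) (size (U1 + {#u#}) * (k * s - 1)) (\<beta> ^ size (U1 + {#u#})) (sw k H (U1 + {#u#}) E)"
      by (rule dens_sw_mset) (use UE vu R \<beta> sz in auto)
    then have "dens X V (k * s) (k * (k * s - 1)) (\<beta> ^ k) (sw k H (U1 + {#u#}) E)"
      unfolding sz .
    show "dens X V (k * s) (k * (k * s - 1)) (\<beta> ^ k) (\<lambda>C' U'. \<exists>U1 E. U = U1 + E \<and> wpm k H C (U1 + {#v#}) \<and> wpm k H C E \<and>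
        sw k H (U1 + {#u#}) E C' U')"
      by (rule dens_mono[OF finX finV \<open>dens X V (k * s) _ _ _\<close> order_refl]) (use UE(1-3) in blast)
  next
    fix C U C' U'
    assume "\<exists>U1 E. U = U1 + E \<and> wpm k H C (U1 + {#v#}) \<and> wpm k H C E \<and> sw k H (U1 + {#u#}) E C' U'"
    then obtain U1 E where h: "U = U1 + E" "wpm k H C (U1 + {#v#})" "wpm k H C E"
      "wpm k H C' (U' + (U1 + {#u#}))" "wpm k H C' (U' + E)" by (auto simp: sw_def)
    show "sw k H {#v#} {#u#} (C + C') (U + U')"
      unfolding sw_def using wpm_Un[OF h(2,5)] wpm_Un[OF h(3,4)] h(1) by (simp add: ac_simps)
  qed (use \<beta> in auto)
  moreover have "(k - 1) + k + k * (k * s - 1) = k * (1 + k * s) - 1"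
  proof -
    obtain j where j: "k * s = Suc j" using s k_ge by (cases "k * s") auto
    show ?thesis using k_ge unfolding j by (simp add: algebra_simps)
  qed
  ultimately show ?thesis by (simp add: reach_def)
qed

text \<open>Both vertices are joined to every vertex of \<open>D\<close>, which is at least half of
  \<open>V\<close>; hence the factor 1/2 and the square.\<close>

lemma reach_all:
  assumes D: "D \<subseteq> V" "10 * real k * real (card (V - D)) \<le> n"
    and R: "\<And>u v. u \<in> D \<Longrightarrow> v \<in> D \<Longrightarrow> reach k H X V s \<beta> u v" and \<beta>: "\<beta> \<ge> 0" and s: "s \<ge> 1"
    and "v \<in> V" "v' \<in> V"
  shows "reach k H X V (2 * (1 + k * s)) (1 / 2 * (1 / 20 * \<beta> ^ k) ^ 2) v v'"
proof -
  have "1 / 2 * n \<le> real (card D)"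
  proof -
    have "real (card D) = n - real (card (V - D))"
      using D by (simp add: card_Diff_subset finite_subset[OF D(1)] card_mono of_nat_diff)
    moreover have "10 * 2 * real (card (V - D)) \<le> 10 * real k * real (card (V - D))"
      using k_ge by (intro mult_right_mono) auto
    ultimately show ?thesis using D by linarith
  qed
  then have "reach k H X V ((1 + k * s) + (1 + k * s)) (1 / 2 * ((1 / 20 * \<beta> ^ k) * (1 / 20 * \<beta> ^ k))) v v'"
  proof (rule reach_concat[OF D(1)])
    fix w assume "w \<in> D"
    then show "reach k H X V (1 + k * s) (1 / 20 * \<beta> ^ k) v w \<and> reach k H X V (1 + k * s) (1 / 20 * \<beta> ^ k) w v'"
      using reach_composite[OF D R \<beta> s] assms reach_sym[of k H X V "1 + k * s"] by blast
  qed (use \<beta> in auto)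
  then show ?thesis by (simp only: power2_eq_square mult_2)
qed

section \<open>Absorbers for prescribed colours and vertices\<close>

definition absb :: "'c multiset \<Rightarrow> 'a multiset \<Rightarrow> 'c multiset \<Rightarrow> 'a multiset \<Rightarrow> bool" where
  "absb CW UW C U \<longleftrightarrow> wpm k H C U \<and> wpm k H (C + CW) (U + UW)"

text \<open>The absorber contains an edge \<open>E\<close> of colour \<open>x\<close> and exchange
  tuples between \<open>A\<close> and \<open>E\<close>. At rest these tuples cover \<open>E\<close>;
  to absorb, colour \<open>x\<close> takes \<open>E\<close> and they cover \<open>A\<close>
  instead.\<close>

lemma dens_absorb_one:
  assumes R: "\<And>u v. u \<in> V \<Longrightarrow> v \<in> V \<Longrightarrow> reach k H X V s \<beta> u v" and \<beta>: "\<beta> \<ge> 0" and s: "s \<ge> 1"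
    and "x \<in> X" "set_mset A \<subseteq> V" "size A = k"
  shows "dens X V (k * s) (k * (k * s)) (1 / 5 * \<beta> ^ k) (absb {#x#} A)"
proof -
  have "dens X V (0 + k * s) (k + k * (k * s - 1)) (1 / 5 * \<beta> ^ k) (absb {#x#} A)"
  proof (rule dens_product[OF _ _ _ dens_edge_colour[of x V], where \<Psi> = "\<lambda>C U. sw k H A U"])
    fix C :: "'c multiset" and U :: "'a multiset" assume U: "set_mset U \<subseteq> V" "size U = k"
    have "dens X V (size A * s) (size A * (k * s - 1)) (\<beta> ^ size A) (sw k H A U)"
      by (rule dens_sw_mset) (use assms U in auto)
    then show "dens X V (k * s) (k * (k * s - 1)) (\<beta> ^ k) (sw k H A U)"
      using assms by simp
  next
    fix C C' :: "'c multiset" and U U'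
    assume "C = {#} \<and> wpm k H {#x#} U \<and> set_mset U \<subseteq> V" "sw k H A U C' U'"
    then have h: "C = {#}" "wpm k H {#x#} U" "wpm k H C' (U' + A)" "wpm k H C' (U' + U)" by (auto simp: sw_def)
    show "absb {#x#} A (C + C') (U + U')"
      unfolding absb_def using h wpm_Un[OF h(2,3)] by (simp add: ac_simps)
  qed (use assms in auto)
  moreover have "k + k * (k * s - 1) = k * (k * s)"
  proof -
    obtain j where j: "k * s = Suc j" using s k_ge by (cases "k * s") auto
    show ?thesis unfolding j by simp
  qed
  ultimately show ?thesis by simp
qed

text \<open>The vertices are cut into \<open>q\<close> consecutive groups of \<open>k\<close>, one
  for each colour. Any grouping will do, since every colour can absorb every
  \<open>k\<close>-set.\<close>

lemma dens_absorb:
  assumes R: "\<And>u v. u \<in> V \<Longrightarrow> v \<in> V \<Longrightarrow> reach k H X V s \<beta> u v" and \<beta>: "\<beta> \<ge> 0" and s: "s \<ge> 1"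
    and "xs \<in> nlists X q" "vs \<in> nlists V (q * k)"
  shows "dens X V (q * (k * s)) (q * (k * (k * s))) ((1 / 5 * \<beta> ^ k) ^ q) (absb (mset xs) (mset vs))"
  using assms(4,5)
proof (induction q arbitrary: xs vs)
  case 0
  have "{(cs :: 'c list, vs :: 'a list). cs = [] \<and> vs = [] \<and> absb {#} {#} (mset cs) (mset vs)} = {([], [])}"
    by (auto simp: absb_def wpm_empty)
  then show ?case using 0 by (simp add: dens_def)
next
  case (Suc q)
  obtain x ys where xs: "xs = x # ys" "x \<in> X" "ys \<in> nlists X q"
    using Suc.prems(1) by (auto simp: nlists_Suc)
  obtain as bs where vs: "vs = as @ bs" "as \<in> nlists V k" "bs \<in> nlists V (q * k)"
    using Suc.prems(2) by (auto simp: nlists_append)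
  have "dens X V (k * s + q * (k * s)) (k * (k * s) + q * (k * (k * s))) ((1 / 5 * \<beta> ^ k) * (1 / 5 * \<beta> ^ k) ^ q) (absb (mset xs) (mset vs))"
  proof (rule dens_product[OF _ _ _ dens_absorb_one[OF R \<beta> s, of x "mset as"], where \<Psi> = "\<lambda>C U. absb (mset ys) (mset bs)"])
    fix C C' U U'
    assume "absb {#x#} (mset as) C U" "absb (mset ys) (mset bs) C' U'"
    then have h: "wpm k H C U" "wpm k H (C + {#x#}) (U + mset as)" "wpm k H C' U'" "wpm k H (C' + mset ys) (U' + mset bs)"
      by (auto simp: absb_def)
    show "absb (mset xs) (mset vs) (C + C') (U + U')"
      unfolding absb_def using wpm_Un[OF h(1,3)] wpm_Un[OF h(2,4)] xs vs by (simp add: ac_simps)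
  qed (use Suc.IH xs vs \<beta> in \<open>auto simp: nlists_def\<close>)
  then show ?case by simp
qed

end

subsection \<open>Partitions into blocks\<close>

lemma blocks_fill:
  assumes "finite Y" "finite U" "card U = k * card Y"
  shows "\<exists>P. blocks k Y U P"
  using assms
proof (induction Y arbitrary: U rule: finite_induct)
  case empty
  then show ?case by (auto simp: blocks_def disjoint_family_on_def)
next
  case (insert y Y)
  have "k \<le> card U" using insert by simp
  then obtain W where W: "W \<subseteq> U" "card W = k" by (meson obtain_subset_with_card_n)
  have "card (U - W) = k * card Y"
    using insert W by (simp add: card_Diff_subset finite_subset[OF W(1)])
  then obtain P where P: "blocks k Y (U - W) P" using insert by blast
  have "rpm k (\<lambda>_. UNIV) ({y} \<union> Y) (W \<union> (U - W))"
    using P W insert.hyps by (intro rpm_Un rpm_single) (auto simp: rpm_def)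
  then show ?case using W by (auto simp: rpm_def Un_absorb1)
qed

lemma blocks_extend:
  assumes "finite Y" "finite U" "card U = k * card Y" "Z \<subseteq> Y"
    and E: "\<And>z. z \<in> Z \<Longrightarrow> E z \<subseteq> U \<and> card (E z) = k" "disjoint_family_on E Z"
  shows "\<exists>P. blocks k Y U P \<and> (\<forall>z\<in>Z. P z = E z)"
proof -
  let ?W = "\<Union>z\<in>Z. E z"
  have fZ: "finite Z" using assms finite_subset by blast
  have fE: "finite (E z)" if "z \<in> Z" for z using E(1)[OF that] assms(2) finite_subset by blast
  have "card ?W = (\<Sum>z\<in>Z. card (E z))"
    using E(2) fE fZ by (intro card_UN_disjoint) (auto simp: disjoint_family_on_def)
  then have cW: "card ?W = k * card Z" using E(1) by simp
  have WU: "?W \<subseteq> U" using E(1) by blast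
  have "card (U - ?W) = k * card (Y - Z)"
    using cW assms fZ card_Diff_subset[OF finite_subset[OF WU assms(2)] WU]
    by (simp add: card_Diff_subset diff_mult_distrib2)
  then obtain Q where Q: "blocks k (Y - Z) (U - ?W) Q"
    using blocks_fill[of "Y - Z" "U - ?W" k] assms by auto
  let ?H = "\<lambda>x. if x \<in> Z then {E x} else UNIV"
  have 1: "rpm k ?H Z ?W"
    unfolding rpm_def blocks_def using E by (intro exI[of _ E]) auto
  have 2: "rpm k ?H (Y - Z) (U - ?W)" using Q by (auto simp: rpm_def)
  have "rpm k ?H (Z \<union> (Y - Z)) (?W \<union> (U - ?W))"
    by (rule rpm_Un[OF 1 2]) auto
  then obtain P where P: "blocks k (Z \<union> (Y - Z)) (?W \<union> (U - ?W)) P" "\<And>x. x \<in> Z \<union> (Y - Z) \<Longrightarrow> P x \<in> ?H x"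
    by (auto simp: rpm_def)
  have "P z = E z" if "z \<in> Z" for z using P(2)[of z] that by auto
  moreover have "Z \<union> (Y - Z) = Y" "?W \<union> (U - ?W) = U" using assms(4) WU by auto
  ultimately show ?thesis using P(1) by auto
qed

lemma blocks_replace:
  assumes "blocks k X V P" "Y \<subseteq> X" "blocks k Y (\<Union>y\<in>Y. P y) Q"
  shows "blocks k X V (\<lambda>x. if x \<in> Y then Q x else P x)"
proof -
  let ?R = "\<lambda>x. if x \<in> Y then Q x else P x"
  have disj: "P x \<inter> P y = {}" if "x \<in> X" "y \<in> X" "x \<noteq> y" for x y
    using assms(1) that by (auto simp: blocks_def disjoint_family_on_def)
  have Q: "Q x \<subseteq> (\<Union>y\<in>Y. P y)" "card (Q x) = k" if "x \<in> Y" for x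
    using assms(3) that by (auto simp: blocks_def)
  have P: "P x \<subseteq> V" "card (P x) = k" if "x \<in> X" for x
    using assms(1) that by (auto simp: blocks_def)
  have UQ: "(\<Union>x\<in>Y. Q x) = (\<Union>x\<in>Y. P x)" using assms(3) by (simp add: blocks_def)
  have QP: "Q x \<inter> P y = {}" if "x \<in> Y" "y \<in> X - Y" for x y
    using Q(1)[OF that(1)] disj assms(2) that by fastforce
  have "disjoint_family_on ?R X"
    unfolding disjoint_family_on_def
  proof (intro ballI impI)
    fix x y assume xy: "x \<in> X" "y \<in> X" "x \<noteq> y"
    have "Q x \<inter> Q y = {}" if "x \<in> Y" "y \<in> Y"
      using assms(3) xy that by (auto simp: blocks_def disjoint_family_on_def)
    then show "?R x \<inter> ?R y = {}"
      using QP[of x y] QP[of y x] disj[OF xy] xy by (auto simp: Int_commute)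
  qed
  moreover have "(\<Union>x\<in>X. ?R x) = V"
  proof -
    have "(\<Union>x\<in>X. ?R x) = (\<Union>x\<in>Y. Q x) \<union> (\<Union>x\<in>X - Y. P x)" using assms(2) by auto
    also have "\<dots> = (\<Union>x\<in>X. P x)" unfolding UQ using assms(2) by auto
    also have "\<dots> = V" using assms(1) by (simp add: blocks_def)
    finally show ?thesis .
  qed
  moreover have "?R x \<subseteq> V \<and> card (?R x) = k" if "x \<in> X" for x
  proof (cases "x \<in> Y")
    case True
    have "Q x \<subseteq> V" using Q(1)[OF True] P(1) assms(2) by blast
    then show ?thesis using True Q(2) by simp
  qed (use P that in auto)
  ultimately show ?thesis by (simp add: blocks_def)
qed

lemma card_UN_blocks:
  assumes "blocks k X V P" "Y \<subseteq> X" "finite X" "finite V"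
  shows "card (\<Union>y\<in>Y. P y) = k * card Y"
proof -
  have "card (\<Union>y\<in>Y. P y) = (\<Sum>y\<in>Y. card (P y))"
  proof (rule card_UN_disjoint)
    show "finite Y" using assms finite_subset by blast
    show "\<forall>i\<in>Y. finite (P i)" using assms finite_subset unfolding blocks_def by blast
    show "\<forall>i\<in>Y. \<forall>j\<in>Y. i \<noteq> j \<longrightarrow> P i \<inter> P j = {}"
      using assms unfolding blocks_def disjoint_family_on_def by blast
  qed
  also have "\<dots> = (\<Sum>y\<in>Y. k)" using assms by (intro sum.cong) (auto simp: blocks_def)
  finally show ?thesis by simp
qed

text \<open>The colours in \<open>Y\<close> give up their blocks, and those in \<open>Z\<close>
  receive edges inside the common territory; what remains is dealt out arbitrarily to
  \<open>Y\<close>. At most \<open>card Y\<close> edges are lost and \<open>card Z\<close> are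
  gained.\<close>

lemma blocks_augment:
  assumes P: "blocks k X V P" and fin: "finite X" "finite V"
    and Z: "Z \<subseteq> X" "\<And>z. z \<in> Z \<Longrightarrow> P z \<notin> H z" and Y: "Y \<subseteq> X" "Z \<inter> Y = {}"
    and E: "\<And>z. z \<in> Z \<Longrightarrow> E z \<in> H z \<and> E z \<subseteq> (\<Union>x\<in>Z \<union> Y. P x) \<and> card (E z) = k"
    and dis: "disjoint_family_on E Z" and less: "card Y < card Z"
  shows "\<exists>Q. blocks k X V Q \<and> card {x \<in> X. P x \<in> H x} < card {x \<in> X. Q x \<in> H x}"
proof -
  let ?ZY = "Z \<union> Y"
  have ZY: "?ZY \<subseteq> X" using Z Y by auto
  have "finite (\<Union>x\<in>?ZY. P x)"
    using P ZY fin by (auto simp: blocks_def intro!: finite_subset[of _ V])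
  moreover have "finite ?ZY" using ZY fin finite_subset by blast
  ultimately obtain R where R: "blocks k ?ZY (\<Union>x\<in>?ZY. P x) R" "\<And>z. z \<in> Z \<Longrightarrow> R z = E z"
    using blocks_extend[of ?ZY "\<Union>x\<in>?ZY. P x" k Z E] E dis card_UN_blocks[OF P ZY fin] by auto
  let ?Q = "\<lambda>x. if x \<in> ?ZY then R x else P x"
  let ?A = "{x \<in> X. P x \<in> H x}" and ?B = "{x \<in> X. ?Q x \<in> H x}"
  have "blocks k X V ?Q" by (rule blocks_replace[OF P ZY R(1)])
  moreover have "card ?A < card ?B"
  proof -
    have fA: "finite ?A" "finite ?B" "finite Z" "finite Y" using fin Z Y finite_subset by auto
    have "(?A - Y) \<union> Z \<subseteq> ?B" using Z E R(2) by auto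
    then have "card ((?A - Y) \<union> Z) \<le> card ?B" using fA by (intro card_mono)
    moreover have "card ((?A - Y) \<union> Z) = card (?A - Y) + card Z"
      using fA Z by (intro card_Un_disjoint) auto
    moreover have "card ?A \<le> card (?A - Y) + card Y"
      using diff_card_le_card_Diff[OF fA(4), of ?A] by linarith
    ultimately show ?thesis using less by linarith
  qed
  ultimately show ?thesis by blast
qed

subsection \<open>Functions on a cube with constant sum over all perfect matchings\<close>

lemma ex_bij_two_values:
  assumes "a < k" "b < k" "a \<noteq> b"
  shows "\<exists>\<tau>. bij_betw \<tau> {..<k} {..<k} \<and> \<tau> 0 = a \<and> \<tau> 1 = (b::nat)"
proof -
  have "card {2..<k} = card ({..<k} - {a, b})"
    using assms by (simp add: card_Diff_subset)
  then obtain h where h: "bij_betw h {2..<k} ({..<k} - {a, b})"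
    using finite_same_card_bij by blast
  define \<tau> where "\<tau> i = (if i = 0 then a else if i = 1 then b else h i)" for i
  have "bij_betw \<tau> ({2..<k} \<union> {0, 1}) (({..<k} - {a, b}) \<union> {a, b})"
  proof (rule bij_betw_combine)
    show "bij_betw \<tau> {2..<k} ({..<k} - {a, b})"
      using h by (rule bij_betw_cong[THEN iffD1, rotated]) (auto simp: \<tau>_def)
    show "bij_betw \<tau> {0, 1} {a, b}" using assms by (auto simp: bij_betw_def \<tau>_def)
  qed auto
  moreover have "{2..<k} \<union> {0, 1} = {..<k}" "({..<k} - {a, b}) \<union> {a, b} = {..<k}"
    using assms by auto
  ultimately show ?thesis using assms by (auto simp: \<tau>_def)
qed

text \<open>\<open>F t\<close> stands for the event that the vertices number \<open>t 0, \<dots>, t (r - 1)\<close> of \<open>r\<close> fixed blocks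
  extend a fixed \<open>(k - r)\<close>-set to an edge. If any \<open>k\<close> disjoint choices give exactly \<open>r = k / 2\<close> edges,
  then \<open>F\<close> depends on one coordinate only.\<close>

locale cube =
  fixes F :: "(nat \<Rightarrow> nat) \<Rightarrow> bool" and r k :: nat
  assumes r2: "r \<ge> 2" and k_eq: "k = 2 * r"
    and dep: "\<And>t s. (\<And>j. j < r \<Longrightarrow> t j = s j) \<Longrightarrow> F t = F s"
    and ex: "\<And>\<tau>. (\<And>j. j < r \<Longrightarrow> bij_betw (\<tau> j) {..<k} {..<k}) \<Longrightarrow> card {i. i < k \<and> F (\<lambda>j. \<tau> j i)} = r"
begin

definition valid :: "(nat \<Rightarrow> nat) \<Rightarrow> bool" where
  "valid t \<longleftrightarrow> (\<forall>j<r. t j < k)"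

lemma valid_upd [simp]: "valid t \<Longrightarrow> a < k \<Longrightarrow> valid (t(j := a))"
  by (auto simp: valid_def)

text \<open>Complete \<open>t\<close> and \<open>t'\<close> to a perfect matching of the cube, as
  its elements 0 and 1, then interchange their coordinates \<open>j\<^sub>0\<close>. The other
  elements are unchanged and both sums are \<open>r\<close>, so the loss at \<open>t\<close> must be
  made up at \<open>t'\<close>.\<close>

lemma exchange:
  assumes "valid t" "valid t'" "\<And>j. j < r \<Longrightarrow> t j \<noteq> t' j" "j\<^sub>0 < r" "F t" "\<not> F (t(j\<^sub>0 := t' j\<^sub>0))"
  shows "\<not> F t' \<and> F (t'(j\<^sub>0 := t j\<^sub>0))"
proof -
  have "\<forall>j. \<exists>\<tau>. j < r \<longrightarrow> bij_betw \<tau> {..<k} {..<k} \<and> \<tau> 0 = t j \<and> \<tau> 1 = t' j"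
    using assms(1-3) ex_bij_two_values unfolding valid_def by meson
  then obtain \<tau> where \<tau>: "\<And>j. j < r \<Longrightarrow> bij_betw (\<tau> j) {..<k} {..<k} \<and> \<tau> j 0 = t j \<and> \<tau> j 1 = t' j"
    by metis
  define sw :: "nat \<Rightarrow> nat" where "sw i = (if i = 0 then 1 else if i = 1 then 0 else i)" for i
  define \<sigma> where "\<sigma> j i = (if j = j\<^sub>0 then \<tau> j (sw i) else \<tau> j i)" for j i
  have k2: "k > 2" using r2 k_eq by simp
  have "bij_betw sw {..<k} {..<k}"
    by (rule bij_betwI[of _ _ _ sw]) (use k2 in \<open>auto simp: sw_def\<close>)
  then have bs: "bij_betw (\<tau> j\<^sub>0 \<circ> sw) {..<k} {..<k}"
    using \<tau>[OF assms(4)] by (blast intro: bij_betw_trans)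
  have \<sigma>b: "bij_betw (\<sigma> j) {..<k} {..<k}" if "j < r" for j
    using \<tau>[OF that] bs unfolding \<sigma>_def by (cases "j = j\<^sub>0") (auto simp: comp_def)
  have split: "{i. i < k \<and> Q i} = {i. i < 2 \<and> Q i} \<union> {i. 2 \<le> i \<and> i < k \<and> Q i}" for Q :: "nat \<Rightarrow> bool"
    using k2 by auto
  have cs: "card {i. i < k \<and> Q i} = card {i. i < 2 \<and> Q i} + card {i. 2 \<le> i \<and> i < k \<and> Q i}" for Q :: "nat \<Rightarrow> bool"
    unfolding split[of Q] by (rule card_Un_disjoint) auto
  have two: "card {i. i < (2::nat) \<and> Q i} = of_bool (Q 0) + of_bool (Q 1)" for Q
  proof -
    have "{i. i < (2::nat) \<and> Q i} = (if Q 0 then {0} else {}) \<union> (if Q 1 then {1} else {})"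
    proof (rule set_eqI)
      fix x :: nat
      consider "x = 0" | "x = 1" | "x \<ge> 2" by linarith
      then show "x \<in> {i. i < (2::nat) \<and> Q i} \<longleftrightarrow> x \<in> (if Q 0 then {0} else {}) \<union> (if Q 1 then {1} else {})"
        by cases auto
    qed
    then show ?thesis by auto
  qed
  have eq: "(\<lambda>j. \<tau> j i) = (\<lambda>j. \<sigma> j i)" if "2 \<le> i" for i
    using that by (auto simp: fun_eq_iff \<sigma>_def sw_def)
  have "card {i. 2 \<le> i \<and> i < k \<and> F (\<lambda>j. \<tau> j i)} = card {i. 2 \<le> i \<and> i < k \<and> F (\<lambda>j. \<sigma> j i)}"
    using eq by (intro arg_cong[where f = card] Collect_cong) metis
  moreover have "card {i. i < k \<and> F (\<lambda>j. \<tau> j i)} = card {i. i < k \<and> F (\<lambda>j. \<sigma> j i)}"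
    using ex[of \<tau>] ex[of \<sigma>] \<tau> \<sigma>b by simp
  ultimately have "of_bool (F (\<lambda>j. \<tau> j 0)) + of_bool (F (\<lambda>j. \<tau> j 1)) = of_bool (F (\<lambda>j. \<sigma> j 0)) + (of_bool (F (\<lambda>j. \<sigma> j 1)) :: nat)"
    unfolding cs two by linarith
  moreover have "F (\<lambda>j. \<tau> j 0) = F t" "F (\<lambda>j. \<tau> j 1) = F t'"
    using \<tau> by (auto intro!: dep)
  moreover have "F (\<lambda>j. \<sigma> j 0) = F (t(j\<^sub>0 := t' j\<^sub>0))" "F (\<lambda>j. \<sigma> j 1) = F (t'(j\<^sub>0 := t j\<^sub>0))"
    using \<tau> by (auto intro!: dep simp: \<sigma>_def sw_def)
  ultimately show ?thesis using assms(5,6) by (auto split: if_splits simp: of_bool_def)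
qed

text \<open>A coordinate that is decisive at one point is decisive everywhere, with the same two
  values. If \<open>s\<close> differs from \<open>t\<close> in all other coordinates, this is
  \<open>exchange\<close>; otherwise pass through a point that differs from both.\<close>

lemma slice:
  assumes "valid t" "j < r" "a < k" "F t" "\<not> F (t(j := a))" "valid s"
  shows "F (s(j := t j)) \<and> \<not> F (s(j := a))"
proof -
  have ne: "t j \<noteq> a" using assms(4,5) by (metis fun_upd_triv)
  have tk: "t j < k" using assms by (simp add: valid_def)
  have step: "F (s(j := u j)) \<and> \<not> F (s(j := a))"
    if "valid u" "u j = t j" "F u" "\<not> F (u(j := a))" "valid s" "\<And>i. i < r \<Longrightarrow> i \<noteq> j \<Longrightarrow> u i \<noteq> s i" for u s
    using exchange[of u "s(j := a)" j] that ne assms(2,3) by auto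
  \<comment> \<open>At most two of the \<open>k \<ge> 4\<close> values are excluded.\<close>
  have "\<forall>i. \<exists>c. c < k \<and> c \<noteq> t i \<and> c \<noteq> s i"
  proof
    fix i
    have "card ({..<k} - {t i, s i}) \<ge> k - card {t i, s i}"
      by (metis card_lessThan diff_card_le_card_Diff finite.emptyI finite_insert)
    moreover have "card {t i, s i} \<le> 2" by (simp add: card_insert_if)
    ultimately have "card ({..<k} - {t i, s i}) > 0" using r2 k_eq by linarith
    then obtain c where "c \<in> {..<k} - {t i, s i}" by (metis card.empty equals0I less_irrefl)
    then show "\<exists>c. c < k \<and> c \<noteq> t i \<and> c \<noteq> s i" by auto
  qed
  then obtain c where c: "\<And>i. c i < k \<and> c i \<noteq> t i \<and> c i \<noteq> s i" by metis
  have vc: "valid c" using c by (auto simp: valid_def)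
  have 1: "F (c(j := t j)) \<and> \<not> F (c(j := a))"
    using step[of t c] assms c vc by metis
  show ?thesis
    using step[of "c(j := t j)" s] 1 assms c vc tk by auto
qed

text \<open>Replace the coordinates of \<open>t\<close> by those of \<open>s\<close> one at a time;
  the value must drop at some step.\<close>

lemma hybrid:
  assumes "valid t" "valid s" "F t" "\<not> F s"
  shows "\<exists>i<r. \<exists>u. valid u \<and> F u \<and> u i = t i \<and> \<not> F (u(i := s i))"
proof -
  define h where "h i j = (if j < i then s j else t j)" for i j :: nat
  have "h 0 = t" by (simp add: h_def fun_eq_iff)
  then have h0: "F (h 0)" using assms by simp
  have hr: "\<not> F (h r)" using dep[of "h r" s] assms by (simp add: h_def)
  have "\<exists>i<r. F (h i) \<and> \<not> F (h (Suc i))"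
  proof (rule ccontr)
    assume c: "\<not> ?thesis"
    have "i \<le> r \<Longrightarrow> F (h i)" for i
      by (induction i) (use h0 c in auto)
    then show False using hr by simp
  qed
  then obtain i where i: "i < r" "F (h i)" "\<not> F (h (Suc i))" by blast
  have "h (Suc i) = (h i)(i := s i)" by (auto simp: h_def fun_eq_iff)
  moreover have "valid (h i)" using assms by (auto simp: valid_def h_def)
  moreover have "h i i = t i" by (simp add: h_def)
  ultimately show ?thesis using i by (intro exI[of _ i]) auto
qed

lemma dictator:
  "\<exists>j<r. \<exists>C\<subseteq>{..<k}. card C = r \<and> (\<forall>t. valid t \<longrightarrow> (F t \<longleftrightarrow> t j \<in> C))"
proof -
  \<comment> \<open>The diagonal is a perfect matching of the cube with \<open>0 < r < k\<close>
    hits, so \<open>F\<close> takes both values.\<close>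
  have idc: "card {i. i < k \<and> F (\<lambda>j. i)} = r"
    using ex[of "\<lambda>j i. i"] by (simp add: bij_betw_def)
  have kr: "k > r" "r > 0" using r2 k_eq by auto
  have "\<exists>i<k. F (\<lambda>j. i)"
    using idc kr by (metis (mono_tags, lifting) card.empty empty_Collect_eq less_irrefl)
  moreover have "\<exists>i<k. \<not> F (\<lambda>j. i)"
  proof (rule ccontr)
    assume "\<not> ?thesis"
    then have "{i. i < k \<and> F (\<lambda>j. i)} = {..<k}" by auto
    then show False using idc kr by simp
  qed
  ultimately obtain a b where ab: "a < k" "F (\<lambda>j. a)" "b < k" "\<not> F (\<lambda>j. b)" by blast
  define t s :: "nat \<Rightarrow> nat" where "t = (\<lambda>j. a)" and "s = (\<lambda>j. b)"
  have "valid t" "valid s" "F t" "\<not> F s" using ab by (auto simp: valid_def t_def s_def)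
  from hybrid[OF this] obtain j u where j: "j < r" "valid u" "F u" "\<not> F (u(j := s j))" by blast
  have sj: "s j < k" using \<open>valid s\<close> j by (simp add: valid_def)
  \<comment> \<open>If a second coordinate \<open>i\<close> were decisive, then at a point carrying
    both entries the slice at \<open>i\<close> would force the value true and the slice at
    \<open>j\<close> the value false.\<close>
  have nochange: "F w'" if "valid w" "valid w'" "w j = w' j" "F w" for w w'
  proof (rule ccontr)
    assume "\<not> F w'"
    from hybrid[OF that(1,2,4) this] obtain i v where i: "i < r" "valid v" "F v" "v i = w i" "\<not> F (v(i := w' i))"
      by blast
    have ij: "i \<noteq> j" using i that by (metis fun_upd_triv)
    have w'i: "w' i < k" "v i < k" using that i by (auto simp: valid_def)
    have "F ((u(j := s j))(i := v i))"
      using slice[of v i "w' i" "u(j := s j)"] i w'i j sj by auto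
    moreover have "\<not> F ((u(i := v i))(j := s j))"
      using slice[of u j "s j" "u(i := v i)"] j sj w'i by auto
    ultimately show False using ij by (simp add: fun_upd_twist)
  qed
  define C where "C = {a. a < k \<and> F (\<lambda>_. a)}"
  have "F w \<longleftrightarrow> w j \<in> C" if "valid w" for w
    using nochange[of w "\<lambda>_. w j"] nochange[of "\<lambda>_. w j" w] that j by (auto simp: C_def valid_def)
  moreover have "card C = r" using idc by (simp add: C_def)
  moreover have "C \<subseteq> {..<k}" by (auto simp: C_def)
  ultimately show ?thesis using j(1) by blast
qed

end

subsection \<open>Almost perfect matchings\<close>

lemma mod_add_cancel_less:
  assumes "(a + c) mod k = (b + c) mod k" "a < k" "b < (k::nat)"
  shows "a = b"
proof -
  have "x = y" if "x \<le> y" "y < k" "(y + c) mod k = (x + c) mod k" for x y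
  proof -
    have "k dvd (y + c) - (x + c)" using that by (subst mod_eq_dvd_iff_nat[symmetric]) auto
    then have "k dvd y - x" by simp
    then show ?thesis using that by (meson diff_is_0_eq dvd_imp_le le_less_trans less_imp_diff_less not_le le_antisym zero_less_diff)
  qed
  then show ?thesis using assms by (metis nat_le_linear)
qed

lemma nth_nlists: "xs \<in> nlists V j \<Longrightarrow> i < j \<Longrightarrow> xs ! i \<in> V"
  by (metis length_nlists nth_mem set_nlists subsetD)

text \<open>As the shift vector \<open>s\<close> runs through the cube, the \<open>i\<close>-th
  element of the shifted matching meets every point exactly once.\<close>

lemma bij_betw_cube_shift:
  assumes "\<And>j. j < r \<Longrightarrow> bij_betw (\<tau> j) {..<k} {..<k}" "i < (k::nat)"
  shows "bij_betw (\<lambda>s. map (\<lambda>j. \<tau> j ((i + s ! j) mod k)) [0..<r]) (nlists {..<k} r) (nlists {..<k} r)"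
    (is "bij_betw ?f ?N ?N")
proof -
  have k: "k > 0" using assms(2) by simp
  have "inj_on ?f ?N"
  proof (rule inj_onI)
    fix s s' assume s: "s \<in> ?N" "s' \<in> ?N" and eq: "?f s = ?f s'"
    have "s ! j = s' ! j" if "j < r" for j
    proof -
      have lt: "s ! j < k" "s' ! j < k" using nth_nlists[OF s(1) that] nth_nlists[OF s(2) that] by auto
      have "\<tau> j ((i + s ! j) mod k) = \<tau> j ((i + s' ! j) mod k)"
        using eq that by auto
      then have "(i + s ! j) mod k = (i + s' ! j) mod k"
        using assms(1)[OF that] k by (meson bij_betw_imp_inj_on inj_onD lessThan_iff mod_less_divisor)
      then show ?thesis using mod_add_cancel_less[of "s ! j" i k "s' ! j"] lt by (simp add: add.commute)
    qed
    then show "s = s'" using s by (auto simp: nlists_def intro: nth_equalityI)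
  qed
  moreover have "?f ` ?N \<subseteq> ?N"
  proof -
    have "\<tau> j ((i + s ! j) mod k) < k" if "j < r" for j s
      using bij_betwE[OF assms(1)[OF that]] k by simp
    then show ?thesis by (auto simp: nlists_def)
  qed
  ultimately show ?thesis
    unfolding bij_betw_def by (simp add: endo_inj_surj)
qed

text \<open>The hypothesis says that \<open>en\<close> enumerates \<open>V\<close> by block and
  position; a tuple of vertices then is a tuple of blocks with a tuple of positions.\<close>

lemma sum_nlists_pairs:
  assumes "\<And>f :: 'a \<Rightarrow> nat. (\<Sum>v\<in>V. f v) = (\<Sum>x\<in>X. \<Sum>i<k. f (en x i))"
  shows "(\<Sum>T\<in>nlists V j. (f :: 'a list \<Rightarrow> nat) T) = (\<Sum>y\<in>nlists X j. \<Sum>t\<in>nlists {..<k} j. f (map2 en y t))"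
proof (induction j arbitrary: f)
  case 0
  then show ?case by simp
next
  case (Suc j)
  have "(\<Sum>T\<in>nlists V (Suc j). f T) = (\<Sum>x\<in>X. \<Sum>i<k. \<Sum>T\<in>nlists V j. f (en x i # T))"
    unfolding sum_nlists_Suc assms ..
  also have "\<dots> = (\<Sum>x\<in>X. \<Sum>i<k. \<Sum>y\<in>nlists X j. \<Sum>t\<in>nlists {..<k} j. f (en x i # map2 en y t))"
    by (simp add: Suc)
  also have "\<dots> = (\<Sum>x\<in>X. \<Sum>y\<in>nlists X j. \<Sum>i<k. \<Sum>t\<in>nlists {..<k} j. f (en x i # map2 en y t))"
    by (intro sum.cong refl sum.swap)
  also have "\<dots> = (\<Sum>y\<in>nlists X (Suc j). \<Sum>t\<in>nlists {..<k} (Suc j). f (map2 en y t))"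
    unfolding sum_nlists_Suc by simp
  finally show ?case .
qed

text \<open>The blocks of the colours in \<open>Z\<close> are not edges. If \<open>k\<close> disjoint transversals of \<open>r\<close> further blocks
  extended the sets \<open>S z\<close> for distinct \<open>z\<close> in \<open>Z\<close> to more than \<open>r\<close> edges, then giving up the \<open>r\<close> blocks
  for \<open>r + 1\<close> of these edges would contradict the maximality of \<open>P\<close>.\<close>

locale max_blocks =
  fixes X :: "'c set" and V :: "'a set" and H :: "'c \<Rightarrow> 'a set set" and k r :: nat
    and P :: "'c \<Rightarrow> 'a set" and Z :: "'c set" and S :: "'c \<Rightarrow> 'a set" and en :: "'c \<Rightarrow> nat \<Rightarrow> 'a"
  assumes fin [simp]: "finite X" "finite V"
    and edge_card: "\<And>x e. x \<in> X \<Longrightarrow> e \<in> H x \<Longrightarrow> card e = k"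
    and P: "blocks k X V P"
    and maxP: "\<And>Q. blocks k X V Q \<Longrightarrow> card {x \<in> X. Q x \<in> H x} \<le> card {x \<in> X. P x \<in> H x}"
    and Z: "Z \<subseteq> X" "card Z = k + 1" "\<And>z. z \<in> Z \<Longrightarrow> P z \<notin> H z"
    and S: "\<And>z. z \<in> Z \<Longrightarrow> S z \<subseteq> P z"
    and en: "\<And>y. y \<in> X \<Longrightarrow> bij_betw (en y) {..<k} (P y)"
    and rk: "r \<ge> 1" "2 * r \<le> k"
begin

lemma en_in: "y \<in> X \<Longrightarrow> a < k \<Longrightarrow> en y a \<in> P y"
  using en bij_betwE by fastforce

lemma P_disjoint: "x \<in> X \<Longrightarrow> y \<in> X \<Longrightarrow> v \<in> P x \<Longrightarrow> v \<in> P y \<Longrightarrow> x = y"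
  using P unfolding blocks_def disjoint_family_on_def by blast

lemma en_inj: "y \<in> X \<Longrightarrow> z \<in> X \<Longrightarrow> a < k \<Longrightarrow> b < k \<Longrightarrow> en y a = en z b \<Longrightarrow> y = z \<and> a = b"
  using P_disjoint[of y z "en y a"] en_in en[of y]
  by (metis bij_betw_imp_inj_on inj_onD lessThan_iff)

lemma finZ [simp]: "finite Z"
  using Z(1) fin(1) finite_subset by blast

text \<open>More hits than blocks in \<open>Y\<close> would let \<open>blocks_augment\<close>
  improve \<open>P\<close>. The sets of positions are arbitrary because the bound is needed both for
  \<open>r\<close> blocks and for the \<open>r + 1\<close> blocks of two overlapping tuples.\<close>

lemma hit_le:
  assumes I: "inj_on \<kappa> I" "\<kappa> ` I \<subseteq> Z" and Y: "Y \<subseteq> X" "Y \<inter> Z = {}"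
    and pos: "\<And>i. i \<in> I \<Longrightarrow> pos i \<subseteq> Y \<times> {..<k}"
    and dis: "\<And>i i'. i \<in> I \<Longrightarrow> i' \<in> I \<Longrightarrow> i \<noteq> i' \<Longrightarrow> pos i \<inter> pos i' = {}"
    and hit: "\<And>i. i \<in> I \<Longrightarrow> S (\<kappa> i) \<union> (\<lambda>(c, a). en c a) ` pos i \<in> H (\<kappa> i)"
  shows "card I \<le> card Y"
proof (rule ccontr)
  assume "\<not> ?thesis"
  then have less: "card Y < card (\<kappa> ` I)" using I by (simp add: card_image)
  define \<iota> where "\<iota> = inv_into I \<kappa>"
  have \<iota>: "\<iota> z \<in> I" "\<kappa> (\<iota> z) = z" if "z \<in> \<kappa> ` I" for z
    using that by (auto simp: \<iota>_def inv_into_into f_inv_into_f)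
  let ?E = "\<lambda>z. S z \<union> (\<lambda>(c, a). en c a) ` pos (\<iota> z)"
  have ZX: "\<kappa> ` I \<subseteq> X" using I Z by auto
  have E: "?E z \<in> H z \<and> ?E z \<subseteq> (\<Union>x\<in>\<kappa> ` I \<union> Y. P x) \<and> card (?E z) = k" if "z \<in> \<kappa> ` I" for z
  proof -
    have 1: "?E z \<in> H z" using hit[OF \<iota>(1)[OF that]] \<iota>(2)[OF that] by simp
    moreover have "card (?E z) = k" using edge_card[OF _ 1] that ZX by blast
    moreover have "S z \<subseteq> (\<Union>x\<in>\<kappa> ` I \<union> Y. P x)"
      using S[of z] that I by blast
    moreover have "(\<lambda>(c, a). en c a) ` pos (\<iota> z) \<subseteq> (\<Union>x\<in>\<kappa> ` I \<union> Y. P x)"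
    proof clarify
      fix c a assume "(c, a) \<in> pos (\<iota> z)"
      then have "c \<in> Y" "a < k" using pos[OF \<iota>(1)[OF that]] by auto
      then show "en c a \<in> (\<Union>x\<in>\<kappa> ` I \<union> Y. P x)" using en_in[of c a] Y by blast
    qed
    ultimately show ?thesis by blast
  qed
  have "disjoint_family_on ?E (\<kappa> ` I)"
    unfolding disjoint_family_on_def
  proof (intro ballI impI)
    fix z z' assume z: "z \<in> \<kappa> ` I" "z' \<in> \<kappa> ` I" "z \<noteq> z'"
    have zX: "z \<in> Z" "z' \<in> Z" "z \<in> X" "z' \<in> X" using z I Z by auto
    have en_Y: "\<exists>c\<in>Y. \<exists>a<k. v = en c a \<and> (c, a) \<in> pos (\<iota> w)"
      if "v \<in> (\<lambda>(c, a). en c a) ` pos (\<iota> w)" "w \<in> \<kappa> ` I" for v w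
      using pos[OF \<iota>(1)[OF that(2)]] that(1) by auto
    have 1: "S z \<inter> S z' = {}" using S zX P_disjoint z(3) by blast
    have 2: "S w \<inter> (\<lambda>(c, a). en c a) ` pos (\<iota> w') = {}" if w: "w \<in> \<kappa> ` I" and w': "w' \<in> \<kappa> ` I" for w w'
    proof (rule ccontr)
      assume "\<not> ?thesis"
      then obtain v where v: "v \<in> S w" "v \<in> (\<lambda>(c, a). en c a) ` pos (\<iota> w')" by blast
      obtain c a where ca: "c \<in> Y" "a < k" "v = en c a" using en_Y[OF v(2) w'] by blast
      have wZ: "w \<in> Z" using w I by auto
      have "v \<in> P c" using en_in[of c a] ca Y by auto
      moreover have "v \<in> P w" using S[OF wZ] v(1) by auto
      ultimately have "c = w" using P_disjoint[of c w v] ca(1) wZ Y(1) Z(1) by auto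
      then show False using ca(1) wZ Y(2) by auto
    qed
    have 3: "(\<lambda>(c, a). en c a) ` pos (\<iota> z) \<inter> (\<lambda>(c, a). en c a) ` pos (\<iota> z') = {}"
    proof (rule ccontr)
      assume "\<not> ?thesis"
      then obtain v where v: "v \<in> (\<lambda>(c, a). en c a) ` pos (\<iota> z)" "v \<in> (\<lambda>(c, a). en c a) ` pos (\<iota> z')" by blast
      obtain c a where h: "c \<in> Y" "a < k" "v = en c a" "(c, a) \<in> pos (\<iota> z)" using en_Y[OF v(1) z(1)] by blast
      obtain c' a' where h': "c' \<in> Y" "a' < k" "v = en c' a'" "(c', a') \<in> pos (\<iota> z')" using en_Y[OF v(2) z(2)] by blast
      then have "c = c' \<and> a = a'" using en_inj[of c c' a a'] Y h h' by auto
      moreover have "\<iota> z \<noteq> \<iota> z'" using \<iota> z by metis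
      ultimately show False using dis[OF \<iota>(1)[OF z(1)] \<iota>(1)[OF z(2)]] h(4) h'(4) by auto
    qed
    show "?E z \<inter> ?E z' = {}" using 1 2[OF z(1,2)] 2[OF z(2,1)] 3 by blast
  qed
  from blocks_augment[OF P fin ZX _ Y(1) _ E this less] obtain Q where
    "blocks k X V Q" "card {x \<in> X. P x \<in> H x} < card {x \<in> X. Q x \<in> H x}"
    using Z(3) I(2) Y(2) by blast
  then show False using maxP by fastforce
qed

section \<open>Averaging over disjoint transversals of r blocks\<close>

definition g :: "'c \<Rightarrow> 'c list \<Rightarrow> (nat \<Rightarrow> nat) \<Rightarrow> bool" where
  "g x y t \<longleftrightarrow> S x \<union> (\<lambda>l. en (y ! l) (t l)) ` {..<r} \<in> H x"

definition good :: "'c list \<Rightarrow> bool" where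
  "good y \<longleftrightarrow> y \<in> nlists X r \<and> distinct y \<and> set y \<inter> Z = {}"

definition tot :: "'c \<Rightarrow> 'c list \<Rightarrow> nat" where
  "tot x y = card {t \<in> nlists {..<k} r. g x y (\<lambda>j. t ! j)}"

lemma g_cong: "(\<And>j. j < r \<Longrightarrow> t j = s j) \<Longrightarrow> g x y t = g x y s"
  unfolding g_def by (metis (mono_tags, lifting) image_cong lessThan_iff)

lemma tot_le: "tot x y \<le> k ^ r"
proof -
  have "tot x y \<le> card (nlists {..<k} r)" unfolding tot_def by (intro card_mono) auto
  then show ?thesis by (simp add: card_nlists)
qed

lemma hits_le:
  assumes y: "good y" and \<kappa>: "inj_on \<kappa> {..<k}" "\<kappa> ` {..<k} \<subseteq> Z"
    and \<tau>: "\<And>j. j < r \<Longrightarrow> bij_betw (\<tau> j) {..<k} {..<k}"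
  shows "card {i. i < k \<and> g (\<kappa> i) y (\<lambda>j. \<tau> j i)} \<le> r"
proof -
  have len: "length y = r" "set y \<subseteq> X" using y by (auto simp: good_def nlists_def)
  have "card {i. i < k \<and> g (\<kappa> i) y (\<lambda>j. \<tau> j i)} \<le> card (set y)"
  proof (rule hit_le[where pos = "\<lambda>i. (\<lambda>l. (y ! l, \<tau> l i)) ` {..<r}"])
    show "inj_on \<kappa> {i. i < k \<and> g (\<kappa> i) y (\<lambda>j. \<tau> j i)}" using \<kappa>(1) by (rule inj_on_subset) auto
    show "\<kappa> ` {i. i < k \<and> g (\<kappa> i) y (\<lambda>j. \<tau> j i)} \<subseteq> Z" using \<kappa>(2) by auto
    show "set y \<subseteq> X" "set y \<inter> Z = {}" using y by (auto simp: good_def nlists_def)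
    fix i assume i: "i \<in> {i. i < k \<and> g (\<kappa> i) y (\<lambda>j. \<tau> j i)}"
    show "(\<lambda>l. (y ! l, \<tau> l i)) ` {..<r} \<subseteq> set y \<times> {..<k}"
      using \<tau> i len bij_betwE by fastforce
    show "S (\<kappa> i) \<union> (\<lambda>(c, a). en c a) ` (\<lambda>l. (y ! l, \<tau> l i)) ` {..<r} \<in> H (\<kappa> i)"
      using i by (simp add: g_def image_image)
    fix i' assume i': "i' \<in> {i. i < k \<and> g (\<kappa> i) y (\<lambda>j. \<tau> j i)}" "i \<noteq> i'"
    show "(\<lambda>l. (y ! l, \<tau> l i)) ` {..<r} \<inter> (\<lambda>l. (y ! l, \<tau> l i')) ` {..<r} = {}"
    proof (rule ccontr)
      assume "\<not> ?thesis"
      then obtain l l' where l: "l < r" "l' < r" "y ! l = y ! l'" "\<tau> l i = \<tau> l' i'" by auto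
      then have "l = l'" using y len by (auto simp: good_def nth_eq_iff_index_eq)
      then have "i = i'" using l \<tau>[of l] i i' by (metis (mono_tags, lifting) bij_betw_imp_inj_on inj_onD lessThan_iff mem_Collect_eq)
      then show False using i' by simp
    qed
  qed
  then show ?thesis using y len by (simp add: good_def distinct_card)
qed

text \<open>Double counting: over all cyclic shifts of a perfect matching of the cube, each of its
  \<open>k\<close> elements runs through all points exactly once.\<close>

lemma sum_tot_shift:
  assumes \<tau>: "\<And>j. j < r \<Longrightarrow> bij_betw (\<tau> j) {..<k} {..<k}"
  shows "(\<Sum>i<k. tot (\<kappa> i) y) =
     (\<Sum>s\<in>nlists {..<k} r. card {i. i < k \<and> g (\<kappa> i) y (\<lambda>j. \<tau> j ((i + s ! j) mod k))})"
proof -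
  let ?N = "nlists {..<k} r"
  have "tot (\<kappa> i) y = (\<Sum>s\<in>?N. of_bool (g (\<kappa> i) y (\<lambda>j. \<tau> j ((i + s ! j) mod k))))" if "i < k" for i
  proof -
    have "tot (\<kappa> i) y = (\<Sum>t\<in>?N. of_bool (g (\<kappa> i) y (\<lambda>j. t ! j)))"
      by (simp add: tot_def Int_def)
    also have "\<dots> = (\<Sum>s\<in>?N. of_bool (g (\<kappa> i) y (\<lambda>j. map (\<lambda>j. \<tau> j ((i + s ! j) mod k)) [0..<r] ! j)))"
      by (rule sum.reindex_bij_betw[OF bij_betw_cube_shift[OF \<tau> that], symmetric])
    also have "\<dots> = (\<Sum>s\<in>?N. of_bool (g (\<kappa> i) y (\<lambda>j. \<tau> j ((i + s ! j) mod k))))"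
      by (intro sum.cong arg_cong[where f = of_bool] g_cong refl) simp
    finally show ?thesis .
  qed
  then have "(\<Sum>i<k. tot (\<kappa> i) y) = (\<Sum>i<k. \<Sum>s\<in>?N. of_bool (g (\<kappa> i) y (\<lambda>j. \<tau> j ((i + s ! j) mod k))))"
    by simp
  also have "\<dots> = (\<Sum>s\<in>?N. \<Sum>i<k. of_bool (g (\<kappa> i) y (\<lambda>j. \<tau> j ((i + s ! j) mod k))))"
    by (rule sum.swap)
  also have "\<dots> = (\<Sum>s\<in>?N. card {i. i < k \<and> g (\<kappa> i) y (\<lambda>j. \<tau> j ((i + s ! j) mod k))})"
    by (intro sum.cong refl) (simp add: Int_def)
  finally show ?thesis .
qed

lemma bij_shift: "bij_betw f {..<k} {..<k} \<Longrightarrow> bij_betw (\<lambda>i. f ((i + c) mod k)) {..<k} {..<k}"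
proof -
  assume f: "bij_betw f {..<k} {..<k}"
  have k: "k > 0" using rk by simp
  have "inj_on (\<lambda>i. (i + c) mod k) {..<k}"
  proof (rule inj_onI)
    fix i j assume ij: "i \<in> {..<k}" "j \<in> {..<k}" "(i + c) mod k = (j + c) mod k"
    then show "i = j" by (auto intro: mod_add_cancel_less)
  qed
  moreover have "(\<lambda>i. (i + c) mod k) ` {..<k} \<subseteq> {..<k}" using k by auto
  ultimately have "bij_betw (\<lambda>i. (i + c) mod k) {..<k} {..<k}"
    by (simp add: bij_betw_def endo_inj_surj)
  from bij_betw_trans[OF this f] show ?thesis by (simp add: comp_def)
qed

lemma sum_tot_le:
  assumes "good y" "K \<subseteq> Z" "card K = k"
  shows "(\<Sum>x\<in>K. tot x y) \<le> r * k ^ r"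
proof -
  obtain \<kappa> where \<kappa>: "bij_betw \<kappa> {..<k} K"
    using assms finite_same_card_bij[of "{..<k}" K] finite_subset[OF assms(2)] by auto
  have inj: "inj_on \<kappa> {..<k}" "\<kappa> ` {..<k} \<subseteq> Z"
    using \<kappa> assms by (auto simp: bij_betw_def)
  have "(\<Sum>x\<in>K. tot x y) = (\<Sum>i<k. tot (\<kappa> i) y)"
    by (rule sum.reindex_bij_betw[OF \<kappa>, symmetric])
  also have "\<dots> = (\<Sum>s\<in>nlists {..<k} r. card {i. i < k \<and> g (\<kappa> i) y (\<lambda>j. ((i + s ! j) mod k))})"
    by (rule sum_tot_shift[of "\<lambda>j i. i"]) (auto simp: bij_betw_def)
  also have "\<dots> \<le> (\<Sum>s\<in>nlists {..<k} r. r)"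
    by (intro sum_mono hits_le[OF assms(1) inj, of "\<lambda>j i. (i + _ j) mod k"] bij_shift[of "\<lambda>i. i"])
       (auto simp: bij_betw_def)
  also have "\<dots> = r * k ^ r" by (simp add: card_nlists)
  finally show ?thesis .
qed

text \<open>Each shifted matching has at most \<open>r\<close> hits. If the average is
  \<open>r\<close>, so is every term, in particular the one with shift zero.\<close>

lemma exact_hits:
  assumes y: "good y" and \<kappa>: "inj_on \<kappa> {..<k}" "\<kappa> ` {..<k} \<subseteq> Z"
    and \<tau>: "\<And>j. j < r \<Longrightarrow> bij_betw (\<tau> j) {..<k} {..<k}"
    and eq: "(\<Sum>x\<in>\<kappa> ` {..<k}. tot x y) = r * k ^ r"
  shows "card {i. i < k \<and> g (\<kappa> i) y (\<lambda>j. \<tau> j i)} = r"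
proof -
  let ?N = "nlists {..<k} r"
  let ?h = "\<lambda>s. card {i. i < k \<and> g (\<kappa> i) y (\<lambda>j. \<tau> j ((i + s ! j) mod k))}"
  have le: "?h s \<le> r" for s
    by (rule hits_le[OF y \<kappa>, of "\<lambda>j i. \<tau> j ((i + s ! j) mod k)"]) (intro bij_shift \<tau>)
  have "(\<Sum>s\<in>?N. ?h s) = r * k ^ r"
    using eq sum_tot_shift[where \<tau> = \<tau> and \<kappa> = \<kappa> and y = y, OF \<tau>] \<kappa> by (simp add: sum.reindex)
  then have sum: "(\<Sum>s\<in>?N. ?h s) = (\<Sum>s\<in>?N. r)" by (simp add: card_nlists)
  have 0: "replicate r 0 \<in> ?N" using rk by (auto simp: nlists_def)
  have "?h (replicate r 0) = r"
  proof (rule ccontr)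
    assume "?h (replicate r 0) \<noteq> r"
    then have "?h (replicate r 0) < r" using le[of "replicate r 0"] by linarith
    then have "(\<Sum>s\<in>?N. ?h s) < (\<Sum>s\<in>?N. r)"
      using le 0 by (intro sum_strict_mono_ex1) auto
    then show False using sum by simp
  qed
  moreover have "?h (replicate r 0) = card {i. i < k \<and> g (\<kappa> i) y (\<lambda>j. \<tau> j i)}"
    by (intro arg_cong[where f = card] Collect_cong conj_cong refl g_cong) simp
  ultimately show ?thesis by simp
qed

text \<open>The averaged bound is attained for every choice of \<open>k\<close> out of the
  \<open>k + 1\<close> colours in \<open>Z\<close>.\<close>

definition exact :: "'c list \<Rightarrow> bool" where
  "exact y \<longleftrightarrow> good y \<and> (\<forall>x\<in>Z. (\<Sum>z\<in>Z - {x}. tot z y) = r * k ^ r)"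

lemma exact_hits':
  assumes "exact y" "inj_on \<kappa> {..<k}" "\<kappa> ` {..<k} \<subseteq> Z"
    and \<tau>: "\<And>j. j < r \<Longrightarrow> bij_betw (\<tau> j) {..<k} {..<k}"
  shows "card {i. i < k \<and> g (\<kappa> i) y (\<lambda>j. \<tau> j i)} = r"
proof -
  have "card (\<kappa> ` {..<k}) = k" using assms(2) by (simp add: card_image)
  then have "card (Z - \<kappa> ` {..<k}) = 1"
    using Z(2) assms(3) by (simp add: card_Diff_subset)
  then obtain x where "Z - \<kappa> ` {..<k} = {x}" by (auto simp: card_1_singleton_iff)
  then have "\<kappa> ` {..<k} = Z - {x}" "x \<in> Z" using assms(3) by blast+
  then show ?thesis
    using assms(1) by (intro exact_hits assms \<tau>) (auto simp: exact_def)
qed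

text \<open>Take two families of \<open>k\<close> colours that differ only in position 0, where one
  has \<open>x\<close> and the other \<open>x'\<close>. Along a matching through \<open>t\<close>
  both have exactly \<open>r\<close> hits, so they agree at \<open>t\<close>. This comparison is
  what the \<open>k + 1\<close> colours are for.\<close>

lemma exact_same:
  assumes "exact y" "x \<in> Z" "x' \<in> Z" "\<And>j. j < r \<Longrightarrow> t j < k"
  shows "g x y t = g x' y t"
proof (cases "x = x'")
  case False
  have k: "k > 0" using rk by simp
  have "card {1..<k} = card (Z - {x, x'})"
    using assms Z False by (simp add: card_Diff_subset)
  then obtain h where h: "bij_betw h {1..<k} (Z - {x, x'})"
    using finite_same_card_bij[of "{1..<k}" "Z - {x, x'}"] by auto
  have inj_h: "inj_on h {1..<k}" and h_in: "\<And>i. 1 \<le> i \<Longrightarrow> i < k \<Longrightarrow> h i \<in> Z - {x, x'}"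
    using h bij_betwE[OF h] by (auto simp: bij_betw_def)
  define \<kappa> where "\<kappa> u i = (if i = 0 then u else h i)" for u i
  have \<kappa>: "inj_on (\<kappa> u) {..<k}" "\<kappa> u ` {..<k} \<subseteq> Z" if "u \<in> {x, x'}" for u
  proof -
    show "inj_on (\<kappa> u) {..<k}"
    proof (rule inj_onI)
      fix i j assume ij: "i \<in> {..<k}" "j \<in> {..<k}" "\<kappa> u i = \<kappa> u j"
      show "i = j"
        using ij inj_onD[OF inj_h, of i j] h_in[of i] h_in[of j] that unfolding \<kappa>_def
        by (cases "i = 0"; cases "j = 0") auto
    qed
    show "\<kappa> u ` {..<k} \<subseteq> Z"
    proof clarify
      fix i assume "i < k"
      then show "\<kappa> u i \<in> Z" using h_in[of i] that assms by (cases "i = 0") (auto simp: \<kappa>_def)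
    qed
  qed
  \<comment> \<open>The diagonal matching, shifted so that its element 0 is
    \<open>t\<close>.\<close>
  define \<tau> where "\<tau> j i = (i + t j) mod k" for j i
  have \<tau>: "bij_betw (\<tau> j) {..<k} {..<k}" for j
    unfolding \<tau>_def by (rule bij_shift[of "\<lambda>i. i", unfolded]) (simp add: bij_betw_def)
  have split: "card {i. i < k \<and> g (\<kappa> u i) y (\<lambda>j. \<tau> j i)} =
      of_bool (g u y (\<lambda>j. \<tau> j 0)) + card {i. 1 \<le> i \<and> i < k \<and> g (h i) y (\<lambda>j. \<tau> j i)}" for u
  proof -
    have eq: "{i. i < k \<and> g (\<kappa> u i) y (\<lambda>j. \<tau> j i)} =
        {i. i = 0 \<and> g u y (\<lambda>j. \<tau> j 0)} \<union> {i. 1 \<le> i \<and> i < k \<and> g (h i) y (\<lambda>j. \<tau> j i)}"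
    proof (rule set_eqI)
      fix i show "i \<in> {i. i < k \<and> g (\<kappa> u i) y (\<lambda>j. \<tau> j i)} \<longleftrightarrow>
        i \<in> {i. i = 0 \<and> g u y (\<lambda>j. \<tau> j 0)} \<union> {i. 1 \<le> i \<and> i < k \<and> g (h i) y (\<lambda>j. \<tau> j i)}"
        using k by (cases "i = 0") (auto simp: \<kappa>_def)
    qed
    have "card {i. i = (0::nat) \<and> g u y (\<lambda>j. \<tau> j 0)} = of_bool (g u y (\<lambda>j. \<tau> j 0))"
      by (cases "g u y (\<lambda>j. \<tau> j 0)") auto
    then show ?thesis unfolding eq by (subst card_Un_disjoint) auto
  qed
  have "card {i. i < k \<and> g (\<kappa> x i) y (\<lambda>j. \<tau> j i)} = card {i. i < k \<and> g (\<kappa> x' i) y (\<lambda>j. \<tau> j i)}"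
    using exact_hits'[OF assms(1) \<kappa> \<tau>] by simp
  then have "g x y (\<lambda>j. \<tau> j 0) = g x' y (\<lambda>j. \<tau> j 0)"
    unfolding split by (auto simp: of_bool_def split: if_splits)
  moreover have "g u y (\<lambda>j. \<tau> j 0) = g u y t" for u
    using assms(4) by (intro g_cong) (simp add: \<tau>_def)
  ultimately show ?thesis by simp
qed simp

end

text \<open>Otherwise every point of \<open>E\<close> is alone on one of the lines through it.
  Deleting that coordinate is injective on the points assigned to it, which leaves at most
  \<open>r * card X ^ (r - 1)\<close> points.\<close>

lemma ex_non_unique_on_lines:
  assumes "finite X" "E \<subseteq> nlists X r" "r * card X ^ (r - 1) < card E"
  shows "\<exists>y\<in>E. \<forall>j<r. \<exists>z. z \<noteq> y ! j \<and> y[j := z] \<in> E"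
proof (rule ccontr)
  assume neg: "\<not> ?thesis"
  define U where "U j = {y \<in> E. \<forall>z. y[j := z] \<in> E \<longrightarrow> z = y ! j}" for j
  have finE: "finite E" using assms finite_subset finite_nlists by blast
  have "E \<subseteq> (\<Union>j<r. U j)"
  proof
    fix y assume y: "y \<in> E"
    then obtain j where "j < r" "\<forall>z. y[j := z] \<in> E \<longrightarrow> z = y ! j" using neg by blast
    then show "y \<in> (\<Union>j<r. U j)" using y by (auto simp: U_def)
  qed
  then have "card E \<le> card (\<Union>j<r. U j)"
    using finE by (intro card_mono) (auto simp: U_def)
  also have "\<dots> \<le> (\<Sum>j<r. card (U j))" by (rule card_UN_le) simp
  also have "\<dots> \<le> (\<Sum>j<r. card X ^ (r - 1))"
  proof (rule sum_mono)
    fix j assume "j \<in> {..<r}"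
    then have j: "j < r" by simp
    let ?f = "\<lambda>y. take j y @ drop (Suc j) y"
    have "inj_on ?f (U j)"
    proof (rule inj_onI)
      fix y y' assume y: "y \<in> U j" "y' \<in> U j" "?f y = ?f y'"
      have len: "length y = r" "length y' = r" using y assms(2) by (auto simp: U_def nlists_def)
      then have td: "take j y = take j y'" "drop (Suc j) y = drop (Suc j) y'"
        using y(3) j by (auto simp: append_eq_append_conv)
      have "y' = y[j := y' ! j]"
        using len j td id_take_nth_drop[of j y'] upd_conv_take_nth_drop[of j y "y' ! j"] by simp
      then have "y' ! j = y ! j" using y by (auto simp: U_def)
      then show "y = y'" using \<open>y' = y[j := y' ! j]\<close> by simp
    qed
    moreover have "?f ` U j \<subseteq> nlists X (r - 1)"
    proof (rule image_subsetI)
      fix y assume "y \<in> U j"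
      then have "set y \<subseteq> X" "length y = r" using assms(2) by (auto simp: U_def nlists_def)
      then show "?f y \<in> nlists X (r - 1)"
        using j by (auto simp: nlists_def dest!: in_set_takeD in_set_dropD)
    qed
    ultimately have "card (U j) \<le> card (nlists X (r - 1))"
      using assms(1) by (intro card_inj_on_le) auto
    then show "card (U j) \<le> card X ^ (r - 1)" using assms(1) by (simp add: card_nlists)
  qed
  also have "\<dots> = r * card X ^ (r - 1)" by simp
  finally show False using assms(3) by simp
qed

section \<open>The dictator case and the contradiction from k + 1 non-edges\<close>

context max_blocks
begin

lemma exact_dictator:
  assumes kr: "k = 2 * r" "r \<ge> 2" and y: "exact y"
  shows "\<exists>j<r. \<exists>C\<subseteq>{..<k}. card C = r \<and> (\<forall>x\<in>Z. \<forall>t. (\<forall>l<r. t l < k) \<longrightarrow> (g x y t \<longleftrightarrow> t j \<in> C))"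
proof -
  have "card {..<k} \<le> card Z" using Z by simp
  then obtain \<kappa> where \<kappa>: "\<kappa> ` {..<k} \<subseteq> Z" "inj_on \<kappa> {..<k}"
    using card_le_inj[of "{..<k}" Z] by auto
  have "Z \<noteq> {}" using Z by auto
  then obtain z where z: "z \<in> Z" by blast
  interpret cube "g z y" r k
  proof
    show "card {i. i < k \<and> g z y (\<lambda>j. \<tau> j i)} = r"
      if \<tau>: "\<And>j. j < r \<Longrightarrow> bij_betw (\<tau> j) {..<k} {..<k}" for \<tau>
    proof -
      have "g z y (\<lambda>j. \<tau> j i) = g (\<kappa> i) y (\<lambda>j. \<tau> j i)" if "i < k" for i
      proof (rule exact_same[OF y z])
        show "\<kappa> i \<in> Z" using \<kappa> that by auto
        show "\<tau> j i < k" if "j < r" for j using bij_betwE[OF \<tau>[OF that]] \<open>i < k\<close> by auto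
      qed
      then have "{i. i < k \<and> g z y (\<lambda>j. \<tau> j i)} = {i. i < k \<and> g (\<kappa> i) y (\<lambda>j. \<tau> j i)}" by blast
      then show ?thesis using exact_hits'[OF y \<kappa>(2,1) \<tau>] by simp
    qed
    show "g z y t = g z y s" if "\<And>j. j < r \<Longrightarrow> t j = s j" for t s using that by (rule g_cong)
  qed (use kr in auto)
  obtain j C where jC: "j < r" "C \<subseteq> {..<k}" "card C = r" "\<And>t. valid t \<Longrightarrow> g z y t \<longleftrightarrow> t j \<in> C"
    using dictator by blast
  have "g x y t \<longleftrightarrow> t j \<in> C" if "x \<in> Z" "\<forall>l<r. t l < k" for x t
    using jC(4)[of t] exact_same[OF y that(1) z, of t] that by (auto simp: valid_def)
  then show ?thesis using jC(1-3) by blast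
qed

text \<open>The tuples \<open>y\<close> and \<open>y' = y[j := z]\<close> occupy only
  \<open>r + 1\<close> blocks together. The dictating block \<open>y ! j\<close> of \<open>y\<close>
  is not in \<open>y'\<close>, so \<open>r\<close> edges can be made from \<open>y\<close> with the
  positions \<open>C\<close> of that block, without hindering \<open>r\<close> further edges from
  \<open>y'\<close>. These \<open>2 r > r + 1\<close> disjoint edges contradict
  \<open>hit_le\<close>.\<close>

lemma no_exact_lines:
  assumes kr: "k = 2 * r" "r \<ge> 2" and y: "exact y" and ln: "\<And>j. j < r \<Longrightarrow> \<exists>z. z \<noteq> y ! j \<and> exact (y[j := z])"
  shows False
proof -
  obtain j C where j: "j < r" "C \<subseteq> {..<k}" "card C = r"
    and gC: "\<And>x t. x \<in> Z \<Longrightarrow> (\<And>l. l < r \<Longrightarrow> t l < k) \<Longrightarrow> g x y t \<longleftrightarrow> t j \<in> C"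
    using exact_dictator[OF kr y] by blast
  obtain z where z: "z \<noteq> y ! j" "exact (y[j := z])" using ln[OF j(1)] by blast
  define y' where "y' = y[j := z]"
  obtain j' C' where j': "j' < r" "C' \<subseteq> {..<k}" "card C' = r"
    and gC': "\<And>x t. x \<in> Z \<Longrightarrow> (\<And>l. l < r \<Longrightarrow> t l < k) \<Longrightarrow> g x y' t \<longleftrightarrow> t j' \<in> C'"
    using exact_dictator[OF kr z(2)] unfolding y'_def by blast
  have gy: "length y = r" "distinct y" "set y \<subseteq> X" "set y \<inter> Z = {}"
    using y by (auto simp: exact_def good_def nlists_def)
  have gy': "length y' = r" "distinct y'" "set y' \<subseteq> X" "set y' \<inter> Z = {}"
    using z(2) by (auto simp: exact_def good_def nlists_def y'_def)
  have y'nth: "y' ! l = (if l = j then z else y ! l)" if "l < r" for l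
    using that gy(1) by (simp add: y'_def)
  have fC: "finite C" "finite C'" using j j' finite_subset by auto
  obtain c where c: "bij_betw c {..<r} C" using finite_same_card_bij[of "{..<r}" C] j fC by auto
  obtain c' where c': "bij_betw c' {..<r} C'" using finite_same_card_bij[of "{..<r}" C'] j' fC by auto
  have "card ({..<k} - C') = r" using j' fC kr by (simp add: card_Diff_subset)
  then obtain d where d: "bij_betw d {..<r} ({..<k} - C')"
    using finite_same_card_bij[of "{..<r}" "{..<k} - C'"] by auto
  have inC: "c i \<in> C" "c' i \<in> C'" "d i \<in> {..<k} - C'" if "i < r" for i
    using that bij_betwE[OF c] bij_betwE[OF c'] bij_betwE[OF d] by auto
  have inj: "c i = c i' \<Longrightarrow> i = i'" "c' i = c' i' \<Longrightarrow> i = i'" "d i = d i' \<Longrightarrow> i = i'" if "i < r" "i' < r" for i i'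
    using that c c' d by (auto simp: bij_betw_def inj_on_def)
  \<comment> \<open>In the shared blocks the two families must use different positions: at
    coordinate \<open>j'\<close> the second needs \<open>C'\<close>, so the first takes the
    complement; at all other coordinates the \<open>i\<close>-th set simply takes position
    \<open>i\<close>.\<close>
  define t where "t i l = (if i < r then (if l = j then c i else if l = j' then d i else i)
        else (if l = j' then c' (i - r) else i))" for i l
  have lt_k: "c i < k" "c' i < k" "d i < k" if "i < r" for i
    using inC[OF that] j(2) j'(2) by auto
  have tk: "t i l < k" if "i < 2 * r" for i l
  proof (cases "i < r")
    case True
    then show ?thesis using lt_k kr that by (simp add: t_def)
  next
    case False
    then have "i - r < r" using that by linarith
    then show ?thesis using False lt_k kr that by (simp add: t_def)
  qed
  define pos where "pos i = (\<lambda>l. ((if i < r then y else y') ! l, t i l)) ` {..<r}" for i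
  have "card {..<2 * r} \<le> card Z" using Z kr by simp
  then obtain \<kappa> where \<kappa>: "\<kappa> ` {..<2 * r} \<subseteq> Z" "inj_on \<kappa> {..<2 * r}"
    using card_le_inj[of "{..<2 * r}" Z] by auto
  have "card {..<2 * r} \<le> card (set y \<union> set y')"
  proof (rule hit_le[OF \<kappa>(2,1), where pos = pos])
    show "set y \<union> set y' \<subseteq> X" "(set y \<union> set y') \<inter> Z = {}" using gy gy' by auto
    show "pos i \<subseteq> (set y \<union> set y') \<times> {..<k}" if "i \<in> {..<2 * r}" for i
      using tk that gy(1) gy'(1) by (auto simp: pos_def)
    show "S (\<kappa> i) \<union> (\<lambda>(c, a). en c a) ` pos i \<in> H (\<kappa> i)" if i: "i \<in> {..<2 * r}" for i
    proof (cases "i < r")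
      case True
      then have "t i j \<in> C" using inC by (simp add: t_def)
      then have "g (\<kappa> i) y (t i)" using gC[of "\<kappa> i" "t i"] tk i \<kappa>(1) by auto
      then show ?thesis using True by (simp add: g_def pos_def image_image)
    next
      case False
      then have "t i j' \<in> C'" using inC(2)[of "i - r"] i by (simp add: t_def)
      then have "g (\<kappa> i) y' (t i)" using gC'[of "\<kappa> i" "t i"] tk i \<kappa>(1) by auto
      then show ?thesis using False by (simp add: g_def pos_def image_image)
    qed
    have main: "False" if i: "i < 2 * r" "i' < 2 * r" "i < i'" and l: "l < r" "l' < r"
      and eq: "(if i < r then y else y') ! l = (if i' < r then y else y') ! l'" "t i l = t i' l'" for i i' l l'
    proof -
      consider "i' < r" | "r \<le> i" | "i < r" "r \<le> i'" by linarith
      then show False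
      proof cases
        case 1
        then have "l = l'" using eq(1) gy l i by (simp add: nth_eq_iff_index_eq)
        then show False using eq(2) 1 i inj[of i i'] by (auto simp: t_def split: if_splits)
      next
        case 2
        then have "l = l'" using eq(1) gy' l i by (simp add: nth_eq_iff_index_eq)
        moreover have "i - r < r" "i' - r < r" "i - r \<noteq> i' - r" using 2 i by linarith+
        ultimately show False using eq(2) 2 i inj(2)[of "i - r" "i' - r"] by (auto simp: t_def split: if_splits)
      next
        case 3
        then have e: "y ! l = y' ! l'" using eq(1) by simp
        have "l' \<noteq> j"
        proof
          assume l'j: "l' = j"
          show False
          proof (cases "l = j")
            case True
            then show False using e y'nth[OF l(2)] l'j z by simp
          next
            case False
            then have "y' ! l = y' ! l'" using e y'nth[OF l(1)] by simp
            then have "l = l'" using gy' l by (simp add: nth_eq_iff_index_eq)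
            then show False using False l'j by simp
          qed
        qed
        then have "l = l'" using e y'nth[OF l(2)] gy l by (simp add: nth_eq_iff_index_eq)
        then show False
          using eq(2) 3 i \<open>l' \<noteq> j\<close> inC(3)[of i] inC(2)[of "i' - r"] by (auto simp: t_def split: if_splits)
      qed
    qed
    show "pos i \<inter> pos i' = {}" if i: "i \<in> {..<2 * r}" "i' \<in> {..<2 * r}" "i \<noteq> i'" for i i'
    proof (rule ccontr)
      assume "pos i \<inter> pos i' \<noteq> {}"
      then obtain l l' where l: "l < r" "l' < r"
        "(if i < r then y else y') ! l = (if i' < r then y else y') ! l'" "t i l = t i' l'"
        unfolding pos_def by (smt (verit) Int_emptyI image_iff lessThan_iff prod.inject)
      then show False using main[of i i' l l'] main[of i' i l' l] i
        by (metis lessThan_iff linorder_neqE_nat)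
    qed
  qed
  also have "card (set y \<union> set y') \<le> card (insert z (set y))"
    using set_update_subset_insert[of y j z] by (intro card_mono) (auto simp: y'_def)
  also have "\<dots> \<le> Suc r" using gy by (simp add: card_insert_if distinct_card)
  finally show False using kr by simp
qed

text \<open>The link to the degree condition: summing over all tuples of blocks counts all
  extensions of \<open>S x\<close>.\<close>

lemma sum_tot_eq:
  "(\<Sum>y\<in>nlists X r. tot x y) = card {T \<in> nlists V r. S x \<union> set T \<in> H x}"
proof -
  have en_sum: "(\<Sum>v\<in>V. f v) = (\<Sum>c\<in>X. \<Sum>i<k. f (en c i))" for f :: "'a \<Rightarrow> nat"
  proof -
    have "(\<Sum>v\<in>V. f v) = (\<Sum>v\<in>(\<Union>c\<in>X. P c). f v)" using P by (simp add: blocks_def)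
    also have "\<dots> = (\<Sum>c\<in>X. \<Sum>v\<in>P c. f v)"
    proof (rule sum.UNION_disjoint)
      show "\<forall>i\<in>X. finite (P i)" using P finite_subset[OF _ fin(2)] by (auto simp: blocks_def)
      show "\<forall>i\<in>X. \<forall>j\<in>X. i \<noteq> j \<longrightarrow> P i \<inter> P j = {}" using P by (auto simp: blocks_def disjoint_family_on_def)
    qed simp
    also have "\<dots> = (\<Sum>c\<in>X. \<Sum>i<k. f (en c i))"
      by (intro sum.cong refl sum.reindex_bij_betw[symmetric] en)
    finally show ?thesis .
  qed
  have "card {T \<in> nlists V r. S x \<union> set T \<in> H x} = (\<Sum>T\<in>nlists V r. of_bool (S x \<union> set T \<in> H x))"
    by (simp add: Int_def)
  also have "\<dots> = (\<Sum>y\<in>nlists X r. \<Sum>t\<in>nlists {..<k} r. of_bool (S x \<union> set (map2 en y t) \<in> H x))"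
    by (rule sum_nlists_pairs[OF en_sum])
  also have "\<dots> = (\<Sum>y\<in>nlists X r. \<Sum>t\<in>nlists {..<k} r. of_bool (g x y (\<lambda>j. t ! j)))"
  proof (intro sum.cong refl arg_cong[where f = of_bool])
    fix y t assume "y \<in> nlists X r" "t \<in> nlists {..<k} r"
    then have "length y = r" "length t = r" by (auto simp: nlists_def)
    then have "map2 en y t = map (\<lambda>l. en (y ! l) (t ! l)) [0..<r]"
      by (intro nth_equalityI) auto
    then have "set (map2 en y t) = (\<lambda>l. en (y ! l) (t ! l)) ` {..<r}"
      by (simp add: atLeast0LessThan)
    then show "(S x \<union> set (map2 en y t) \<in> H x) = g x y (\<lambda>j. t ! j)" by (simp add: g_def)
  qed
  also have "\<dots> = (\<Sum>y\<in>nlists X r. tot x y)" by (simp add: tot_def Int_def)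
  finally show ?thesis by simp
qed

lemma card_not_good:
  assumes "X \<noteq> {}"
  shows "real (card {y \<in> nlists X r. \<not> good y}) \<le> real (r * r + r * (k + 1)) / real (card X) * real (card X) ^ r"
proof -
  have "{y \<in> nlists X r. \<not> good y} \<subseteq> {y \<in> nlists X r. \<not> distinct y} \<union> {y \<in> nlists X r. set y \<inter> Z \<noteq> {}}"
    by (auto simp: good_def)
  then have "card {y \<in> nlists X r. \<not> good y} \<le> card ({y \<in> nlists X r. \<not> distinct y} \<union> {y \<in> nlists X r. set y \<inter> Z \<noteq> {}})"
    by (intro card_mono) auto
  also have "\<dots> \<le> card {y \<in> nlists X r. \<not> distinct y} + card {y \<in> nlists X r. set y \<inter> Z \<noteq> {}}"
    by (rule card_Un_le)
  finally have "real (card {y \<in> nlists X r. \<not> good y})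
      \<le> real (card {y \<in> nlists X r. \<not> distinct y}) + real (card {y \<in> nlists X r. set y \<inter> Z \<noteq> {}})" by linarith
  also have "\<dots> \<le> real (r * r) / real (card X) * real (card X) ^ r + real r * real (card Z) / real (card X) * real (card X) ^ r"
    using assms by (intro add_mono card_nlists_not_distinct_real card_nlists_meeting_real) auto
  also have "\<dots> = real (r * r + r * (k + 1)) / real (card X) * real (card X) ^ r"
    using Z(2) by (simp add: add_divide_distrib algebra_simps)
  finally show ?thesis .
qed

lemma false_if_dense:
  fixes \<theta> :: real
  assumes k3: "k \<ge> 3"
    and deg: "\<And>x. x \<in> Z \<Longrightarrow> (1 / 2 - \<theta>) * real (card V) ^ r \<le> real (card {T \<in> nlists V r. S x \<union> set T \<in> H x})"
    and cardV: "card V = k * card X"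
    and \<theta>: "8 * (real k + 1) * real k ^ Suc r * \<theta> \<le> 1"
    and big: "8 * (real k + 1) * real k ^ Suc r * real (r * r + r * (k + 1)) \<le> real (card X)"
  shows False
proof -
  define m where "m = real (card X)"
  \<comment> \<open>Chosen so that the \<open>k + 1\<close> exceptional sets below together have
    size at most \<open>M / 4\<close>.\<close>
  define B where "B = (real k + 1) * real k ^ Suc r"
  define M where "M = m ^ r"
  define D where "D = real k ^ r"
  define NG where "NG = real (card {y \<in> nlists X r. \<not> good y})"
  define GG where "GG = {y \<in> nlists X r. good y}"
  have D1: "D \<ge> 1" unfolding D_def using k3 by (intro one_le_power) auto
  have BD: "B = (real k + 1) * (real k * D)" by (simp add: B_def D_def)
  have B1: "B > 0" unfolding BD using D1 k3 by simp
  have c1: "real (r * r + r * (k + 1)) \<ge> 1"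
  proof -
    have "1 \<le> r * r + r * (k + 1)" using rk by (cases r) auto
    then have "real 1 \<le> real (r * r + r * (k + 1))" by (rule of_nat_mono)
    then show ?thesis by simp
  qed
  have "8 * B * 1 \<le> 8 * B * real (r * r + r * (k + 1))"
    using c1 B1 by (intro mult_left_mono) auto
  then have m8: "8 * B \<le> m" using big unfolding m_def B_def by linarith
  have mpos: "m > 0" using m8 B1 by linarith
  have Xne: "X \<noteq> {}" using mpos by (auto simp: m_def)
  have Mpos: "M > 0" using mpos by (simp add: M_def)
  have NG: "NG \<le> 1 / (8 * B) * M"
  proof -
    have "NG \<le> real (r * r + r * (k + 1)) / m * M"
      using card_not_good[OF Xne] by (simp add: NG_def m_def M_def)
    also have "\<dots> \<le> 1 / (8 * B) * M"
      using big mpos B1 Mpos by (intro mult_right_mono) (auto simp: field_simps m_def B_def)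
    finally show ?thesis .
  qed
  have \<theta>B: "\<theta> \<le> 1 / (8 * B)" using \<theta> B1 by (simp add: field_simps B_def)
  have VM: "real (card V) ^ r = D * M"
    by (simp add: cardV power_mult_distrib D_def M_def m_def)
  have finGG: "finite GG" by (simp add: GG_def)
  have cGG: "real (card GG) + NG = M"
  proof -
    have "card (nlists X r) = card GG + card {y \<in> nlists X r. \<not> good y}"
      unfolding GG_def by (subst card_Un_disjoint[symmetric]) (auto intro: arg_cong[where f = card])
    then show ?thesis by (simp add: NG_def M_def m_def card_nlists flip: of_nat_add)
  qed
  \<comment> \<open>The deficiency in the averaged bound \<open>sum_tot_le\<close>: non-negative on
    good tuples by maximality, but with a sum bounded by the degree condition.\<close>
  define def where "def z y = real (r * k ^ r) - (\<Sum>x\<in>Z - {z}. real (tot x y))" for z y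
  have cZ: "card (Z - {z}) = k" if "z \<in> Z" for z using that Z by simp
  have def_nonneg: "def z y \<ge> 0" if "z \<in> Z" "y \<in> GG" for z y
  proof -
    have "(\<Sum>x\<in>Z - {z}. tot x y) \<le> r * k ^ r"
      using that cZ by (intro sum_tot_le) (auto simp: GG_def)
    then have "real (\<Sum>x\<in>Z - {z}. tot x y) \<le> real (r * k ^ r)" by (rule of_nat_mono)
    then show ?thesis by (simp add: def_def)
  qed
  have sum_def: "(\<Sum>y\<in>GG. def z y) \<le> M * D * (real r - real k / 2 + real k * (2 / (8 * B)))" if z: "z \<in> Z" for z
  proof -
    have 1: "(1 / 2 - \<theta>) * (D * M) - D * NG \<le> (\<Sum>y\<in>GG. real (tot x y))" if x: "x \<in> Z" for x
    proof -
      have split: "nlists X r = GG \<union> {y \<in> nlists X r. \<not> good y}" "GG \<inter> {y \<in> nlists X r. \<not> good y} = {}"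
        by (auto simp: GG_def)
      have "(\<Sum>y\<in>nlists X r. real (tot x y)) = (\<Sum>y\<in>GG. real (tot x y)) + (\<Sum>y\<in>{y \<in> nlists X r. \<not> good y}. real (tot x y))"
        by (subst split(1), rule sum.union_disjoint) (use split(2) in \<open>auto simp: GG_def\<close>)
      moreover have "(\<Sum>y\<in>{y \<in> nlists X r. \<not> good y}. real (tot x y)) \<le> (\<Sum>y\<in>{y \<in> nlists X r. \<not> good y}. D)"
        using tot_le by (intro sum_mono) (simp add: D_def flip: of_nat_power)
      moreover have "(\<Sum>y\<in>{y \<in> nlists X r. \<not> good y}. D) = D * NG" by (simp add: NG_def)
      moreover have "(1 / 2 - \<theta>) * (D * M) \<le> (\<Sum>y\<in>nlists X r. real (tot x y))"
        using deg[OF x] sum_tot_eq[of x] by (simp add: VM flip: of_nat_sum)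
      ultimately show ?thesis by linarith
    qed
    have "(\<Sum>y\<in>GG. def z y) = real (card GG) * (real r * D) - (\<Sum>y\<in>GG. \<Sum>x\<in>Z - {z}. real (tot x y))"
      by (simp add: def_def sum_subtractf D_def)
    also have "(\<Sum>y\<in>GG. \<Sum>x\<in>Z - {z}. real (tot x y)) = (\<Sum>x\<in>Z - {z}. \<Sum>y\<in>GG. real (tot x y))"
      by (rule sum.swap)
    finally have "(\<Sum>y\<in>GG. def z y) = real (card GG) * (real r * D) - (\<Sum>x\<in>Z - {z}. \<Sum>y\<in>GG. real (tot x y))" .
    moreover have "(\<Sum>x\<in>Z - {z}. (1 / 2 - \<theta>) * (D * M) - D * NG) \<le> (\<Sum>x\<in>Z - {z}. \<Sum>y\<in>GG. real (tot x y))"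
      using 1 by (intro sum_mono) auto
    moreover have "(\<Sum>x\<in>Z - {z}. (1 / 2 - \<theta>) * (D * M) - D * NG) = real k * ((1 / 2 - \<theta>) * (D * M) - D * NG)"
      using cZ[OF z] by simp
    moreover have "real (card GG) * (real r * D) \<le> M * (real r * D)"
      using cGG D1 by (intro mult_right_mono) (auto simp: NG_def)
    ultimately have "(\<Sum>y\<in>GG. def z y) \<le> M * (real r * D) - real k * ((1 / 2 - \<theta>) * (D * M) - D * NG)"
      by linarith
    also have "\<dots> = M * (real r * D) - real k * (D * M) / 2 + real k * D * (\<theta> * M + NG)"
      by (simp add: algebra_simps)
    also have "\<dots> \<le> M * (real r * D) - real k * (D * M) / 2 + real k * D * (1 / (8 * B) * M + 1 / (8 * B) * M)"
      using NG \<theta>B Mpos D1 k3 by (intro add_left_mono mult_left_mono add_mono mult_right_mono) auto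
    also have "\<dots> = M * D * (real r - real k / 2 + real k * (2 / (8 * B)))"
      by (simp add: algebra_simps)
    finally show ?thesis .
  qed
  have kB: "real k * (2 / (8 * B)) * D * (real k + 1) = 1 / 4"
  proof -
    have e: "real k * D * (real k + 1) = B" by (simp add: BD)
    have "real k * (2 / (8 * B)) * D * (real k + 1) = 2 * (real k * D * (real k + 1)) / (8 * B)" by simp
    also have "\<dots> = 1 / 4" unfolding e using B1 by simp
    finally show ?thesis .
  qed
  have kB': "real k * (2 / (8 * B)) \<le> 1 / 4"
  proof -
    have "real k * (2 / (8 * B)) * 1 \<le> real k * (2 / (8 * B)) * (D * (real k + 1))"
    proof (rule mult_left_mono)
      have "1 * 1 \<le> D * (real k + 1)" using D1 by (intro mult_mono) auto
      then show "1 \<le> D * (real k + 1)" by simp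
    qed (use B1 in simp)
    then show ?thesis using kB unfolding mult.assoc mult_1_right by linarith
  qed
  obtain z0 where z0: "z0 \<in> Z" using Z(2) by (metis Suc_eq_plus1 card.empty equals0I nat.distinct(1))
  show False
  proof (cases "2 * r = k")
    case False
    \<comment> \<open>By integrality \<open>2 r < k\<close> costs at least 1/2 per tuple, which
      exceeds the error terms.\<close>
    then have "real r - real k / 2 \<le> - (1 / 2)" using rk by linarith
    then have "M * D * (real r - real k / 2 + real k * (2 / (8 * B))) < 0"
      using kB' Mpos D1 by (intro mult_pos_neg) auto
    moreover have "(\<Sum>y\<in>GG. def z0 y) \<ge> 0" using def_nonneg z0 by (intro sum_nonneg) auto
    ultimately show False using sum_def[OF z0] by linarith
  next
    case True
    then have kr: "k = 2 * r" "r \<ge> 2" using k3 by auto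
    have nonex: "real (card {y \<in> GG. def z y \<noteq> 0}) \<le> M / (4 * (real k + 1))" if z: "z \<in> Z" for z
    proof -
      \<comment> \<open>Deficiencies are integers, so a small sum means that few tuples have
        any.\<close>
      have ge1: "def z y \<ge> 1" if "y \<in> GG" "def z y \<noteq> 0" for y
      proof -
        have "def z y = real_of_int (int (r * k ^ r) - int (\<Sum>x\<in>Z - {z}. tot x y))"
          by (simp add: def_def)
        then obtain i :: int where "def z y = real_of_int i" by blast
        then show ?thesis using def_nonneg[OF z that(1)] that(2) by simp
      qed
      have "real (card {y \<in> GG. def z y \<noteq> 0}) = (\<Sum>y\<in>{y \<in> GG. def z y \<noteq> 0}. 1)" by simp
      also have "\<dots> \<le> (\<Sum>y\<in>{y \<in> GG. def z y \<noteq> 0}. def z y)"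
        using ge1 by (intro sum_mono) auto
      also have "\<dots> \<le> (\<Sum>y\<in>GG. def z y)"
        using finGG def_nonneg[OF z] by (intro sum_mono2) auto
      also have "\<dots> \<le> M * D * (real k * (2 / (8 * B)))"
        using sum_def[OF z] kr by simp
      also have "\<dots> = M / (4 * (real k + 1))"
        using kB by (simp add: field_simps)
      finally show ?thesis .
    qed
    let ?E = "{y \<in> nlists X r. exact y}"
    have "GG \<subseteq> ?E \<union> (\<Union>z\<in>Z. {y \<in> GG. def z y \<noteq> 0})"
    proof
      fix y assume y: "y \<in> GG"
      have "exact y" if "\<forall>z\<in>Z. def z y = 0"
        unfolding exact_def
      proof
        show "\<forall>x\<in>Z. (\<Sum>z\<in>Z - {x}. tot z y) = r * k ^ r"
        proof
          fix x assume "x \<in> Z"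
          then have "real (\<Sum>z\<in>Z - {x}. tot z y) = real (r * k ^ r)" using that by (simp add: def_def)
          then show "(\<Sum>z\<in>Z - {x}. tot z y) = r * k ^ r" by (rule of_nat_eq_iff[THEN iffD1])
        qed
      qed (use y in \<open>auto simp: GG_def\<close>)
      then show "y \<in> ?E \<union> (\<Union>z\<in>Z. {y \<in> GG. def z y \<noteq> 0})" using y by (auto simp: GG_def)
    qed
    then have "card GG \<le> card (?E \<union> (\<Union>z\<in>Z. {y \<in> GG. def z y \<noteq> 0}))"
      using finGG by (intro card_mono) auto
    also have "\<dots> \<le> card ?E + card (\<Union>z\<in>Z. {y \<in> GG. def z y \<noteq> 0})" by (rule card_Un_le)
    also have "card (\<Union>z\<in>Z. {y \<in> GG. def z y \<noteq> 0}) \<le> (\<Sum>z\<in>Z. card {y \<in> GG. def z y \<noteq> 0})"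
      by (rule card_UN_le) simp
    finally have "card GG \<le> card ?E + (\<Sum>z\<in>Z. card {y \<in> GG. def z y \<noteq> 0})" by simp
    then have "real (card GG) \<le> real (card ?E + (\<Sum>z\<in>Z. card {y \<in> GG. def z y \<noteq> 0}))" by (rule of_nat_mono)
    also have "\<dots> = real (card ?E) + (\<Sum>z\<in>Z. real (card {y \<in> GG. def z y \<noteq> 0}))" by simp
    also have "(\<Sum>z\<in>Z. real (card {y \<in> GG. def z y \<noteq> 0})) \<le> (\<Sum>z\<in>Z. M / (4 * (real k + 1)))"
      using nonex by (intro sum_mono) auto
    also have "\<dots> = M / 4" using Z(2) by (simp add: field_simps)
    finally have "real (card GG) \<le> real (card ?E) + M / 4" by simp
    moreover have "NG \<le> M / 8"
    proof -
      have "real k * D \<ge> 1 * 1" using D1 k3 by (intro mult_mono) auto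
      then have "(real k + 1) * (real k * D) \<ge> 1 * 1" by (intro mult_mono) auto
      then have "1 / (8 * B) * M \<le> 1 / 8 * M" unfolding BD using Mpos by (intro mult_right_mono) (auto simp: field_simps)
      then show ?thesis using NG by linarith
    qed
    ultimately have E: "real (card ?E) \<ge> M / 2" using cGG Mpos by linarith
    have "real r * m ^ (r - 1) < M / 2"
    proof -
      have "M = m * m ^ (r - 1)" using rk by (simp add: M_def flip: power_Suc)
      moreover have "2 * real r < m"
      proof -
        have "real k * D \<ge> real k * 1" using D1 by (intro mult_left_mono) auto
        then have "(real k + 1) * (real k * D) \<ge> 1 * real k" by (intro mult_mono) auto
        then show ?thesis using m8 kr k3 unfolding BD by linarith
      qed
      moreover have "m ^ (r - 1) > 0" using mpos by simp
      ultimately show ?thesis by simp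
    qed
    then have "real (r * card X ^ (r - 1)) < real (card ?E)" using E by (simp add: m_def)
    then have "r * card X ^ (r - 1) < card ?E" by (rule of_nat_less_imp_less)
    then obtain y where "y \<in> ?E" "\<forall>j<r. \<exists>z. z \<noteq> y ! j \<and> y[j := z] \<in> ?E"
      using ex_non_unique_on_lines[of X ?E r] by auto
    then show False using no_exact_lines[OF kr, of y] by blast
  qed
qed

end

theorem almost_perfect:
  fixes \<theta> :: real and X :: "'c set" and V :: "'a set"
  assumes fin: "finite X" "finite V" and k3: "k \<ge> 3" and rk: "r \<ge> 1" "2 * r \<le> k"
    and edge_card: "\<And>x e. x \<in> X \<Longrightarrow> e \<in> H x \<Longrightarrow> card e = k"
    and deg: "\<And>x S. x \<in> X \<Longrightarrow> S \<subseteq> V \<Longrightarrow> card S = k - r \<Longrightarrow>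
        (1 / 2 - \<theta>) * real (card V) ^ r \<le> real (card {T \<in> nlists V r. S \<union> set T \<in> H x})"
    and cardV: "card V = k * card X"
    and \<theta>: "8 * (real k + 1) * real k ^ Suc r * \<theta> \<le> 1"
    and big: "8 * (real k + 1) * real k ^ Suc r * real (r * r + r * (k + 1)) \<le> real (card X)"
  shows "\<exists>P. blocks k X V P \<and> card {x \<in> X. P x \<notin> H x} \<le> k"
proof -
  obtain P0 where P0: "blocks k X V P0" using blocks_fill[OF fin cardV] by blast
  have "\<exists>P. blocks k X V P \<and> (\<forall>Q. blocks k X V Q \<longrightarrow> card {x \<in> X. Q x \<in> H x} \<le> card {x \<in> X. P x \<in> H x})"
  proof (rule ex_has_greatest_nat[of _ P0 _ "Suc (card X)"])
    show "\<forall>y. blocks k X V y \<longrightarrow> card {x \<in> X. y x \<in> H x} < Suc (card X)"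
      using fin by (auto intro!: card_mono simp: less_Suc_eq_le)
  qed (use P0 in auto)
  then obtain P where P: "blocks k X V P"
    "\<And>Q. blocks k X V Q \<Longrightarrow> card {x \<in> X. Q x \<in> H x} \<le> card {x \<in> X. P x \<in> H x}" by blast
  have "card {x \<in> X. P x \<notin> H x} \<le> k"
  proof (rule ccontr)
    assume "\<not> ?thesis"
    then have "k + 1 \<le> card {x \<in> X. P x \<notin> H x}" by simp
    then obtain Z where Z: "Z \<subseteq> {x \<in> X. P x \<notin> H x}" "card Z = k + 1" by (meson obtain_subset_with_card_n)
    \<comment> \<open>Any \<open>(k - r)\<close>-subset of the bad block will do, since the degree
      condition holds for all of them.\<close>
    have "\<forall>z. \<exists>S. z \<in> Z \<longrightarrow> S \<subseteq> P z \<and> card S = k - r"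
    proof (intro allI)
      fix z
      show "\<exists>S. z \<in> Z \<longrightarrow> S \<subseteq> P z \<and> card S = k - r"
      proof (cases "z \<in> Z")
        case True
        then have "card (P z) = k" using P(1) Z(1) by (auto simp: blocks_def)
        then show ?thesis using obtain_subset_with_card_n[of "k - r" "P z"] by (metis diff_le_self)
      qed simp
    qed
    then obtain S where S': "\<And>z. z \<in> Z \<Longrightarrow> S z \<subseteq> P z \<and> card (S z) = k - r" by metis
    have "\<forall>y. \<exists>f. y \<in> X \<longrightarrow> bij_betw f {..<k} (P y)"
    proof
      fix y show "\<exists>f. y \<in> X \<longrightarrow> bij_betw f {..<k} (P y)"
        using P(1) finite_same_card_bij[of "{..<k}" "P y"] finite_subset[OF _ fin(2)] by (auto simp: blocks_def)
    qed
    then obtain en where en: "\<And>y. y \<in> X \<Longrightarrow> bij_betw (en y) {..<k} (P y)" by metis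
    interpret max_blocks X V H k r P Z S en
      by unfold_locales (use fin edge_card P Z S' en rk in auto)
    show False
    proof (rule false_if_dense[OF k3 _ cardV \<theta> big])
      fix x assume x: "x \<in> Z"
      then have "S x \<subseteq> V" using S'[OF x] P(1) Z(1) by (auto simp: blocks_def)
      then show "(1 / 2 - \<theta>) * real (card V) ^ r \<le> real (card {T \<in> nlists V r. S x \<union> set T \<in> H x})"
        using deg[of x "S x"] x Z(1) S'[OF x] by auto
    qed
  qed
  then show ?thesis using P by blast
qed

subsection \<open>Absorbing families\<close>

context colgraphs
begin

lemma wpm_concat:
  assumes "\<And>z. z \<in> set Fs \<Longrightarrow> wpm k H (mset (fst z)) (mset (snd z))"
  shows "wpm k H (mset (concat (map fst Fs))) (mset (concat (map snd Fs)))"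
  using assms by (induction Fs) (auto intro!: wpm_Un wpm_empty)

lemma wpm_concat_absorb:
  assumes "\<And>z. z \<in> set Fs \<Longrightarrow> wpm k H (mset (fst z)) (mset (snd z))"
    and "z \<in> set Fs" "absb CW UW (mset (fst z)) (mset (snd z))"
  shows "wpm k H (mset (concat (map fst Fs)) + CW) (mset (concat (map snd Fs)) + UW)"
proof -
  obtain as bs where Fs: "Fs = as @ z # bs" using split_list[OF assms(2)] by blast
  have "wpm k H (mset (concat (map fst as))) (mset (concat (map snd as)))"
    "wpm k H (mset (concat (map fst bs))) (mset (concat (map snd bs)))"
    using assms(1) Fs by (auto intro!: wpm_concat)
  note w = wpm_Un[OF this]
  have "wpm k H (mset (fst z) + CW) (mset (snd z) + UW)" using assms(3) by (simp add: absb_def)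
  from wpm_Un[OF w this] show ?thesis by (simp add: Fs ac_simps)
qed

lemma m_le_n: "m \<le> n"
proof -
  have "1 * m \<le> real k * m" using k_ge by (intro mult_right_mono) auto
  then show ?thesis by (simp add: cardV)
qed

definition gfam :: "nat \<Rightarrow> nat \<Rightarrow> ('c list \<times> 'a list) list \<Rightarrow> bool" where
  "gfam a b Fs \<longleftrightarrow> (\<forall>z\<in>set Fs. fst z \<in> nlists X a \<and> snd z \<in> nlists V b \<and> wpm k H (mset (fst z)) (mset (snd z))) \<and>
     distinct (concat (map fst Fs)) \<and> distinct (concat (map snd Fs))"

lemma length_concat_const: "(\<And>z. z \<in> set Fs \<Longrightarrow> length z = a) \<Longrightarrow> length (concat Fs) = a * length Fs"
  by (induction Fs) auto

text \<open>Excluded are tuples with a repetition and tuples hitting what is already used. All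
  errors are put over \<open>m\<close>, the smaller of \<open>m\<close> and
  \<open>n\<close>.\<close>

lemma bad_tuples:
  assumes "finite Fc" "card Fc \<le> a * j" "finite Fv" "card Fv \<le> b * j" "b \<ge> 1"
  shows "real (card {(cs, vs) \<in> nlists X a \<times> nlists V b. \<not> (distinct cs \<and> distinct vs \<and> set cs \<inter> Fc = {} \<and> set vs \<inter> Fv = {})})
      \<le> real ((j + 1) * (a * a + b * b)) / m * (m ^ a * n ^ b)"
proof -
  have Xne: "X \<noteq> {}" using m_pos by auto
  let ?A1 = "{e \<in> nlists X a. \<not> distinct e}" and ?A2 = "{e \<in> nlists X a. set e \<inter> Fc \<noteq> {}}"
  let ?B1 = "{e \<in> nlists V b. \<not> distinct e}" and ?B2 = "{e \<in> nlists V b. set e \<inter> Fv \<noteq> {}}"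
  let ?N = "nlists X a" and ?M = "nlists V b"
  have "{(cs, vs) \<in> nlists X a \<times> nlists V b. \<not> (distinct cs \<and> distinct vs \<and> set cs \<inter> Fc = {} \<and> set vs \<inter> Fv = {})}
     \<subseteq> ((?A1 \<times> ?M) \<union> (?A2 \<times> ?M)) \<union> ((?N \<times> ?B1) \<union> (?N \<times> ?B2))" by auto
  then have "card {(cs, vs) \<in> nlists X a \<times> nlists V b. \<not> (distinct cs \<and> distinct vs \<and> set cs \<inter> Fc = {} \<and> set vs \<inter> Fv = {})}
     \<le> card (((?A1 \<times> ?M) \<union> (?A2 \<times> ?M)) \<union> ((?N \<times> ?B1) \<union> (?N \<times> ?B2)))"
    by (intro card_mono) auto
  also have "\<dots> \<le> (card (?A1 \<times> ?M) + card (?A2 \<times> ?M)) + (card (?N \<times> ?B1) + card (?N \<times> ?B2))"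
    by (rule order_trans[OF card_Un_le add_mono[OF card_Un_le card_Un_le]])
  also have "\<dots> = (card ?A1 * card V ^ b + card ?A2 * card V ^ b) + (card X ^ a * card ?B1 + card X ^ a * card ?B2)"
    by (simp add: card_cartesian_product card_nlists)
  finally have "real (card {(cs, vs) \<in> nlists X a \<times> nlists V b. \<not> (distinct cs \<and> distinct vs \<and> set cs \<inter> Fc = {} \<and> set vs \<inter> Fv = {})})
     \<le> real ((card ?A1 * card V ^ b + card ?A2 * card V ^ b) + (card X ^ a * card ?B1 + card X ^ a * card ?B2))"
    by (rule of_nat_mono)
  also have "\<dots> = (real (card ?A1) * n ^ b + real (card ?A2) * n ^ b) + (m ^ a * real (card ?B1) + m ^ a * real (card ?B2))"
    by simp
  also have "\<dots> \<le> ((real (a * a) / m * m ^ a) * n ^ b + (real (a * (a * j)) / m * m ^ a) * n ^ b)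
      + (m ^ a * (real (b * b) / m * n ^ b) + m ^ a * (real (b * (b * j)) / m * n ^ b))"
  proof (intro add_mono mult_right_mono mult_left_mono)
    show "real (card ?A1) \<le> real (a * a) / m * m ^ a"
      by (rule card_nlists_not_distinct_real[OF finX Xne])
    show "real (card ?A2) \<le> real (a * (a * j)) / m * m ^ a"
    proof (rule order_trans[OF card_nlists_meeting_real[OF finX assms(1) Xne]])
      have "a * card Fc \<le> a * (a * j)" using assms(2) by simp
      then have "real (a * card Fc) \<le> real (a * (a * j))" by (rule of_nat_mono)
      then show "real a * real (card Fc) / m * m ^ a \<le> real (a * (a * j)) / m * m ^ a"
        using m_pos by (intro mult_right_mono divide_right_mono) auto
    qed
    have nm: "1 / n \<le> 1 / m"
      using m_pos n_pos m_le_n by (intro divide_left_mono) auto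
    show "real (card ?B1) \<le> real (b * b) / m * n ^ b"
    proof (rule order_trans[OF card_nlists_not_distinct_real[OF finV V_ne]])
      have "real (b * b) * (1 / n) \<le> real (b * b) * (1 / m)" using nm by (intro mult_left_mono) auto
      then show "real (b * b) / n * n ^ b \<le> real (b * b) / m * n ^ b"
        by (intro mult_right_mono) auto
    qed
    show "real (card ?B2) \<le> real (b * (b * j)) / m * n ^ b"
    proof (rule order_trans[OF card_nlists_meeting_real[OF finV assms(3) V_ne]])
      have "b * card Fv \<le> b * (b * j)" using assms(4) by simp
      then have "real (b * card Fv) \<le> real (b * (b * j))" by (rule of_nat_mono)
      then have "real (b * card Fv) * (1 / n) \<le> real (b * (b * j)) * (1 / m)"
        using nm n_pos by (intro mult_mono) auto
      then show "real b * real (card Fv) / n * n ^ b \<le> real (b * (b * j)) / m * n ^ b"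
        by (intro mult_right_mono) auto
    qed
  qed auto
  also have "\<dots> = real ((j + 1) * (a * a + b * b)) / m * (m ^ a * n ^ b)"
    by (simp add: add_divide_distrib algebra_simps)
  finally show ?thesis .
qed

text \<open>Each target in \<open>W\<close> has absorbers of density \<open>\<beta>\<close>, at
  least half of which avoid the earlier choices. Averaging over tuples gives one that serves a
  proportion \<open>\<beta> / 2\<close> of the targets.\<close>

lemma greedy_step:
  assumes dens: "\<And>xs vs. (xs, vs) \<in> W \<Longrightarrow> dens X V a b \<beta> (absb (mset xs) (mset vs))"
    and W: "finite W" "W \<noteq> {}" and \<beta>: "\<beta> > 0"
    and Fs: "gfam a b Fs" "length Fs \<le> j" and b: "b \<ge> 1"
    and big: "real ((j + 1) * (a * a + b * b)) \<le> \<beta> / 2 * m"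
  shows "\<exists>z. gfam a b (z # Fs) \<and>
     real (card {w \<in> W. \<not> absb (mset (fst w)) (mset (snd w)) (mset (fst z)) (mset (snd z))}) \<le> (1 - \<beta> / 2) * real (card W)"
proof -
  let ?\<Omega> = "nlists X a \<times> nlists V b"
  let ?R = "\<lambda>w z. absb (mset (fst w)) (mset (snd w)) (mset (fst z)) (mset (snd z))"
  define Fc where "Fc = set (concat (map fst Fs))"
  define Fv where "Fv = set (concat (map snd Fs))"
  define Bad where "Bad = {(cs, vs) \<in> ?\<Omega>. \<not> (distinct cs \<and> distinct vs \<and> set cs \<inter> Fc = {} \<and> set vs \<inter> Fv = {})}"
  define Om where "Om = m ^ a * n ^ b"
  have Opos: "Om > 0" unfolding Om_def using m_pos n_pos by simp
  have fB: "finite Bad" unfolding Bad_def by (rule finite_nlists_prod) auto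
  have lens: "length (concat (map fst Fs)) = a * length Fs" "length (concat (map snd Fs)) = b * length Fs"
    using length_concat_const[of "map fst Fs" a] length_concat_const[of "map snd Fs" b] Fs(1)
    by (auto simp: gfam_def nlists_def)
  have c1: "card Fc \<le> a * j"
    using card_length[of "concat (map fst Fs)"] Fs(2) unfolding Fc_def lens by (meson le_trans mult_le_mono2)
  have c2: "card Fv \<le> b * j"
    using card_length[of "concat (map snd Fs)"] Fs(2) unfolding Fv_def lens by (meson le_trans mult_le_mono2)
  have "real (card Bad) \<le> real ((j + 1) * (a * a + b * b)) / m * Om"
    unfolding Bad_def Om_def by (rule bad_tuples) (use c1 c2 b in \<open>auto simp: Fc_def Fv_def\<close>)
  also have "\<dots> \<le> \<beta> / 2 * Om"
    using big m_pos Opos by (intro mult_right_mono) (auto simp: field_simps)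
  finally have Bad: "real (card Bad) \<le> \<beta> / 2 * Om" .
  have cw: "\<beta> / 2 * Om \<le> real (card {z \<in> ?\<Omega> - Bad. ?R w z})" if "w \<in> W" for w
  proof -
    have "{z \<in> ?\<Omega>. ?R w z} \<subseteq> {z \<in> ?\<Omega> - Bad. ?R w z} \<union> Bad" by auto
    then have "card {z \<in> ?\<Omega>. ?R w z} \<le> card ({z \<in> ?\<Omega> - Bad. ?R w z} \<union> Bad)"
      using fB by (intro card_mono) auto
    also have "\<dots> \<le> card {z \<in> ?\<Omega> - Bad. ?R w z} + card Bad" by (rule card_Un_le)
    finally have "real (card {z \<in> ?\<Omega>. ?R w z}) \<le> real (card {z \<in> ?\<Omega> - Bad. ?R w z}) + real (card Bad)" by linarith
    moreover have "\<beta> * Om \<le> real (card {z \<in> ?\<Omega>. ?R w z})"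
      using dens[of "fst w" "snd w"] that unfolding dens_def Om_def by (simp add: case_prod_unfold mem_Times_iff conj_assoc)
    ultimately show ?thesis using Bad by linarith
  qed
  have ex: "\<exists>z\<in>?\<Omega> - Bad. \<beta> / 2 * real (card W) \<le> real (card {w \<in> W. ?R w z})"
  proof (rule ccontr)
    assume neg: "\<not> ?thesis"
    have "real (card W) * (\<beta> / 2 * Om) = (\<Sum>w\<in>W. \<beta> / 2 * Om)" by simp
    also have "\<dots> \<le> (\<Sum>w\<in>W. real (card {z \<in> ?\<Omega> - Bad. ?R w z}))"
      using cw by (intro sum_mono) auto
    also have "\<dots> = (\<Sum>w\<in>W. \<Sum>z\<in>?\<Omega> - Bad. of_bool (?R w z))"
      by (simp add: Int_def)
    also have "\<dots> = (\<Sum>z\<in>?\<Omega> - Bad. \<Sum>w\<in>W. of_bool (?R w z))" by (rule sum.swap)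
    also have "\<dots> = (\<Sum>z\<in>?\<Omega> - Bad. real (card {w \<in> W. ?R w z}))"
      using W by (simp add: Int_def)
    finally have 1: "real (card W) * (\<beta> / 2 * Om) \<le> (\<Sum>z\<in>?\<Omega> - Bad. real (card {w \<in> W. ?R w z}))" .
    show False
    proof (cases "?\<Omega> - Bad = {}")
      case True
      have "real (card W) > 0" using W by (simp add: card_gt_0_iff)
      then have "real (card W) * (\<beta> / 2 * Om) > 0" using \<beta> Opos by simp
      then show False using 1 unfolding True by simp
    next
      case False
      have "(\<Sum>z\<in>?\<Omega> - Bad. real (card {w \<in> W. ?R w z})) < (\<Sum>z\<in>?\<Omega> - Bad. \<beta> / 2 * real (card W))"
      proof (rule sum_strict_mono)
        fix z assume "z \<in> ?\<Omega> - Bad"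
        then have "\<not> \<beta> / 2 * real (card W) \<le> real (card {w \<in> W. ?R w z})" using neg by blast
        then show "real (card {w \<in> W. ?R w z}) < \<beta> / 2 * real (card W)" by linarith
      qed (use False in auto)
      also have "\<dots> = real (card (?\<Omega> - Bad)) * (\<beta> / 2 * real (card W))" by simp
      also have "\<dots> \<le> Om * (\<beta> / 2 * real (card W))"
      proof (rule mult_right_mono)
        have "card (?\<Omega> - Bad) \<le> card ?\<Omega>" by (intro card_mono) auto
        then have "real (card (?\<Omega> - Bad)) \<le> real (card ?\<Omega>)" by (rule of_nat_mono)
        then show "real (card (?\<Omega> - Bad)) \<le> Om" by (simp add: Om_def card_cartesian_product card_nlists)
      qed (use \<beta> in simp)
      finally show False using 1 by (simp add: algebra_simps)
    qed
  qed
  then obtain z where z: "z \<in> ?\<Omega> - Bad" "\<beta> / 2 * real (card W) \<le> real (card {w \<in> W. ?R w z})" by blast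
  have "real (card W) > 0" using W by (simp add: card_gt_0_iff)
  then have "\<beta> / 2 * real (card W) > 0" using \<beta> by simp
  then have "card {w \<in> W. ?R w z} \<noteq> 0" using z(2) by linarith
  then have "{w \<in> W. ?R w z} \<noteq> {}" by fastforce
  then have wz: "wpm k H (mset (fst z)) (mset (snd z))" by (auto simp: absb_def)
  have "gfam a b (z # Fs)"
    using z(1) wz Fs(1) unfolding gfam_def Bad_def Fc_def Fv_def by auto
  moreover have "real (card {w \<in> W. \<not> ?R w z}) \<le> (1 - \<beta> / 2) * real (card W)"
  proof -
    have "card W = card {w \<in> W. ?R w z} + card {w \<in> W. \<not> ?R w z}"
      using W(1) by (subst card_Un_disjoint[symmetric]) (auto intro: arg_cong[where f = card])
    then have "real (card W) = real (card {w \<in> W. ?R w z}) + real (card {w \<in> W. \<not> ?R w z})" by simp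
    then show ?thesis using z(2) by (simp add: algebra_simps)
  qed
  ultimately show ?thesis by blast
qed

lemma greedy:
  assumes dens: "\<And>xs vs. (xs, vs) \<in> W \<Longrightarrow> dens X V a b \<beta> (absb (mset xs) (mset vs))"
    and W: "finite W" and \<beta>: "\<beta> > 0" "\<beta> \<le> 1" and b: "b \<ge> 1"
    and big: "real ((J + 1) * (a * a + b * b)) \<le> \<beta> / 2 * m"
  shows "j \<le> J \<Longrightarrow> \<exists>Fs. gfam a b Fs \<and> length Fs \<le> j \<and>
     real (card {w \<in> W. \<forall>z\<in>set Fs. \<not> absb (mset (fst w)) (mset (snd w)) (mset (fst z)) (mset (snd z))}) \<le> (1 - \<beta> / 2) ^ j * real (card W)"
proof (induction j)
  case 0
  show ?case by (intro exI[of _ "[]"]) (auto simp: gfam_def)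
next
  case (Suc j)
  let ?R = "\<lambda>w z. absb (mset (fst w)) (mset (snd w)) (mset (fst z)) (mset (snd z))"
  obtain Fs where Fs: "gfam a b Fs" "length Fs \<le> j"
    "real (card {w \<in> W. \<forall>z\<in>set Fs. \<not> ?R w z}) \<le> (1 - \<beta> / 2) ^ j * real (card W)"
    using Suc by auto
  define U where "U = {w \<in> W. \<forall>z\<in>set Fs. \<not> ?R w z}"
  show ?case
  proof (cases "U = {}")
    case True
    have "0 \<le> (1 - \<beta> / 2) ^ Suc j * real (card W)" using \<beta> by (intro mult_nonneg_nonneg zero_le_power) auto
    moreover have e: "{w \<in> W. \<forall>z\<in>set Fs. \<not> ?R w z} = {}" using True unfolding U_def .
    ultimately have "real (card {w \<in> W. \<forall>z\<in>set Fs. \<not> ?R w z}) \<le> (1 - \<beta> / 2) ^ Suc j * real (card W)"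
      unfolding e by simp
    then show ?thesis using Fs(1,2) by (intro exI[of _ Fs]) auto
  next
    case False
    have "real ((j + 1) * (a * a + b * b)) \<le> real ((J + 1) * (a * a + b * b))"
      using Suc.prems by (intro of_nat_mono mult_le_mono) auto
    then have "real ((j + 1) * (a * a + b * b)) \<le> \<beta> / 2 * m" using big by linarith
    then obtain z where z: "gfam a b (z # Fs)" "real (card {w \<in> U. \<not> ?R w z}) \<le> (1 - \<beta> / 2) * real (card U)"
      using greedy_step[of U a b \<beta> Fs j] dens False \<beta> Fs b W unfolding U_def by auto
    have "{w \<in> W. \<forall>z\<in>set (z # Fs). \<not> ?R w z} = {w \<in> U. \<not> ?R w z}" by (auto simp: U_def)
    moreover have "(1 - \<beta> / 2) * real (card U) \<le> (1 - \<beta> / 2) * ((1 - \<beta> / 2) ^ j * real (card W))"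
      using Fs(3) \<beta> unfolding U_def by (intro mult_left_mono) auto
    ultimately have "real (card {w \<in> W. \<forall>z\<in>set (z # Fs). \<not> ?R w z}) \<le> (1 - \<beta> / 2) ^ Suc j * real (card W)"
      using z(2) by (simp add: mult.assoc)
    then show ?thesis using z(1) Fs(2) by (intro exI[of _ "z # Fs"]) auto
  qed
qed

text \<open>One absorber per target suffices, since only one set of \<open>q\<close> colours and
  \<open>q * k\<close> vertices is going to be absorbed while the other absorbers stay at rest.
  After \<open>J\<close> steps fewer than one target, hence none, is unserved.\<close>

lemma absorbing_set:
  assumes dens: "\<And>xs vs. xs \<in> nlists X q \<Longrightarrow> vs \<in> nlists V (q * k) \<Longrightarrow> dens X V a (k * a) \<beta> (absb (mset xs) (mset vs))"
    and \<beta>: "\<beta> > 0" "\<beta> \<le> 1" and a: "a \<ge> 1"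
    and big: "real ((J + 1) * (a * a + (k * a) * (k * a))) \<le> \<beta> / 2 * m"
    and small: "(1 - \<beta> / 2) ^ J * n ^ (q + q * k) < 1"
  shows "\<exists>XA VA. XA \<subseteq> X \<and> VA \<subseteq> V \<and> card XA \<le> a * J \<and> card VA = k * card XA \<and>
    (\<forall>XW VW. XW \<subseteq> X - XA \<longrightarrow> VW \<subseteq> V - VA \<longrightarrow> card XW = q \<longrightarrow> card VW = q * k \<longrightarrow> rpm k H (XA \<union> XW) (VA \<union> VW))"
proof -
  let ?R = "\<lambda>w z. absb (mset (fst w)) (mset (snd w)) (mset (fst z)) (mset (snd z))"
  let ?W = "nlists X q \<times> nlists V (q * k)"
  have "k * a \<ge> 1" using a k_ge by (simp add: Suc_le_eq)
  then obtain Fs where Fs: "gfam a (k * a) Fs" "length Fs \<le> J"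
    "real (card {w \<in> ?W. \<forall>z\<in>set Fs. \<not> ?R w z}) \<le> (1 - \<beta> / 2) ^ J * real (card ?W)"
    using greedy[of ?W a "k * a" \<beta> J J] dens \<beta> big by auto
  have "real (card ?W) = m ^ q * n ^ (q * k)" by (simp add: card_cartesian_product card_nlists)
  also have "\<dots> \<le> n ^ q * n ^ (q * k)"
    using m_le_n by (intro mult_right_mono power_mono) auto
  also have "\<dots> = n ^ (q + q * k)" by (simp add: power_add)
  finally have "(1 - \<beta> / 2) ^ J * real (card ?W) \<le> (1 - \<beta> / 2) ^ J * n ^ (q + q * k)"
    using \<beta> by (intro mult_left_mono zero_le_power) auto
  then have "real (card {w \<in> ?W. \<forall>z\<in>set Fs. \<not> ?R w z}) < 1" using Fs(3) small by linarith
  then have "card {w \<in> ?W. \<forall>z\<in>set Fs. \<not> ?R w z} = 0" by simp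
  moreover have "finite {w \<in> ?W. \<forall>z\<in>set Fs. \<not> ?R w z}" by simp
  ultimately have "{w \<in> ?W. \<forall>z\<in>set Fs. \<not> ?R w z} = {}" by (simp only: card_0_eq)
  then have cover: "\<exists>z\<in>set Fs. ?R w z" if "w \<in> ?W" for w using that by blast
  define XA where "XA = set (concat (map fst Fs))"
  define VA where "VA = set (concat (map snd Fs))"
  have dist: "distinct (concat (map fst Fs))" "distinct (concat (map snd Fs))" using Fs(1) by (auto simp: gfam_def)
  have len: "length (concat (map fst Fs)) = a * length Fs" "length (concat (map snd Fs)) = k * a * length Fs"
    using length_concat_const[of "map fst Fs" a] length_concat_const[of "map snd Fs" "k * a"] Fs(1)
    by (auto simp: gfam_def nlists_def)
  have cXA: "card XA = a * length Fs" "card VA = k * a * length Fs"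
    unfolding XA_def VA_def using dist len by (simp_all only: distinct_card)
  have sub: "XA \<subseteq> X" "VA \<subseteq> V" using Fs(1) by (auto simp: XA_def VA_def gfam_def nlists_def)
  have "rpm k H (XA \<union> XW) (VA \<union> VW)"
    if XW: "XW \<subseteq> X - XA" "card XW = q" and VW: "VW \<subseteq> V - VA" "card VW = q * k" for XW VW
  proof -
    have "finite XW" "finite VW" using XW VW finite_subset[of XW X] finite_subset[of VW V] by auto
    then obtain xs vs where xv: "set xs = XW" "distinct xs" "set vs = VW" "distinct vs"
      by (meson finite_distinct_list)
    then have "(xs, vs) \<in> ?W" using XW VW distinct_card[of xs] distinct_card[of vs] by (auto simp: nlists_def)
    then obtain z where z: "z \<in> set Fs" "absb (mset xs) (mset vs) (mset (fst z)) (mset (snd z))"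
      using cover by fastforce
    have "wpm k H (mset (concat (map fst Fs)) + mset xs) (mset (concat (map snd Fs)) + mset vs)"
      by (rule wpm_concat_absorb[OF _ z]) (use Fs(1) in \<open>auto simp: gfam_def\<close>)
    then have w: "wpm k H (mset (concat (map fst Fs) @ xs)) (mset (concat (map snd Fs) @ vs))" by simp
    have d: "distinct (concat (map fst Fs) @ xs)" "distinct (concat (map snd Fs) @ vs)"
      using dist xv XW VW unfolding XA_def VA_def by auto
    have "rpm k H (set_mset (mset (concat (map fst Fs) @ xs))) (set_mset (mset (concat (map snd Fs) @ vs)))"
      by (rule wpm_imp_rpm[OF w]) (use d in \<open>auto simp only: distinct_count_atmost_1 split: if_splits\<close>)
    then show ?thesis unfolding set_mset_mset set_append XA_def VA_def xv .
  qed
  then show ?thesis using sub cXA Fs(2) by (intro exI[of _ XA] exI[of _ VA]) auto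
qed

end

text \<open>The base is at most \<open>exp (- (\<beta> / 2))\<close>, and an exponential outgrows
  every power.\<close>

lemma power_exp_small:
  fixes \<beta> \<tau> :: real
  assumes "0 < \<beta>" "\<beta> \<le> 1" "\<tau> > 0" "k \<ge> 1"
  shows "\<exists>N. \<forall>m\<ge>N. (1 - \<beta> / 2) ^ nat \<lfloor>\<tau> * real m\<rfloor> * real (k * m) ^ c < 1"
proof -
  define \<gamma> where "\<gamma> = \<beta> / 2 * \<tau>"
  have \<gamma>: "\<gamma> > 0" using assms by (simp add: \<gamma>_def)
  have "((\<lambda>x::real. x ^ c / exp x) \<longlongrightarrow> 0) at_top" by (rule tendsto_power_div_exp_0)
  moreover have "filterlim (\<lambda>m. \<gamma> * real m) at_top sequentially"
    using \<gamma> by (intro filterlim_tendsto_pos_mult_at_top[OF tendsto_const]) (auto simp: filterlim_real_sequentially)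
  ultimately have "((\<lambda>m. (\<gamma> * real m) ^ c / exp (\<gamma> * real m)) \<longlongrightarrow> 0) sequentially"
    by (rule filterlim_compose)
  moreover have pos: "0 < \<gamma> ^ c / (exp 1 * real k ^ c)" using \<gamma> assms by simp
  ultimately have "\<forall>\<^sub>F m in sequentially. (\<gamma> * real m) ^ c / exp (\<gamma> * real m) < \<gamma> ^ c / (exp 1 * real k ^ c)"
    by (rule order_tendstoD)
  then obtain N where N: "\<And>m. m \<ge> N \<Longrightarrow> (\<gamma> * real m) ^ c / exp (\<gamma> * real m) < \<gamma> ^ c / (exp 1 * real k ^ c)"
    by (auto simp: eventually_sequentially)
  show ?thesis
  proof (intro exI allI impI)
    fix m assume "m \<ge> N"
    let ?J = "nat \<lfloor>\<tau> * real m\<rfloor>"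
    have J: "real ?J \<ge> \<tau> * real m - 1" by linarith
    have "1 - \<beta> / 2 \<le> exp (- (\<beta> / 2))" using exp_ge_add_one_self[of "- (\<beta> / 2)"] by simp
    then have "(1 - \<beta> / 2) ^ ?J \<le> exp (- (\<beta> / 2)) ^ ?J" using assms by (intro power_mono) auto
    also have "\<dots> = exp (- (\<beta> / 2 * real ?J))" by (simp flip: exp_of_nat_mult add: mult.commute)
    also have "\<dots> \<le> exp (1 - \<gamma> * real m)"
    proof -
      have "\<beta> / 2 * real ?J \<ge> \<beta> / 2 * (\<tau> * real m - 1)" using J assms by (intro mult_left_mono) auto
      also have "\<beta> / 2 * (\<tau> * real m - 1) = \<gamma> * real m - \<beta> / 2" by (simp add: \<gamma>_def algebra_simps)
      finally show ?thesis using assms by simp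
    qed
    also have "\<dots> = exp 1 / exp (\<gamma> * real m)" by (simp add: exp_diff)
    finally have "(1 - \<beta> / 2) ^ ?J * real (k * m) ^ c \<le> exp 1 / exp (\<gamma> * real m) * real (k * m) ^ c"
      by (intro mult_right_mono) auto
    also have "\<dots> = (\<gamma> * real m) ^ c / exp (\<gamma> * real m) * (exp 1 * real k ^ c / \<gamma> ^ c)"
      using \<gamma> by (simp add: power_mult_distrib field_simps)
    also have "\<dots> < \<gamma> ^ c / (exp 1 * real k ^ c) * (exp 1 * real k ^ c / \<gamma> ^ c)"
      using N[OF \<open>m \<ge> N\<close>] \<gamma> assms by (intro mult_strict_right_mono) auto
    also have "\<dots> = 1" using \<gamma> assms by simp
    finally show "(1 - \<beta> / 2) ^ ?J * real (k * m) ^ c < 1" .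
  qed
qed

theorem rpm_if_reach:
  fixes \<theta> \<beta> :: real
  assumes k3: "k \<ge> 3" and rk: "r \<ge> 1" "2 * r \<le> k" and s: "s \<ge> 1" and \<beta>: "0 < \<beta>" "\<beta> \<le> 1"
    and \<theta>: "\<theta> > 0" "16 * (real k + 1) * real k ^ Suc r * \<theta> \<le> 1"
  shows "\<exists>N. \<forall>(X :: 'c set) (V :: 'a set) H.
     card X \<ge> N \<longrightarrow> colgraphs X V H k \<longrightarrow>
     (\<forall>x\<in>X. \<forall>S\<subseteq>V. card S = k - r \<longrightarrow>
        (1 / 2 - \<theta>) * real (card V) ^ r \<le> real (card {T \<in> nlists V r. S \<union> set T \<in> H x})) \<longrightarrow>
     (\<forall>u\<in>V. \<forall>v\<in>V. reach k H X V s \<beta> u v) \<longrightarrow> rpm k H X V"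
proof -
  define a where "a = k * (k * s)"
  define b where "b = k * a"
  \<comment> \<open>Density of absorbers for \<open>k\<close> colours and \<open>k * k\<close>
    vertices, the number of non-edges allowed by \<open>almost_perfect\<close>.\<close>
  define \<beta>' where "\<beta>' = (1 / 5 * \<beta> ^ k) ^ k"
  \<comment> \<open>There will be at most \<open>\<tau> * m\<close> absorbers, more than the
    logarithmic number that is needed. The three bounds make the removed vertices cost at most
    \<open>\<theta>\<close> in the degree condition, leave at least half of the colours, and meet
    the size condition of the greedy choice.\<close>
  define \<tau> where "\<tau> = min (\<theta> / real r) (min (1 / 2) (\<beta>' / 4)) / real (a * a + b * b)"
  define c where "c = k + k * k"
  have a1: "a \<ge> 1" using s k3 by (simp add: a_def Suc_le_eq)
  have ab: "real (a * a + b * b) \<ge> real a" "real (a * a + b * b) > 0"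
  proof -
    have "a * 1 \<le> a * a" using a1 by (intro mult_le_mono) auto
    then have "a \<le> a * a + b * b" by linarith
    then show "real (a * a + b * b) \<ge> real a" by (rule of_nat_mono)
    then show "real (a * a + b * b) > 0" using a1 by linarith
  qed
  have \<beta>': "0 < \<beta>'" "\<beta>' \<le> 1"
  proof -
    have "\<beta> ^ k \<le> 1" "\<beta> ^ k > 0" using \<beta> by (auto simp: power_le_one)
    then show "0 < \<beta>'" "\<beta>' \<le> 1" unfolding \<beta>'_def by (auto intro!: power_le_one)
  qed
  have \<tau>pos: "\<tau> > 0" unfolding \<tau>_def using \<theta> rk \<beta>' ab by simp
  obtain N1 where N1: "\<And>m. m \<ge> N1 \<Longrightarrow> (1 - \<beta>' / 2) ^ nat \<lfloor>\<tau> * real m\<rfloor> * real (k * m) ^ c < 1"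
    using power_exp_small[OF \<beta>' \<tau>pos, of k c] k3 by auto
  define N2 where "N2 = nat \<lceil>2 * (8 * (real k + 1) * real k ^ Suc r * real (r * r + r * (k + 1)) + real k)\<rceil>"
  define N3 where "N3 = nat \<lceil>4 * real (a * a + b * b) / \<beta>'\<rceil>"
  show ?thesis
  proof (intro exI[of _ "max N1 (max N2 N3)"] allI impI)
    fix X :: "'c set" and V :: "'a set" and H
    assume N: "max N1 (max N2 N3) \<le> card X" and cg: "colgraphs X V H k"
      and deg: "\<forall>x\<in>X. \<forall>S\<subseteq>V. card S = k - r \<longrightarrow>
        (1 / 2 - \<theta>) * real (card V) ^ r \<le> real (card {T \<in> nlists V r. S \<union> set T \<in> H x})"
      and R: "\<forall>u\<in>V. \<forall>v\<in>V. reach k H X V s \<beta> u v"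
    interpret colgraphs X V H k by (rule cg)
    define J where "J = nat \<lfloor>\<tau> * m\<rfloor>"
    have Jle: "real J \<le> \<tau> * m" unfolding J_def using \<tau>pos m_pos by simp
    have \<tau>ab: "\<tau> * real (a * a + b * b) \<le> \<theta> / real r" "\<tau> * real (a * a + b * b) \<le> 1 / 2" "\<tau> * real (a * a + b * b) \<le> \<beta>' / 4"
    proof -
      have "x / y * y = x" if "y > 0" for x y :: real using that by simp
      then have "\<tau> * real (a * a + b * b) = min (\<theta> / real r) (min (1 / 2) (\<beta>' / 4))"
        unfolding \<tau>_def using ab(2) by blast
      then show "\<tau> * real (a * a + b * b) \<le> \<theta> / real r" "\<tau> * real (a * a + b * b) \<le> 1 / 2" "\<tau> * real (a * a + b * b) \<le> \<beta>' / 4"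
        by linarith+
    qed
    have dens: "dens X V a (k * a) \<beta>' (absb (mset xs) (mset vs))" if "xs \<in> nlists X k" "vs \<in> nlists V (k * k)" for xs vs
      using dens_absorb[of s \<beta> xs k vs] R \<beta> s that unfolding a_def \<beta>'_def by simp
    have big: "real ((J + 1) * (a * a + k * a * (k * a))) \<le> \<beta>' / 2 * m"
    proof -
      have "real ((J + 1) * (a * a + k * a * (k * a))) = real J * real (a * a + b * b) + real (a * a + b * b)"
        by (simp add: b_def algebra_simps)
      also have "real J * real (a * a + b * b) \<le> (\<tau> * m) * real (a * a + b * b)"
        using Jle by (intro mult_right_mono) auto
      also have "(\<tau> * m) * real (a * a + b * b) = (\<tau> * real (a * a + b * b)) * m" by simp
      also have "\<dots> \<le> (\<beta>' / 4) * m" using \<tau>ab m_pos by (intro mult_right_mono) auto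
      also have "real (a * a + b * b) \<le> (\<beta>' / 4) * m"
      proof -
        have "4 * real (a * a + b * b) / \<beta>' \<le> real N3" unfolding N3_def by linarith
        also have "\<dots> \<le> m" using N by simp
        finally show ?thesis using \<beta>' by (simp add: field_simps)
      qed
      finally show ?thesis by simp
    qed
    have small: "(1 - \<beta>' / 2) ^ J * n ^ (k + k * k) < 1"
      using N1[of "card X"] N unfolding J_def c_def cardV by simp
    obtain XA VA where A: "XA \<subseteq> X" "VA \<subseteq> V" "card XA \<le> a * J" "card VA = k * card XA"
      and absorb: "\<And>XW VW. XW \<subseteq> X - XA \<Longrightarrow> VW \<subseteq> V - VA \<Longrightarrow> card XW = k \<Longrightarrow> card VW = k * k \<Longrightarrow> rpm k H (XA \<union> XW) (VA \<union> VW)"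
      using absorbing_set[OF dens \<beta>' a1 big small] by blast
    define X' where "X' = X - XA"
    define V' where "V' = V - VA"
    define H' where "H' x = {e \<in> H x. e \<subseteq> V'}" for x
    have fA: "finite XA" "finite VA" using finite_subset[OF A(1)] finite_subset[OF A(2)] by auto
    have cV': "card V' = k * card X'"
      using A fA cardV by (simp add: V'_def X'_def card_Diff_subset diff_mult_distrib2)
    have XAm: "real (card XA) \<le> \<tau> * real (a * a + b * b) * m"
    proof -
      have "real (card XA) \<le> real (a * J)" using A(3) by (rule of_nat_mono)
      also have "\<dots> = real a * real J" by simp
      also have "\<dots> \<le> real (a * a + b * b) * (\<tau> * m)" using Jle ab by (intro mult_mono) auto
      finally show ?thesis by (simp add: mult_ac)
    qed
    have "\<tau> * real (a * a + b * b) * m \<le> 1 / 2 * m" using \<tau>ab m_pos by (intro mult_right_mono) auto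
    then have XAh: "real (card XA) \<le> 1 / 2 * m" using XAm by linarith
    have "real (card X') = m - real (card XA)"
      using A fA by (simp add: X'_def card_Diff_subset card_mono of_nat_diff)
    then have X'm: "real (card X') \<ge> 1 / 2 * m" using XAh by linarith
    have X'big: "8 * (real k + 1) * real k ^ Suc r * real (r * r + r * (k + 1)) + real k \<le> real (card X')"
    proof -
      have "2 * (8 * (real k + 1) * real k ^ Suc r * real (r * r + r * (k + 1)) + real k) \<le> real N2"
        unfolding N2_def by linarith
      also have "\<dots> \<le> m" using N by simp
      also have "m \<le> 2 * real (card X')" using X'm by simp
      finally show ?thesis by (rule mult_left_le_imp_le) simp
    qed
    have VAn: "real r * real (card VA) / n \<le> \<theta>"
    proof -
      have "real (card VA) = real k * real (card XA)" using A(4) by simp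
      also have "\<dots> \<le> real k * (\<theta> / real r * m)"
      proof (rule mult_left_mono)
        have "\<tau> * real (a * a + b * b) * m \<le> \<theta> / real r * m" using \<tau>ab m_pos by (intro mult_right_mono) auto
        then show "real (card XA) \<le> \<theta> / real r * m" using XAm by linarith
      qed simp
      also have "\<dots> = \<theta> / real r * n" by (simp add: cardV)
      finally have "real r * real (card VA) \<le> real r * (\<theta> / real r * n)" by (intro mult_left_mono) auto
      also have "\<dots> = \<theta> * n" using rk by simp
      finally show ?thesis using n_pos by (simp add: field_simps)
    qed
    \<comment> \<open>Removing the absorbing set costs another \<open>\<theta>\<close>; hence the
      factor 16 instead of 8 in the hypothesis on \<open>\<theta>\<close>.\<close>
    have "\<exists>P. blocks k X' V' P \<and> card {x \<in> X'. P x \<notin> H' x} \<le> k"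
    proof (rule almost_perfect[OF _ _ k3 rk, where \<theta> = "2 * \<theta>"])
      show "finite X'" "finite V'" by (auto simp: X'_def V'_def)
      show "card e = k" if "x \<in> X'" "e \<in> H' x" for x e
        using edges[of x e] that by (auto simp: X'_def H'_def)
      show "card V' = k * card X'" by (rule cV')
      show "8 * (real k + 1) * real k ^ Suc r * (2 * \<theta>) \<le> 1"
      proof -
        have "8 * (real k + 1) * real k ^ Suc r * (2 * \<theta>) = 16 * (real k + 1) * real k ^ Suc r * \<theta>" by algebra
        then show ?thesis using \<theta>(2) by (simp only:)
      qed
      show "8 * (real k + 1) * real k ^ Suc r * real (r * r + r * (k + 1)) \<le> real (card X')"
        using X'big by linarith
      fix x S assume x: "x \<in> X'" and S: "S \<subseteq> V'" "card S = k - r"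
      let ?A = "{T \<in> nlists V r. S \<union> set T \<in> H x}" and ?B = "{T \<in> nlists V r. set T \<inter> VA \<noteq> {}}"
      let ?C = "{T \<in> nlists V' r. S \<union> set T \<in> H' x}"
      have "?A \<subseteq> ?C \<union> ?B" using S by (auto simp: nlists_def V'_def H'_def)
      then have "card ?A \<le> card (?C \<union> ?B)" by (intro card_mono) (auto simp: V'_def)
      also have "\<dots> \<le> card ?C + card ?B" by (rule card_Un_le)
      finally have 1: "real (card ?A) \<le> real (card ?C) + real (card ?B)" by linarith
      have 2: "(1 / 2 - \<theta>) * n ^ r \<le> real (card ?A)"
        using deg x S by (auto simp: X'_def V'_def)
      have 3: "real (card ?B) \<le> \<theta> * n ^ r"
        using order_trans[OF card_nlists_meeting_real[OF finV fA(2) V_ne, of r] mult_right_mono[OF VAn, of "n ^ r"]] by simp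
      have th: "1 / 2 - 2 * \<theta> \<ge> 0"
      proof -
        have "1 * 1 \<le> (real k + 1) * real k ^ Suc r"
          using k3 by (intro mult_mono one_le_power) auto
        then have "16 * \<theta> * 1 \<le> 16 * \<theta> * ((real k + 1) * real k ^ Suc r)" using \<theta> by (intro mult_left_mono) auto
        also have "\<dots> = 16 * (real k + 1) * real k ^ Suc r * \<theta>" by algebra
        also have "\<dots> \<le> 1" by (rule \<theta>(2))
        finally show ?thesis by simp
      qed
      have "(1 / 2 - 2 * \<theta>) * real (card V') ^ r \<le> (1 / 2 - 2 * \<theta>) * n ^ r"
        using th by (intro mult_left_mono power_mono of_nat_mono card_mono) (auto simp: V'_def)
      also have "\<dots> = (1 / 2 - \<theta>) * n ^ r - \<theta> * n ^ r" by (simp add: algebra_simps)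
      finally show "(1 / 2 - 2 * \<theta>) * real (card V') ^ r \<le> real (card ?C)" using 1 2 3 by linarith
    qed
    then obtain P where P: "blocks k X' V' P" "card {x \<in> X'. P x \<notin> H' x} \<le> k" by blast
    have "k \<le> card X'" 
    proof -
      have "0 \<le> 8 * (real k + 1) * real k ^ Suc r * real (r * r + r * (k + 1))" by simp
      then have "real k \<le> real (card X')" using X'big by linarith
      then show ?thesis by simp
    qed
    \<comment> \<open>The absorbing set takes exactly \<open>k\<close> colours, so the non-edges are
      filled up with further colours.\<close>
    then obtain F where F: "{x \<in> X'. P x \<notin> H' x} \<subseteq> F" "F \<subseteq> X'" "card F = k"
      using exists_subset_between[of "{x \<in> X'. P x \<notin> H' x}" k X'] P(2) by (auto simp: X'_def)
    have fX': "finite X'" "finite V'" by (auto simp: X'_def V'_def)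
    let ?VF = "\<Union>x\<in>F. P x"
    have VF: "?VF \<subseteq> V'" using P(1) F(2) by (auto simp: blocks_def)
    have "rpm k H (XA \<union> F) (VA \<union> ?VF)"
      by (rule absorb) (use F VF card_UN_blocks[OF P(1) F(2) fX'] in \<open>auto simp: X'_def V'_def mult.commute\<close>)
    moreover have "rpm k H (X' - F) (V' - ?VF)"
      unfolding rpm_def
    proof (intro exI[of _ P] conjI)
      show "\<forall>x\<in>X' - F. P x \<in> H x" using F(1) by (auto simp: H'_def)
      have d: "P x \<inter> P y = {}" if "x \<in> X'" "y \<in> X'" "x \<noteq> y" for x y
        using P(1) that by (auto simp: blocks_def disjoint_family_on_def)
      have U: "(\<Union>x\<in>X'. P x) = V'" using P(1) by (simp add: blocks_def)
      have "P x \<subseteq> V' - ?VF" if "x \<in> X' - F" for x using d[of x] U that F(2) by blast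
      moreover have "(\<Union>x\<in>X' - F. P x) = V' - ?VF"
      proof
        show "(\<Union>x\<in>X' - F. P x) \<subseteq> V' - ?VF" using calculation by blast
        show "V' - ?VF \<subseteq> (\<Union>x\<in>X' - F. P x)" using U by blast
      qed
      ultimately show "blocks k (X' - F) (V' - ?VF) P"
        using P(1) by (auto simp: blocks_def disjoint_family_on_def)
    qed
    ultimately have "rpm k H ((XA \<union> F) \<union> (X' - F)) ((VA \<union> ?VF) \<union> (V' - ?VF))"
    proof (rule rpm_Un)
      show "(XA \<union> F) \<inter> (X' - F) = {}" by (auto simp: X'_def)
      show "(VA \<union> ?VF) \<inter> (V' - ?VF) = {}" by (auto simp: V'_def)
    qed
    moreover have "(XA \<union> F) \<union> (X' - F) = X" "(VA \<union> ?VF) \<union> (V' - ?VF) = V"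
      using A F(2) VF by (auto simp: X'_def V'_def)
    ultimately show "rpm k H X V" by simp
  qed
qed

subsection \<open>Either all vertices can be exchanged or the colours are close to parity graphs\<close>

lemma sum_nlists_snoc:
  "sum f (nlists V (Suc j)) = (\<Sum>S\<in>nlists V j. \<Sum>v\<in>V. f (S @ [v]))"
  using sum_nlists_append[of f V j 1] by (simp add: sum_nlists_Suc[of _ V 0])

lemma card_three_sets:
  assumes "finite \<Omega>" "A \<subseteq> \<Omega>" "B \<subseteq> \<Omega>" "C \<subseteq> \<Omega>"
  shows "card A + card B + card C \<le> card \<Omega> + card (A \<inter> B) + card (A \<inter> C) + card (B \<inter> C)"
proof -
  have fin: "finite A" "finite B" "finite C"
    using assms(2-4) by (auto intro: finite_subset[OF _ assms(1)])
  have 1: "card A + card B = card (A \<union> B) + card (A \<inter> B)" by (rule card_Un_Int[OF fin(1,2)])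
  have 2: "card (A \<union> B) + card C = card (A \<union> B \<union> C) + card ((A \<union> B) \<inter> C)"
    using fin by (intro card_Un_Int) auto
  have "card (A \<union> B \<union> C) \<le> card \<Omega>" using assms by (intro card_mono) auto
  moreover have "card ((A \<union> B) \<inter> C) \<le> card (A \<inter> C) + card (B \<inter> C)"
    using card_Un_le[of "A \<inter> C" "B \<inter> C"] by (simp add: Int_Un_distrib2)
  ultimately show ?thesis using 1 2 by linarith
qed

locale colgraphs_half = colgraphs +
  fixes \<eta> :: real
  assumes \<eta>_pos: "\<eta> > 0" and \<eta>_small: "20 * real k * \<eta> \<le> 1"
    and deg_half: "\<And>x v. x \<in> X \<Longrightarrow> v \<in> V \<Longrightarrow>
       (1 / 2 - \<eta>) * real (card V) ^ (k - 1) \<le> real (card {S \<in> nlists V (k - 1). insert v (set S) \<in> H x})"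
begin

lemma \<eta>_le: "40 * \<eta> \<le> 1"
proof -
  have "20 * 2 * \<eta> \<le> 20 * real k * \<eta>" using k_ge \<eta>_pos by (intro mult_right_mono) auto
  then show ?thesis using \<eta>_small by linarith
qed

section \<open>The graph of vertex pairs with substantially intersecting links\<close>

definition Om where "Om = X \<times> nlists V (k - 1)"
definition N :: real where "N = m * n ^ (k - 1)"
definition Lam where "Lam v = {z \<in> Om. insert v (set (snd z)) \<in> H (fst z)}"
definition adj where "adj u v \<longleftrightarrow> \<eta> * N \<le> real (card (Lam u \<inter> Lam v))"

lemma finite_Om [simp]: "finite Om"
  by (simp add: Om_def)

lemma card_Om: "real (card Om) = N"
  by (simp add: Om_def N_def card_cartesian_product card_nlists)

lemma N_pos: "N > 0"
  using m_pos n_pos by (simp add: N_def)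

lemma Lam_sub: "Lam v \<subseteq> Om"
  by (auto simp: Lam_def)

lemma finite_Lam [simp]: "finite (Lam v)"
  by (rule finite_subset[OF Lam_sub finite_Om])

lemma card_Lam_sum: "card (Lam v) = (\<Sum>x\<in>X. card {S \<in> nlists V (k - 1). insert v (set S) \<in> H x})"
proof -
  have "Lam v = (SIGMA x : X. {S \<in> nlists V (k - 1). insert v (set S) \<in> H x})"
    by (auto simp: Lam_def Om_def)
  then show ?thesis by simp
qed

lemma card_Lam: "v \<in> V \<Longrightarrow> (1 / 2 - \<eta>) * N \<le> real (card (Lam v))"
proof -
  assume v: "v \<in> V"
  have "(1 / 2 - \<eta>) * N = (\<Sum>x\<in>X. (1 / 2 - \<eta>) * n ^ (k - 1))" by (simp add: N_def)
  also have "\<dots> \<le> (\<Sum>x\<in>X. real (card {S \<in> nlists V (k - 1). insert v (set S) \<in> H x}))"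
    using deg_half v by (intro sum_mono) auto
  finally show ?thesis by (simp add: card_Lam_sum)
qed

lemma adj_sym: "adj u v = adj v u"
  by (simp add: adj_def Int_commute)

text \<open>Three sets of density nearly 1/2 cannot be nearly disjoint, as 3/2 exceeds 1.
  Consequently the non-neighbours of a vertex form a clique.\<close>

lemma adj_three:
  assumes "u \<in> V" "v \<in> V" "w \<in> V"
  shows "adj u v \<or> adj u w \<or> adj v w"
proof (rule ccontr)
  assume neg: "\<not> ?thesis"
  have "real (card (Lam u) + card (Lam v) + card (Lam w)) \<le>
     real (card Om + card (Lam u \<inter> Lam v) + card (Lam u \<inter> Lam w) + card (Lam v \<inter> Lam w))"
    by (intro of_nat_mono card_three_sets finite_Om Lam_sub)
  then have "real (card (Lam u)) + real (card (Lam v)) + real (card (Lam w)) \<le>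
     N + real (card (Lam u \<inter> Lam v)) + real (card (Lam u \<inter> Lam w)) + real (card (Lam v \<inter> Lam w))"
    by (simp add: card_Om)
  moreover have "real (card (Lam u \<inter> Lam v)) < \<eta> * N" "real (card (Lam u \<inter> Lam w)) < \<eta> * N" "real (card (Lam v \<inter> Lam w)) < \<eta> * N"
    using neg by (auto simp: adj_def not_le)
  ultimately have "3 * ((1 / 2 - \<eta>) * N) < N + 3 * (\<eta> * N)"
    using card_Lam[OF assms(1)] card_Lam[OF assms(2)] card_Lam[OF assms(3)] by linarith
  then have "(1 / 2) * N < (6 * \<eta>) * N" by (simp add: algebra_simps)
  then show False using N_pos \<eta>_le by simp
qed

text \<open>A common element \<open>(x, S)\<close> of both links completes to an edge of colour
  \<open>x\<close> with either vertex.\<close>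

lemma adj_reach: "adj u v \<Longrightarrow> reach k H X V 1 \<eta> u v"
proof -
  assume adj: "adj u v"
  let ?A = "{(cs, vs) \<in> nlists X 1 \<times> nlists V (k * 1 - 1). sw k H {#u#} {#v#} (mset cs) (mset vs)}"
  let ?f = "\<lambda>(x, S). ([x], S)"
  have "wpm k H {#x#} (add_mset w (mset S))" if "(x, S) \<in> Lam w" for x S w
    using that wpm_list[of x "w # S"] k_ge by (auto simp: Lam_def Om_def nlists_def)
  then have "?f ` (Lam u \<inter> Lam v) \<subseteq> ?A"
    by (auto simp: sw_def Lam_def Om_def nlists_def)
  moreover have "finite ?A" by (rule finite_nlists_prod) auto
  ultimately have "card (?f ` (Lam u \<inter> Lam v)) \<le> card ?A" by (intro card_mono)
  moreover have "card (?f ` (Lam u \<inter> Lam v)) = card (Lam u \<inter> Lam v)"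
    by (rule card_image) (auto simp: inj_on_def)
  ultimately have "real (card (Lam u \<inter> Lam v)) \<le> real (card ?A)" by simp
  then show ?thesis using adj unfolding reach_def dens_def adj_def N_def by simp
qed

text \<open>The density obtained in \<open>cross_reach3\<close>, the smallest of the three that
  occur: two factors \<open>\<eta> ^ 2 / 8\<close> and three factors \<open>\<eta>\<close>.\<close>

definition \<beta>\<^sub>0 where "\<beta>\<^sub>0 = \<eta> ^ 7 / 64"

lemma \<beta>0: "0 \<le> \<beta>\<^sub>0" "\<beta>\<^sub>0 \<le> \<eta> / 25" "\<beta>\<^sub>0 \<le> \<eta> ^ 3 / 5"
proof -
  have e: "0 \<le> \<eta>" "\<eta> \<le> 1" using \<eta>_pos \<eta>_le by auto
  show "0 \<le> \<beta>\<^sub>0" using e by (simp add: \<beta>\<^sub>0_def)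
  have "\<eta> ^ 7 \<le> \<eta> ^ 1" "\<eta> ^ 7 \<le> \<eta> ^ 3" using e by (intro power_decreasing; simp)+
  moreover have "0 \<le> \<eta> ^ 3" using e by simp
  ultimately show "\<beta>\<^sub>0 \<le> \<eta> / 25" "\<beta>\<^sub>0 \<le> \<eta> ^ 3 / 5" using e unfolding \<beta>\<^sub>0_def power_one_right by linarith+
qed

lemma adj_reach3: "adj u v \<Longrightarrow> reach k H X V 3 \<beta>\<^sub>0 u v"
proof -
  assume "adj u v"
  then have "reach k H X V (1 + 1 + 1) (\<eta> * (1 / 5) * (1 / 5)) u v"
    using \<eta>_pos by (intro reach_pad adj_reach) auto
  moreover have "(1 + 1 + 1 :: nat) = 3" by simp
  ultimately have "reach k H X V 3 (\<eta> * (1 / 5) * (1 / 5)) u v" by (simp only:)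
  moreover have "\<beta>\<^sub>0 \<le> \<eta> * (1 / 5) * (1 / 5)" using \<beta>0(2) by linarith
  ultimately show ?thesis by (rule reach_mono)
qed

lemma two_step_reach3:
  assumes "\<eta> * n \<le> real (card {w \<in> V. adj u w \<and> adj w v})"
  shows "reach k H X V 3 \<beta>\<^sub>0 u v"
proof -
  have "reach k H X V (1 + 1) (\<eta> * (\<eta> * \<eta>)) u v"
    by (rule reach_concat[OF _ assms]) (use \<eta>_pos adj_reach in auto)
  then have "reach k H X V (1 + 1 + 1) (\<eta> * (\<eta> * \<eta>) * (1 / 5)) u v"
    using \<eta>_pos by (intro reach_pad) auto
  moreover have "(1 + 1 + 1 :: nat) = 3" by simp
  ultimately have "reach k H X V 3 (\<eta> * (\<eta> * \<eta>) * (1 / 5)) u v" by (simp only:)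
  moreover have "\<beta>\<^sub>0 \<le> \<eta> * (\<eta> * \<eta>) * (1 / 5)"
    using \<beta>0(3) by (simp add: power3_eq_cube mult.assoc)
  ultimately show ?thesis by (rule reach_mono)
qed

text \<open>Go from \<open>a\<close> to a vertex \<open>w\<close> of \<open>A\<close> with many
  neighbours in \<open>B\<close>, then to such a neighbour, then to \<open>b\<close>. The many cross
  pairs provide many such \<open>w\<close>.\<close>

lemma cross_reach3:
  assumes AB: "A \<subseteq> V" "B \<subseteq> V"
    and cA: "\<And>a a'. a \<in> A \<Longrightarrow> a' \<in> A \<Longrightarrow> adj a a'" and cB: "\<And>a a'. a \<in> B \<Longrightarrow> a' \<in> B \<Longrightarrow> adj a a'"
    and cross: "\<eta> ^ 2 / 4 * n ^ 2 \<le> real (\<Sum>a\<in>A. card {b \<in> B. adj a b})"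
    and ab: "a \<in> A" "b \<in> B"
  shows "reach k H X V 3 \<beta>\<^sub>0 a b"
proof -
  \<comment> \<open>Half the density of cross pairs: with fewer than \<open>\<zeta> * n\<close> rich
    vertices, the rich and the poor ones would contribute less than \<open>\<zeta> * n ^ 2\<close>
    and at most \<open>\<zeta> * n ^ 2\<close> pairs.\<close>
  define \<zeta> where "\<zeta> = \<eta> ^ 2 / 8"
  define W where "W = {a \<in> A. \<zeta> * n \<le> real (card {b \<in> B. adj a b})}"
  have finA: "finite A" "finite B" using finite_subset[OF AB(1) finV] finite_subset[OF AB(2) finV] by auto
  have cn: "card A \<le> card V" "card B \<le> card V" using AB by (auto intro: card_mono)
  have Wn: "\<zeta> * n \<le> real (card W)"
  proof (rule ccontr)
    assume "\<not> ?thesis"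
    then have less: "real (card W) < \<zeta> * n" by simp
    have "real (\<Sum>a\<in>A. card {b \<in> B. adj a b}) = (\<Sum>a\<in>A. real (card {b \<in> B. adj a b}))" by simp
    also have "\<dots> = (\<Sum>a\<in>W. real (card {b \<in> B. adj a b})) + (\<Sum>a\<in>A - W. real (card {b \<in> B. adj a b}))"
      using finA by (intro sum.subset_diff[THEN trans]) (auto simp: W_def add.commute)
    also have "(\<Sum>a\<in>W. real (card {b \<in> B. adj a b})) \<le> (\<Sum>a\<in>W. n)"
    proof (rule sum_mono)
      fix a have "card {b \<in> B. adj a b} \<le> card B" using finA by (intro card_mono) auto
      then show "real (card {b \<in> B. adj a b}) \<le> n" using cn by simp
    qed
    also have "(\<Sum>a\<in>A - W. real (card {b \<in> B. adj a b})) \<le> (\<Sum>a\<in>A - W. \<zeta> * n)"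
      by (intro sum_mono) (auto simp: W_def)
    also have "\<dots> \<le> n * (\<zeta> * n)"
    proof -
      have "card (A - W) \<le> card A" using finA by (intro card_mono) auto
      then have "real (card (A - W)) \<le> n" using cn by simp
      then have "real (card (A - W)) * (\<zeta> * n) \<le> n * (\<zeta> * n)"
        using \<eta>_pos by (intro mult_right_mono) (auto simp: \<zeta>_def)
      then show ?thesis by simp
    qed
    finally have "real (\<Sum>a\<in>A. card {b \<in> B. adj a b}) \<le> real (card W) * n + n * (\<zeta> * n)" by simp
    also have "real (card W) * n < (\<zeta> * n) * n" using less n_pos by (intro mult_strict_right_mono)
    also have "(\<zeta> * n) * n + n * (\<zeta> * n) = \<eta> ^ 2 / 4 * n ^ 2" by (simp add: \<zeta>_def power2_eq_square)
    finally show False using cross by simp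
  qed
  have "reach k H X V (1 + (1 + 1)) (\<zeta> * (\<eta> * (\<zeta> * (\<eta> * \<eta>)))) a b"
  proof (rule reach_concat[OF _ Wn])
    fix w assume w: "w \<in> W"
    have "reach k H X V (1 + 1) (\<zeta> * (\<eta> * \<eta>)) w b"
      by (rule reach_concat[where W = "{b \<in> B. adj w b}"])
         (use w AB \<eta>_pos adj_reach cB ab in \<open>auto simp: W_def\<close>)
    moreover have "reach k H X V 1 \<eta> a w" using w cA ab by (intro adj_reach) (auto simp: W_def)
    ultimately show "reach k H X V 1 \<eta> a w \<and> reach k H X V (1 + 1) (\<zeta> * (\<eta> * \<eta>)) w b" by blast
  qed (use \<eta>_pos AB in \<open>auto simp: W_def \<zeta>_def\<close>)
  moreover have "\<zeta> * (\<eta> * (\<zeta> * (\<eta> * \<eta>))) = \<beta>\<^sub>0"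
    by (simp add: \<zeta>_def \<beta>\<^sub>0_def power2_eq_square eval_nat_numeral)
  moreover have "(1 + (1 + 1) :: nat) = 3" by simp
  ultimately show ?thesis by (simp only:)
qed

text \<open>Counts the tuples on which replacing \<open>u\<close> by \<open>v\<close> does not act
  as in a parity graph of \<open>A\<close>, where the status flips exactly when \<open>u\<close> and
  \<open>v\<close> lie on different sides.\<close>

definition dis where
  "dis A u v = card {z \<in> Om. ((z \<in> Lam u) \<noteq> (z \<in> Lam v)) \<noteq> ((u \<in> A) \<noteq> (v \<in> A))}"

lemma dis_le: "real (dis A u v) \<le> N"
proof -
  have "dis A u v \<le> card Om" unfolding dis_def by (intro card_mono) auto
  then show ?thesis by (metis card_Om of_nat_mono)
qed

text \<open>Two links of density at least nearly 1/2 with little intersection nearly partition the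
  space.\<close>

lemma card_agree:
  assumes "u \<in> V" "v \<in> V" "\<not> adj u v"
  shows "real (card {z \<in> Om. (z \<in> Lam u) = (z \<in> Lam v)}) \<le> 4 * \<eta> * N"
proof -
  let ?I = "Lam u \<inter> Lam v" and ?U = "Lam u \<union> Lam v"
  have "{z \<in> Om. (z \<in> Lam u) = (z \<in> Lam v)} = ?I \<union> (Om - ?U)" using Lam_sub by blast
  then have "card {z \<in> Om. (z \<in> Lam u) = (z \<in> Lam v)} \<le> card ?I + card (Om - ?U)"
    using card_Un_le[of ?I "Om - ?U"] by simp
  moreover have "card (Om - ?U) + card ?U = card Om"
  proof -
    have U: "?U \<subseteq> Om" using Lam_sub by blast
    then have "card (Om - ?U) = card Om - card ?U" by (intro card_Diff_subset) auto
    moreover have "card ?U \<le> card Om" using U by (intro card_mono) auto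
    ultimately show ?thesis by linarith
  qed
  moreover have "card ?U + card ?I = card (Lam u) + card (Lam v)"
    by (intro card_Un_Int[symmetric]) auto
  ultimately have "card {z \<in> Om. (z \<in> Lam u) = (z \<in> Lam v)} + card (Lam u) + card (Lam v) \<le> card Om + 2 * card ?I"
    by linarith
  then have "real (card {z \<in> Om. (z \<in> Lam u) = (z \<in> Lam v)} + card (Lam u) + card (Lam v)) \<le> real (card Om + 2 * card ?I)"
    by (rule of_nat_mono)
  then have "real (card {z \<in> Om. (z \<in> Lam u) = (z \<in> Lam v)}) + real (card (Lam u)) + real (card (Lam v)) \<le> N + 2 * real (card ?I)"
    by (simp add: card_Om)
  moreover have "real (card ?I) < \<eta> * N" using assms(3) by (simp add: adj_def)
  moreover have "2 * ((1 / 2 - \<eta>) * N) = N - 2 * (\<eta> * N)" by (simp add: algebra_simps)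
  ultimately show ?thesis using card_Lam[OF assms(1)] card_Lam[OF assms(2)] by linarith
qed

lemma dis_cross:
  assumes "u \<in> V" "v \<in> V" "\<not> adj u v" "(u \<in> A) \<noteq> (v \<in> A)"
  shows "real (dis A u v) \<le> 4 * \<eta> * N"
proof -
  have "{z \<in> Om. ((z \<in> Lam u) \<noteq> (z \<in> Lam v)) \<noteq> ((u \<in> A) \<noteq> (v \<in> A))} = {z \<in> Om. (z \<in> Lam u) = (z \<in> Lam v)}"
    using assms(4) by auto
  then show ?thesis using card_agree[OF assms(1-3)] by (simp add: dis_def)
qed

text \<open>Both links are nearly the complement of the link of \<open>w\<close>.\<close>

lemma dis_same:
  assumes "u \<in> V" "v \<in> V" "w \<in> V" "\<not> adj u w" "\<not> adj v w" "(u \<in> A) = (v \<in> A)"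
  shows "real (dis A u v) \<le> 8 * \<eta> * N"
proof -
  let ?P = "{z \<in> Om. (z \<in> Lam u) = (z \<in> Lam w)}" and ?Q = "{z \<in> Om. (z \<in> Lam v) = (z \<in> Lam w)}"
  have "{z \<in> Om. ((z \<in> Lam u) \<noteq> (z \<in> Lam v)) \<noteq> ((u \<in> A) \<noteq> (v \<in> A))} \<subseteq> ?P \<union> ?Q"
    using assms(6) by auto
  then have "dis A u v \<le> card (?P \<union> ?Q)" unfolding dis_def by (intro card_mono) auto
  also have "\<dots> \<le> card ?P + card ?Q" by (rule card_Un_le)
  finally have "real (dis A u v) \<le> real (card ?P) + real (card ?Q)" by linarith
  then show ?thesis using card_agree[OF assms(1,3,4)] card_agree[OF assms(2,3,5)] by linarith
qed

lemma card_Lam_upper: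
  assumes "u \<in> V" "v \<in> V" "\<not> adj u v"
  shows "real (card (Lam u)) \<le> (1 / 2 + 2 * \<eta>) * N"
proof -
  have "card (Lam u \<union> Lam v) \<le> card Om" using Lam_sub by (intro card_mono) auto
  moreover have "card (Lam u) + card (Lam v) = card (Lam u \<union> Lam v) + card (Lam u \<inter> Lam v)"
    by (intro card_Un_Int) auto
  ultimately have "real (card (Lam u) + card (Lam v)) \<le> real (card Om + card (Lam u \<inter> Lam v))"
    by (intro of_nat_mono) linarith
  then have "real (card (Lam u)) + real (card (Lam v)) \<le> N + real (card (Lam u \<inter> Lam v))"
    by (simp add: card_Om)
  then have "real (card (Lam u)) \<le> N + \<eta> * N - (1 / 2 - \<eta>) * N"
    using card_Lam[OF assms(2)] assms(3) unfolding adj_def by linarith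
  then show ?thesis by (simp add: algebra_simps)
qed

text \<open>Vertices in \<open>C\<close> or with many neighbours across are exceptional. Two others
  on the same side share a non-neighbour on the other side, so their links nearly agree;
  non-adjacent vertices on different sides have nearly complementary links. The second bound, by
  which links are hardly larger than one half on average, later yields that the parts are
  balanced.\<close>

lemma two_cliques:
  assumes parts: "A \<union> B \<union> C = V" "A \<inter> B = {}" "A \<inter> C = {}" "B \<inter> C = {}"
    and C: "real (card C) < \<eta> * n" and A: "\<eta> * n \<le> real (card A)" and B: "\<eta> * n \<le> real (card B)"
    and cross: "real (\<Sum>a\<in>A. card {b \<in> B. adj a b}) < \<eta> ^ 2 / 4 * n ^ 2"
  shows "(\<Sum>u\<in>V. \<Sum>v\<in>V. real (dis A u v)) \<le> 13 * \<eta> * n ^ 2 * N"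
    and "(\<Sum>v\<in>V. real (card (Lam v))) \<le> (1 / 2 + 4 * \<eta>) * n * N"
proof -
  have fin: "finite A" "finite B" "finite C" using parts(1) finV by (metis finite_Un)+
  have cross': "(\<Sum>b\<in>B. card {a \<in> A. adj b a}) = (\<Sum>a\<in>A. card {b \<in> B. adj a b})"
  proof -
    have "(\<Sum>a\<in>A. card {b \<in> B. adj a b}) = (\<Sum>a\<in>A. \<Sum>b\<in>B. of_bool (adj a b))" using fin by (simp add: Int_def)
    also have "\<dots> = (\<Sum>b\<in>B. \<Sum>a\<in>A. of_bool (adj a b))" by (rule sum.swap)
    also have "\<dots> = (\<Sum>b\<in>B. card {a \<in> A. adj b a})" using fin by (simp add: Int_def adj_sym)
    finally show ?thesis by simp
  qed
  \<comment> \<open>Each exceptional vertex accounts for at least \<open>\<eta> * n / 2\<close> of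
    the few cross pairs.\<close>
  have few: "real (card {a \<in> D. real (card E) / 2 \<le> real (card {b \<in> E. adj a b})}) \<le> \<eta> / 2 * n"
    if D: "finite D" and cr: "real (\<Sum>a\<in>D. card {b \<in> E. adj a b}) < \<eta> ^ 2 / 4 * n ^ 2" and E: "\<eta> * n \<le> real (card E)" for D E
  proof -
    let ?M = "{a \<in> D. real (card E) / 2 \<le> real (card {b \<in> E. adj a b})}"
    have "real (card ?M) * (\<eta> * n / 2) \<le> real (card ?M) * (real (card E) / 2)" using E by (intro mult_left_mono) auto
    also have "\<dots> = (\<Sum>a\<in>?M. real (card E) / 2)" by simp
    also have "\<dots> \<le> (\<Sum>a\<in>?M. real (card {b \<in> E. adj a b}))" by (intro sum_mono) auto
    also have "\<dots> \<le> (\<Sum>a\<in>D. real (card {b \<in> E. adj a b}))" using D by (intro sum_mono2) auto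
    also have "\<dots> < \<eta> ^ 2 / 4 * n ^ 2" using cr by simp
    also have "\<eta> ^ 2 / 4 * n ^ 2 = (\<eta> / 2 * n) * (\<eta> * n / 2)" by (simp add: power2_eq_square)
    finally show ?thesis using \<eta>_pos n_pos by (simp add: mult_less_cancel_right)
  qed
  define EA where "EA = {a \<in> A. real (card B) / 2 \<le> real (card {b \<in> B. adj a b})}"
  define EB where "EB = {b \<in> B. real (card A) / 2 \<le> real (card {a \<in> A. adj b a})}"
  define E where "E = C \<union> EA \<union> EB"
  have EV: "E \<subseteq> V" using parts by (auto simp: E_def EA_def EB_def)
  have cE: "real (card E) \<le> 2 * \<eta> * n"
  proof -
    have "card E \<le> card C + card EA + card EB"
      unfolding E_def using card_Un_le[of "C \<union> EA" EB] card_Un_le[of C EA] by linarith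
    then have "real (card E) \<le> real (card C) + real (card EA) + real (card EB)" by linarith
    moreover have "real (card EA) \<le> \<eta> / 2 * n" unfolding EA_def by (rule few) (use fin cross B in auto)
    moreover have "real (card EB) \<le> \<eta> / 2 * n" unfolding EB_def by (rule few) (use fin cross cross' A in auto)
    ultimately show ?thesis using C by linarith
  qed
  have common: "\<exists>w\<in>G. \<not> adj u w \<and> \<not> adj v w"
    if "finite G" "\<not> real (card G) / 2 \<le> real (card {b \<in> G. adj u b})" "\<not> real (card G) / 2 \<le> real (card {b \<in> G. adj v b})" for G u v
  proof (rule ccontr)
    assume "\<not> ?thesis"
    then have "G \<subseteq> {b \<in> G. adj u b} \<union> {b \<in> G. adj v b}" by blast
    then have "card G \<le> card ({b \<in> G. adj u b} \<union> {b \<in> G. adj v b})" using that by (intro card_mono) auto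
    also have "\<dots> \<le> card {b \<in> G. adj u b} + card {b \<in> G. adj v b}" by (rule card_Un_le)
    finally show False using that by linarith
  qed
  define cr where "cr u v \<longleftrightarrow> adj u v \<and> (u \<in> A \<and> v \<in> B \<or> u \<in> B \<and> v \<in> A)" for u v
  have dis_uv: "real (dis A u v) \<le> (of_bool (u \<in> E) + of_bool (v \<in> E) + of_bool (cr u v) + 8 * \<eta>) * N"
    if uv: "u \<in> V" "v \<in> V" for u v
  proof -
    consider "u \<in> E \<or> v \<in> E \<or> cr u v" | "u \<notin> E" "v \<notin> E" "\<not> cr u v" by blast
    then show ?thesis
    proof cases
      case 1
      have "1 * N \<le> (of_bool (u \<in> E) + of_bool (v \<in> E) + of_bool (cr u v) + 8 * \<eta>) * N"
        using 1 \<eta>_pos N_pos by (intro mult_right_mono) (auto simp: of_bool_def)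
      then show ?thesis using dis_le[of A u v] by linarith
    next
      case 2
      then have AB: "u \<in> A \<or> u \<in> B" "v \<in> A \<or> v \<in> B" using uv parts by (auto simp: E_def)
      have nE: "u \<in> A \<Longrightarrow> u \<notin> EA" "v \<in> A \<Longrightarrow> v \<notin> EA" "u \<in> B \<Longrightarrow> u \<notin> EB" "v \<in> B \<Longrightarrow> v \<notin> EB"
        using 2 by (auto simp: E_def)
      have "real (dis A u v) \<le> 8 * \<eta> * N"
      proof (cases "(u \<in> A) = (v \<in> A)")
        case True
        have "\<exists>w\<in>V. \<not> adj u w \<and> \<not> adj v w"
        proof (cases "u \<in> A")
          case uA: True
          then have "\<exists>w\<in>B. \<not> adj u w \<and> \<not> adj v w"
            using True nE fin by (intro common) (auto simp: EA_def)
          then show ?thesis using parts by blast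
        next
          case False
          then have "u \<in> B" "v \<in> B" using AB True by auto
          then have "\<exists>w\<in>A. \<not> adj u w \<and> \<not> adj v w"
            using nE fin by (intro common) (auto simp: EB_def)
          then show ?thesis using parts by blast
        qed
        then show ?thesis using dis_same[OF uv _ _ _ True] by blast
      next
        case False
        then have "\<not> adj u v" using 2(3) AB by (auto simp: cr_def)
        then have "real (dis A u v) \<le> 4 * \<eta> * N" using dis_cross[OF uv _ False] by blast
        also have "\<dots> \<le> 8 * \<eta> * N" using \<eta>_pos N_pos by (intro mult_right_mono) auto
        finally show ?thesis .
      qed
      then show ?thesis using 2 by simp
    qed
  qed
  have sumcr: "(\<Sum>u\<in>V. \<Sum>v\<in>V. of_bool (cr u v)) \<le> (\<eta> ^ 2 / 2 * n ^ 2 :: real)"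
  proof -
    have "(\<Sum>u\<in>V. \<Sum>v\<in>V. of_bool (cr u v)) = (\<Sum>u\<in>V. (of_bool (u \<in> A) * real (card {b \<in> B. adj u b}) + of_bool (u \<in> B) * real (card {a \<in> A. adj u a})))"
    proof (intro sum.cong refl)
      fix u assume "u \<in> V"
      have "(\<Sum>v\<in>V. of_bool (cr u v)) = real (card {v \<in> V. cr u v})" by (simp add: Int_def)
      also have "{v \<in> V. cr u v} = (if u \<in> A then {b \<in> B. adj u b} else if u \<in> B then {a \<in> A. adj u a} else {})"
        using parts by (auto simp: cr_def)
      finally show "(\<Sum>v\<in>V. of_bool (cr u v)) = of_bool (u \<in> A) * real (card {b \<in> B. adj u b}) + of_bool (u \<in> B) * real (card {a \<in> A. adj u a})"
        using parts by (auto split: if_splits)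
    qed
    also have "\<dots> = (\<Sum>u\<in>V. of_bool (u \<in> A) * real (card {b \<in> B. adj u b})) + (\<Sum>u\<in>V. of_bool (u \<in> B) * real (card {a \<in> A. adj u a}))"
      by (rule sum.distrib)
    also have "(\<Sum>u\<in>V. of_bool (u \<in> A) * real (card {b \<in> B. adj u b})) = (\<Sum>u\<in>A. real (card {b \<in> B. adj u b}))"
      using parts(1) by (intro sum.mono_neutral_cong_right) auto
    also have "(\<Sum>u\<in>V. of_bool (u \<in> B) * real (card {a \<in> A. adj u a})) = (\<Sum>u\<in>B. real (card {a \<in> A. adj u a}))"
      using parts(1) by (intro sum.mono_neutral_cong_right) auto
    also have "(\<Sum>u\<in>A. real (card {b \<in> B. adj u b})) + (\<Sum>u\<in>B. real (card {a \<in> A. adj u a})) = 2 * real (\<Sum>a\<in>A. card {b \<in> B. adj a b})"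
      using cross' by (simp flip: of_nat_sum)
    finally show ?thesis using cross by linarith
  qed
  have sumE: "(\<Sum>v\<in>V. of_bool (v \<in> E)) = real (card E)"
    using EV by (simp add: Int_absorb1)
  have "(\<Sum>u\<in>V. \<Sum>v\<in>V. real (dis A u v)) \<le> (\<Sum>u\<in>V. \<Sum>v\<in>V. (of_bool (u \<in> E) + of_bool (v \<in> E) + of_bool (cr u v) + 8 * \<eta>) * N)"
    using dis_uv by (intro sum_mono) auto
  also have "\<dots> = ((\<Sum>u\<in>V. \<Sum>v\<in>V. of_bool (u \<in> E)) + (\<Sum>u\<in>V. \<Sum>v\<in>V. of_bool (v \<in> E)) + (\<Sum>u\<in>V. \<Sum>v\<in>V. of_bool (cr u v)) + (\<Sum>u\<in>V. \<Sum>v\<in>V. 8 * \<eta>)) * N"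
    by (simp only: sum_distrib_right[symmetric] sum.distrib)
  also have "\<dots> = (n * real (card E) + n * real (card E) + (\<Sum>u\<in>V. \<Sum>v\<in>V. of_bool (cr u v)) + n * n * (8 * \<eta>)) * N"
  proof -
    have "(\<Sum>u\<in>V. \<Sum>v\<in>V. of_bool (u \<in> E)) = n * real (card E)"
      by (simp only: sum_constant sum_distrib_left[symmetric] sumE)
    moreover have "(\<Sum>u\<in>V. \<Sum>v\<in>V. of_bool (v \<in> E)) = n * real (card E)"
      by (simp only: sum_constant sumE)
    ultimately show ?thesis by simp
  qed
  \<comment> \<open>In units of \<open>\<eta>\<close>: 2 + 2 for pairs whose first or second vertex
    is exceptional, at most 1 for adjacent pairs across, 8 for all pairs.\<close>
  also have "\<dots> \<le> (13 * \<eta> * n ^ 2) * N"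
  proof (rule mult_right_mono)
    have "n * real (card E) \<le> n * (2 * \<eta> * n)" using cE by (intro mult_left_mono) auto
    moreover have "\<eta> ^ 2 / 2 * n ^ 2 \<le> \<eta> * n ^ 2"
    proof (rule mult_right_mono)
      have "\<eta> * \<eta> \<le> 1 * \<eta>" using \<eta>_pos \<eta>_le by (intro mult_right_mono) auto
      then show "\<eta> ^ 2 / 2 \<le> \<eta>" using \<eta>_pos by (simp add: power2_eq_square)
    qed simp
    moreover have "n * (2 * \<eta> * n) = 2 * (\<eta> * n ^ 2)" "n * n * (8 * \<eta>) = 8 * (\<eta> * n ^ 2)" "13 * \<eta> * n ^ 2 = 13 * (\<eta> * n ^ 2)"
      by (simp_all add: power2_eq_square)
    ultimately show "n * real (card E) + n * real (card E) + (\<Sum>u\<in>V. \<Sum>v\<in>V. of_bool (cr u v)) + n * n * (8 * \<eta>) \<le> 13 * \<eta> * n ^ 2"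
      using sumcr by linarith
  qed (use N_pos in simp)
  finally show "(\<Sum>u\<in>V. \<Sum>v\<in>V. real (dis A u v)) \<le> 13 * \<eta> * n ^ 2 * N" .
  have Lam_le: "real (card (Lam v)) \<le> (of_bool (v \<in> E) + (1 / 2 + 2 * \<eta>)) * N" if v: "v \<in> V" for v
  proof (cases "v \<in> E")
    case True
    have "card (Lam v) \<le> card Om" using Lam_sub by (intro card_mono) auto
    then have "real (card (Lam v)) \<le> N" by (metis card_Om of_nat_mono)
    moreover have "1 * N \<le> (of_bool (v \<in> E) + (1 / 2 + 2 * \<eta>)) * N"
      using True \<eta>_pos N_pos by (intro mult_right_mono) auto
    ultimately show ?thesis by linarith
  next
    case False
    then have "v \<in> A \<and> v \<notin> EA \<or> v \<in> B \<and> v \<notin> EB" using v parts by (auto simp: E_def)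
    then have "\<exists>w\<in>V. \<not> adj v w \<and> \<not> adj v w"
      using common[of B v v] common[of A v v] fin parts(1) by (auto simp: EA_def EB_def)
    then show ?thesis using card_Lam_upper[OF v] False by auto
  qed
  have "(\<Sum>v\<in>V. real (card (Lam v))) \<le> (\<Sum>v\<in>V. (of_bool (v \<in> E) + (1 / 2 + 2 * \<eta>)) * N)"
    using Lam_le by (intro sum_mono) auto
  also have "\<dots> = (real (card E) + n * (1 / 2 + 2 * \<eta>)) * N"
    by (simp only: sum_distrib_right[symmetric] sum.distrib sumE sum_constant) (simp add: algebra_simps)
  also have "\<dots> \<le> ((1 / 2 + 4 * \<eta>) * n) * N"
    using cE N_pos by (intro mult_right_mono) (auto simp: algebra_simps)
  finally show "(\<Sum>v\<in>V. real (card (Lam v))) \<le> (1 / 2 + 4 * \<eta>) * n * N" .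
qed

text \<open>Fix a non-adjacent pair with few common neighbours. By \<open>adj_three\<close> the
  non-neighbours of either vertex form a clique, and the two cliques cover all but few vertices. If
  one of them is small or there are many cross pairs, nearly all vertices are mutually reachable,
  and \<open>reach_all\<close> extends this to \<open>V\<close>; otherwise the cliques are the two
  parts.\<close>

lemma reach_or_two_cliques:
  "(\<forall>u\<in>V. \<forall>v\<in>V. reach k H X V (2 * (1 + k * 3)) (1 / 2 * (1 / 20 * \<beta>\<^sub>0 ^ k) ^ 2) u v) \<or>
   (\<exists>A\<subseteq>V. (\<Sum>u\<in>V. \<Sum>v\<in>V. real (dis A u v)) \<le> 13 * \<eta> * n ^ 2 * N \<and>
      (\<Sum>v\<in>V. real (card (Lam v))) \<le> (1 / 2 + 4 * \<eta>) * n * N)"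
proof -
  have closed: ?thesis if D: "D \<subseteq> V" "real (card (V - D)) \<le> 2 * \<eta> * n" and R: "\<And>u v. u \<in> D \<Longrightarrow> v \<in> D \<Longrightarrow> reach k H X V 3 \<beta>\<^sub>0 u v" for D
  proof -
    have "10 * real k * real (card (V - D)) \<le> 10 * real k * (2 * \<eta> * n)" using D by (intro mult_left_mono) auto
    also have "\<dots> = (20 * real k * \<eta>) * n" by simp
    also have "\<dots> \<le> 1 * n" using \<eta>_small by (intro mult_right_mono) auto
    finally have "10 * real k * real (card (V - D)) \<le> n" by simp
    then show ?thesis using reach_all[OF D(1) _ R \<beta>0(1)] by auto
  qed
  show ?thesis
  proof (cases "\<forall>u\<in>V. \<forall>v\<in>V. adj u v \<or> \<eta> * n \<le> real (card {w \<in> V. adj u w \<and> adj w v})")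
    case True
    then have "reach k H X V 3 \<beta>\<^sub>0 u v" if "u \<in> V" "v \<in> V" for u v
      using that adj_reach3 two_step_reach3 by blast
    then show ?thesis using \<eta>_pos by (intro closed[of V]) auto
  next
    case False
    then obtain u v where uv: "u \<in> V" "v \<in> V" "\<not> adj u v" "real (card {w \<in> V. adj u w \<and> adj w v}) < \<eta> * n" by force
    define A where "A = {w \<in> V. adj u w \<and> \<not> adj v w}"
    define B where "B = {w \<in> V. adj v w \<and> \<not> adj u w}"
    define C where "C = {w \<in> V. adj u w \<and> adj w v}"
    have parts: "A \<union> B \<union> C = V" "A \<inter> B = {}" "A \<inter> C = {}" "B \<inter> C = {}"
      using adj_three[OF uv(1,2)] uv(3) by (auto simp: A_def B_def C_def adj_sym)
    have fin: "finite A" "finite B" "finite C" using parts(1) finV by (metis finite_Un)+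
    have cA: "adj a a'" if "a \<in> A" "a' \<in> A" for a a'
      using adj_three[OF uv(2), of a a'] that by (auto simp: A_def)
    have cB: "adj a a'" if "a \<in> B" "a' \<in> B" for a a'
      using adj_three[OF uv(1), of a a'] that by (auto simp: B_def)
    have cC: "real (card C) < \<eta> * n" using uv(4) by (simp add: C_def)
    consider "real (card A) < \<eta> * n" | "real (card B) < \<eta> * n" | "\<eta> * n \<le> real (card A)" "\<eta> * n \<le> real (card B)"
      by linarith
    then show ?thesis
    proof cases
      case 1
      have "V - B = A \<union> C" using parts by blast
      then have "card (V - B) \<le> card A + card C" using card_Un_le[of A C] by simp
      then have small: "real (card (V - B)) \<le> 2 * \<eta> * n" using 1 cC by linarith
      show ?thesis
      proof (rule closed[OF _ small])
        show "B \<subseteq> V" by (auto simp: B_def)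
        show "reach k H X V 3 \<beta>\<^sub>0 a a'" if "a \<in> B" "a' \<in> B" for a a'
          using that by (intro adj_reach3 cB)
      qed
    next
      case 2
      have "V - A = B \<union> C" using parts by blast
      then have "card (V - A) \<le> card B + card C" using card_Un_le[of B C] by simp
      then have small: "real (card (V - A)) \<le> 2 * \<eta> * n" using 2 cC by linarith
      show ?thesis
      proof (rule closed[OF _ small])
        show "A \<subseteq> V" by (auto simp: A_def)
        show "reach k H X V 3 \<beta>\<^sub>0 a a'" if "a \<in> A" "a' \<in> A" for a a'
          using that by (intro adj_reach3 cA)
      qed
    next
      case 3
      have AV: "A \<subseteq> V" "B \<subseteq> V" using parts by auto
      show ?thesis
      proof (cases "\<eta> ^ 2 / 4 * n ^ 2 \<le> real (\<Sum>a\<in>A. card {b \<in> B. adj a b})")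
        case True
        have VC: "V - (A \<union> B) = C" using parts by blast
        have "0 \<le> \<eta> * n" using \<eta>_pos n_pos by simp
        then have "real (card (V - (A \<union> B))) \<le> 2 * \<eta> * n"
          using cC unfolding VC by linarith
        moreover have "reach k H X V 3 \<beta>\<^sub>0 a b" if ab: "a \<in> A \<union> B" "b \<in> A \<union> B" for a b
        proof -
          note cr = cross_reach3[OF AV cA cB True]
          consider "a \<in> A" "b \<in> A" | "a \<in> B" "b \<in> B" | "a \<in> A" "b \<in> B" | "a \<in> B" "b \<in> A"
            using ab by blast
          then show ?thesis
          proof cases
            case 1 then show ?thesis by (intro adj_reach3 cA)
          next
            case 2 then show ?thesis by (intro adj_reach3 cB)
          next
            case 3 then show ?thesis by (intro cr)
          next
            case 4 then show ?thesis by (subst reach_sym) (intro cr)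
          qed
        qed
        ultimately show ?thesis using AV by (intro closed[of "A \<union> B"]) auto
      next
        case False
        then have "real (\<Sum>a\<in>A. card {b \<in> B. adj a b}) < \<eta> ^ 2 / 4 * n ^ 2" by linarith
        from two_cliques[OF parts cC 3 this] show ?thesis using AV(1) by blast
      qed
    qed
  qed
qed

section \<open>From agreement of links to parity graphs\<close>

definition edge where "edge x e \<longleftrightarrow> set e \<in> H x"

lemma dis_sum:
  "real (dis A u v) = (\<Sum>x\<in>X. \<Sum>R\<in>nlists V (k - 1). of_bool ((edge x (u # R) \<noteq> edge x (v # R)) \<noteq> ((u \<in> A) \<noteq> (v \<in> A))))"
proof -
  have "real (dis A u v) = (\<Sum>z\<in>Om. of_bool (((z \<in> Lam u) \<noteq> (z \<in> Lam v)) \<noteq> ((u \<in> A) \<noteq> (v \<in> A))))"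
    by (simp add: dis_def Int_def)
  also have "\<dots> = (\<Sum>z\<in>Om. of_bool ((edge (fst z) (u # snd z) \<noteq> edge (fst z) (v # snd z)) \<noteq> ((u \<in> A) \<noteq> (v \<in> A))))"
    by (intro sum.cong refl arg_cong[where f = of_bool]) (auto simp: Lam_def edge_def)
  finally show ?thesis by (simp only: Om_def sum.cartesian_product case_prod_unfold)
qed

text \<open>Fixing the coordinates one by one at a value for which the error is at most average.\<close>

lemma parity_structure_step:
  assumes sum: "(\<Sum>u\<in>V. \<Sum>v\<in>V. real (dis A u v)) \<le> \<epsilon> * n ^ 2 * N"
  shows "j \<le> k \<Longrightarrow> \<exists>c. (\<Sum>x\<in>X. \<Sum>a\<in>nlists V j. \<Sum>S\<in>nlists V (k - j). of_bool (edge x (a @ S) \<noteq> (npar A a \<noteq> c x S))) \<le> real j * \<epsilon> * n * N"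
proof (induction j)
  case 0
  show ?case by (intro exI[of _ edge]) simp
next
  case (Suc j)
  then obtain c where c: "(\<Sum>x\<in>X. \<Sum>a\<in>nlists V j. \<Sum>S\<in>nlists V (k - j). of_bool (edge x (a @ S) \<noteq> (npar A a \<noteq> c x S))) \<le> real j * \<epsilon> * n * N"
    by auto
  let ?i = "k - Suc j"
  have ki: "k - j = Suc ?i" "k - 1 = j + ?i" using Suc.prems by auto
  \<comment> \<open>Replacing the next entry \<open>v\<close> by the fixed vertex \<open>w\<close>
    changes the status as predicted, except on tuples counted by \<open>dis\<close>; so
    \<open>c'\<close> depends on one entry less than \<open>c\<close>.\<close>
  define c' where "c' w x S = ((w \<in> A) \<noteq> c x (w # S))" for w x S
  define bad where "bad w = (\<Sum>x\<in>X. \<Sum>a\<in>nlists V (Suc j). \<Sum>S\<in>nlists V ?i. of_bool (edge x (a @ S) \<noteq> (npar A a \<noteq> c' w x S)) :: real)" for w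
  define bj where "bj w = (\<Sum>x\<in>X. \<Sum>a\<in>nlists V j. \<Sum>S\<in>nlists V ?i. of_bool (edge x (a @ w # S) \<noteq> (npar A a \<noteq> c x (w # S))) :: real)" for w
  have edge_mid: "edge x (a @ w # S) = edge x (w # (a @ S))" for x a w S by (simp add: edge_def)
  have bad_le: "bad w \<le> (\<Sum>v\<in>V. real (dis A v w)) + n * bj w" if "w \<in> V" for w
  proof -
    have "bad w = (\<Sum>x\<in>X. \<Sum>a\<in>nlists V j. \<Sum>v\<in>V. \<Sum>S\<in>nlists V ?i. of_bool (edge x (a @ v # S) \<noteq> (npar A (a @ [v]) \<noteq> c' w x S)))"
      unfolding bad_def sum_nlists_snoc append_assoc append_Cons append_Nil ..
    also have "\<dots> \<le> (\<Sum>x\<in>X. \<Sum>a\<in>nlists V j. \<Sum>v\<in>V. \<Sum>S\<in>nlists V ?i.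
         of_bool ((edge x (v # (a @ S)) \<noteq> edge x (w # (a @ S))) \<noteq> ((v \<in> A) \<noteq> (w \<in> A))) +
         of_bool (edge x (a @ w # S) \<noteq> (npar A a \<noteq> c x (w # S))))"
      by (intro sum_mono) (auto simp: c'_def edge_mid)
    also have "\<dots> = (\<Sum>x\<in>X. \<Sum>a\<in>nlists V j. \<Sum>v\<in>V. \<Sum>S\<in>nlists V ?i.
         of_bool ((edge x (v # (a @ S)) \<noteq> edge x (w # (a @ S))) \<noteq> ((v \<in> A) \<noteq> (w \<in> A)))) +
        (\<Sum>x\<in>X. \<Sum>a\<in>nlists V j. \<Sum>v\<in>V. \<Sum>S\<in>nlists V ?i. of_bool (edge x (a @ w # S) \<noteq> (npar A a \<noteq> c x (w # S))))"
      by (simp only: sum.distrib)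
    also have "(\<Sum>x\<in>X. \<Sum>a\<in>nlists V j. \<Sum>v\<in>V. \<Sum>S\<in>nlists V ?i.
         of_bool ((edge x (v # (a @ S)) \<noteq> edge x (w # (a @ S))) \<noteq> ((v \<in> A) \<noteq> (w \<in> A)))) =
       (\<Sum>x\<in>X. \<Sum>v\<in>V. \<Sum>a\<in>nlists V j. \<Sum>S\<in>nlists V ?i.
         of_bool ((edge x (v # (a @ S)) \<noteq> edge x (w # (a @ S))) \<noteq> ((v \<in> A) \<noteq> (w \<in> A))))"
      by (intro sum.cong refl sum.swap)
    also have "\<dots> = (\<Sum>v\<in>V. \<Sum>x\<in>X. \<Sum>a\<in>nlists V j. \<Sum>S\<in>nlists V ?i.
         of_bool ((edge x (v # (a @ S)) \<noteq> edge x (w # (a @ S))) \<noteq> ((v \<in> A) \<noteq> (w \<in> A))))"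
      by (rule sum.swap)
    also have "\<dots> = (\<Sum>v\<in>V. real (dis A v w))"
      unfolding dis_sum ki(2) sum_nlists_append ..
    also have "(\<Sum>x\<in>X. \<Sum>a\<in>nlists V j. \<Sum>v\<in>V. \<Sum>S\<in>nlists V ?i. of_bool (edge x (a @ w # S) \<noteq> (npar A a \<noteq> c x (w # S)))) = n * bj w"
      by (simp add: bj_def sum_distrib_left)
    finally show ?thesis .
  qed
  have "(\<Sum>w\<in>V. bj w) = (\<Sum>x\<in>X. \<Sum>a\<in>nlists V j. \<Sum>S\<in>nlists V (k - j). of_bool (edge x (a @ S) \<noteq> (npar A a \<noteq> c x S)))"
  proof -
    have "(\<Sum>w\<in>V. bj w) = (\<Sum>x\<in>X. \<Sum>w\<in>V. \<Sum>a\<in>nlists V j. \<Sum>S\<in>nlists V ?i. of_bool (edge x (a @ w # S) \<noteq> (npar A a \<noteq> c x (w # S))))"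
      unfolding bj_def by (rule sum.swap)
    also have "\<dots> = (\<Sum>x\<in>X. \<Sum>a\<in>nlists V j. \<Sum>w\<in>V. \<Sum>S\<in>nlists V ?i. of_bool (edge x (a @ w # S) \<noteq> (npar A a \<noteq> c x (w # S))))"
      by (intro sum.cong refl sum.swap)
    finally show ?thesis unfolding ki(1) sum_nlists_Suc .
  qed
  then have sbj: "(\<Sum>w\<in>V. bj w) \<le> real j * \<epsilon> * n * N" using c by simp
  have "(\<Sum>w\<in>V. bad w) \<le> (\<Sum>w\<in>V. (\<Sum>v\<in>V. real (dis A v w)) + n * bj w)"
    using bad_le by (intro sum_mono) auto
  also have "\<dots> = (\<Sum>w\<in>V. \<Sum>v\<in>V. real (dis A v w)) + n * (\<Sum>w\<in>V. bj w)"
    by (simp add: sum.distrib sum_distrib_left)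
  also have "(\<Sum>w\<in>V. \<Sum>v\<in>V. real (dis A v w)) = (\<Sum>v\<in>V. \<Sum>w\<in>V. real (dis A v w))" by (rule sum.swap)
  also have "\<dots> \<le> \<epsilon> * n ^ 2 * N" by (rule sum)
  also have "n * (\<Sum>w\<in>V. bj w) \<le> n * (real j * \<epsilon> * n * N)" using sbj by (intro mult_left_mono) auto
  finally have "(\<Sum>w\<in>V. bad w) \<le> n * (real (Suc j) * \<epsilon> * n * N)"
    by (simp add: power2_eq_square algebra_simps)
  then have le: "(\<Sum>w\<in>V. bad w) \<le> (\<Sum>w\<in>V. real (Suc j) * \<epsilon> * n * N)" by simp
  have "\<exists>w\<in>V. bad w \<le> real (Suc j) * \<epsilon> * n * N"
  proof (rule ccontr)
    assume "\<not> ?thesis"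
    then have "(\<Sum>w\<in>V. real (Suc j) * \<epsilon> * n * N) < (\<Sum>w\<in>V. bad w)"
      using V_ne by (intro sum_strict_mono) auto
    then show False using le by linarith
  qed
  then obtain w where "bad w \<le> real (Suc j) * \<epsilon> * n * N" by blast
  then show ?case unfolding bad_def by (intro exI[of _ "c' w"])
qed

text \<open>For the balance of \<open>A\<close>, one colour with small error and few surplus edges
  is picked by averaging. Its number of edges is close both to half of all tuples and to the size of
  a parity class, so \<open>card_npar\<close> bounds the imbalance.\<close>

lemma reach_or_parity:
  "(\<forall>u\<in>V. \<forall>v\<in>V. reach k H X V (2 * (1 + k * 3)) (1 / 2 * (1 / 20 * \<beta>\<^sub>0 ^ k) ^ 2) u v) \<or>
   (\<exists>A\<subseteq>V. \<exists>t. (\<Sum>x\<in>X. real (card {e \<in> nlists V k. (set e \<in> H x) \<noteq> (npar A e = t x)})) \<le> 13 * real k * \<eta> * m * n ^ k \<and>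
      \<bar>real (card (V - A)) - real (card A)\<bar> ^ k \<le> 72 * real k * \<eta> * n ^ k)"
proof (rule disjE[OF reach_or_two_cliques], blast, rule disjI2)
  assume "\<exists>A\<subseteq>V. (\<Sum>u\<in>V. \<Sum>v\<in>V. real (dis A u v)) \<le> 13 * \<eta> * n ^ 2 * N \<and>
      (\<Sum>v\<in>V. real (card (Lam v))) \<le> (1 / 2 + 4 * \<eta>) * n * N"
  then obtain A where A: "A \<subseteq> V" "(\<Sum>u\<in>V. \<Sum>v\<in>V. real (dis A u v)) \<le> 13 * \<eta> * n ^ 2 * N"
    and L: "(\<Sum>v\<in>V. real (card (Lam v))) \<le> (1 / 2 + 4 * \<eta>) * n * N" by blast
  have "k = Suc (k - 1)" using k_ge by simp
  then have nk: "n ^ k = n * n ^ (k - 1)" by (metis power_Suc)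
  have nN: "n * N = m * n ^ k" by (simp add: N_def nk)
  obtain c where c: "(\<Sum>x\<in>X. \<Sum>a\<in>nlists V k. \<Sum>S\<in>nlists V (k - k). of_bool (edge x (a @ S) \<noteq> (npar A a \<noteq> c x S))) \<le> real k * (13 * \<eta>) * n * N"
    using parity_structure_step[OF A(2), of k] by auto
  define t where "t x = (\<not> c x [])" for x
  define err where "err x = real (card {e \<in> nlists V k. (set e \<in> H x) \<noteq> (npar A e = t x)})" for x
  define F where "F x = real (card {e \<in> nlists V k. set e \<in> H x})" for x
  have "(\<Sum>x\<in>X. err x) = (\<Sum>x\<in>X. \<Sum>a\<in>nlists V k. of_bool (edge x a \<noteq> (npar A a \<noteq> c x [])))"
    by (intro sum.cong refl) (auto simp: err_def Int_def edge_def t_def intro!: arg_cong[where f = card])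
  also have "\<dots> = (\<Sum>x\<in>X. \<Sum>a\<in>nlists V k. \<Sum>S\<in>nlists V (k - k). of_bool (edge x (a @ S) \<noteq> (npar A a \<noteq> c x S)))"
    by (simp del: sum_of_bool_eq)
  also have "\<dots> \<le> real k * (13 * \<eta>) * n * N" by (rule c)
  also have "\<dots> = 13 * real k * \<eta> * (n * N)" by simp
  finally have err: "(\<Sum>x\<in>X. err x) \<le> 13 * real k * \<eta> * (m * n ^ k)" unfolding nN .
  have Fv: "F x = (\<Sum>v\<in>V. real (card {S \<in> nlists V (k - 1). insert v (set S) \<in> H x}))" for x
  proof -
    have "Suc (k - 1) = k" using k_ge by simp
    then show ?thesis using card_nlists_Suc_filter[OF finV, of "k - 1" "\<lambda>e. set e \<in> H x"] by (simp add: F_def)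
  qed
  have Flow: "(1 / 2 - \<eta>) * n ^ k \<le> F x" if "x \<in> X" for x
  proof -
    have "(1 / 2 - \<eta>) * n ^ k = (\<Sum>v\<in>V. (1 / 2 - \<eta>) * n ^ (k - 1))" by (simp add: nk)
    also have "\<dots> \<le> F x" unfolding Fv using deg_half that by (intro sum_mono) auto
    finally show ?thesis .
  qed
  have "(\<Sum>x\<in>X. F x) = (\<Sum>v\<in>V. real (card (Lam v)))"
    unfolding Fv card_Lam_sum of_nat_sum by (rule sum.swap)
  then have sF: "(\<Sum>x\<in>X. F x) \<le> (1 / 2 + 4 * \<eta>) * (m * n ^ k)" using L nN by (simp add: mult.assoc)
  \<comment> \<open>\<open>5 * \<eta>\<close> from the surplus of edges and
    \<open>13 * k * \<eta>\<close> from the errors. Both quantities are non-negative, so a bound on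
    their sum for one colour controls each of them.\<close>
  define K where "K = 18 * real k * \<eta>"
  have "\<exists>x\<in>X. (F x - (1 / 2 - \<eta>) * n ^ k) + err x \<le> K * n ^ k"
  proof (rule ccontr)
    assume neg: "\<not> ?thesis"
    have "X \<noteq> {}" using m_pos by auto
    then have "(\<Sum>x\<in>X. K * n ^ k) < (\<Sum>x\<in>X. (F x - (1 / 2 - \<eta>) * n ^ k) + err x)"
      using neg by (intro sum_strict_mono) (auto simp: not_le)
    also have "\<dots> = (\<Sum>x\<in>X. F x) - (1 / 2 - \<eta>) * (m * n ^ k) + (\<Sum>x\<in>X. err x)"
      by (simp add: sum.distrib sum_subtractf)
    also have "\<dots> \<le> (1 / 2 + 4 * \<eta>) * (m * n ^ k) - (1 / 2 - \<eta>) * (m * n ^ k) + 13 * real k * \<eta> * (m * n ^ k)"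
      using sF err by linarith
    also have "\<dots> = (5 * \<eta> + 13 * real k * \<eta>) * (m * n ^ k)" by (simp add: algebra_simps)
    also have "\<dots> \<le> K * (m * n ^ k)"
    proof (rule mult_right_mono)
      have "1 * \<eta> \<le> real k * \<eta>" using k_ge \<eta>_pos by (intro mult_right_mono) auto
      then show "5 * \<eta> + 13 * real k * \<eta> \<le> K" unfolding K_def by linarith
    qed simp
    finally show False by simp
  qed
  then obtain x where x: "x \<in> X" "(F x - (1 / 2 - \<eta>) * n ^ k) + err x \<le> K * n ^ k" by blast
  define p where "p = real (card {e \<in> nlists V k. npar A e \<longleftrightarrow> t x})"
  let ?F = "{e \<in> nlists V k. set e \<in> H x}" and ?p = "{e \<in> nlists V k. npar A e \<longleftrightarrow> t x}" and ?E = "{e \<in> nlists V k. (set e \<in> H x) \<noteq> (npar A e = t x)}"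
  have "card ?F \<le> card (?p \<union> ?E)" "card ?p \<le> card (?F \<union> ?E)" by (intro card_mono; auto)+
  then have "card ?F \<le> card ?p + card ?E" "card ?p \<le> card ?F + card ?E"
    using card_Un_le[of ?p ?E] card_Un_le[of ?F ?E] by linarith+
  then have pF: "F x \<le> p + err x" "p \<le> F x + err x" by (auto simp: F_def p_def err_def)
  have err0: "err x \<ge> 0" by (simp add: err_def)
  have K\<eta>: "\<eta> \<le> K"
  proof -
    have "1 * \<eta> \<le> (18 * real k) * \<eta>" using k_ge \<eta>_pos by (intro mult_right_mono) auto
    then show ?thesis by (simp only: K_def mult_1_left)
  qed
  let ?d = "real (card (V - A)) - real (card A)"
  have d: "2 * p = n ^ k + (if t x then -1 else 1) * ?d ^ k"
    unfolding p_def by (rule card_npar[OF finV A(1)])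
  have up: "2 * p - n ^ k \<le> 4 * K * n ^ k"
  proof -
    have "2 * p \<le> 2 * F x + 2 * err x" using pF by simp
    also have "\<dots> \<le> 2 * ((1 / 2 - \<eta>) * n ^ k) + 2 * (K * n ^ k)" using x(2) by linarith
    also have "\<dots> = n ^ k - 2 * (\<eta> * n ^ k) + 2 * (K * n ^ k)" by (simp add: algebra_simps)
    also have "\<dots> \<le> n ^ k + 4 * K * n ^ k"
    proof -
      have "0 \<le> \<eta> * n ^ k" "0 \<le> K * n ^ k" using \<eta>_pos K\<eta> by auto
      then show ?thesis by linarith
    qed
    finally show ?thesis by simp
  qed
  have lo: "- (4 * K * n ^ k) \<le> 2 * p - n ^ k"
  proof -
    have "err x \<le> K * n ^ k" using x(2) Flow[OF x(1)] by linarith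
    moreover have "\<eta> * n ^ k \<le> K * n ^ k" using K\<eta> by (intro mult_right_mono) auto
    moreover have "(1 / 2 - \<eta>) * n ^ k = n ^ k / 2 - \<eta> * n ^ k" by (simp add: algebra_simps)
    ultimately have "p \<ge> n ^ k / 2 - 2 * (K * n ^ k)" using pF(1) Flow[OF x(1)] by linarith
    then show ?thesis by linarith
  qed
  have "\<bar>?d ^ k\<bar> \<le> 4 * K * n ^ k" using up lo unfolding d by (auto split: if_splits)
  then have "\<bar>?d\<bar> ^ k \<le> 72 * real k * \<eta> * n ^ k" by (simp add: power_abs K_def)
  then show "\<exists>A\<subseteq>V. \<exists>t. (\<Sum>x\<in>X. real (card {e \<in> nlists V k. (set e \<in> H x) \<noteq> (npar A e = t x)})) \<le> 13 * real k * \<eta> * m * n ^ k \<and>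
      \<bar>real (card (V - A)) - real (card A)\<bar> ^ k \<le> 72 * real k * \<eta> * n ^ k"
    using A(1) err unfolding err_def by (intro exI[of _ A] exI[of _ t] conjI) (auto simp: mult.assoc)
qed

end

subsection \<open>Perfect matchings in nearly complete parity graphs\<close>

lemma ex_sum_below_caps:
  fixes h :: "'c \<Rightarrow> nat"
  assumes "finite Y" "T \<le> sum h Y"
  shows "\<exists>b. (\<forall>y\<in>Y. b y \<le> h y) \<and> sum b Y = T"
  using assms
proof (induction Y arbitrary: T rule: finite_induct)
  case empty
  then show ?case by auto
next
  case (insert y Y)
  define c where "c = min T (h y)"
  have "T - c \<le> sum h Y" using insert by (simp add: c_def)
  then obtain b where b: "\<forall>z\<in>Y. b z \<le> h z" "sum b Y = T - c" using insert by blast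
  have "sum (b(y := c)) Y = sum b Y" using insert.hyps by (intro sum.cong) auto
  then have "(\<forall>z\<in>insert y Y. (b(y := c)) z \<le> h z) \<and> sum (b(y := c)) (insert y Y) = T"
    using b insert.hyps by (auto simp: c_def)
  then show ?case by blast
qed

lemma ex_partition_sizes:
  assumes "finite Y" "finite A" "card A = (\<Sum>y\<in>Y. s y)"
  shows "\<exists>D. (\<forall>y\<in>Y. D y \<subseteq> A \<and> card (D y) = s y) \<and> disjoint_family_on D Y \<and> (\<Union>y\<in>Y. D y) = A"
  using assms
proof (induction Y arbitrary: A rule: finite_induct)
  case empty
  then show ?case by (auto simp: disjoint_family_on_def)
next
  case (insert y Y)
  have "s y \<le> card A" using insert by simp
  then obtain W where W: "W \<subseteq> A" "card W = s y" by (meson obtain_subset_with_card_n)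
  have "card (A - W) = (\<Sum>y\<in>Y. s y)"
    using insert W by (simp add: card_Diff_subset finite_subset[OF W(1)])
  then obtain D where D: "\<forall>y\<in>Y. D y \<subseteq> A - W \<and> card (D y) = s y" "disjoint_family_on D Y" "(\<Union>y\<in>Y. D y) = A - W"
    using insert.IH[of "A - W"] insert.prems by auto
  let ?D = "D(y := W)"
  have "\<forall>z\<in>insert y Y. ?D z \<subseteq> A \<and> card (?D z) = s z" using D W by auto
  moreover have "disjoint_family_on ?D (insert y Y)"
    using D insert.hyps unfolding disjoint_family_on_def by auto
  moreover have "(\<Union>z\<in>insert y Y. ?D z) = A" using D(3) W insert.hyps by auto
  ultimately show ?case by blast
qed

lemma card_inter_set: "distinct e \<Longrightarrow> card (set e \<inter> A) = length (filter (\<lambda>v. v \<in> A) e)"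
  by (metis Int_commute distinct_card distinct_filter inter_set_filter)

text \<open>\<open>R\<close> is a reservoir of blocks with equal profile: each has exactly
  \<open>a\<close> vertices in \<open>A\<close>, and \<open>1 \<le> a \<le> k - 1\<close> provides a
  vertex on either side. \<open>P\<close> is best among the partitions with these parities and
  profiles.\<close>

locale parity_blocks =
  fixes X :: "'c set" and V :: "'a set" and H :: "'c \<Rightarrow> 'a set set" and k :: nat
    and A :: "'a set" and t :: "'c \<Rightarrow> bool" and R :: "'c set" and a :: nat
    and P :: "'c \<Rightarrow> 'a set" and x\<^sub>0 :: 'c
  assumes fin [simp]: "finite X" "finite V" and k3: "k \<ge> 3"
    and P: "blocks k X V P" "\<And>x. x \<in> X \<Longrightarrow> odd (card (P x \<inter> A)) = t x" "\<And>x. x \<in> R \<Longrightarrow> card (P x \<inter> A) = a"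
    and R: "R \<subseteq> X" "1 \<le> a" "a \<le> k - 1" and x0: "x\<^sub>0 \<in> X" "P x\<^sub>0 \<notin> H x\<^sub>0"
    and maxP: "\<And>Q. blocks k X V Q \<Longrightarrow> (\<And>x. x \<in> X \<Longrightarrow> odd (card (Q x \<inter> A)) = t x) \<Longrightarrow>
       (\<And>x. x \<in> R \<Longrightarrow> card (Q x \<inter> A) = a) \<Longrightarrow> card {x \<in> X. Q x \<in> H x} \<le> card {x \<in> X. P x \<in> H x}"
begin

lemma finite_P: "x \<in> X \<Longrightarrow> finite (P x)"
  using P(1) by (auto simp: blocks_def intro: finite_subset[OF _ fin(2)])

lemma P_disjoint: "x \<in> X \<Longrightarrow> y \<in> X \<Longrightarrow> v \<in> P x \<Longrightarrow> v \<in> P y \<Longrightarrow> x = y"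
  using P(1) unfolding blocks_def disjoint_family_on_def by blast

lemma ex_v: "\<exists>v. bij_betw v {..<k} (P x\<^sub>0)"
  using finite_same_card_bij[of "{..<k}" "P x\<^sub>0"] finite_P[OF x0(1)] P(1) x0(1) by (auto simp: blocks_def)

lemma ex_en: "y \<in> R \<Longrightarrow> \<exists>f. bij_betw f {..<k} (P y) \<and> (\<forall>i<k. f i \<in> A \<longleftrightarrow> i < a)"
proof -
  assume y: "y \<in> R"
  then have yX: "y \<in> X" using R by auto
  have fP: "finite (P y)" by (rule finite_P[OF yX])
  have c: "card (P y) = k" using P(1) yX by (auto simp: blocks_def)
  have cA: "card (P y \<inter> A) = a" by (rule P(3)[OF y])
  have cB: "card (P y - A) = k - a"
    using c cA fP by (metis card_Diff_subset_Int finite_Int)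
  obtain f where f: "bij_betw f {..<a} (P y \<inter> A)"
    using finite_same_card_bij[of "{..<a}" "P y \<inter> A"] fP cA by auto
  obtain g where g: "bij_betw g {a..<k} (P y - A)"
    using finite_same_card_bij[of "{a..<k}" "P y - A"] fP cB by auto
  define h where "h i = (if i < a then f i else g i)" for i
  have "bij_betw h ({..<a} \<union> {a..<k}) ((P y \<inter> A) \<union> (P y - A))"
  proof (rule bij_betw_combine)
    show "bij_betw h {..<a} (P y \<inter> A)" using f by (rule bij_betw_cong[THEN iffD1, rotated]) (auto simp: h_def)
    show "bij_betw h {a..<k} (P y - A)" using g by (rule bij_betw_cong[THEN iffD1, rotated]) (auto simp: h_def)
  qed auto
  moreover have "{..<a} \<union> {a..<k} = {..<k}" "(P y \<inter> A) \<union> (P y - A) = P y" using R k3 by auto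
  ultimately have "bij_betw h {..<k} (P y)" by simp
  moreover have "h i \<in> A \<longleftrightarrow> i < a" if "i < k" for i
    using bij_betwE[OF f] bij_betwE[OF g] that by (auto simp: h_def)
  ultimately show ?thesis by blast
qed

definition v where "v = (SOME v. bij_betw v {..<k} (P x\<^sub>0))"
definition en where "en y = (SOME f. bij_betw f {..<k} (P y) \<and> (\<forall>i<k. f i \<in> A \<longleftrightarrow> i < a))"

lemma v: "bij_betw v {..<k} (P x\<^sub>0)"
  unfolding v_def by (rule someI_ex[OF ex_v])

lemma en: "y \<in> R \<Longrightarrow> bij_betw (en y) {..<k} (P y)" "y \<in> R \<Longrightarrow> i < k \<Longrightarrow> en y i \<in> A \<longleftrightarrow> i < a"
  using someI_ex[OF ex_en, of y] unfolding en_def by blast+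

lemma v_in: "i < k \<Longrightarrow> v i \<in> P x\<^sub>0"
  using v bij_betwE by blast

lemma en_in: "y \<in> R \<Longrightarrow> i < k \<Longrightarrow> en y i \<in> P y"
  using bij_betwE[OF en(1)] by blast

lemma en_inj: "y \<in> R \<Longrightarrow> z \<in> R \<Longrightarrow> i < k \<Longrightarrow> j < k \<Longrightarrow> en y i = en z j \<Longrightarrow> y = z \<and> i = j"
  using P_disjoint[of y z "en y i"] en_in R(1) en(1)[of y]
  by (metis bij_betw_imp_inj_on inj_onD lessThan_iff subsetD)

text \<open>To repair the block of \<open>x\<^sub>0\<close>, its vertex \<open>v i\<close> is joined with one vertex of each of the \<open>k - 1\<close> blocks
  \<open>ys ! j\<close> with \<open>j \<noteq> i\<close>, and \<open>e0 ys\<close> consists of the vertices left over. The enumeration \<open>en\<close> lists the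
  vertices in \<open>A\<close> first, so number \<open>0\<close> is in \<open>A\<close> and number \<open>k - 1\<close> is not; with the choice made in
  \<open>idx\<close> each new set meets \<open>A\<close> in as many vertices as the block it replaces.\<close>

definition idx where
  "idx i d = (if d = 1 then (if v i \<in> A then k - 1 else 0) else d - 1)"

definition e0 where
  "e0 ys = map (\<lambda>i. en (ys ! ((i + 1) mod k)) (if v i \<in> A then 0 else k - 1)) [0..<k]"

definition et where
  "et ys i = map (\<lambda>d. en (ys ! ((i + d) mod k)) (idx i d)) [1..<k]"

definition adm where
  "adm ys \<longleftrightarrow> ys \<in> nlists (R - {x\<^sub>0}) k \<and> distinct ys"

lemma idx_less: "1 \<le> d \<Longrightarrow> d < k \<Longrightarrow> idx i d < k"
  using k3 by (auto simp: idx_def)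

lemma ys_in: "ys \<in> nlists (R - {x\<^sub>0}) k \<Longrightarrow> ys ! (j mod k) \<in> R \<and> ys ! (j mod k) \<noteq> x\<^sub>0 \<and> ys ! (j mod k) \<in> X"
  using nth_nlists[of ys "R - {x\<^sub>0}" k "j mod k"] k3 R(1) by auto

lemma ys_eq: "adm ys \<Longrightarrow> ys ! (i mod k) = ys ! (j mod k) \<Longrightarrow> i mod k = j mod k"
  using k3 by (auto simp: adm_def nlists_def nth_eq_iff_index_eq)

lemma e0_elem: "u \<in> set (e0 ys) \<Longrightarrow> \<exists>i<k. u = en (ys ! ((i + 1) mod k)) (if v i \<in> A then 0 else k - 1)"
  by (auto simp: e0_def)

lemma et_elem: "u \<in> set (et ys i) \<Longrightarrow> \<exists>d. 1 \<le> d \<and> d < k \<and> u = en (ys ! ((i + d) mod k)) (idx i d)"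
  by (auto simp: et_def)

lemma distinct_e0:
  assumes "adm ys" shows "distinct (e0 ys)"
  unfolding e0_def distinct_map
proof (intro conjI inj_onI)
  fix i j assume ij: "i \<in> set [0..<k]" "j \<in> set [0..<k]"
    "en (ys ! ((i + 1) mod k)) (if v i \<in> A then 0 else k - 1) = en (ys ! ((j + 1) mod k)) (if v j \<in> A then 0 else k - 1)"
  have y: "ys ! ((i + 1) mod k) \<in> R" "ys ! ((j + 1) mod k) \<in> R" using ys_in assms by (auto simp: adm_def)
  have "ys ! ((i + 1) mod k) = ys ! ((j + 1) mod k)"
    using en_inj[OF y _ _ ij(3)] k3 by auto
  then have "(i + 1) mod k = (j + 1) mod k" by (rule ys_eq[OF assms])
  then show "i = j" using ij by (intro mod_add_cancel_less[of i 1 k j]) auto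
qed simp

lemma distinct_et:
  assumes "adm ys" shows "distinct (et ys i)"
  unfolding et_def distinct_map
proof (intro conjI inj_onI)
  fix d d' assume d: "d \<in> set [1..<k]" "d' \<in> set [1..<k]"
    "en (ys ! ((i + d) mod k)) (idx i d) = en (ys ! ((i + d') mod k)) (idx i d')"
  have y: "ys ! ((i + d) mod k) \<in> R" "ys ! ((i + d') mod k) \<in> R" using ys_in assms by (auto simp: adm_def)
  have "ys ! ((i + d) mod k) = ys ! ((i + d') mod k)"
    using en_inj[OF y _ _ d(3)] idx_less d by auto
  then have "(i + d) mod k = (i + d') mod k" by (rule ys_eq[OF assms])
  then show "d = d'" using d mod_add_cancel_less[of d i k d'] by (auto simp: add.commute)
qed simp

lemma et_not_P0: "adm ys \<Longrightarrow> u \<in> set (et ys i) \<Longrightarrow> u \<notin> P x\<^sub>0"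
proof
  assume ys: "adm ys" and u: "u \<in> set (et ys i)" "u \<in> P x\<^sub>0"
  obtain d where d: "1 \<le> d" "d < k" "u = en (ys ! ((i + d) mod k)) (idx i d)" using et_elem[OF u(1)] by blast
  have y: "ys ! ((i + d) mod k) \<in> R" "ys ! ((i + d) mod k) \<noteq> x\<^sub>0" "ys ! ((i + d) mod k) \<in> X"
    using ys_in ys by (auto simp: adm_def)
  have "u \<in> P (ys ! ((i + d) mod k))" unfolding d(3) by (rule en_in[OF y(1) idx_less[OF d(1,2)]])
  then show False using P_disjoint[OF y(3) x0(1) _ u(2)] y(2) by blast
qed

lemma e0_not_P0: "adm ys \<Longrightarrow> u \<in> set (e0 ys) \<Longrightarrow> u \<notin> P x\<^sub>0"
proof
  assume ys: "adm ys" and u: "u \<in> set (e0 ys)" "u \<in> P x\<^sub>0"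
  obtain i where i: "i < k" "u = en (ys ! ((i + 1) mod k)) (if v i \<in> A then 0 else k - 1)" using e0_elem[OF u(1)] by blast
  have y: "ys ! ((i + 1) mod k) \<in> R" "ys ! ((i + 1) mod k) \<noteq> x\<^sub>0" "ys ! ((i + 1) mod k) \<in> X"
    using ys_in ys by (auto simp: adm_def)
  have "u \<in> P (ys ! ((i + 1) mod k))" unfolding i(2) by (rule en_in[OF y(1)]) (use k3 in auto)
  then show False using P_disjoint[OF y(3) x0(1) _ u(2)] y(2) by blast
qed

lemma distinct_ei:
  assumes "adm ys" "i < k" shows "distinct (v i # et ys i)"
  using distinct_et[OF assms(1)] et_not_P0[OF assms(1)] v_in[OF assms(2)] by auto

text \<open>Each \<open>v i\<close> is replaced by a vertex on the same side.\<close>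

lemma count_e0:
  assumes "adm ys" shows "card (set (e0 ys) \<inter> A) = card (P x\<^sub>0 \<inter> A)"
proof -
  have "en (ys ! ((i + 1) mod k)) (if v i \<in> A then 0 else k - 1) \<in> A \<longleftrightarrow> v i \<in> A" for i
    using en(2)[of "ys ! ((i + 1) mod k)" "if v i \<in> A then 0 else k - 1"] ys_in assms R k3 by (auto simp: adm_def)
  then have "length (filter (\<lambda>u. u \<in> A) (e0 ys)) = length (filter (\<lambda>i. v i \<in> A) [0..<k])"
    unfolding e0_def filter_map by (simp add: comp_def)
  also have "\<dots> = card {i. i < k \<and> v i \<in> A}" by (simp add: length_filter_conv_card cong: conj_cong)
  also have "\<dots> = card (v ` {i. i < k \<and> v i \<in> A})"
    using v by (intro card_image[symmetric]) (auto simp: bij_betw_def inj_on_def)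
  also have "v ` {i. i < k \<and> v i \<in> A} = P x\<^sub>0 \<inter> A" using v by (auto simp: bij_betw_def)
  finally show ?thesis using card_inter_set[OF distinct_e0[OF assms]] by simp
qed

text \<open>The vertex \<open>v i\<close> and the entry with \<open>d = 1\<close> lie on opposite
  sides and contribute one to \<open>A\<close>; the positions from 1 to \<open>k - 2\<close>
  contribute \<open>a - 1\<close>.\<close>

lemma count_ei:
  assumes "adm ys" "i < k" shows "card (set (v i # et ys i) \<inter> A) = a"
proof -
  have en_A: "en (ys ! ((i + d) mod k)) (idx i d) \<in> A \<longleftrightarrow> idx i d < a" if "1 \<le> d" "d < k" for d
    using en(2)[OF _ idx_less[OF that]] ys_in assms by (auto simp: adm_def)
  have up: "[1..<k] = 1 # [2..<k]" using k3 by (simp add: upt_conv_Cons numeral_2_eq_2)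
  have "length (filter (\<lambda>u. u \<in> A) (et ys i)) = length (filter (\<lambda>d. idx i d < a) [1..<k])"
    unfolding et_def filter_map length_map comp_def
    by (intro arg_cong[where f = length] filter_cong refl) (use en_A in auto)
  also have "\<dots> = (if v i \<in> A then 0 else 1) + length (filter (\<lambda>d. idx i d < a) [2..<k])"
    unfolding up using R k3 by (simp add: idx_def)
  also have "filter (\<lambda>d. idx i d < a) [2..<k] = filter (\<lambda>d. d \<le> a) [2..<k]"
    using R by (intro filter_cong refl) (auto simp: idx_def)
  also have "length (filter (\<lambda>d. d \<le> a) [2..<k]) = card {2..a}"
  proof -
    have "set (filter (\<lambda>d. d \<le> a) [2..<k]) = {2..a}" using R k3 by auto
    then show ?thesis using distinct_card[of "filter (\<lambda>d. d \<le> a) [2..<k]"] by simp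
  qed
  finally have "length (filter (\<lambda>u. u \<in> A) (v i # et ys i)) = a" using R by auto
  then show ?thesis using card_inter_set[OF distinct_ei[OF assms]] by simp
qed

text \<open>The position determines \<open>d\<close>, as 0 and \<open>k - 1\<close> occur only for
  \<open>d = 1\<close>; the block together with \<open>d\<close> then determines
  \<open>i\<close>.\<close>

lemma disjoint_ei:
  assumes "adm ys" "i < k" "i' < k" "i \<noteq> i'"
  shows "set (v i # et ys i) \<inter> set (v i' # et ys i') = {}"
proof (rule ccontr)
  assume "\<not> ?thesis"
  then obtain u where u: "u \<in> set (v i # et ys i)" "u \<in> set (v i' # et ys i')" by blast
  have "v i \<noteq> v i'" using v assms by (auto simp: bij_betw_def inj_on_def)
  then have u': "u \<in> set (et ys i)" "u \<in> set (et ys i')"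
    using u et_not_P0[OF assms(1)] v_in assms by auto
  obtain d where d: "1 \<le> d" "d < k" "u = en (ys ! ((i + d) mod k)) (idx i d)" using et_elem[OF u'(1)] by blast
  obtain d' where d': "1 \<le> d'" "d' < k" "u = en (ys ! ((i' + d') mod k)) (idx i' d')" using et_elem[OF u'(2)] by blast
  have y: "ys ! ((i + d) mod k) \<in> R" "ys ! ((i' + d') mod k) \<in> R" using ys_in assms by (auto simp: adm_def)
  have e: "ys ! ((i + d) mod k) = ys ! ((i' + d') mod k)" "idx i d = idx i' d'"
    using en_inj[OF y idx_less[OF d(1,2)] idx_less[OF d'(1,2)] trans[OF d(3)[symmetric] d'(3)]] by auto
  have "d = d'" using e(2) d d' k3 by (auto simp: idx_def split: if_splits)
  moreover have "(i + d) mod k = (i' + d') mod k" using ys_eq[OF assms(1) e(1)] .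
  ultimately show False using mod_add_cancel_less[of i d k i'] assms by simp
qed

text \<open>A common vertex would have position 0 or \<open>k - 1\<close> in the block following
  number \<open>i\<close>, where \<open>e0\<close> and \<open>et\<close> use opposite ends.\<close>

lemma disjoint_e0:
  assumes "adm ys" "i < k" shows "set (e0 ys) \<inter> set (v i # et ys i) = {}"
proof (rule ccontr)
  assume "\<not> ?thesis"
  then obtain u where u: "u \<in> set (e0 ys)" "u \<in> set (v i # et ys i)" by blast
  then have u': "u \<in> set (et ys i)" using e0_not_P0[OF assms(1)] v_in[OF assms(2)] by auto
  obtain d where d: "1 \<le> d" "d < k" "u = en (ys ! ((i + d) mod k)) (idx i d)" using et_elem[OF u'] by blast
  obtain j where j: "j < k" "u = en (ys ! ((j + 1) mod k)) (if v j \<in> A then 0 else k - 1)" using e0_elem[OF u(1)] by blast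
  have y: "ys ! ((i + d) mod k) \<in> R" "ys ! ((j + 1) mod k) \<in> R" using ys_in assms by (auto simp: adm_def)
  have e: "ys ! ((i + d) mod k) = ys ! ((j + 1) mod k)" "idx i d = (if v j \<in> A then 0 else k - 1)"
    using en_inj[OF y idx_less[OF d(1,2)] _ trans[OF d(3)[symmetric] j(2)]] k3 by auto
  have d1: "d = 1" using e(2) d k3 by (auto simp: idx_def split: if_splits)
  have "(i + d) mod k = (j + 1) mod k" using ys_eq[OF assms(1) e(1)] .
  then have "i = j" using mod_add_cancel_less[of i 1 k j] assms j d1 by simp
  then show False using e(2) d1 k3 by (auto simp: idx_def split: if_splits)
qed

text \<open>All \<open>k + 1\<close> blocks involved become edges with unchanged intersection
  numbers, among them the non-edge at \<open>x\<^sub>0\<close>.\<close>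

lemma no_improvement:
  assumes ys: "adm ys" and h0: "set (e0 ys) \<in> H x\<^sub>0" and hi: "\<And>i. i < k \<Longrightarrow> set (v i # et ys i) \<in> H (ys ! i)"
  shows False
proof -
  have dys: "distinct ys" and lys: "length ys = k" and sys: "set ys \<subseteq> R - {x\<^sub>0}"
    using ys by (auto simp: adm_def nlists_def)
  define ix where "ix y = (THE i. i < k \<and> ys ! i = y)" for y
  have ix: "ix (ys ! i) = i" if "i < k" for i
    unfolding ix_def using that dys lys by (intro the_equality) (auto simp: nth_eq_iff_index_eq)
  define Q where "Q y = (if y = x\<^sub>0 then set (e0 ys) else set (v (ix y) # et ys (ix y)))" for y
  define Y where "Y = insert x\<^sub>0 (set ys)"
  have YX: "Y \<subseteq> X" using sys x0 R by (auto simp: Y_def)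
  have Q0: "Q x\<^sub>0 = set (e0 ys)" by (simp add: Q_def)
  have Qi: "Q (ys ! i) = set (v i # et ys i)" if "i < k" for i
  proof -
    have "ys ! i \<in> set ys" using that lys by simp
    then have "ys ! i \<noteq> x\<^sub>0" using sys by blast
    then show ?thesis by (simp add: Q_def ix[OF that])
  qed
  have Yc: "y = x\<^sub>0 \<or> (\<exists>i<k. y = ys ! i)" if "y \<in> Y" for y
    using that lys by (auto simp: Y_def in_set_conv_nth)
  have len: "length (e0 ys) = k" "length (v i # et ys i) = k" for i using k3 by (auto simp: e0_def et_def)
  have cQ: "card (Q y) = k" if "y \<in> Y" for y
    using Yc[OF that] Q0 Qi distinct_card[OF distinct_e0[OF ys]] distinct_card[OF distinct_ei[OF ys]] len by metis
  have enU: "en (ys ! (j mod k)) i \<in> (\<Union>y\<in>Y. P y)" if "i < k" for i j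
  proof -
    have "ys ! (j mod k) \<in> set ys" using lys k3 by simp
    moreover have "en (ys ! (j mod k)) i \<in> P (ys ! (j mod k))" using ys_in ys that by (intro en_in) (auto simp: adm_def)
    ultimately show ?thesis by (auto simp: Y_def)
  qed
  have vU: "v i \<in> (\<Union>y\<in>Y. P y)" if "i < k" for i using v_in[OF that] by (auto simp: Y_def)
  have subQ: "Q y \<subseteq> (\<Union>y\<in>Y. P y)" if "y \<in> Y" for y
    using Yc[OF that]
  proof (elim disjE exE conjE)
    assume y: "y = x\<^sub>0"
    show ?thesis
    proof
      fix u assume "u \<in> Q y"
      then have "u \<in> set (e0 ys)" unfolding y Q0 .
      from e0_elem[OF this] obtain i where u: "u = en (ys ! ((i + 1) mod k)) (if v i \<in> A then 0 else k - 1)" by blast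
      show "u \<in> (\<Union>y\<in>Y. P y)" unfolding u by (rule enU) (use k3 in auto)
    qed
  next
    fix i assume i: "i < k" "y = ys ! i"
    show ?thesis
    proof
      fix u assume "u \<in> Q y"
      then have "u = v i \<or> u \<in> set (et ys i)" unfolding i(2) Qi[OF i(1)] by simp
      then show "u \<in> (\<Union>y\<in>Y. P y)"
      proof
        assume "u \<in> set (et ys i)"
        from et_elem[OF this] obtain d where d: "1 \<le> d" "d < k" "u = en (ys ! ((i + d) mod k)) (idx i d)" by blast
        show ?thesis unfolding d(3) by (rule enU[OF idx_less[OF d(1,2)]])
      qed (use vU[OF i(1)] in blast)
    qed
  qed
  have disj: "disjoint_family_on Q Y"
    unfolding disjoint_family_on_def
  proof (intro ballI impI)
    fix y z assume yz: "y \<in> Y" "z \<in> Y" "y \<noteq> z"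
    show "Q y \<inter> Q z = {}"
      using Yc[OF yz(1)] Yc[OF yz(2)]
    proof (elim disjE exE conjE)
      assume "y = x\<^sub>0" "z = x\<^sub>0" then show ?thesis using yz by simp
    next
      fix i assume "y = x\<^sub>0" "i < k" "z = ys ! i"
      then show ?thesis using disjoint_e0[OF ys] Q0 Qi by metis
    next
      fix i assume "z = x\<^sub>0" "i < k" "y = ys ! i"
      then show ?thesis using disjoint_e0[OF ys] Q0 Qi by (metis Int_commute)
    next
      fix i j assume "i < k" "y = ys ! i" "j < k" "z = ys ! j"
      then show ?thesis using disjoint_ei[OF ys, of i j] Qi yz(3) by auto
    qed
  qed
  have fY: "finite Y" by (simp add: Y_def)
  have finQ: "finite (Q y)" for y by (simp add: Q_def)
  have "card (\<Union>y\<in>Y. Q y) = (\<Sum>y\<in>Y. card (Q y))"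
    using disj fY finQ by (intro card_UN_disjoint) (auto simp: disjoint_family_on_def)
  also have "\<dots> = k * card Y" using cQ by simp
  also have "\<dots> = card (\<Union>y\<in>Y. P y)" by (rule card_UN_blocks[OF P(1) YX fin, symmetric])
  finally have "(\<Union>y\<in>Y. Q y) = (\<Union>y\<in>Y. P y)"
    using subQ finite_P YX fY by (intro card_subset_eq) auto
  then have bQ: "blocks k Y (\<Union>y\<in>Y. P y) Q"
    using subQ cQ disj by (auto simp: blocks_def)
  define P' where "P' x = (if x \<in> Y then Q x else P x)" for x
  have 1: "blocks k X V P'" unfolding P'_def by (rule blocks_replace[OF P(1) YX bQ])
  have pat: "card (P' x \<inter> A) = card (P x \<inter> A)" if "x \<in> X" for x
  proof (cases "x \<in> Y")
    case True
    then show ?thesis using Yc[OF True]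
    proof (elim disjE exE conjE)
      assume "x = x\<^sub>0" then show ?thesis using count_e0[OF ys] Q0 True by (simp add: P'_def)
    next
      fix i assume i: "i < k" "x = ys ! i"
      have "ys ! i \<in> set ys" using i lys by simp
      then have "ys ! i \<in> R" using sys by blast
      then show ?thesis using count_ei[OF ys i(1)] Qi[OF i(1)] P(3) i True by (simp add: P'_def)
    qed
  qed (simp add: P'_def)
  have "card {x \<in> X. P' x \<in> H x} \<le> card {x \<in> X. P x \<in> H x}"
    by (rule maxP[OF 1]) (use pat P R in auto)
  moreover have "insert x\<^sub>0 {x \<in> X. P x \<in> H x} \<subseteq> {x \<in> X. P' x \<in> H x}"
  proof -
    have "P' y \<in> H y" if "y \<in> Y" for y
      using Yc[OF that] h0 hi Q0 Qi that by (auto simp: P'_def)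
    then have "P' x\<^sub>0 \<in> H x\<^sub>0" "\<And>x. P x \<in> H x \<Longrightarrow> P' x \<in> H x" by (auto simp: Y_def P'_def)
    then show ?thesis using x0 by auto
  qed
  then have "card (insert x\<^sub>0 {x \<in> X. P x \<in> H x}) \<le> card {x \<in> X. P' x \<in> H x}"
    by (intro card_mono) auto
  ultimately show False using x0 by simp
qed

text \<open>Count the admissible tuples \<open>ys\<close>. A missing \<open>e0 ys\<close> determines
  \<open>ys\<close>, and so does a missing set through \<open>v i\<close> together with its colour,
  so each of the \<open>k + 1\<close> conditions fails for few tuples. As \<open>v i\<close> is a
  fixed vertex here, a bound on the missing sets at every single vertex is required.\<close>

lemma false_if_nearly_complete:
  fixes \<eta> :: real
  assumes miss0: "real (card {e \<in> nlists V k. npar A e = t x\<^sub>0 \<and> set e \<notin> H x\<^sub>0}) \<le> \<eta> * real (card V) ^ k"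
    and missv: "\<And>w. w \<in> V \<Longrightarrow> real (card {(x, S) \<in> X \<times> nlists V (k - 1). npar A (w # S) = t x \<and> insert w (set S) \<notin> H x}) \<le> \<eta> * real (card V) ^ k"
    and small: "real ((k + 1)) * \<eta> * real (card V) ^ k \<le> 1 / 4 * real (card (R - {x\<^sub>0})) ^ k"
    and big: "4 * real (k * k) \<le> real (card (R - {x\<^sub>0}))"
  shows False
proof -
  define R' where "R' = R - {x\<^sub>0}"
  have finR': "finite R'" unfolding R'_def using finite_subset[OF R(1) fin(1)] by simp
  have R'pos: "real (card R') > 0"
  proof -
    have "0 < 4 * real (k * k)" using k3 by simp
    then show ?thesis using big unfolding R'_def by linarith
  qed
  have R'ne: "R' \<noteq> {}" using R'pos by auto
  have ys_P: "ys ! j = y" if "ys \<in> nlists R' k" "j < k" "y \<in> X" "u \<in> P (ys ! j)" "u \<in> P y" for ys j u y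
    using that P_disjoint[of "ys ! j" y u] nth_nlists[OF that(1,2)] R(1) by (auto simp: R'_def)
  define B0 where "B0 = {ys \<in> nlists R' k. distinct ys \<and> set (e0 ys) \<notin> H x\<^sub>0}"
  define Bi where "Bi i = {ys \<in> nlists R' k. distinct ys \<and> set (v i # et ys i) \<notin> H (ys ! i)}" for i
  have adm: "adm ys" if "ys \<in> nlists R' k" "distinct ys" for ys using that by (simp add: adm_def R'_def)
  have PV: "P x \<subseteq> V" if "x \<in> X" for x using P(1) that by (auto simp: blocks_def)
  have en_V: "en (ys ! (j mod k)) i \<in> V" if "ys \<in> nlists R' k" "i < k" for ys i j
    using en_in[of "ys ! (j mod k)" i] ys_in[of ys j] PV that by (auto simp: R'_def)
  have vV: "v i \<in> V" if "i < k" for i using v_in[OF that] PV[OF x0(1)] by auto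
  have nth_shift: "\<exists>d. 1 \<le> d \<and> d < k \<and> (i + d) mod k = j" if "i < k" "j < k" "j \<noteq> i" for i j
  proof (cases "i < j")
    case True then show ?thesis using that by (intro exI[of _ "j - i"]) auto
  next
    case False then show ?thesis using that by (intro exI[of _ "j + k - i"]) auto
  qed
  have en_P: "en (ys ! (j mod k)) i \<in> P (ys ! (j mod k))" if "ys \<in> nlists R' k" "i < k" for ys i j
    using that ys_in[of ys j] by (intro en_in) (auto simp: R'_def)
  have inR: "ys ! (j mod k) \<in> X" if "ys \<in> nlists R' k" for ys j using that ys_in[of ys j] by (auto simp: R'_def)
  have c0: "real (card B0) \<le> \<eta> * real (card V) ^ k"
  proof -
    have "inj_on e0 B0"
    proof (rule inj_onI)
      fix ys zs assume h: "ys \<in> B0" "zs \<in> B0" "e0 ys = e0 zs"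
      have n: "ys \<in> nlists R' k" "zs \<in> nlists R' k" using h by (auto simp: B0_def)
      have "ys ! j = zs ! j" if j: "j < k" for j
      proof -
        \<comment> \<open>The cyclic predecessor of \<open>j\<close>, since entry \<open>i\<close>
          of \<open>e0\<close> comes from the block after number \<open>i\<close>.\<close>
        define i where "i = (j + (k - 1)) mod k"
        have ik: "i < k" "(i + 1) mod k = j" using j k3 by (auto simp: i_def mod_Suc_eq)
        have eq: "en (ys ! ((i + 1) mod k)) (if v i \<in> A then 0 else k - 1) = en (zs ! ((i + 1) mod k)) (if v i \<in> A then 0 else k - 1)"
          using h(3) ik(1) unfolding e0_def by (auto simp: map_eq_conv)
        have lt: "(if v i \<in> A then 0 else k - 1) < k" using k3 by auto
        have "ys ! ((i + 1) mod k) = zs ! ((i + 1) mod k)"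
          using P_disjoint[OF inR[OF n(1)] inR[OF n(2)] en_P[OF n(1) lt]] en_P[OF n(2) lt] eq by metis
        then show ?thesis using ik by simp
      qed
      then show "ys = zs" using n by (auto simp: nlists_def intro: nth_equalityI)
    qed
    moreover have "e0 ` B0 \<subseteq> {e \<in> nlists V k. npar A e = t x\<^sub>0 \<and> set e \<notin> H x\<^sub>0}"
    proof (rule image_subsetI)
      fix ys assume h: "ys \<in> B0"
      then have a: "adm ys" "ys \<in> nlists R' k" using adm by (auto simp: B0_def)
      have "npar A (e0 ys) = t x\<^sub>0"
        using npar_distinct[OF distinct_e0[OF a(1)], of A] count_e0[OF a(1)] P(2)[OF x0(1)] by simp
      moreover have "e0 ys \<in> nlists V k" using en_V[OF a(2)] k3 by (auto simp: nlists_def e0_def)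
      ultimately show "e0 ys \<in> {e \<in> nlists V k. npar A e = t x\<^sub>0 \<and> set e \<notin> H x\<^sub>0}" using h by (simp add: B0_def)
    qed
    ultimately have "card B0 \<le> card {e \<in> nlists V k. npar A e = t x\<^sub>0 \<and> set e \<notin> H x\<^sub>0}"
      by (intro card_inj_on_le) auto
    then show ?thesis using miss0 by linarith
  qed
  have ci: "real (card (Bi i)) \<le> \<eta> * real (card V) ^ k" if i: "i < k" for i
  proof -
    let ?M = "{(x, S) \<in> X \<times> nlists V (k - 1). npar A (v i # S) = t x \<and> insert (v i) (set S) \<notin> H x}"
    let ?f = "\<lambda>ys. (ys ! i, et ys i)"
    have "inj_on ?f (Bi i)"
    proof (rule inj_onI)
      fix ys zs assume h: "ys \<in> Bi i" "zs \<in> Bi i" "?f ys = ?f zs"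
      have n: "ys \<in> nlists R' k" "zs \<in> nlists R' k" using h by (auto simp: Bi_def)
      have "ys ! j = zs ! j" if j: "j < k" for j
      proof (cases "j = i")
        case False
        then obtain d where d: "1 \<le> d" "d < k" "(i + d) mod k = j" using nth_shift[OF i j] by blast
        have eq: "en (ys ! ((i + d) mod k)) (idx i d) = en (zs ! ((i + d) mod k)) (idx i d)"
          using h(3) d unfolding et_def by (auto simp: map_eq_conv)
        have "ys ! ((i + d) mod k) = zs ! ((i + d) mod k)"
          using P_disjoint[OF inR[OF n(1)] inR[OF n(2)] en_P[OF n(1) idx_less[OF d(1,2)]]] en_P[OF n(2) idx_less[OF d(1,2)]] eq by metis
        then show ?thesis using d by simp
      qed (use h in simp)
      then show "ys = zs" using n by (auto simp: nlists_def intro: nth_equalityI)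
    qed
    moreover have "?f ` Bi i \<subseteq> ?M"
    proof (rule image_subsetI)
      fix ys assume h: "ys \<in> Bi i"
      then have a: "adm ys" "ys \<in> nlists R' k" using adm by (auto simp: Bi_def)
      have yR: "ys ! i \<in> R" "ys ! i \<in> X" using nth_nlists[OF a(2) i] R by (auto simp: R'_def)
      have "npar A (v i # et ys i) = t (ys ! i)"
        using npar_distinct[OF distinct_ei[OF a(1) i], of A] count_ei[OF a(1) i] P(2)[OF yR(2)] P(3)[OF yR(1)] by simp
      moreover have "et ys i \<in> nlists V (k - 1)" using en_V[OF a(2)] idx_less k3 by (auto simp: nlists_def et_def)
      ultimately show "?f ys \<in> ?M" using h yR by (simp add: Bi_def)
    qed
    moreover have "finite ?M" by (rule finite_subset[of _ "X \<times> nlists V (k - 1)"]) auto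
    ultimately have "card (Bi i) \<le> card ?M" by (intro card_inj_on_le)
    then show ?thesis using missv[OF vV[OF i]] by linarith
  qed
  let ?N = "{ys \<in> nlists R' k. \<not> distinct ys}"
  have "nlists R' k \<subseteq> (?N \<union> B0) \<union> (\<Union>i<k. Bi i)"
  proof
    fix ys assume ys: "ys \<in> nlists R' k"
    show "ys \<in> (?N \<union> B0) \<union> (\<Union>i<k. Bi i)"
    proof (rule ccontr)
      assume n: "\<not> ?thesis"
      then have "distinct ys" "set (e0 ys) \<in> H x\<^sub>0" "\<And>i. i < k \<Longrightarrow> set (v i # et ys i) \<in> H (ys ! i)"
        using ys by (auto simp: B0_def Bi_def)
      then show False using no_improvement[OF adm[OF ys]] by blast
    qed
  qed
  then have "card (nlists R' k) \<le> card ((?N \<union> B0) \<union> (\<Union>i<k. Bi i))"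
    using finR' by (intro card_mono) (auto simp: B0_def Bi_def)
  also have "\<dots> \<le> card ?N + card B0 + (\<Sum>i<k. card (Bi i))"
    using card_Un_le[of "?N \<union> B0" "\<Union>i<k. Bi i"] card_Un_le[of ?N B0] card_UN_le[OF finite_lessThan, of Bi k] by linarith
  finally have "real (card (nlists R' k)) \<le> real (card ?N + card B0 + (\<Sum>i<k. card (Bi i)))" by (rule of_nat_mono)
  then have "real (card R') ^ k \<le> real (card ?N) + real (card B0) + (\<Sum>i<k. real (card (Bi i)))"
    using finR' by (simp add: card_nlists)
  also have "\<dots> \<le> real (k * k) / real (card R') * real (card R') ^ k + \<eta> * real (card V) ^ k + (\<Sum>i<k. \<eta> * real (card V) ^ k)"
    using c0 ci by (intro add_mono card_nlists_not_distinct_real finR' R'ne sum_mono) auto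
  also have "\<dots> = real (k * k) / real (card R') * real (card R') ^ k + real (k + 1) * \<eta> * real (card V) ^ k"
    by (simp add: algebra_simps)
  also have "\<dots> \<le> 1 / 4 * real (card R') ^ k + 1 / 4 * real (card R') ^ k"
  proof (intro add_mono mult_right_mono)
    show "real (k * k) / real (card R') \<le> 1 / 4" using big R'pos unfolding R'_def by (simp add: field_simps)
    show "real (k + 1) * \<eta> * real (card V) ^ k \<le> 1 / 4 * real (card R') ^ k" using small by (simp add: R'_def)
  qed simp
  finally have "real (card R') ^ k \<le> 0" by simp
  moreover have "real (card R') ^ k > 0" using R'pos by simp
  ultimately show False by linarith
qed

end

text \<open>Prescribe the number of vertices in \<open>A\<close> for each block: \<open>a\<close> on
  \<open>R\<close>, and elsewhere the least number of the right parity plus an even amount. The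
  balance condition puts \<open>card A\<close> within \<open>card X / 8\<close> of half of
  \<open>card V\<close>, so that the total can be met.\<close>

lemma ex_parity_partition:
  fixes X :: "'c set" and V :: "'a set"
  assumes fin: "finite X" "finite V" and k3: "k \<ge> 3" and cardV: "card V = k * card X"
    and A: "A \<subseteq> V" and par: "even (card A) = even (card {x \<in> X. t x})"
    and bal: "4 * k * card A \<le> 4 * k * card (V - A) + card V" "4 * k * card (V - A) \<le> 4 * k * card A + card V"
  shows "\<exists>P R a. blocks k X V P \<and> (\<forall>x\<in>X. odd (card (P x \<inter> A)) = t x) \<and> (\<forall>x\<in>R. card (P x \<inter> A) = a) \<and>
     R \<subseteq> X \<and> 1 \<le> a \<and> a \<le> k - 1 \<and> card R = card X div 8"
proof -
  let ?m = "card X"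
  have finA: "finite A" "finite (V - A)" using finite_subset[OF A fin(2)] fin by auto
  have cA: "card A + card (V - A) = k * ?m"
    using cardV A fin by (metis card_Un_disjoint Diff_disjoint Diff_partition finA)
  have Abounds: "8 * card A \<le> 4 * k * ?m + ?m" "4 * k * ?m \<le> 8 * card A + ?m"
  proof -
    have "4 * k * (2 * card A) \<le> 4 * k * (card A + card (V - A)) + k * ?m"
      using bal(1) cardV by (simp add: algebra_simps)
    then have "k * (8 * card A) \<le> k * (4 * k * ?m + ?m)" unfolding cA by (simp add: algebra_simps)
    then show "8 * card A \<le> 4 * k * ?m + ?m" using k3 by simp
    have "4 * k * (card A + card (V - A)) \<le> 4 * k * (2 * card A) + k * ?m"
      using bal(2) cardV by (simp add: algebra_simps)
    then have "k * (4 * k * ?m) \<le> k * (8 * card A + ?m)" unfolding cA by (simp add: algebra_simps)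
    then show "4 * k * ?m \<le> 8 * card A + ?m" using k3 by simp
  qed
  obtain b where b: "card X div 8 \<le> card {x \<in> X. t x = b}"
  proof -
    have "X = {x \<in> X. t x = True} \<union> {x \<in> X. t x = False}" by auto
    then have "card X \<le> card {x \<in> X. t x = True} + card {x \<in> X. t x = False}"
      by (metis card_Un_le)
    then have "card X div 8 \<le> card {x \<in> X. t x = True} \<or> card X div 8 \<le> card {x \<in> X. t x = False}" by linarith
    then show ?thesis using that by blast
  qed
  then obtain R where R: "R \<subseteq> {x \<in> X. t x = b}" "card R = card X div 8" by (meson obtain_subset_with_card_n)
  \<comment> \<open>The least positive number of the parity given by \<open>b\<close>; the value 2
    is at most \<open>k - 1\<close> because \<open>k \<ge> 3\<close>.\<close>
  define a :: nat where "a = (if b then 1 else 2)"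
  have RX: "R \<subseteq> X" and tR: "\<And>x. x \<in> R \<Longrightarrow> t x = b" using R by auto
  have finR: "finite R" "finite (X - R)" using finite_subset[OF RX fin(1)] fin by auto
  define q where "q x = (if t x then 1 else 0 :: nat)" for x
  define h where "h x = (k - q x) div 2" for x
  have cXR: "card (X - R) + card R = ?m" using RX fin finR by (simp add: card_Diff_subset card_mono)
  have qsum: "sum q (X - R) \<le> card (X - R)"
    using sum_mono[of "X - R" q "\<lambda>_. 1"] by (auto simp: q_def)
  have "?m * 3 \<le> k * ?m" using k3 by simp
  then have m3: "12 * ?m \<le> 4 * k * ?m" by simp
  have lower: "a * card R + sum q (X - R) \<le> card A"
  proof -
    have "a * card R \<le> 2 * card R" by (simp add: a_def)
    moreover have "8 * card R \<le> ?m" using R(2) by simp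
    ultimately show ?thesis using qsum cXR Abounds(2) m3 by linarith
  qed
  \<comment> \<open>What is left of \<open>A\<close> after the minimum in every block. It is even by
    the parity hypothesis, hence can be handed out in pairs.\<close>
  define T where "T = card A - a * card R - sum q (X - R)"
  have "even T"
  proof -
    have "card {x \<in> X. t x} = sum q X" using fin by (simp add: q_def sum.If_cases Int_def)
    also have "\<dots> = sum q (X - R) + sum q R" using RX fin by (intro sum.subset_diff)
    also have "sum q R = (if b then card R else 0)" using tR by (simp add: q_def)
    finally have "even (card A) = even (sum q (X - R) + (if b then card R else 0))" using par by simp
    then have "even (card A) = even (a * card R + sum q (X - R))" by (auto simp: a_def)
    then show ?thesis using lower unfolding T_def by (simp add: even_diff_nat diff_diff_add)
  qed
  moreover have "T \<le> 2 * sum h (X - R)"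
  proof -
    have "q x + 2 * h x \<ge> k - 1" for x using k3 by (auto simp: h_def q_def)
    then have "(\<Sum>x\<in>X - R. k - 1) \<le> (\<Sum>x\<in>X - R. q x + 2 * h x)" by (intro sum_mono)
    then have "(k - 1) * card (X - R) \<le> sum q (X - R) + 2 * sum h (X - R)"
      by (simp add: sum.distrib sum_distrib_left mult.commute)
    moreover have "card A \<le> (k - 1) * card (X - R)"
    proof -
      have "8 * card R \<le> ?m" using R(2) by simp
      then have "7 * ?m \<le> 8 * card (X - R)" using cXR by linarith
      then have "(k - 1) * (7 * ?m) \<le> (k - 1) * (8 * card (X - R))" by (rule mult_le_mono2)
      \<comment> \<open>For \<open>k = 3\<close> this compares 13 with 14, so there is little room
        for a larger \<open>R\<close>.\<close>
      moreover have "4 * k * ?m + ?m \<le> (k - 1) * (7 * ?m)"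
      proof -
        define j where "j = k - 3"
        have "k = j + 3" using k3 by (simp add: j_def)
        then show ?thesis by (simp add: algebra_simps)
      qed
      moreover have "(k - 1) * (8 * card (X - R)) = 8 * ((k - 1) * card (X - R))" by simp
      ultimately have "8 * card A \<le> 8 * ((k - 1) * card (X - R))" using Abounds(1) by linarith
      then show ?thesis by simp
    qed
    ultimately show ?thesis unfolding T_def by linarith
  qed
  ultimately have "T div 2 \<le> sum h (X - R)" by simp
  from ex_sum_below_caps[OF finR(2) this] obtain c where c: "\<forall>x\<in>X - R. c x \<le> h x" "sum c (X - R) = T div 2" by blast
  define s where "s x = (if x \<in> R then a else q x + 2 * c x)" for x
  have sk: "s x \<le> k" if "x \<in> X" for x
  proof (cases "x \<in> R")
    case False
    then have "2 * c x \<le> 2 * h x" using c(1) that by auto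
    also have "2 * h x \<le> k - q x" by (simp add: h_def)
    finally show ?thesis using False k3 by (auto simp: s_def q_def split: if_splits)
  qed (use k3 in \<open>auto simp: s_def a_def\<close>)
  have "(\<Sum>x\<in>X. s x) = (\<Sum>x\<in>X - R. s x) + (\<Sum>x\<in>R. s x)" using RX fin by (intro sum.subset_diff)
  also have "(\<Sum>x\<in>X - R. s x) = sum q (X - R) + 2 * sum c (X - R)"
    by (simp add: s_def sum.distrib sum_distrib_left)
  also have "(\<Sum>x\<in>R. s x) = a * card R" by (simp add: s_def)
  also have "2 * sum c (X - R) = T" using c(2) \<open>even T\<close> by simp
  finally have ssum: "(\<Sum>x\<in>X. s x) = card A" using lower unfolding T_def by linarith
  have "(\<Sum>x\<in>X. k - s x) + (\<Sum>x\<in>X. s x) = (\<Sum>x\<in>X. (k - s x) + s x)" by (rule sum.distrib[symmetric])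
  also have "\<dots> = (\<Sum>x\<in>X. k)" using sk by (intro sum.cong) auto
  finally have ssum': "(\<Sum>x\<in>X. k - s x) = card (V - A)" using ssum cA by (simp add: mult.commute)
  obtain D where D: "\<forall>x\<in>X. D x \<subseteq> A \<and> card (D x) = s x" "disjoint_family_on D X" "(\<Union>x\<in>X. D x) = A"
    using ex_partition_sizes[OF fin(1) finA(1) ssum[symmetric]] by blast
  obtain E where E: "\<forall>x\<in>X. E x \<subseteq> V - A \<and> card (E x) = k - s x" "disjoint_family_on E X" "(\<Union>x\<in>X. E x) = V - A"
    using ex_partition_sizes[OF fin(1) finA(2) ssum'[symmetric]] by blast
  define P where "P x = D x \<union> E x" for x
  have PA: "P x \<inter> A = D x" if "x \<in> X" for x using D(1) E(1) that by (auto simp: P_def)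
  have finDE: "finite (D x)" "finite (E x)" if "x \<in> X" for x
    using D(1) E(1) that finite_subset[OF _ finA(1), of "D x"] finite_subset[OF _ finA(2), of "E x"] by auto
  have "card (P x) = k" if "x \<in> X" for x
  proof -
    have "card (P x) = card (D x) + card (E x)"
      unfolding P_def using D(1) E(1) that finDE[OF that] by (intro card_Un_disjoint) auto
    then show ?thesis using D(1) E(1) that sk[OF that] by simp
  qed
  moreover have "disjoint_family_on P X"
    unfolding disjoint_family_on_def
  proof (intro ballI impI)
    fix x y assume xy: "x \<in> X" "y \<in> X" "x \<noteq> y"
    have "D x \<inter> D y = {}" "E x \<inter> E y = {}" using D(2) E(2) xy by (auto simp: disjoint_family_on_def)
    moreover have "D x \<inter> E y = {}" "E x \<inter> D y = {}" using D(1) E(1) xy by blast+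
    ultimately show "P x \<inter> P y = {}" by (auto simp: P_def)
  qed
  moreover have "(\<Union>x\<in>X. P x) = V"
  proof -
    have "(\<Union>x\<in>X. P x) = (\<Union>x\<in>X. D x) \<union> (\<Union>x\<in>X. E x)" by (auto simp: P_def)
    then show ?thesis using D(3) E(3) A by auto
  qed
  ultimately have "blocks k X V P" by (auto simp: blocks_def)
  moreover have "odd (card (P x \<inter> A)) = t x" if "x \<in> X" for x
    using PA[OF that] D(1) that tR by (auto simp: s_def a_def q_def)
  moreover have "card (P x \<inter> A) = a" if "x \<in> R" for x
    using PA D(1) that RX by (auto simp: s_def)
  moreover have "1 \<le> a" "a \<le> k - 1" using k3 by (auto simp: a_def)
  ultimately show ?thesis using RX R(2) by blast
qed

theorem parity_completion:
  fixes X :: "'c set" and V :: "'a set" and \<eta> :: real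
  assumes fin: "finite X" "finite V" and k3: "k \<ge> 3" and cardV: "card V = k * card X"
    and A: "A \<subseteq> V" and par: "even (card A) = even (card {x \<in> X. t x})"
    and bal: "4 * k * card A \<le> 4 * k * card (V - A) + card V" "4 * k * card (V - A) \<le> 4 * k * card A + card V"
    and missx: "\<And>x. x \<in> X \<Longrightarrow> real (card {e \<in> nlists V k. npar A e = t x \<and> set e \<notin> H x}) \<le> \<eta> * real (card V) ^ k"
    and missv: "\<And>w. w \<in> V \<Longrightarrow> real (card {(x, S) \<in> X \<times> nlists V (k - 1). npar A (w # S) = t x \<and> insert w (set S) \<notin> H x}) \<le> \<eta> * real (card V) ^ k"
    and small: "4 * real (k + 1) * \<eta> * (16 * real k) ^ k \<le> 1"
    and big: "64 * k * k \<le> card X"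
  shows "rpm k H X V"
proof -
  obtain P0 R a where P0: "blocks k X V P0" "\<forall>x\<in>X. odd (card (P0 x \<inter> A)) = t x" "\<forall>x\<in>R. card (P0 x \<inter> A) = a"
    and R: "R \<subseteq> X" "1 \<le> a" "a \<le> k - 1" and card_R: "card R = card X div 8"
    using ex_parity_partition[OF fin k3 cardV A par bal] by blast
  define I where "I P \<longleftrightarrow> blocks k X V P \<and> (\<forall>x\<in>X. odd (card (P x \<inter> A)) = t x) \<and> (\<forall>x\<in>R. card (P x \<inter> A) = a)" for P
  have "\<exists>P. I P \<and> (\<forall>Q. I Q \<longrightarrow> card {x \<in> X. Q x \<in> H x} \<le> card {x \<in> X. P x \<in> H x})"
  proof (rule ex_has_greatest_nat[of _ P0 _ "Suc (card X)"])
    show "\<forall>y. I y \<longrightarrow> card {x \<in> X. y x \<in> H x} < Suc (card X)"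
      using fin by (auto intro!: card_mono simp: less_Suc_eq_le)
  qed (use P0 in \<open>auto simp: I_def\<close>)
  then obtain P where P: "I P" "\<And>Q. I Q \<Longrightarrow> card {x \<in> X. Q x \<in> H x} \<le> card {x \<in> X. P x \<in> H x}" by blast
  have "P x \<in> H x" if x: "x \<in> X" for x
  proof (rule ccontr)
    assume neg: "P x \<notin> H x"
    interpret parity_blocks X V H k A t R a P x
      by unfold_locales (use fin k3 P R x neg in \<open>auto simp: I_def\<close>)
    \<comment> \<open>An eighth of the colours, rounded down and with one removed. Together with
      \<open>card V = k * card X\<close> this is the origin of \<open>16 * real k\<close>.\<close>
    have c16: "card X \<le> 16 * card (R - {x})"
    proof -
      have "64 * 3 * 3 \<le> 64 * k * k" using k3 by (intro mult_le_mono) auto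
      then have "576 \<le> card X" using big by linarith
      moreover have "card R \<le> card (R - {x}) + 1" using diff_card_le_card_Diff[of "{x}" R] by simp
      ultimately show ?thesis using card_R by linarith
    qed
    show False
    proof (rule false_if_nearly_complete[OF missx[OF x] missv])
      have "real (card V) \<le> 16 * real k * real (card (R - {x}))"
      proof -
        have "card V \<le> k * (16 * card (R - {x}))" using cardV c16 by simp
        then have "real (card V) \<le> real (k * (16 * card (R - {x})))" by (rule of_nat_mono)
        then show ?thesis by simp
      qed
      then have V: "real (card V) ^ k \<le> (16 * real k) ^ k * real (card (R - {x})) ^ k"
        using power_mono[of "real (card V)" "16 * real k * real (card (R - {x}))" k] by (simp add: power_mult_distrib)
      have \<eta>0: "0 \<le> \<eta> * real (card V) ^ k" using missx[OF x] by (rule order_trans[rotated]) simp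
      have Vpos: "real (card V) ^ k > 0"
      proof -
        have "card X > 0" using x assms(1) by (auto simp: card_gt_0_iff)
        then show ?thesis using k3 by (simp add: cardV)
      qed
      have "\<eta> \<ge> 0" using \<eta>0 Vpos by (simp add: zero_le_mult_iff)
      then have "real (k + 1) * \<eta> * real (card V) ^ k \<le> real (k + 1) * \<eta> * ((16 * real k) ^ k * real (card (R - {x})) ^ k)"
        using V by (intro mult_left_mono) auto
      also have "\<dots> = (real (k + 1) * \<eta> * (16 * real k) ^ k) * real (card (R - {x})) ^ k" by simp
      also have "\<dots> \<le> 1 / 4 * real (card (R - {x})) ^ k"
      proof (rule mult_right_mono)
        have "4 * (real (k + 1) * \<eta> * (16 * real k) ^ k) \<le> 1" using small by (simp only: mult.assoc)
        then show "real (k + 1) * \<eta> * (16 * real k) ^ k \<le> 1 / 4" by linarith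
      qed simp
      finally show "real (k + 1) * \<eta> * real (card V) ^ k \<le> 1 / 4 * real (card (R - {x})) ^ k" .
      have "64 * k * k \<le> 16 * card (R - {x})" using big c16 by linarith
      then have "4 * (k * k) \<le> card (R - {x})" by simp
      then have "real (4 * (k * k)) \<le> real (card (R - {x}))" by (rule of_nat_mono)
      then show "4 * real (k * k) \<le> real (card (R - {x}))" by simp
    qed
  qed
  then show ?thesis using P(1) by (auto simp: rpm_def I_def)
qed

subsection \<open>Atypical vertices and colours\<close>

lemma card_markov:
  fixes f :: "'b \<Rightarrow> real"
  assumes "finite S" "\<And>s. s \<in> S \<Longrightarrow> f s \<ge> 0" "sum f S \<le> c * d" "d > 0"
  shows "real (card {s \<in> S. f s > d}) \<le> c"
proof -
  have "real (card {s \<in> S. f s > d}) * d = (\<Sum>s\<in>{s \<in> S. f s > d}. d)" by simp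
  also have "\<dots> \<le> (\<Sum>s\<in>{s \<in> S. f s > d}. f s)" by (intro sum_mono) auto
  also have "\<dots> \<le> sum f S" using assms by (intro sum_mono2) auto
  finally have "real (card {s \<in> S. f s > d}) * d \<le> c * d" using assms(3) by linarith
  then show ?thesis using assms(4) by simp
qed

lemma card_le_split3:
  assumes "finite T" "finite U" "finite W" "S \<subseteq> T \<union> U \<union> W"
  shows "real (card S) \<le> real (card T) + real (card U) + real (card W)"
proof -
  have "card S \<le> card (T \<union> U \<union> W)" using assms by (intro card_mono) auto
  also have "\<dots> \<le> card (T \<union> U) + card W" by (rule card_Un_le)
  also have "card (T \<union> U) \<le> card T + card U" by (rule card_Un_le)
  finally show ?thesis by linarith
qed

context colgraphs
begin

lemma edges_card: "x \<in> X \<Longrightarrow> 2 / 5 * n ^ k \<le> real (card {e \<in> nlists V k. set e \<in> H x})"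
proof -
  assume x: "x \<in> X"
  have k: "k = Suc (k - 1)" using k_ge by simp
  have "2 / 5 * n ^ k = (\<Sum>v\<in>V. 2 / 5 * n ^ (k - 1))" by (subst k) simp
  also have "\<dots> \<le> (\<Sum>v\<in>V. real (card {S \<in> nlists V (k - 1). insert v (set S) \<in> H x}))"
    using deg1 x by (intro sum_mono) auto
  also have "\<dots> = real (card {e \<in> nlists V (Suc (k - 1)). set e \<in> H x})"
    by (simp only: card_nlists_Suc_filter[OF finV] of_nat_sum list.set)
  finally show ?thesis using k by simp
qed

text \<open>The necessary condition for covering \<open>VM\<close> by edges of the right parities in
  the colours \<open>XM\<close>; each edge of the wrong parity toggles it.\<close>

definition used_even :: "'a set \<Rightarrow> ('c \<Rightarrow> bool) \<Rightarrow> 'c set \<Rightarrow> 'a set \<Rightarrow> bool" where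
  "used_even A t XM VM \<longleftrightarrow> even (card (VM \<inter> A)) = even (card {x \<in> XM. t x})"

lemma used_even_insert:
  assumes "finite XM" "finite VM" "finite e" "x \<notin> XM" "e \<inter> VM = {}"
  shows "used_even A t (insert x XM) (e \<union> VM) \<longleftrightarrow> (used_even A t XM VM \<longleftrightarrow> odd (card (e \<inter> A)) = t x)"
proof -
  have "(e \<union> VM) \<inter> A = (e \<inter> A) \<union> (VM \<inter> A)" by auto
  then have 1: "card ((e \<union> VM) \<inter> A) = card (e \<inter> A) + card (VM \<inter> A)"
  proof -
    have "(e \<inter> A) \<inter> (VM \<inter> A) = {}" using assms(5) by auto
    then have "card ((e \<inter> A) \<union> (VM \<inter> A)) = card (e \<inter> A) + card (VM \<inter> A)"
      using assms by (intro card_Un_disjoint) auto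
    then show ?thesis by (simp add: \<open>(e \<union> VM) \<inter> A = (e \<inter> A) \<union> (VM \<inter> A)\<close>)
  qed
  have "{y \<in> insert x XM. t y} = (if t x then insert x {y \<in> XM. t y} else {y \<in> XM. t y})" by auto
  then have 2: "card {y \<in> insert x XM. t y} = card {y \<in> XM. t y} + (if t x then 1 else 0)"
    using assms by simp
  show ?thesis unfolding used_even_def 1 2 by auto
qed

lemma used_even_diff:
  assumes "XM \<subseteq> X" "VM \<subseteq> V" "A \<subseteq> V" "used_even A t XM VM \<longleftrightarrow> used_even A t X V"
  shows "used_even A t (X - XM) (V - VM)"
proof -
  have fin: "finite XM" "finite VM" using finite_subset[OF assms(1)] finite_subset[OF assms(2)] by auto
  have "V \<inter> A = ((V - VM) \<inter> A) \<union> (VM \<inter> A)" using assms by auto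
  then have 1: "card (V \<inter> A) = card ((V - VM) \<inter> A) + card (VM \<inter> A)"
    using fin by (metis (no_types, lifting) card_Un_disjoint finV finite_Diff finite_Int Int_Diff Diff_disjoint Int_assoc Int_commute Int_empty_right inf_left_commute)
  have "{x \<in> X. t x} = {x \<in> X - XM. t x} \<union> {x \<in> XM. t x}" using assms by auto
  then have 2: "card {x \<in> X. t x} = card {x \<in> X - XM. t x} + card {x \<in> XM. t x}"
    using fin by (subst card_Un_disjoint[symmetric]) auto
  show ?thesis using assms(4) unfolding used_even_def 1 2 by auto
qed

text \<open>The value \<open>b\<close> is kept fixed while the matching grows, so that in the end
  the uncovered remainder satisfies the parity condition.\<close>

definition pm_state :: "'a set \<Rightarrow> ('c \<Rightarrow> bool) \<Rightarrow> bool \<Rightarrow> nat \<Rightarrow> 'c set \<Rightarrow> 'a set \<Rightarrow> bool" where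
  "pm_state A t b j XM VM \<longleftrightarrow> rpm k H XM VM \<and> XM \<subseteq> X \<and> VM \<subseteq> V \<and> card XM \<le> j \<and> card VM = k * card XM \<and>
     (used_even A t XM VM \<longleftrightarrow> b)"

lemma pm_state_add:
  assumes "pm_state A t b j XM VM" "x \<in> X - XM" "set e \<in> H x" "set e \<inter> VM = {}" "npar A e = t x" "length e = k"
  shows "pm_state A t b (Suc j) (insert x XM) (set e \<union> VM)"
proof -
  have e: "set e \<subseteq> V" "card (set e) = k" using edges[of x "set e"] assms by auto
  have de: "distinct e" using e(2) assms(6) by (simp add: card_distinct)
  have fin: "finite XM" "finite VM" using assms(1) finite_subset[of XM X] finite_subset[of VM V] by (auto simp: pm_state_def)
  have "rpm k H ({x} \<union> XM) (set e \<union> VM)"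
    using assms e by (intro rpm_Un rpm_single) (auto simp: pm_state_def)
  moreover have "card (set e \<union> VM) = card (set e) + card VM"
    using fin assms(4) by (intro card_Un_disjoint) auto
  moreover have "used_even A t (insert x XM) (set e \<union> VM) \<longleftrightarrow> b"
    using used_even_insert[OF fin finite_set, of x e A t] assms npar_distinct[OF de, of A] by (auto simp: pm_state_def)
  ultimately show ?thesis
    using assms e fin by (auto simp: pm_state_def)
qed

text \<open>The at most \<open>j\<close> colours used so far and their vertices spoil a proportion
  of at most \<open>k * j / m\<close> of all pairs, which is less than 1/8.\<close>

lemma cover_vertex:
  assumes st: "pm_state A t b j XM VM" and v: "v \<in> V - VM"
    and good: "1 / 8 * (m * n ^ (k - 1)) \<le> real (card {(x, S) \<in> X \<times> nlists V (k - 1). insert v (set S) \<in> H x \<and> npar A (v # S) = t x})"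
    and small: "8 * real k * real j < m"
  shows "\<exists>XM' VM'. pm_state A t b (Suc j) XM' VM' \<and> XM \<subseteq> XM' \<and> VM \<subseteq> VM' \<and> v \<in> VM'"
proof -
  let ?G = "{(x, S) \<in> X \<times> nlists V (k - 1). insert v (set S) \<in> H x \<and> npar A (v # S) = t x}"
  let ?T = "{(x, S) \<in> X \<times> nlists V (k - 1). insert v (set S) \<in> H x \<and> npar A (v # S) = t x \<and> x \<notin> XM \<and> set S \<inter> VM = {}}"
  let ?U = "XM \<times> nlists V (k - 1)" and ?W = "X \<times> {S \<in> nlists V (k - 1). set S \<inter> VM \<noteq> {}}"
  have s: "XM \<subseteq> X" "VM \<subseteq> V" "card XM \<le> j" "card VM = k * card XM" using st by (auto simp: pm_state_def)
  have fin: "finite XM" "finite VM" using finite_subset[OF s(1)] finite_subset[OF s(2)] by auto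
  have fT: "finite ?T" by (rule finite_subset[of _ "X \<times> nlists V (k - 1)"]) auto
  have "real (card ?G) \<le> real (card ?T) + real (card ?U) + real (card ?W)"
    using fT fin by (intro card_le_split3) auto
  moreover have "real (card ?U) = real (card XM) * n ^ (k - 1)" by (simp add: card_cartesian_product card_nlists)
  moreover have "real (card ?W) \<le> real (k - 1) * real (card XM) * n ^ (k - 1)"
  proof -
    have "real (card ?W) = m * real (card {S \<in> nlists V (k - 1). set S \<inter> VM \<noteq> {}})" by (simp add: card_cartesian_product)
    also have "\<dots> \<le> m * (real (k - 1) * real (card VM) / n * n ^ (k - 1))"
      using V_ne fin by (intro mult_left_mono card_nlists_meeting_real) auto
    also have "\<dots> = real (k - 1) * real (card XM) * n ^ (k - 1)"
      using m_pos k_ge by (simp add: s(4) cardV)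
    finally show ?thesis .
  qed
  moreover have "real (card XM) * n ^ (k - 1) + real (k - 1) * real (card XM) * n ^ (k - 1) < 1 / 8 * (m * n ^ (k - 1))"
  proof -
    have "real (card XM) * n ^ (k - 1) + real (k - 1) * real (card XM) * n ^ (k - 1) = (real k * real (card XM)) * n ^ (k - 1)"
      using k_ge by (simp add: of_nat_diff algebra_simps)
    also have "\<dots> < (1 / 8 * m) * n ^ (k - 1)"
    proof (rule mult_strict_right_mono)
      have "real k * real (card XM) \<le> real k * real j" using s(3) by (intro mult_left_mono) auto
      then show "real k * real (card XM) < 1 / 8 * m" using small by linarith
    qed (use n_pos in simp)
    finally show ?thesis by simp
  qed
  ultimately have "real (card ?T) > 0" using good by linarith
  then have "?T \<noteq> {}" by (metis card.empty of_nat_0 less_irrefl)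
  then obtain x S where xS: "x \<in> X" "S \<in> nlists V (k - 1)" "insert v (set S) \<in> H x" "npar A (v # S) = t x" "x \<notin> XM" "set S \<inter> VM = {}" by blast
  have "pm_state A t b (Suc j) (insert x XM) (set (v # S) \<union> VM)"
    by (rule pm_state_add[OF st]) (use xS v k_ge length_nlists[OF xS(2)] in auto)
  then show ?thesis by (intro exI[of _ "insert x XM"] exI[of _ "set (v # S) \<union> VM"]) auto
qed

lemma cover_colour:
  assumes st: "pm_state A t b j XM VM" and x: "x \<in> X - XM"
    and good: "1 / 8 * n ^ k \<le> real (card {e \<in> nlists V k. set e \<in> H x \<and> npar A e = t x})"
    and small: "8 * real k * real j < m"
  shows "\<exists>XM' VM'. pm_state A t b (Suc j) XM' VM' \<and> XM \<subseteq> XM' \<and> VM \<subseteq> VM' \<and> x \<in> XM'"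
proof -
  let ?G = "{e \<in> nlists V k. set e \<in> H x \<and> npar A e = t x}"
  let ?T = "{e \<in> nlists V k. set e \<in> H x \<and> npar A e = t x \<and> set e \<inter> VM = {}}"
  let ?W = "{S \<in> nlists V k. set S \<inter> VM \<noteq> {}}"
  have s: "XM \<subseteq> X" "VM \<subseteq> V" "card XM \<le> j" "card VM = k * card XM" using st by (auto simp: pm_state_def)
  have fin: "finite XM" "finite VM" using finite_subset[OF s(1)] finite_subset[OF s(2)] by auto
  have "real (card ?G) \<le> real (card ?T) + real (card ({} :: 'a list set)) + real (card ?W)"
    by (intro card_le_split3) auto
  moreover have "real (card ?W) < 1 / 8 * n ^ k"
  proof -
    have "real (card ?W) \<le> real k * real (card VM) / n * n ^ k"
      using V_ne fin by (intro card_nlists_meeting_real) auto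
    also have "\<dots> < 1 / 8 * n ^ k"
    proof (rule mult_strict_right_mono)
      have "8 * (real k * real (card XM)) \<le> 8 * (real k * real j)" using s(3) by (intro mult_left_mono) auto
      then have "8 * (real k * real (card XM)) < m" using small by linarith
      then have "real k * (8 * (real k * real (card XM))) < real k * m" using k_ge by (intro mult_strict_left_mono) auto
      then have "8 * (real k * real (card VM)) < n" by (simp add: s(4) cardV mult_ac)
      then show "real k * real (card VM) / n < 1 / 8"
        using n_pos by (simp add: field_simps)
    qed (use n_pos in simp)
    finally show ?thesis .
  qed
  ultimately have "real (card ?T) > 0" using good by simp
  then have "?T \<noteq> {}" by (metis card.empty of_nat_0 less_irrefl)
  then obtain e where e: "e \<in> nlists V k" "set e \<in> H x" "npar A e = t x" "set e \<inter> VM = {}" by blast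
  have "pm_state A t b (Suc j) (insert x XM) (set e \<union> VM)"
    by (rule pm_state_add[OF st]) (use e x length_nlists[OF e(1)] in auto)
  then show ?thesis by (intro exI[of _ "insert x XM"] exI[of _ "set e \<union> VM"]) auto
qed

lemma pm_state_mono: "pm_state A t b j XM VM \<Longrightarrow> j \<le> j' \<Longrightarrow> pm_state A t b j' XM VM"
  by (auto simp: pm_state_def)

lemma cover_vertices:
  assumes "finite W" "W \<subseteq> V" "pm_state A t b j XM VM"
    and good: "\<And>v. v \<in> W \<Longrightarrow> 1 / 8 * (m * n ^ (k - 1)) \<le> real (card {(x, S) \<in> X \<times> nlists V (k - 1). insert v (set S) \<in> H x \<and> npar A (v # S) = t x})"
    and small: "8 * real k * real (j + card W) < m"
  shows "\<exists>XM' VM'. pm_state A t b (j + card W) XM' VM' \<and> XM \<subseteq> XM' \<and> VM \<subseteq> VM' \<and> W \<subseteq> VM'"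
  using assms(1,2) good small
proof (induction W rule: finite_induct)
  case empty
  then show ?case using assms(3) by auto
next
  case (insert v W)
  have "8 * real k * real (j + card W) \<le> 8 * real k * real (j + card (insert v W))"
    using insert.hyps by (intro mult_left_mono) auto
  then have sm: "8 * real k * real (j + card W) < m" using insert.prems(3) by linarith
  obtain XM1 VM1 where 1: "pm_state A t b (j + card W) XM1 VM1" "XM \<subseteq> XM1" "VM \<subseteq> VM1" "W \<subseteq> VM1"
    using insert.IH[OF _ _ sm] insert.prems by auto
  show ?case
  proof (cases "v \<in> VM1")
    case True
    have "pm_state A t b (j + card (insert v W)) XM1 VM1" by (rule pm_state_mono[OF 1(1)]) (use insert.hyps in simp)
    then show ?thesis using 1 True by blast
  next
    case False
    then obtain XM2 VM2 where 2: "pm_state A t b (Suc (j + card W)) XM2 VM2" "XM1 \<subseteq> XM2" "VM1 \<subseteq> VM2" "v \<in> VM2"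
      using cover_vertex[OF 1(1) _ _ sm, of v] insert.prems by auto
    have "pm_state A t b (j + card (insert v W)) XM2 VM2" using 2(1) insert.hyps by simp
    then show ?thesis using 1 2 by blast
  qed
qed

lemma cover_colours:
  assumes "finite W" "W \<subseteq> X" "pm_state A t b j XM VM"
    and good: "\<And>x. x \<in> W \<Longrightarrow> 1 / 8 * n ^ k \<le> real (card {e \<in> nlists V k. set e \<in> H x \<and> npar A e = t x})"
    and small: "8 * real k * real (j + card W) < m"
  shows "\<exists>XM' VM'. pm_state A t b (j + card W) XM' VM' \<and> XM \<subseteq> XM' \<and> VM \<subseteq> VM' \<and> W \<subseteq> XM'"
  using assms(1,2) good small
proof (induction W rule: finite_induct)
  case empty
  then show ?case using assms(3) by auto
next
  case (insert x W)
  have "8 * real k * real (j + card W) \<le> 8 * real k * real (j + card (insert x W))"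
    using insert.hyps by (intro mult_left_mono) auto
  then have sm: "8 * real k * real (j + card W) < m" using insert.prems(3) by linarith
  obtain XM1 VM1 where 1: "pm_state A t b (j + card W) XM1 VM1" "XM \<subseteq> XM1" "VM \<subseteq> VM1" "W \<subseteq> XM1"
    using insert.IH[OF _ _ sm] insert.prems by auto
  show ?case
  proof (cases "x \<in> XM1")
    case True
    have "pm_state A t b (j + card (insert x W)) XM1 VM1" by (rule pm_state_mono[OF 1(1)]) (use insert.hyps in simp)
    then show ?thesis using 1 True by blast
  next
    case False
    then obtain XM2 VM2 where 2: "pm_state A t b (Suc (j + card W)) XM2 VM2" "XM1 \<subseteq> XM2" "VM1 \<subseteq> VM2" "x \<in> XM2"
      using cover_colour[OF 1(1) _ _ sm, of x] insert.prems by auto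
    have "pm_state A t b (j + card (insert x W)) XM2 VM2" using 2(1) insert.hyps by simp
    then show ?thesis using 1 2 by blast
  qed
qed

text \<open>Atypical vertices and colours are reassigned to the side or parity that most of their
  edges support. The hypothesis \<open>wrong\<close> ranges over all \<open>B\<close> and
  \<open>s\<close> because it is applied to these corrected data, not to the given \<open>A\<close>
  and \<open>t\<close>.\<close>

theorem rpm_if_near_parity:
  fixes \<sigma> :: real
  assumes k3: "k \<ge> 3" and \<sigma>: "\<sigma> > 0" "4 * real (k + 1) * (32 * real k) ^ k * \<sigma> \<le> 1"
    and big: "200 * real k * real k \<le> m"
    and A: "A \<subseteq> V" and err: "(\<Sum>x\<in>X. real (card {e \<in> nlists V k. (set e \<in> H x) \<noteq> (npar A e = t x)})) \<le> \<sigma> ^ 2 * m * n ^ k"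
    and bal: "\<bar>real (card (V - A)) - real (card A)\<bar> \<le> \<sigma> * n"
    and wrong: "\<And>B s. B \<subseteq> V \<Longrightarrow> even (card B) \<noteq> even (card {x \<in> X. s x}) \<Longrightarrow> \<exists>x\<in>X. \<exists>e\<in>H x. odd (card (e \<inter> B)) \<noteq> s x"
  shows "rpm k H X V"
proof -
  have kk: "k = Suc (k - 1)" using k3 by simp
  have nk: "n ^ k = n * n ^ (k - 1)" using kk by (metis power_Suc)
  define N where "N = m * n ^ (k - 1)"
  have Npos: "N > 0" unfolding N_def using m_pos n_pos by simp
  have nkpos: "n ^ k > 0" using n_pos by simp
  have \<sigma>k: "128 * real k * real (k + 1) * \<sigma> \<le> 1"
  proof -
    have "(32 * real k) ^ 1 \<le> (32 * real k) ^ k" using k3 by (intro power_increasing) auto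
    then have "(4 * real (k + 1) * \<sigma>) * (32 * real k) \<le> (4 * real (k + 1) * \<sigma>) * (32 * real k) ^ k"
      using \<sigma> by (intro mult_left_mono) auto
    also have "\<dots> = 4 * real (k + 1) * (32 * real k) ^ k * \<sigma>" by simp
    also have "\<dots> \<le> 1" by (rule \<sigma>(2))
    finally show ?thesis by (simp add: mult_ac)
  qed
  have \<sigma>40: "40 * real k * \<sigma> \<le> 1"
  proof -
    have "40 * real k * \<sigma> * 1 \<le> 40 * real k * \<sigma> * real (k + 1)" using \<sigma> by (intro mult_left_mono) auto
    also have "\<dots> = 40 * (real k * real (k + 1) * \<sigma>)" by simp
    also have "\<dots> \<le> 128 * (real k * real (k + 1) * \<sigma>)" using \<sigma> by (intro mult_right_mono) auto
    also have "\<dots> = 128 * real k * real (k + 1) * \<sigma>" by simp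
    finally show ?thesis using \<sigma>k unfolding mult_1_right by linarith
  qed
  define bad where "bad x e \<longleftrightarrow> (set e \<in> H x) \<noteq> (npar A e = t x)" for x e
  define bx where "bx x = real (card {e \<in> nlists V k. bad x e})" for x
  define bv where "bv v = real (card {(x, S) \<in> X \<times> nlists V (k - 1). bad x (v # S)})" for v
  have pairs: "card {(x, S) \<in> X \<times> nlists V (k - 1). Q x S} = (\<Sum>x\<in>X. card {S \<in> nlists V (k - 1). Q x S})" for Q
  proof -
    have "{(x, S) \<in> X \<times> nlists V (k - 1). Q x S} = (SIGMA x : X. {S \<in> nlists V (k - 1). Q x S})" by auto
    then show ?thesis by simp
  qed
  have fpairs: "finite {(x, S) \<in> X \<times> nlists V (k - 1). Q x S}" for Q
    by (rule finite_subset[of _ "X \<times> nlists V (k - 1)"]) auto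
  have sbx: "sum bx X \<le> \<sigma> ^ 2 * m * n ^ k" using err by (simp add: bx_def bad_def)
  have bxv: "bx x = (\<Sum>v\<in>V. real (card {S \<in> nlists V (k - 1). bad x (v # S)}))" for x
    unfolding bx_def using card_nlists_Suc_filter[OF finV, of "k - 1" "bad x"] kk by simp
  have "sum bv V = (\<Sum>v\<in>V. \<Sum>x\<in>X. real (card {S \<in> nlists V (k - 1). bad x (v # S)}))"
    by (intro sum.cong refl) (simp only: bv_def pairs of_nat_sum)
  also have "\<dots> = sum bx X" unfolding bxv by (rule sum.swap)
  finally have sbv: "sum bv V \<le> \<sigma> ^ 2 * m * n ^ k" using sbx by simp
  \<comment> \<open>The total error has density \<open>\<sigma> ^ 2\<close>; by Markov's inequality
    all but a proportion \<open>\<sigma>\<close> of the colours, and likewise of the vertices, have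
    error density at most \<open>\<sigma>\<close>.\<close>
  define XA where "XA = {x \<in> X. bx x > \<sigma> * n ^ k}"
  define VA where "VA = {v \<in> V. bv v > \<sigma> * N}"
  have cXA: "real (card XA) \<le> \<sigma> * m"
    unfolding XA_def
  proof (rule card_markov)
    show "sum bx X \<le> \<sigma> * m * (\<sigma> * n ^ k)" using sbx by (simp add: power2_eq_square mult_ac)
  qed (use \<sigma> nkpos in \<open>auto simp: bx_def\<close>)
  have cVA: "real (card VA) \<le> \<sigma> * n"
    unfolding VA_def
  proof (rule card_markov)
    show "sum bv V \<le> \<sigma> * n * (\<sigma> * N)" using sbv by (simp add: power2_eq_square mult_ac N_def nk)
  qed (use \<sigma> Npos in \<open>auto simp: bv_def\<close>)
  have finA: "finite XA" "finite VA" by (auto simp: XA_def VA_def)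
  have sub: "XA \<subseteq> X" "VA \<subseteq> V" by (auto simp: XA_def VA_def)
  define gv where "gv b v = real (card {(x, S) \<in> X \<times> nlists V (k - 1). insert v (set S) \<in> H x \<and> ((b \<noteq> npar A S) = t x)})" for b v
  define gx where "gx b x = real (card {e \<in> nlists V k. set e \<in> H x \<and> npar A e = b})" for b x
  \<comment> \<open>Only vertices in \<open>VA\<close> may change sides; each goes where at least
    half of the edges at it have the parity of their colour.\<close>
  define A' where "A' = (A - VA) \<union> {v \<in> VA. gv False v \<le> gv True v}"
  define t' where "t' x = (if x \<in> XA then gx False x \<le> gx True x else t x)" for x
  have A'V: "A' \<subseteq> V" using A sub by (auto simp: A'_def)
  have A'A: "v \<in> A' \<longleftrightarrow> v \<in> A" if "v \<notin> VA" for v using that by (auto simp: A'_def)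
  have par': "npar A' e = npar A e" if "set e \<inter> VA = {}" for e
    using that A'A by (intro npar_cong) auto
  \<comment> \<open>The larger of two classes that together have density at least 2/5.\<close>
  have gv_max: "gv (v \<in> A') v \<ge> 1 / 5 * N" if v: "v \<in> VA" for v
  proof -
    let ?L = "{(x, S) \<in> X \<times> nlists V (k - 1). insert v (set S) \<in> H x}"
    let ?T = "{(x, S) \<in> X \<times> nlists V (k - 1). insert v (set S) \<in> H x \<and> ((True \<noteq> npar A S) = t x)}"
    let ?U = "{(x, S) \<in> X \<times> nlists V (k - 1). insert v (set S) \<in> H x \<and> ((False \<noteq> npar A S) = t x)}"
    have "real (card ?L) \<le> real (card ?T) + real (card ?U) + real (card ({} :: ('c \<times> 'a list) set))"
      by (rule card_le_split3[OF fpairs fpairs]) auto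
    moreover have "2 / 5 * N \<le> real (card ?L)"
    proof -
      have "2 / 5 * N = (\<Sum>x\<in>X. 2 / 5 * n ^ (k - 1))" by (simp add: N_def)
      also have "\<dots> \<le> (\<Sum>x\<in>X. real (card {S \<in> nlists V (k - 1). insert v (set S) \<in> H x}))"
        using deg1 v sub by (intro sum_mono) auto
      finally show ?thesis by (simp only: pairs of_nat_sum)
    qed
    ultimately have "2 / 5 * N \<le> gv True v + gv False v" by (simp add: gv_def)
    moreover have "v \<in> A' \<longleftrightarrow> gv False v \<le> gv True v" using v by (auto simp: A'_def)
    ultimately show ?thesis by (cases "v \<in> A'") auto
  qed
  have gx_max: "gx (t' x) x \<ge> 1 / 5 * n ^ k" if x: "x \<in> XA" for x
  proof -
    let ?L = "{e \<in> nlists V k. set e \<in> H x}"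
    have "real (card ?L) \<le> gx True x + gx False x + real (card ({} :: 'a list set))"
      unfolding gx_def by (rule card_le_split3) auto
    then have "2 / 5 * n ^ k \<le> gx True x + gx False x" using edges_card[of x] x sub by auto
    moreover have "t' x \<longleftrightarrow> gx False x \<le> gx True x" using x by (simp add: t'_def)
    ultimately show ?thesis by (cases "t' x") auto
  qed
  have meetVA: "real (card {S \<in> nlists V j. set S \<inter> VA \<noteq> {}}) \<le> real j * \<sigma> * n ^ j" for j
  proof -
    have "real (card {S \<in> nlists V j. set S \<inter> VA \<noteq> {}}) \<le> real j * real (card VA) / n * n ^ j"
      using V_ne finA by (intro card_nlists_meeting_real) auto
    also have "\<dots> \<le> real j * \<sigma> * n ^ j"
    proof (rule mult_right_mono)
      have "real j * real (card VA) \<le> real j * (\<sigma> * n)" using cVA by (intro mult_left_mono) auto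
      then show "real j * real (card VA) / n \<le> real j * \<sigma>" using n_pos by (simp add: field_simps)
    qed simp
    finally show ?thesis .
  qed
  have goodv: "1 / 8 * (m * n ^ (k - 1)) \<le> real (card {(x, S) \<in> X \<times> nlists V (k - 1). insert v (set S) \<in> H x \<and> npar A' (v # S) = t' x})"
    if v: "v \<in> VA" for v
  proof -
    let ?G = "{(x, S) \<in> X \<times> nlists V (k - 1). insert v (set S) \<in> H x \<and> npar A' (v # S) = t' x}"
    let ?L = "{(x, S) \<in> X \<times> nlists V (k - 1). insert v (set S) \<in> H x \<and> (((v \<in> A') \<noteq> npar A S) = t x)}"
    let ?U = "XA \<times> nlists V (k - 1)" and ?W = "X \<times> {S \<in> nlists V (k - 1). set S \<inter> VA \<noteq> {}}"
    have "?L \<subseteq> ?G \<union> ?U \<union> ?W" using par' by (auto simp: t'_def)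
    then have "real (card ?L) \<le> real (card ?G) + real (card ?U) + real (card ?W)"
      using fpairs finA by (intro card_le_split3) auto
    moreover have "real (card ?L) = gv (v \<in> A') v" by (simp add: gv_def)
    moreover have "real (card ?U) \<le> \<sigma> * N"
      using mult_right_mono[OF cXA, of "n ^ (k - 1)"] by (simp add: card_cartesian_product card_nlists N_def mult.assoc)
    moreover have "real (card ?W) \<le> real (k - 1) * \<sigma> * N"
    proof -
      have "real (card ?W) = m * real (card {S \<in> nlists V (k - 1). set S \<inter> VA \<noteq> {}})" by (simp add: card_cartesian_product)
      also have "\<dots> \<le> m * (real (k - 1) * \<sigma> * n ^ (k - 1))" using meetVA by (intro mult_left_mono) auto
      finally show ?thesis by (simp add: N_def mult_ac)
    qed
    \<comment> \<open>Counting with \<open>A'\<close> and \<open>t'\<close> instead of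
      \<open>A\<close> and \<open>t\<close> loses at most 1/40, and 1/5 - 1/40 exceeds 1/8.\<close>
    moreover have "\<sigma> * N + real (k - 1) * \<sigma> * N \<le> 1 / 40 * N"
    proof -
      have "\<sigma> * N + real (k - 1) * \<sigma> * N = (real k * \<sigma>) * N" using k3 by (simp add: of_nat_diff algebra_simps)
      also have "\<dots> \<le> 1 / 40 * N" using \<sigma>40 Npos by (intro mult_right_mono) auto
      finally show ?thesis .
    qed
    ultimately have "1 / 8 * N \<le> real (card ?G)" using gv_max[OF v] Npos by linarith
    then show ?thesis by (simp add: N_def)
  qed
  have goodx: "1 / 8 * n ^ k \<le> real (card {e \<in> nlists V k. set e \<in> H x \<and> npar A' e = t' x})" if x: "x \<in> XA" for x
  proof -
    let ?G = "{e \<in> nlists V k. set e \<in> H x \<and> npar A' e = t' x}"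
    let ?L = "{e \<in> nlists V k. set e \<in> H x \<and> npar A e = t' x}" and ?W = "{S \<in> nlists V k. set S \<inter> VA \<noteq> {}}"
    have "?L \<subseteq> ?G \<union> ?W \<union> {}" using par' by auto
    then have "real (card ?L) \<le> real (card ?G) + real (card ?W) + real (card ({} :: 'a list set))"
      by (intro card_le_split3) auto
    moreover have "real (card ?L) = gx (t' x) x" by (simp add: gx_def)
    moreover have "real (card ?W) \<le> 1 / 40 * n ^ k"
    proof -
      have "real k * \<sigma> * n ^ k \<le> 1 / 40 * n ^ k" using \<sigma>40 by (intro mult_right_mono) auto
      then show ?thesis using meetVA[of k] by linarith
    qed
    ultimately show ?thesis using gx_max[OF x] nkpos by simp
  qed
  \<comment> \<open>If the totals are consistent, the empty matching is a start; otherwise one edge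
    of the wrong parity is used first. In both cases the used part has the status \<open>tot\<close>
    of the whole, so the remainder is consistent.\<close>
  define tot where "tot = used_even A' t' X V"
  have tot: "tot \<longleftrightarrow> even (card A') = even (card {x \<in> X. t' x})"
    using A'V by (simp add: tot_def used_even_def Int_absorb1)
  have "\<exists>XM VM. pm_state A' t' tot 1 XM VM"
  proof (cases tot)
    case True
    then have "pm_state A' t' tot 1 {} {}" by (simp add: pm_state_def used_even_def)
    then show ?thesis by blast
  next
    case False
    then obtain x e where xe: "x \<in> X" "e \<in> H x" "odd (card (e \<inter> A')) \<noteq> t' x" using wrong[OF A'V, of t'] tot by blast
    have e: "e \<subseteq> V" "card e = k" using edges[OF xe(1,2)] by auto
    have "used_even A' t' (insert x {}) (e \<union> {}) \<longleftrightarrow> (used_even A' t' {} {} \<longleftrightarrow> odd (card (e \<inter> A')) = t' x)"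
      by (rule used_even_insert) (use finite_subset[OF e(1)] in auto)
    then have "pm_state A' t' tot 1 {x} e"
      using False xe e by (auto simp: pm_state_def used_even_def intro: rpm_single)
    then show ?thesis by blast
  qed
  then obtain XM0 VM0 where st0: "pm_state A' t' tot 1 XM0 VM0" by blast
  have cnt: "real (1 + card VA + card XA) \<le> 1 + real (k + 1) * \<sigma> * m"
  proof -
    have "real (1 + card VA + card XA) \<le> 1 + \<sigma> * n + \<sigma> * m" using cVA cXA by simp
    also have "\<dots> = 1 + real (k + 1) * \<sigma> * m" by (simp add: cardV algebra_simps)
    finally show ?thesis .
  qed
  have small: "8 * real k * real (1 + card VA + card XA) < m"
  proof -
    have "8 * real k * real (1 + card VA + card XA) \<le> 8 * real k * (1 + real (k + 1) * \<sigma> * m)"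
      using cnt by (intro mult_left_mono) auto
    also have "\<dots> = 8 * real k + (128 * real k * real (k + 1) * \<sigma>) * m / 16" by (simp add: algebra_simps)
    also have "\<dots> \<le> 8 * real k + 1 * m / 16"
      using \<sigma>k m_pos by (intro add_left_mono divide_right_mono mult_right_mono) auto
    also have "\<dots> < m"
    proof -
      have "200 * real k * 1 \<le> 200 * real k * real k" using k3 by (intro mult_left_mono) auto
      then show ?thesis using big m_pos k3 by linarith
    qed
    finally show ?thesis .
  qed
  have small1: "8 * real k * real (1 + card VA) < m"
  proof -
    have "8 * real k * real (1 + card VA) \<le> 8 * real k * real (1 + card VA + card XA)" by (intro mult_left_mono) auto
    then show ?thesis using small by linarith
  qed
  obtain XM1 VM1 where st1: "pm_state A' t' tot (1 + card VA) XM1 VM1" "VA \<subseteq> VM1"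
    using cover_vertices[OF finA(2) sub(2) st0 goodv small1] by blast
  obtain XM VM where st: "pm_state A' t' tot (1 + card VA + card XA) XM VM" "VM1 \<subseteq> VM" "XA \<subseteq> XM"
    using cover_colours[OF finA(1) sub(1) st1(1) goodx small] by blast
  have M: "rpm k H XM VM" "XM \<subseteq> X" "VM \<subseteq> V" "card XM \<le> 1 + card VA + card XA" "card VM = k * card XM"
    "used_even A' t' XM VM \<longleftrightarrow> used_even A' t' X V"
    using st(1) by (auto simp: pm_state_def tot_def)
  have finM: "finite XM" "finite VM" using finite_subset[OF M(2)] finite_subset[OF M(3)] by auto
  define X' where "X' = X - XM"
  define V' where "V' = V - VM"
  have cV': "card V' = k * card X'"
    using M finM cardV by (simp add: V'_def X'_def card_Diff_subset diff_mult_distrib2)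
  have cX': "real (card X') = m - real (card XM)"
    using M finM by (simp add: X'_def card_Diff_subset card_mono of_nat_diff)
  have XMm: "8 * real k * real (card XM) < m"
  proof -
    have "8 * real k * real (card XM) \<le> 8 * real k * real (1 + card VA + card XA)" using M(4) by (intro mult_left_mono of_nat_mono) auto
    then show ?thesis using small by linarith
  qed
  have XMh: "real (card XM) \<le> 1 / 2 * m"
  proof -
    have "8 * 1 * real (card XM) \<le> 8 * real k * real (card XM)" using k3 by (intro mult_right_mono) auto
    then show ?thesis using XMm m_pos by linarith
  qed
  then have X'h: "1 / 2 * m \<le> real (card X')" using cX' by linarith
  have V'h: "1 / 2 * n \<le> real (card V')" using mult_left_mono[OF X'h, of "real k"] by (simp add: cV' cardV)
  have nV': "n ^ k \<le> 2 ^ k * real (card V') ^ k"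
  proof -
    have "n ^ k \<le> (2 * real (card V')) ^ k" using V'h by (intro power_mono) auto
    then show ?thesis by (simp add: power_mult_distrib)
  qed
  have XX: "x \<in> X" "x \<notin> XA" "bx x \<le> \<sigma> * n ^ k" "t' x = t x" if "x \<in> X'" for x
    using that st(3) by (auto simp: X'_def XA_def t'_def not_less)
  have VV: "v \<in> V" "v \<notin> VA" "bv v \<le> \<sigma> * N" if "v \<in> V'" for v
    using that st(2) st1(2) by (auto simp: V'_def VA_def not_less)
  have V'V: "V' \<subseteq> V" "V' \<inter> VA = {}" using VV by auto
  have parA: "npar (A' \<inter> V') e = npar A e" if "set e \<subseteq> V'" for e
    using that A'A VV(2) by (intro npar_cong) auto
  \<comment> \<open>At least half of \<open>V\<close> survives, so error densities grow by at most
    \<open>2 ^ k\<close>; this turns \<open>16 * real k\<close> into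
    \<open>32 * real k\<close>.\<close>
  have rpm': "rpm k H X' V'"
  proof (rule parity_completion[where A = "A' \<inter> V'" and t = t' and \<eta> = "\<sigma> * 2 ^ k"])
    show "finite X'" "finite V'" by (auto simp: X'_def V'_def)
    show "even (card (A' \<inter> V')) = even (card {x \<in> X'. t' x})"
      using used_even_diff[OF M(2,3) A'V M(6)] by (simp add: used_even_def X'_def V'_def Int_commute)
    show "real (card {e \<in> nlists V' k. npar (A' \<inter> V') e = t' x \<and> set e \<notin> H x}) \<le> \<sigma> * 2 ^ k * real (card V') ^ k" if x: "x \<in> X'" for x
    proof -
      have "{e \<in> nlists V' k. npar (A' \<inter> V') e = t' x \<and> set e \<notin> H x} \<subseteq> {e \<in> nlists V k. bad x e}"
      proof clarify
        fix e assume e: "e \<in> nlists V' k" "npar (A' \<inter> V') e = t' x" "set e \<notin> H x"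
        have "e \<in> nlists V k" using e(1) nlists_mono[OF V'V(1)] by blast
        moreover have "npar A e = t x" using e(2) parA[OF set_nlists[OF e(1)]] XX(4)[OF x] by simp
        ultimately show "e \<in> nlists V k \<and> bad x e" using e(3) by (simp add: bad_def)
      qed
      then have "card {e \<in> nlists V' k. npar (A' \<inter> V') e = t' x \<and> set e \<notin> H x} \<le> card {e \<in> nlists V k. bad x e}"
        by (intro card_mono) auto
      then have "real (card {e \<in> nlists V' k. npar (A' \<inter> V') e = t' x \<and> set e \<notin> H x}) \<le> \<sigma> * n ^ k"
        using XX(3)[OF x] unfolding bx_def by linarith
      also have "\<dots> \<le> \<sigma> * (2 ^ k * real (card V') ^ k)" using nV' \<sigma> by (intro mult_left_mono) auto
      finally show ?thesis by (simp add: mult_ac)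
    qed
    show "real (card {(x, S) \<in> X' \<times> nlists V' (k - 1). npar (A' \<inter> V') (w # S) = t' x \<and> insert w (set S) \<notin> H x}) \<le> \<sigma> * 2 ^ k * real (card V') ^ k" if w: "w \<in> V'" for w
    proof -
      have "{(x, S) \<in> X' \<times> nlists V' (k - 1). npar (A' \<inter> V') (w # S) = t' x \<and> insert w (set S) \<notin> H x} \<subseteq> {(x, S) \<in> X \<times> nlists V (k - 1). bad x (w # S)}"
      proof (rule subsetI)
        fix z assume "z \<in> {(x, S) \<in> X' \<times> nlists V' (k - 1). npar (A' \<inter> V') (w # S) = t' x \<and> insert w (set S) \<notin> H x}"
        then obtain x S where z: "z = (x, S)" and e: "x \<in> X'" "S \<in> nlists V' (k - 1)" "npar (A' \<inter> V') (w # S) = t' x" "insert w (set S) \<notin> H x"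
          by blast
        have "S \<in> nlists V (k - 1)" using e(2) nlists_mono[OF V'V(1)] by blast
        moreover have "npar A (w # S) = t x" using e(3) parA[of "w # S"] set_nlists[OF e(2)] w XX(4)[OF e(1)] by simp
        ultimately show "z \<in> {(x, S) \<in> X \<times> nlists V (k - 1). bad x (w # S)}"
          using e(4) XX(1)[OF e(1)] by (simp add: z bad_def)
      qed
      then have "card {(x, S) \<in> X' \<times> nlists V' (k - 1). npar (A' \<inter> V') (w # S) = t' x \<and> insert w (set S) \<notin> H x} \<le> card {(x, S) \<in> X \<times> nlists V (k - 1). bad x (w # S)}"
        by (intro card_mono fpairs)
      then have "real (card {(x, S) \<in> X' \<times> nlists V' (k - 1). npar (A' \<inter> V') (w # S) = t' x \<and> insert w (set S) \<notin> H x}) \<le> \<sigma> * N"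
        using VV(3)[OF w] unfolding bv_def by linarith
      also have "\<sigma> * N \<le> \<sigma> * n ^ k"
        unfolding N_def nk using \<sigma> m_le_n by (intro mult_left_mono mult_right_mono) auto
      also have "\<dots> \<le> \<sigma> * (2 ^ k * real (card V') ^ k)" using nV' \<sigma> by (intro mult_left_mono) auto
      finally show ?thesis by (simp add: mult_ac)
    qed
    show "4 * real (k + 1) * (\<sigma> * 2 ^ k) * (16 * real k) ^ k \<le> 1"
    proof -
      have "(32 * real k) ^ k = (2 * (16 * real k)) ^ k" by simp
      also have "\<dots> = 2 ^ k * (16 * real k) ^ k" by (rule power_mult_distrib)
      finally have p: "2 ^ k * (16 * real k) ^ k = (32 * real k) ^ k" by (rule sym)
      have "4 * real (k + 1) * (\<sigma> * 2 ^ k) * (16 * real k) ^ k = 4 * real (k + 1) * (2 ^ k * (16 * real k) ^ k) * \<sigma>"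
        by (simp only: mult_ac)
      then show ?thesis using \<sigma>(2) by (simp only: p)
    qed
    show "64 * k * k \<le> card X'"
    proof -
      have "200 * (real k * real k) \<le> m" using big by (simp add: mult.assoc)
      then have "64 * (real k * real k) \<le> real (card X')" using X'h zero_le_square[of "real k"] by linarith
      then have "real (64 * k * k) \<le> real (card X')" by simp
      then show ?thesis by (rule of_nat_le_iff[THEN iffD1])
    qed
    have VMn: "real (card VM) \<le> real k + real (k + 1) * \<sigma> * n"
    proof -
      have "real (card XM) \<le> 1 + real (k + 1) * \<sigma> * m"
        using cnt M(4) by (metis (no_types, lifting) of_nat_mono order_trans)
      then have "real k * real (card XM) \<le> real k * (1 + real (k + 1) * \<sigma> * m)" by (intro mult_left_mono) auto
      then show ?thesis by (simp add: M(5) cardV algebra_simps)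
    qed
    \<comment> \<open>The summands are the imbalance of \<open>A\<close>, the reassigned vertices on
      both sides of the comparison, and the covered vertices \<open>VM\<close>.\<close>
    have tiny: "4 * real k * (\<sigma> * n + 2 * (\<sigma> * n) + (real k + real (k + 1) * \<sigma> * n)) \<le> 1 / 2 * n"
    proof -
      have "3 * \<sigma> \<le> real (k + 1) * \<sigma>" using k3 \<sigma> by (intro mult_right_mono) auto
      then have "3 * \<sigma> * n \<le> real (k + 1) * \<sigma> * n" by (rule mult_right_mono) simp
      then have "\<sigma> * n + 2 * (\<sigma> * n) + (real k + real (k + 1) * \<sigma> * n) \<le> 2 * (real (k + 1) * \<sigma> * n) + real k" by linarith
      then have "4 * real k * (\<sigma> * n + 2 * (\<sigma> * n) + (real k + real (k + 1) * \<sigma> * n)) \<le> 4 * real k * (2 * (real (k + 1) * \<sigma> * n) + real k)"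
        by (intro mult_left_mono) auto
      also have "\<dots> = (128 * real k * real (k + 1) * \<sigma>) * n / 16 + 4 * real k * real k" by (simp add: algebra_simps)
      also have "\<dots> \<le> 1 * n / 16 + 4 * real k * real k"
      proof -
        have "(128 * real k * real (k + 1) * \<sigma>) * n \<le> 1 * n" by (rule mult_right_mono[OF \<sigma>k]) simp
        then show ?thesis by linarith
      qed
      also have "4 * real k * real k \<le> 1 / 4 * n"
      proof -
        have "200 * (real k * real k) \<le> m" using big by (simp add: mult.assoc)
        then have "200 * (real k * real k) \<le> n" using m_le_n by linarith
        then have "16 * (real k * real k) \<le> n" using zero_le_square[of "real k"] by linarith
        then show ?thesis by (simp add: mult.assoc)
      qed
      finally show ?thesis using n_pos by linarith
    qed
    have c1: "card (A' \<inter> V') \<le> card A + card VA"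
    proof -
      have "A' \<inter> V' \<subseteq> A \<union> VA" by (auto simp: A'_def)
      then have "card (A' \<inter> V') \<le> card (A \<union> VA)" using finite_subset[OF A finV] finA by (intro card_mono) auto
      then show ?thesis using card_Un_le[of A VA] by linarith
    qed
    have c2: "card (V' - A' \<inter> V') \<le> card (V - A) + card VA"
    proof -
      have "V' - A' \<inter> V' \<subseteq> (V - A) \<union> VA" using V'V(1) by (auto simp: A'_def)
      then have "card (V' - A' \<inter> V') \<le> card ((V - A) \<union> VA)" using finA by (intro card_mono) auto
      then show ?thesis using card_Un_le[of "V - A" VA] by linarith
    qed
    have c3: "card A \<le> card (A' \<inter> V') + card VA + card VM"
    proof -
      have "A \<subseteq> (A' \<inter> V') \<union> VA \<union> VM" using A by (auto simp: A'_def V'_def)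
      then have "real (card A) \<le> real (card (A' \<inter> V')) + real (card VA) + real (card VM)"
        using finA finM by (intro card_le_split3) (auto simp: V'_def)
      then show ?thesis by linarith
    qed
    have c4: "card (V - A) \<le> card (V' - A' \<inter> V') + card VA + card VM"
    proof -
      have "V - A \<subseteq> (V' - A' \<inter> V') \<union> VA \<union> VM" by (auto simp: A'_def V'_def)
      then have "real (card (V - A)) \<le> real (card (V' - A' \<inter> V')) + real (card VA) + real (card VM)"
        using finA finM by (intro card_le_split3) (auto simp: V'_def)
      then show ?thesis by linarith
    qed
    have d: "real (card P) - real (card Q) \<le> \<sigma> * n + 2 * (\<sigma> * n) + (real k + real (k + 1) * \<sigma> * n)"
      if "card P \<le> card P' + card VA" "card Q' \<le> card Q + card VA + card VM" "real (card P') - real (card Q') \<le> \<sigma> * n"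
      for P Q P' Q' :: "'a set"
    proof -
      have "real (card P) \<le> real (card P') + real (card VA)" "real (card Q') \<le> real (card Q) + real (card VA) + real (card VM)"
        using that by linarith+
      then show ?thesis using that(3) cVA VMn by linarith
    qed
    have fin: "4 * k * card P \<le> 4 * k * card Q + card V'"
      if "real (card P) - real (card Q) \<le> \<sigma> * n + 2 * (\<sigma> * n) + (real k + real (k + 1) * \<sigma> * n)" for P Q :: "'a set"
    proof -
      have "4 * real k * (real (card P) - real (card Q)) \<le> 4 * real k * (\<sigma> * n + 2 * (\<sigma> * n) + (real k + real (k + 1) * \<sigma> * n))"
        using that by (intro mult_left_mono) auto
      also have "\<dots> \<le> real (card V')" using tiny V'h by linarith
      finally have "real (4 * k * card P) \<le> real (4 * k * card Q + card V')" by (simp add: algebra_simps)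
      then show ?thesis by (rule of_nat_le_iff[THEN iffD1])
    qed
    show "4 * k * card (A' \<inter> V') \<le> 4 * k * card (V' - A' \<inter> V') + card V'"
      by (rule fin[OF d[OF c1 c4]]) (use bal in linarith)
    show "4 * k * card (V' - A' \<inter> V') \<le> 4 * k * card (A' \<inter> V') + card V'"
      by (rule fin[OF d[OF c2 c3]]) (use bal in linarith)
  qed (use k3 cV' in auto)
  have "rpm k H (XM \<union> X') (VM \<union> V')"
    by (rule rpm_Un[OF M(1) rpm']) (auto simp: X'_def V'_def)
  moreover have "XM \<union> X' = X" "VM \<union> V' = V" using M by (auto simp: X'_def V'_def)
  ultimately show ?thesis by simp
qed

end

subsection \<open>Degrees in the extremal graphs\<close>

lemma hdeg_alt:
  assumes "finite V" "kgraph_on V k H" "S \<in> [V]\<^bsup>l\<^esup>" "l + r = k"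
  shows "{T. S \<inter> T = {} \<and> S \<union> T \<in> H} = {T \<in> Pow V. card T = r \<and> S \<inter> T = {} \<and> S \<union> T \<in> H}"
proof -
  have S: "S \<subseteq> V" "finite S" "card S = l" using assms(3) by (auto simp: nsets_def)
  have "T \<subseteq> V \<and> card T = r" if T: "S \<inter> T = {}" "S \<union> T \<in> H" for T
  proof -
    have ST: "S \<union> T \<subseteq> V" "finite (S \<union> T)" "card (S \<union> T) = k" using assms(2) T(2) by (auto simp: kgraph_on_def nsets_def)
    then have "card (S \<union> T) = card S + card T" using T(1) by (intro card_Un_disjoint) auto
    then show ?thesis using ST S assms(4) by auto
  qed
  then show ?thesis by blast
qed

lemma card_orderings: "finite T \<Longrightarrow> card {xs. set xs = T \<and> distinct xs} = fact (card T)"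
proof -
  assume f: "finite T"
  have "{xs. set xs = T \<and> distinct xs} = {xs. length xs = card T \<and> distinct xs \<and> set xs \<subseteq> T}"
  proof (rule Collect_cong, rule iffI)
    fix xs assume "length xs = card T \<and> distinct xs \<and> set xs \<subseteq> T"
    then show "set xs = T \<and> distinct xs" using f by (simp add: card_subset_eq distinct_card)
  qed (auto simp: distinct_card)
  then show ?thesis using f by (simp add: card_lists_distinct_length_eq fact_prod)
qed

text \<open>An edge has \<open>l + r\<close> vertices, so a list of length \<open>r\<close>
  completing \<open>S\<close> to an edge is repetition-free and disjoint from \<open>S\<close>; each
  neighbour has \<open>fact r\<close> orderings.\<close>

lemma card_lists_hdeg:
  assumes V: "finite V" and H: "kgraph_on V k H" and S: "S \<in> [V]\<^bsup>l\<^esup>" and lr: "l + r = k"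
  shows "card {T \<in> nlists V r. S \<union> set T \<in> H} = fact r * hdeg H S"
proof -
  let ?\<T> = "{T. S \<inter> T = {} \<and> S \<union> T \<in> H}"
  have Sp: "S \<subseteq> V" "finite S" "card S = l" using S by (auto simp: nsets_def)
  have fT: "finite ?\<T>" unfolding hdeg_alt[OF V H S lr] using V by simp
  have T: "finite T \<and> card T = r \<and> T \<subseteq> V" if "T \<in> ?\<T>" for T
    using that V finite_subset[of T V] unfolding hdeg_alt[OF V H S lr] by auto
  have eq: "{T \<in> nlists V r. S \<union> set T \<in> H} = (\<Union>T\<in>?\<T>. {xs. set xs = T \<and> distinct xs})"
  proof (rule set_eqI)
    fix xs
    show "xs \<in> {T \<in> nlists V r. S \<union> set T \<in> H} \<longleftrightarrow> xs \<in> (\<Union>T\<in>?\<T>. {xs. set xs = T \<and> distinct xs})"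
    proof
      assume xs: "xs \<in> {T \<in> nlists V r. S \<union> set T \<in> H}"
      then have c: "card (S \<union> set xs) = l + r" "length xs = r" using H lr by (auto simp: kgraph_on_def nsets_def nlists_def)
      have "card (S \<union> set xs) + card (S \<inter> set xs) = card S + card (set xs)"
        using card_Un_Int[OF Sp(2) finite_set, of xs] by simp
      moreover have "card (set xs) \<le> r" using card_length[of xs] c by simp
      ultimately have "card (set xs) = r" "card (S \<inter> set xs) = 0" using c Sp(3) by linarith+
      then have "distinct xs" "S \<inter> set xs = {}" using c Sp(2) by (auto simp: card_distinct)
      then show "xs \<in> (\<Union>T\<in>?\<T>. {xs. set xs = T \<and> distinct xs})" using xs by auto
    next
      assume "xs \<in> (\<Union>T\<in>?\<T>. {xs. set xs = T \<and> distinct xs})"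
      then have xs: "set xs \<in> ?\<T>" "distinct xs" by auto
      then show "xs \<in> {T \<in> nlists V r. S \<union> set T \<in> H}"
        using T[OF xs(1)] distinct_card[OF xs(2)] by (auto simp: nlists_def)
    qed
  qed
  have "card {T \<in> nlists V r. S \<union> set T \<in> H} = (\<Sum>T\<in>?\<T>. card {xs. set xs = T \<and> distinct xs})"
    unfolding eq
  proof (rule card_UN_disjoint[OF fT])
    show "\<forall>T\<in>?\<T>. finite {xs. set xs = T \<and> distinct xs}"
    proof
      fix T assume "T \<in> ?\<T>"
      then have "finite T" using T by blast
      then show "finite {xs. set xs = T \<and> distinct xs}" by (rule finite_subset[OF _ finite_subset_distinct, rotated]) auto
    qed
  qed auto
  also have "\<dots> = (\<Sum>T\<in>?\<T>. fact r)" using T by (intro sum.cong) (auto simp: card_orderings)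
  also have "\<dots> = fact r * hdeg H S" by (simp add: hdeg_def mult.commute)
  finally show ?thesis .
qed

lemma finite_nsets: "finite V \<Longrightarrow> finite ([V]\<^bsup>l\<^esup>)"
  by (rule finite_subset[of _ "Pow V"]) (auto simp: nsets_def)

lemma nsets_ne: "finite V \<Longrightarrow> l \<le> card V \<Longrightarrow> [V]\<^bsup>l\<^esup> \<noteq> {}"
  using obtain_subset_with_card_n[of l V] by (auto simp: nsets_def)

lemma min_deg_le: "finite V \<Longrightarrow> S \<in> [V]\<^bsup>l\<^esup> \<Longrightarrow> min_deg V l H \<le> hdeg H S"
  unfolding min_deg_def by (intro Min_le) (auto simp: finite_nsets)

lemma min_deg_ex: "finite V \<Longrightarrow> l \<le> card V \<Longrightarrow> \<exists>S\<in>[V]\<^bsup>l\<^esup>. min_deg V l H = hdeg H S"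
proof -
  assume "finite V" "l \<le> card V"
  then have "min_deg V l H \<in> hdeg H ` [V]\<^bsup>l\<^esup>"
    unfolding min_deg_def by (intro Min_in) (simp_all add: finite_nsets nsets_ne)
  then show ?thesis by auto
qed

section \<open>Parity graphs with nearly equal parts\<close>

abbreviation pgr :: "nat \<Rightarrow> nat \<Rightarrow> 'a set \<Rightarrow> 'a set \<Rightarrow> 'a set set" where
  "pgr k i V A \<equiv> parity_graph k i A (V - A)"

lemma pgr_alt: "A \<subseteq> V \<Longrightarrow> pgr k i V A = {e \<in> [V]\<^bsup>k\<^esup>. card (e \<inter> A) mod 2 = i}"
  by (simp add: parity_graph_def Un_absorb1)

lemma kgraph_pgr: "A \<subseteq> V \<Longrightarrow> kgraph_on V k (pgr k i V A)"
  by (auto simp: pgr_alt kgraph_on_def)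

lemma min_deg_le_ext_delta:
  assumes "finite V" "ext_triple V k i A (V - A)"
  shows "min_deg V l (pgr k i V A) \<le> ext_delta V k l"
proof -
  have "ext_graphs V k \<subseteq> Pow (Pow V)"
    by (auto simp: ext_graphs_def ext_triple_def parity_graph_def nsets_def)
  then have "finite (ext_graphs V k)" by (rule finite_subset) (use assms(1) in simp)
  moreover have "pgr k i V A \<in> ext_graphs V k" using assms(2) by (auto simp: ext_graphs_def)
  ultimately show ?thesis unfolding ext_delta_def by (intro Max_ge) auto
qed

text \<open>The error terms over \<open>card V\<close> are 1 for the imbalance, \<open>r * r\<close>
  for lists with a repetition, and \<open>r * l\<close> for lists meeting \<open>S\<close>.\<close>

lemma pgr_degree_lists:
  assumes V: "finite V" and A: "A \<subseteq> V" and S: "S \<in> [V]\<^bsup>l\<^esup>" and lr: "l + r = k" "r \<ge> 1"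
    and d: "\<bar>real (card (V - A)) - real (card A)\<bar> \<le> 2" and n2: "card V \<ge> 2" and i: "i < 2"
  shows "(1 / 2 - real (1 + r * r + r * l) / real (card V)) * real (card V) ^ r
     \<le> real (card {T \<in> nlists V r. S \<union> set T \<in> pgr k i V A})"
proof -
  let ?n = "real (card V)"
  have npos: "?n > 0" and Vne: "V \<noteq> {}" using n2 by auto
  have Sp: "S \<subseteq> V" "finite S" "card S = l" using S by (auto simp: nsets_def)
  define b where "b \<longleftrightarrow> odd (card (S \<inter> A) + i)"
  let ?P = "{T \<in> nlists V r. npar A T = b}" and ?D = "{T \<in> nlists V r. \<not> distinct T}"
  let ?M = "{T \<in> nlists V r. set T \<inter> S \<noteq> {}}" and ?G = "{T \<in> nlists V r. S \<union> set T \<in> pgr k i V A}"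
  have "T \<in> ?G" if T: "T \<in> nlists V r" "npar A T = b" "distinct T" "set T \<inter> S = {}" for T
  proof -
    have "card (S \<union> set T) = card S + card (set T)" using Sp T(4) by (intro card_Un_disjoint) auto
    then have "card (S \<union> set T) = k" using Sp lr distinct_card[OF T(3)] length_nlists[OF T(1)] by simp
    moreover have "(S \<union> set T) \<inter> A = (S \<inter> A) \<union> (set T \<inter> A)" by auto
    then have "card ((S \<union> set T) \<inter> A) = card (S \<inter> A) + card (set T \<inter> A)"
      using Sp T(4) by (simp only:) (intro card_Un_disjoint, auto)
    moreover have "odd (card (set T \<inter> A)) = b" using npar_distinct[OF T(3), of A] T(2) by simp
    moreover have "i = 0 \<or> i = 1" using i by auto
    ultimately have "i = 0 \<and> even (card ((S \<union> set T) \<inter> A)) \<or> i = 1 \<and> odd (card ((S \<union> set T) \<inter> A))"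
      by (auto simp: b_def)
    then have "card ((S \<union> set T) \<inter> A) mod 2 = i"
      by (auto simp: even_iff_mod_2_eq_zero odd_iff_mod_2_eq_one)
    then show ?thesis
      using T Sp \<open>card (S \<union> set T) = k\<close> set_nlists[OF T(1)] by (auto simp: pgr_alt[OF A] nsets_def)
  qed
  then have "?P \<subseteq> ?G \<union> ?D \<union> ?M" by blast
  then have 1: "real (card ?P) \<le> real (card ?G) + real (card ?D) + real (card ?M)"
    using V by (intro card_le_split3) auto
  have 2: "real (card ?D) \<le> real (r * r) / ?n * ?n ^ r" by (rule card_nlists_not_distinct_real[OF V Vne])
  have 3: "real (card ?M) \<le> real r * real (card S) / ?n * ?n ^ r" by (rule card_nlists_meeting_real[OF V Sp(2) Vne])
  let ?d = "real (card (V - A)) - real (card A)"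
  have 4: "2 * real (card ?P) \<ge> ?n ^ r - \<bar>?d\<bar> ^ r"
  proof -
    have "\<bar>?d ^ r\<bar> = \<bar>?d\<bar> ^ r" by (rule power_abs)
    then show ?thesis using card_npar[OF V A, of r b] by (auto split: if_splits)
  qed
  have 5: "\<bar>?d\<bar> ^ r \<le> 2 / ?n * ?n ^ r"
  proof -
    have "\<bar>?d\<bar> ^ r \<le> 2 ^ r" using d by (intro power_mono) auto
    also have "(2::real) ^ r = 2 * 2 ^ (r - 1)" using lr(2) by (metis power_eq_if not_one_le_zero)
    also have "\<dots> \<le> 2 * ?n ^ (r - 1)" using n2 by (intro mult_left_mono power_mono) auto
    also have "\<dots> = 2 / ?n * ?n ^ r" using lr(2) npos by (simp add: power_eq_if)
    finally show ?thesis .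
  qed
  have "(1 / 2 - real (1 + r * r + r * l) / ?n) * ?n ^ r = ?n ^ r / 2 - (1 / ?n * ?n ^ r) - real (r * r) / ?n * ?n ^ r - real r * real l / ?n * ?n ^ r"
    by (simp add: add_divide_distrib algebra_simps)
  moreover have "2 / ?n * ?n ^ r = 2 * (1 / ?n * ?n ^ r)" by simp
  ultimately show ?thesis using 1 2 3 4 5 unfolding Sp(3) by linarith
qed

text \<open>A set \<open>A\<close> of odd size near half of \<open>V\<close> makes its even parity
  graph extremal, so \<open>ext_delta\<close> is at least the minimum degree of that graph.
  Adjusting the parity costs an imbalance of at most 2.\<close>

lemma degree_from_ext_delta:
  assumes V: "finite V" and n2: "card V \<ge> 2" and lr: "l + r = k" "r \<ge> 1" and lV: "l \<le> card V"
    and H: "kgraph_on V k H" "min_deg V l H > ext_delta V k l" and S: "S \<in> [V]\<^bsup>l\<^esup>"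
  shows "(1 / 2 - real (1 + r * r + r * l) / real (card V)) * real (card V) ^ r
     \<le> real (card {T \<in> nlists V r. S \<union> set T \<in> H})"
proof -
  define a where "a = (if odd (card V div 2) then card V div 2 else card V div 2 + 1)"
  have a: "odd a" "a \<le> card V" "2 * a \<le> card V + 2" "card V \<le> 2 * a + 2"
    using n2 by (auto simp: a_def)
  obtain A where A: "A \<subseteq> V" "card A = a" using obtain_subset_with_card_n[OF a(2)] by blast
  have cVA: "real (card (V - A)) = real (card V) - real a"
    using A V a(2) by (simp add: card_Diff_subset finite_subset of_nat_diff)
  have ext: "ext_triple V k 0 A (V - A)" using A a(1) by (auto simp: ext_triple_def odd_iff_mod_2_eq_one)
  obtain S0 where S0: "S0 \<in> [V]\<^bsup>l\<^esup>" "min_deg V l (pgr k 0 V A) = hdeg (pgr k 0 V A) S0"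
    using min_deg_ex[OF V lV] by blast
  have "hdeg (pgr k 0 V A) S0 \<le> hdeg H S"
    using min_deg_le_ext_delta[OF V ext, of l] S0(2) H(2) min_deg_le[OF V S, of H] by linarith
  then have "card {T \<in> nlists V r. S0 \<union> set T \<in> pgr k 0 V A} \<le> card {T \<in> nlists V r. S \<union> set T \<in> H}"
    unfolding card_lists_hdeg[OF V kgraph_pgr[OF A(1)] S0(1) lr(1)] card_lists_hdeg[OF V H(1) S lr(1)] by simp
  moreover have "(1 / 2 - real (1 + r * r + r * l) / real (card V)) * real (card V) ^ r
     \<le> real (card {T \<in> nlists V r. S0 \<union> set T \<in> pgr k 0 V A})"
  proof (rule pgr_degree_lists[OF V A(1) S0(1) lr _ n2])
    have "real (2 * a) \<le> real (card V + 2)" "real (card V) \<le> real (2 * a + 2)" using a(3,4) by (intro of_nat_mono; simp)+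
    then show "\<bar>real (card (V - A)) - real (card A)\<bar> \<le> 2" unfolding cVA A(2) by simp
  qed simp
  ultimately show ?thesis by linarith
qed

text \<open>Almost every choice of \<open>l - 1\<close> further entries completes \<open>v\<close>
  to an \<open>l\<close>-set, to which the degree condition applies for the remaining
  \<open>r\<close> entries.\<close>

lemma degree1_from_degree:
  fixes \<theta> :: real
  assumes V: "finite V" "V \<noteq> {}" and l: "l \<ge> 1" "l + r = k" and \<theta>: "0 \<le> 1 / 2 - \<theta>" and v: "v \<in> V"
    and big: "real (l * l) / real (card V) \<le> \<theta>"
    and deg: "\<And>S. S \<in> [V]\<^bsup>l\<^esup> \<Longrightarrow> (1 / 2 - \<theta>) * real (card V) ^ r \<le> real (card {T \<in> nlists V r. S \<union> set T \<in> H})"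
  shows "(1 / 2 - 2 * \<theta>) * real (card V) ^ (k - 1) \<le> real (card {S \<in> nlists V (k - 1). insert v (set S) \<in> H})"
proof -
  let ?n = "real (card V)" and ?L = "l - 1"
  have k1: "k - 1 = ?L + r" using l by simp
  have npos: "?n > 0" using V by (simp add: card_gt_0_iff)
  let ?G = "{S \<in> nlists V ?L. distinct (v # S)}"
  let ?D = "{S \<in> nlists V ?L. \<not> distinct S}" and ?M = "{S \<in> nlists V ?L. set S \<inter> {v} \<noteq> {}}"
  have "nlists V ?L \<subseteq> ?G \<union> ?D \<union> ?M" by auto
  then have "real (card (nlists V ?L)) \<le> real (card ?G) + real (card ?D) + real (card ?M)"
    using V by (intro card_le_split3) auto
  moreover have "real (card ?D) \<le> real (?L * ?L) / ?n * ?n ^ ?L" by (rule card_nlists_not_distinct_real[OF V])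
  moreover have "real (card ?M) \<le> real ?L * real (card {v}) / ?n * ?n ^ ?L" by (rule card_nlists_meeting_real[OF V(1) _ V(2)]) simp
  moreover have "real (?L * ?L) / ?n * ?n ^ ?L + real ?L * real (card {v}) / ?n * ?n ^ ?L \<le> \<theta> * ?n ^ ?L"
  proof -
    have "?L * ?L + ?L \<le> l * l" using l(1) by (cases l) auto
    then have "real (?L * ?L + ?L) / ?n \<le> real (l * l) / ?n" by (intro divide_right_mono of_nat_mono) auto
    then have "real (?L * ?L + ?L) / ?n * ?n ^ ?L \<le> \<theta> * ?n ^ ?L" using big by (intro mult_right_mono) auto
    then show ?thesis by (simp add: add_divide_distrib distrib_right)
  qed
  ultimately have G: "(1 - \<theta>) * ?n ^ ?L \<le> real (card ?G)"
    using V by (simp add: card_nlists algebra_simps)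
  have "card {S \<in> nlists V (k - 1). insert v (set S) \<in> H} = (\<Sum>S\<in>nlists V ?L. card {T \<in> nlists V r. insert v (set (S @ T)) \<in> H})"
    unfolding k1 by (rule card_nlists_append_filter[OF V(1)])
  then have eq: "real (card {S \<in> nlists V (k - 1). insert v (set S) \<in> H}) = (\<Sum>S\<in>nlists V ?L. real (card {T \<in> nlists V r. insert v (set (S @ T)) \<in> H}))"
    by simp
  have "(1 / 2 - 2 * \<theta>) * ?n ^ (k - 1) \<le> ((1 - \<theta>) * (1 / 2 - \<theta>)) * ?n ^ (k - 1)"
  proof (rule mult_right_mono)
    have "0 \<le> \<theta>" using big npos by (meson divide_nonneg_pos of_nat_0_le_iff order_trans)
    then have "0 \<le> \<theta> / 2 + \<theta> * \<theta>" by simp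
    moreover have "(1 - \<theta>) * (1 / 2 - \<theta>) = 1 / 2 - 2 * \<theta> + (\<theta> / 2 + \<theta> * \<theta>)" by (simp add: field_simps)
    ultimately show "1 / 2 - 2 * \<theta> \<le> (1 - \<theta>) * (1 / 2 - \<theta>)" by linarith
  qed simp
  also have "\<dots> = ((1 - \<theta>) * ?n ^ ?L) * ((1 / 2 - \<theta>) * ?n ^ r)" unfolding k1 power_add by simp
  also have "\<dots> \<le> real (card ?G) * ((1 / 2 - \<theta>) * ?n ^ r)" using G \<theta> by (intro mult_right_mono) auto
  also have "\<dots> = (\<Sum>S\<in>?G. (1 / 2 - \<theta>) * ?n ^ r)" by simp
  also have "\<dots> \<le> (\<Sum>S\<in>?G. real (card {T \<in> nlists V r. insert v (set (S @ T)) \<in> H}))"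
  proof (rule sum_mono)
    fix S assume S: "S \<in> ?G"
    then have "card (insert v (set S)) = l" using distinct_card[of "v # S"] l(1) by (auto simp: nlists_def)
    then have "insert v (set S) \<in> [V]\<^bsup>l\<^esup>" using S v by (auto simp: nlists_def nsets_def)
    from deg[OF this] show "(1 / 2 - \<theta>) * ?n ^ r \<le> real (card {T \<in> nlists V r. insert v (set (S @ T)) \<in> H})"
      by simp
  qed
  also have "\<dots> \<le> (\<Sum>S\<in>nlists V ?L. real (card {T \<in> nlists V r. insert v (set (S @ T)) \<in> H}))"
    using V by (intro sum_mono2) auto
  finally show ?thesis unfolding eq .
qed

subsection \<open>An edge of the wrong parity\<close>

lemma hdeg_pgr:
  assumes V: "finite V" and A: "A \<subseteq> V" and S: "S \<in> [V]\<^bsup>l\<^esup>" and lr: "l + r = k"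
  shows "hdeg (pgr k i V A) S = card {T \<in> [V - S]\<^bsup>r\<^esup>. (card (S \<inter> A) + card (T \<inter> A)) mod 2 = i}"
proof -
  have Sp: "S \<subseteq> V" "finite S" "card S = l" using S by (auto simp: nsets_def)
  have "(S \<inter> T = {} \<and> S \<union> T \<in> pgr k i V A) \<longleftrightarrow> (T \<in> [V - S]\<^bsup>r\<^esup> \<and> (card (S \<inter> A) + card (T \<inter> A)) mod 2 = i)" for T
  proof (cases "S \<inter> T = {} \<and> finite T")
    case True
    have "card (S \<union> T) = l + card T" using True Sp by (simp add: card_Un_disjoint)
    moreover have "(S \<union> T) \<inter> A = (S \<inter> A) \<union> (T \<inter> A)" by auto
    moreover have "card ((S \<inter> A) \<union> (T \<inter> A)) = card (S \<inter> A) + card (T \<inter> A)"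
      using True Sp by (intro card_Un_disjoint) auto
    ultimately show ?thesis using True Sp lr by (auto simp: pgr_alt[OF A] nsets_def)
  next
    case False
    then show ?thesis by (auto simp: pgr_alt[OF A] nsets_def)
  qed
  then show ?thesis by (simp add: hdeg_def)
qed

text \<open>\<open>p\<close> preserves \<open>A\<close> and is thus an automorphism of the parity
  graph; one inequality is all that is needed below.\<close>

lemma hdeg_pgr_image:
  assumes V: "finite V" and A: "A \<subseteq> V" and S: "S \<in> [V]\<^bsup>l\<^esup>" and lr: "l + r = k"
    and p: "bij_betw p V V" "p ` A = A"
  shows "hdeg (pgr k i V A) S \<le> hdeg (pgr k i V A) (p ` S)"
proof -
  have inj: "inj_on p V" and pV: "p ` V = V" using p(1) by (auto simp: bij_betw_def)
  have Sp: "S \<subseteq> V" "finite S" "card S = l" using S by (auto simp: nsets_def)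
  have pc: "card (p ` T \<inter> A) = card (T \<inter> A)" "card (p ` T) = card T" "p ` T \<subseteq> V" if "T \<subseteq> V" for T
  proof -
    have "p ` T \<inter> A = p ` (T \<inter> A)" using inj_on_image_Int[OF inj that A] p(2) by simp
    moreover have "card (p ` (T \<inter> A)) = card (T \<inter> A)"
      using that by (intro card_image inj_on_subset[OF inj]) auto
    ultimately show "card (p ` T \<inter> A) = card (T \<inter> A)" by simp
    show "card (p ` T) = card T" using that by (intro card_image inj_on_subset[OF inj])
    show "p ` T \<subseteq> V" using that pV by blast
  qed
  have pS: "p ` S \<in> [V]\<^bsup>l\<^esup>" using pc[OF Sp(1)] Sp by (auto simp: nsets_def)
  show ?thesis
    unfolding hdeg_pgr[OF V A S lr] hdeg_pgr[OF V A pS lr]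
  proof (rule card_inj_on_le[of "(`) p"])
    show "inj_on ((`) p) {T \<in> [V - S]\<^bsup>r\<^esup>. (card (S \<inter> A) + card (T \<inter> A)) mod 2 = i}"
      by (rule inj_on_subset[OF inj_on_image_Pow[OF inj]]) (auto simp: nsets_def)
    show "(`) p ` {T \<in> [V - S]\<^bsup>r\<^esup>. (card (S \<inter> A) + card (T \<inter> A)) mod 2 = i}
        \<subseteq> {T \<in> [V - p ` S]\<^bsup>r\<^esup>. (card (p ` S \<inter> A) + card (T \<inter> A)) mod 2 = i}"
    proof (rule image_subsetI)
      fix T assume T: "T \<in> {T \<in> [V - S]\<^bsup>r\<^esup>. (card (S \<inter> A) + card (T \<inter> A)) mod 2 = i}"
      then have TV: "T \<subseteq> V" "T \<inter> S = {}" "finite T" "card T = r" by (auto simp: nsets_def)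
      have "p ` T \<inter> p ` S = {}" using inj_on_image_Int[OF inj TV(1) Sp(1)] TV(2) by simp
      then show "p ` T \<in> {T \<in> [V - p ` S]\<^bsup>r\<^esup>. (card (p ` S \<inter> A) + card (T \<inter> A)) mod 2 = i}"
        using T TV pc[OF TV(1)] pc[OF Sp(1)] by (auto simp: nsets_def)
    qed
  qed (use V in \<open>simp add: finite_nsets\<close>)
qed

lemma hdeg_pgr_sum:
  assumes V: "finite V" and A: "A \<subseteq> V" and S: "S \<in> [V]\<^bsup>l\<^esup>" and lr: "l + r = k"
  shows "hdeg (pgr k 0 V A) S + hdeg (pgr k 1 V A) S = card ([V - S]\<^bsup>r\<^esup>)"
proof -
  let ?Q = "\<lambda>i. {T \<in> [V - S]\<^bsup>r\<^esup>. (card (S \<inter> A) + card (T \<inter> A)) mod 2 = i}"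
  have "[V - S]\<^bsup>r\<^esup> = ?Q 0 \<union> ?Q 1" by auto
  moreover have "card (?Q 0 \<union> ?Q 1) = card (?Q 0) + card (?Q 1)"
    using V by (intro card_Un_disjoint) (auto simp: finite_nsets)
  ultimately show ?thesis unfolding hdeg_pgr[OF V A S lr] by simp
qed

text \<open>Moving one vertex across a partition of the wrong parity changes the minimum degree of one of
  the two parity graphs in the favourable direction: sets containing the moved vertex just swap the
  two graphs, sets meeting the enlarged part are images of those under a transposition, and the
  remaining sets all have the same degree.\<close>

lemma min_deg_move_vertex:
  assumes V: "finite V" and B: "B \<subseteq> V" and b: "b \<in> V - B" and lr: "l + r = k"
    and d: "\<And>i. i < 2 \<Longrightarrow> d \<le> min_deg V l (pgr k i V B)"
  shows "\<exists>i<2. \<forall>S\<in>[V]\<^bsup>l\<^esup>. d \<le> hdeg (pgr k i V (insert b B)) S"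
proof -
  let ?B = "insert b B"
  have B': "?B \<subseteq> V" using B b by auto
  have dS: "d \<le> hdeg (pgr k i V B) S" if "i < 2" "S \<in> [V]\<^bsup>l\<^esup>" for i S
    using d[OF that(1)] min_deg_le[OF V that(2), of "pgr k i V B"] by linarith
  have with_b: "d \<le> hdeg (pgr k i V ?B) S" if i: "i < 2" and S: "S \<in> [V]\<^bsup>l\<^esup>" "b \<in> S" for i S
  proof -
    have fS: "finite S" using S(1) by (auto simp: nsets_def)
    have "S \<inter> ?B = insert b (S \<inter> B)" using S(2) by auto
    then have c: "card (S \<inter> ?B) = card (S \<inter> B) + 1" using b fS by simp
    have "T \<inter> ?B = T \<inter> B" if "T \<in> [V - S]\<^bsup>r\<^esup>" for T using that S(2) by (auto simp: nsets_def)
    moreover have "(card (S \<inter> B) + 1 + x) mod 2 = i \<longleftrightarrow> (card (S \<inter> B) + x) mod 2 = 1 - i" for x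
    proof -
      have "i = 0 \<or> i = 1" using i by auto
      then show ?thesis by (elim disjE) (simp_all, presburger+)
    qed
    ultimately have "{T \<in> [V - S]\<^bsup>r\<^esup>. (card (S \<inter> ?B) + card (T \<inter> ?B)) mod 2 = i} = {T \<in> [V - S]\<^bsup>r\<^esup>. (card (S \<inter> B) + card (T \<inter> B)) mod 2 = 1 - i}"
      unfolding c by (intro Collect_cong) (metis (no_types, lifting))
    then have "hdeg (pgr k i V ?B) S = hdeg (pgr k (1 - i) V B) S"
      unfolding hdeg_pgr[OF V B' S(1) lr] hdeg_pgr[OF V B S(1) lr] by simp
    then show ?thesis using dS[of "1 - i" S] S(1) by simp
  qed
  have with_B: "d \<le> hdeg (pgr k i V ?B) S" if i: "i < 2" and S: "S \<in> [V]\<^bsup>l\<^esup>" "S \<inter> ?B \<noteq> {}" for i S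
  proof (cases "b \<in> S")
    case True then show ?thesis by (rule with_b[OF i S(1)])
  next
    case False
    then obtain a where a: "a \<in> S" "a \<in> B" using S(2) by auto
    define p where "p x = (if x = a then b else if x = b then a else x)" for x
    have ab: "a \<noteq> b" "a \<in> V" "b \<in> V" using a b B by auto
    have pp: "p (p x) = x" for x by (auto simp: p_def)
    have pV: "p x \<in> V" if "x \<in> V" for x using that ab by (auto simp: p_def)
    have bij: "bij_betw p V V" by (rule bij_betwI[of _ _ _ p]) (use pp pV in auto)
    have pB: "p ` ?B = ?B" using a ab by (auto simp: p_def image_iff)
    have Sp: "S \<subseteq> V" "finite S" "card S = l" using S by (auto simp: nsets_def)
    have "card (p ` S) = card S" by (rule card_image) (metis inj_onI pp)
    then have pS: "p ` S \<in> [V]\<^bsup>l\<^esup>" using Sp pV by (auto simp: nsets_def)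
    have "b \<in> p ` S" using a by (auto simp: p_def image_iff)
    then have "d \<le> hdeg (pgr k i V ?B) (p ` S)" by (rule with_b[OF i pS])
    also have "\<dots> \<le> hdeg (pgr k i V ?B) (p ` (p ` S))" by (rule hdeg_pgr_image[OF V B' pS lr bij pB])
    also have "p ` (p ` S) = S" by (simp add: image_image pp)
    finally show ?thesis .
  qed
  show ?thesis
  proof (cases "\<exists>S\<in>[V]\<^bsup>l\<^esup>. S \<inter> ?B = {}")
    case False
    then show ?thesis using with_B[of 0] by (intro exI[of _ 0]) auto
  next
    case True
    then obtain S0 where S0: "S0 \<in> [V]\<^bsup>l\<^esup>" "S0 \<inter> ?B = {}" by blast
    \<comment> \<open>For a set missing the enlarged part, the two degrees have the same sum as
      before the move, so one of them is still at least \<open>d\<close>. This determines which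
      parity graph is taken.\<close>
    have "hdeg (pgr k 0 V ?B) S0 + hdeg (pgr k 1 V ?B) S0 = hdeg (pgr k 0 V B) S0 + hdeg (pgr k 1 V B) S0"
      unfolding hdeg_pgr_sum[OF V B' S0(1) lr] hdeg_pgr_sum[OF V B S0(1) lr] ..
    then have "d \<le> hdeg (pgr k 0 V ?B) S0 \<or> d \<le> hdeg (pgr k 1 V ?B) S0"
      using dS[of 0 S0] dS[of 1 S0] S0(1) by linarith
    then obtain i where i: "i < 2" "d \<le> hdeg (pgr k i V ?B) S0" by (metis one_less_numeral_iff semiring_norm(76) zero_less_numeral)
    have "d \<le> hdeg (pgr k i V ?B) S" if S: "S \<in> [V]\<^bsup>l\<^esup>" for S
    proof (cases "S \<inter> ?B = {}")
      case True
      have Sp: "S \<subseteq> V" "finite S" "card S = l" "S0 \<subseteq> V" "finite S0" "card S0 = l" using S S0 by (auto simp: nsets_def)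
      let ?C = "V - ?B"
      have SC: "S \<subseteq> ?C" "S0 \<subseteq> ?C" using True S0(2) Sp by auto
      obtain f where f: "bij_betw f S0 S" using finite_same_card_bij[of S0 S] Sp by auto
      have "card (?C - S0) = card (?C - S)" using SC Sp by (simp add: card_Diff_subset)
      then obtain g where g: "bij_betw g (?C - S0) (?C - S)" using finite_same_card_bij[of "?C - S0" "?C - S"] V by auto
      define p where "p x = (if x \<in> S0 then f x else if x \<in> ?B then x else g x)" for x
      have p1: "bij_betw p S0 S" using f by (rule bij_betw_cong[THEN iffD1, rotated]) (auto simp: p_def)
      have p2: "bij_betw p (?C - S0) (?C - S)" using g by (rule bij_betw_cong[THEN iffD1, rotated]) (auto simp: p_def)
      have pid: "p x = x" if "x \<in> ?B" for x using that S0(2) by (auto simp: p_def)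
      have p3: "bij_betw p ?B ?B" unfolding bij_betw_def using pid by (auto simp: inj_on_def)
      have "bij_betw p (S0 \<union> (?C - S0)) (S \<union> (?C - S))" by (rule bij_betw_combine[OF p1 p2]) auto
      then have "bij_betw p ((S0 \<union> (?C - S0)) \<union> ?B) ((S \<union> (?C - S)) \<union> ?B)"
        by (rule bij_betw_combine[OF _ p3]) (use SC in auto)
      moreover have "(S0 \<union> (?C - S0)) \<union> ?B = V" "(S \<union> (?C - S)) \<union> ?B = V" using SC B' by auto
      ultimately have pV: "bij_betw p V V" by simp
      have "p ` ?B = ?B" using p3 by (simp only: bij_betw_def)
      from hdeg_pgr_image[OF V B' S0(1) lr pV this, of i] show ?thesis
        using i(2) p1 by (simp add: bij_betw_def)
    qed (use with_B[OF i(1) S] in blast)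
    then show ?thesis using i(1) by blast
  qed
qed

text \<open>If there is none, every colour lies in one of the parity graphs of \<open>B\<close>. Its
  minimum degree then exceeds \<open>ext_delta\<close>, so no parity graph that occurs is
  extremal.\<close>

lemma ex_wrong_edge:
  fixes X :: "'c set" and V :: "'a set"
  assumes V: "finite V" and X: "finite X" "X \<noteq> {}" and cV: "card V = k * card X" and lr: "l + r = k" and k: "k \<ge> 1" and lV: "l \<le> card V"
    and H: "\<And>x. x \<in> X \<Longrightarrow> kgraph_on V k (H x) \<and> min_deg V l (H x) > ext_delta V k l"
    and B: "B \<subseteq> V" and par: "even (card B) \<noteq> even (card {x \<in> X. s x})"
  shows "\<exists>x\<in>X. \<exists>e\<in>H x. odd (card (e \<inter> B)) \<noteq> s x"
proof (rule ccontr)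
  assume neg: "\<not> ?thesis"
  let ?m = "card X"
  have m: "card V div k = ?m" using cV k by simp
  have sub: "H x \<subseteq> pgr k (if s x then 1 else 0) V B" if "x \<in> X" for x
  proof
    fix e assume e: "e \<in> H x"
    then have "odd (card (e \<inter> B)) = s x" using neg that by blast
    moreover have "e \<in> [V]\<^bsup>k\<^esup>" using H[OF that] e by (auto simp: kgraph_on_def)
    ultimately show "e \<in> pgr k (if s x then 1 else 0) V B"
      by (auto simp: pgr_alt[OF B] even_iff_mod_2_eq_zero odd_iff_mod_2_eq_one)
  qed
  have D: "ext_delta V k l < min_deg V l (pgr k (if s x then 1 else 0) V B)" if x: "x \<in> X" for x
  proof -
    obtain S where S: "S \<in> [V]\<^bsup>l\<^esup>" "min_deg V l (pgr k (if s x then 1 else 0) V B) = hdeg (pgr k (if s x then 1 else 0) V B) S"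
      using min_deg_ex[OF V lV] by blast
    have "finite {T. S \<inter> T = {} \<and> S \<union> T \<in> pgr k (if s x then 1 else 0) V B}"
      unfolding hdeg_alt[OF V kgraph_pgr[OF B] S(1) lr] using V by simp
    then have "hdeg (H x) S \<le> hdeg (pgr k (if s x then 1 else 0) V B) S"
      unfolding hdeg_def using sub[OF x] by (intro card_mono) auto
    then show ?thesis using H[OF x] min_deg_le[OF V S(1), of "H x"] S(2) by linarith
  qed
  have no_ext: False if "ext_triple V k (if s x then 1 else 0) B (V - B)" "x \<in> X" for x
    using D[OF that(2)] min_deg_le_ext_delta[OF V that(1), of l] by linarith
  have ext_iff: "ext_triple V k i C (V - C) \<longleftrightarrow> (i = 0 \<or> i = 1) \<and> (i * ?m) mod 2 \<noteq> card C mod 2" if "C \<subseteq> V" for i C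
    using that by (auto simp: ext_triple_def m)
  show False
  \<comment> \<open>With a single parity, the failing count says precisely that the parity graph is
    extremal.\<close>
  proof (cases "\<exists>c. \<forall>x\<in>X. s x = c")
    case True
    then obtain c where c: "\<And>x. x \<in> X \<Longrightarrow> s x = c" by blast
    obtain x where x: "x \<in> X" using X by blast
    have "{x \<in> X. s x} = (if c then X else {})" using c by auto
    then have "even (card B) \<noteq> even (if c then ?m else 0)" using par by simp
    then have "ext_triple V k (if s x then 1 else 0) B (V - B)"
      unfolding ext_iff[OF B] using c[OF x] by (auto simp: even_iff_mod_2_eq_zero odd_iff_mod_2_eq_one split: if_splits)
    then show False using no_ext x by blast
  next
    case False
    obtain x where x: "x \<in> X" "s x" using False by blast
    obtain y where y: "y \<in> X" "\<not> s y" using False by blast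
    have "\<not> ext_triple V k 0 B (V - B)" using no_ext[of y] y by auto
    \<comment> \<open>With both parities present, neither parity graph of \<open>B\<close> is
      extremal, so \<open>card B\<close> and the number of colours are even. A set of odd size is
      then extremal for both parities.\<close>
    then have eB: "even (card B)" unfolding ext_iff[OF B] by (simp add: even_iff_mod_2_eq_zero)
    have "\<not> ext_triple V k 1 B (V - B)" using no_ext[of x] x by auto
    then have em: "even ?m" using eB unfolding ext_iff[OF B] by (simp add: even_iff_mod_2_eq_zero)
    have D2: "ext_delta V k l + 1 \<le> min_deg V l (pgr k i V B)" if "i < 2" for i
    proof -
      have "i = 0 \<or> i = 1" using that by auto
      then show ?thesis using D[OF x(1)] D[OF y(1)] x(2) y(2) by auto
    qed
    show False
    proof (cases "B = V")
      case True
      \<comment> \<open>There is no vertex to move, but all edges meet \<open>V\<close> in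
        \<open>k\<close> vertices, so one of the two parity graphs is empty and has minimum degree
        0.\<close>
      define i where "i = 1 - k mod 2"
      have "e \<notin> pgr k i V B" for e
      proof
        assume "e \<in> pgr k i V B"
        then have e: "e \<subseteq> V" "card e = k" "card (e \<inter> B) mod 2 = i" by (auto simp: pgr_alt[OF B] nsets_def)
        then have "card (e \<inter> B) = k" using True by (simp add: Int_absorb2)
        then show False using e(3) by (simp add: i_def) presburger
      qed
      then have "pgr k i V B = {}" by blast
      moreover obtain S where "min_deg V l (pgr k i V B) = hdeg (pgr k i V B) S" using min_deg_ex[OF V lV] by blast
      ultimately have "min_deg V l (pgr k i V B) = 0" by (simp add: hdeg_def)
      moreover have "i < 2" unfolding i_def by linarith
      ultimately show False using D2[of i] by simp
    next
      case False
      then obtain b where b: "b \<in> V - B" using B by blast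
      have B': "insert b B \<subseteq> V" using B b by auto
      from min_deg_move_vertex[OF V B b lr D2] obtain i where
        i: "i < 2" "\<And>S. S \<in> [V]\<^bsup>l\<^esup> \<Longrightarrow> ext_delta V k l + 1 \<le> hdeg (pgr k i V (insert b B)) S" by blast
      have "odd (card (insert b B))" using eB b finite_subset[OF B V] by simp
      moreover have "even (i * ?m)" using em by simp
      ultimately have "ext_triple V k i (insert b B) (V - insert b B)"
        unfolding ext_iff[OF B'] using i(1) by (auto simp: even_iff_mod_2_eq_zero odd_iff_mod_2_eq_one)
      then have "min_deg V l (pgr k i V (insert b B)) \<le> ext_delta V k l" by (rule min_deg_le_ext_delta[OF V])
      moreover obtain S where "S \<in> [V]\<^bsup>l\<^esup>" "min_deg V l (pgr k i V (insert b B)) = hdeg (pgr k i V (insert b B)) S"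
        using min_deg_ex[OF V lV] by blast
      ultimately show False using i(2)[of S] by simp
    qed
  qed
qed

subsection \<open>The exact result\<close>

lemma has_perfect_matching_if_rpm:
  assumes "rpm k H {1..m} V" "k \<ge> 1"
  shows "has_perfect_matching (T_verts m V) (T_graph m H)"
proof -
  obtain P where P: "blocks k {1..m} V P" "\<forall>x\<in>{1..m}. P x \<in> H x" using assms by (auto simp: rpm_def)
  define E where "E x = {Inl x} \<union> Inr ` P x" for x
  have "pairwise disjnt (E ` {1..m})"
  proof (rule pairwiseI)
    fix e f assume "e \<in> E ` {1..m}" "f \<in> E ` {1..m}" "e \<noteq> f"
    then obtain x y where xy: "x \<in> {1..m}" "y \<in> {1..m}" "e = E x" "f = E y" "x \<noteq> y" by blast
    then have "P x \<inter> P y = {}" using P(1) by (auto simp: blocks_def disjoint_family_on_def)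
    then show "disjnt e f" using xy by (auto simp: E_def disjnt_def)
  qed
  moreover have "E ` {1..m} \<subseteq> T_graph m H" using P(2) by (auto simp: E_def T_graph_def)
  moreover have "\<Union>(E ` {1..m}) = T_verts m V"
  proof -
    have U: "(\<Union>x\<in>{1..m}. P x) = V" using P(1) by (simp add: blocks_def)
    have "\<Union>(E ` {1..m}) = Inl ` {1..m} \<union> Inr ` (\<Union>x\<in>{1..m}. P x)" by (auto simp: E_def)
    then show ?thesis by (simp only: U T_verts_def)
  qed
  ultimately show ?thesis unfolding has_perfect_matching_def by blast
qed

lemma exact_threshold:
  fixes k l :: nat
  assumes k3: "k \<ge> 3" and kl: "k \<le> 2 * l" "l < k"
  shows "\<exists>N. \<forall>(V :: 'a set) (H :: nat \<Rightarrow> 'a set set). finite V \<longrightarrow> k dvd card V \<longrightarrow> N \<le> card V \<longrightarrow>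
     (\<forall>i\<in>{1..card V div k}. kgraph_on V k (H i) \<and> min_deg V l (H i) > ext_delta V k l) \<longrightarrow>
     rpm k H {1..card V div k} V"
proof -
  define r where "r = k - l"
  have lr: "l + r = k" "r \<ge> 1" "2 * r \<le> k" "k - r = l" "l \<ge> 1" using kl k3 by (auto simp: r_def)
  define \<sigma> :: real where "\<sigma> = 1 / (4 * real (k + 1) * (32 * real k) ^ k)"
  have den: "4 * real (k + 1) * (32 * real k) ^ k > 0" using k3 by simp
  have \<sigma>: "\<sigma> > 0" "4 * real (k + 1) * (32 * real k) ^ k * \<sigma> \<le> 1"
    using den by (auto simp: \<sigma>_def)
  \<comment> \<open>The first two bounds turn the error and the imbalance from
    \<open>reach_or_parity\<close> into those allowed by \<open>rpm_if_near_parity\<close>; the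
    third is required by \<open>colgraphs_half\<close>.\<close>
  define \<eta> where "\<eta> = min (\<sigma> ^ 2 / (13 * real k)) (min (\<sigma> ^ k / (72 * real k)) (1 / (20 * real k)))"
  have \<eta>: "\<eta> > 0" "13 * real k * \<eta> \<le> \<sigma> ^ 2" "72 * real k * \<eta> \<le> \<sigma> ^ k" "20 * real k * \<eta> \<le> 1"
  proof -
    have e: "\<eta> \<le> \<sigma> ^ 2 / (13 * real k)" "\<eta> \<le> \<sigma> ^ k / (72 * real k)" "\<eta> \<le> 1 / (20 * real k)" by (auto simp: \<eta>_def)
    show "\<eta> > 0" using \<sigma> k3 by (simp add: \<eta>_def)
    show "13 * real k * \<eta> \<le> \<sigma> ^ 2" "72 * real k * \<eta> \<le> \<sigma> ^ k" "20 * real k * \<eta> \<le> 1"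
      using e k3 by (auto simp: field_simps)
  qed
  define W where "W = 16 * (real k + 1) * real k ^ Suc r"
  have Wpos: "W > 0" using k3 by (simp add: W_def)
  \<comment> \<open>Half of \<open>\<eta>\<close>, because passing from \<open>l\<close>-degrees to
    vertex degrees doubles the loss; \<open>1 / W\<close> is needed for
    \<open>rpm_if_reach\<close>.\<close>
  define \<theta> where "\<theta> = min (\<eta> / 2) (1 / W)"
  have \<theta>: "\<theta> > 0" "2 * \<theta> \<le> \<eta>" "16 * (real k + 1) * real k ^ Suc r * \<theta> \<le> 1"
  proof -
    have "W * \<theta> \<le> W * (1 / W)" using Wpos by (intro mult_left_mono) (auto simp: \<theta>_def)
    also have "W * (1 / W) = 1" using Wpos by simp
    finally show "16 * (real k + 1) * real k ^ Suc r * \<theta> \<le> 1" unfolding W_def .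
  qed (use \<eta> Wpos in \<open>auto simp: \<theta>_def\<close>)
  have \<eta>20: "\<eta> \<le> 1 / 60"
  proof -
    have "20 * 3 * \<eta> \<le> 20 * real k * \<eta>" using k3 \<eta> by (intro mult_right_mono) auto
    then show ?thesis using \<eta>(4) by linarith
  qed
  \<comment> \<open>The density that \<open>reach_or_parity\<close> delivers for this
    \<open>\<eta>\<close>.\<close>
  define \<beta> where "\<beta> = 1 / 2 * (1 / 20 * (\<eta> ^ 7 / 64) ^ k) ^ 2"
  have \<beta>: "0 < \<beta>" "\<beta> \<le> 1"
  proof -
    define y where "y = \<eta> ^ 7 / 64"
    define z where "z = 1 / 20 * y ^ k"
    have y: "0 < y" "y \<le> 1" using \<eta>(1) \<eta>20 power_le_one[of \<eta> 7] by (auto simp: y_def)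
    have z: "0 < z" using y by (simp add: z_def)
    have z1: "z \<le> 1" using power_le_one[of y k] y unfolding z_def by linarith
    have "0 < z ^ 2" "z ^ 2 \<le> 1" using z z1 by (auto intro: power_le_one)
    then show "0 < \<beta>" "\<beta> \<le> 1" unfolding \<beta>_def y_def[symmetric] z_def[symmetric] by linarith+
  qed
  have s1: "1 \<le> 2 * (1 + k * 3)" by simp
  obtain N1 where N1: "\<And>(X :: nat set) (V :: 'a set) H. card X \<ge> N1 \<Longrightarrow> colgraphs X V H k \<Longrightarrow>
     (\<forall>x\<in>X. \<forall>S\<subseteq>V. card S = k - r \<longrightarrow>
        (1 / 2 - \<theta>) * real (card V) ^ r \<le> real (card {T \<in> nlists V r. S \<union> set T \<in> H x})) \<Longrightarrow>
     (\<forall>u\<in>V. \<forall>v\<in>V. reach k H X V (2 * (1 + k * 3)) \<beta> u v) \<Longrightarrow> rpm k H X V"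
    using rpm_if_reach[OF k3 lr(2,3) s1 \<beta> \<theta>(1,3)] by blast
  \<comment> \<open>Makes the O(1/n) errors in the degree estimates at most
    \<open>\<theta>\<close>.\<close>
  define N2 where "N2 = nat \<lceil>real (1 + r * r + r * l + l * l) / \<theta>\<rceil>"
  define N3 where "N3 = 200 * k * k"
  show ?thesis
  proof (intro exI[of _ "k * (N1 + N2 + N3 + 2)"] allI impI)
    fix V :: "'a set" and H :: "nat \<Rightarrow> 'a set set"
    assume V: "finite V" and dvd: "k dvd card V" and N: "k * (N1 + N2 + N3 + 2) \<le> card V"
      and H: "\<forall>i\<in>{1..card V div k}. kgraph_on V k (H i) \<and> min_deg V l (H i) > ext_delta V k l"
    define X where "X = {1..card V div k}"
    have cX: "card X = card V div k" by (simp add: X_def)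
    have cV: "card V = k * card X" using dvd by (simp add: cX)
    have mN: "N1 + N2 + N3 + 2 \<le> card X"
    proof -
      have "k * (N1 + N2 + N3 + 2) \<le> k * card X" using N by (simp only: cV)
      then show ?thesis by (rule nat_mult_le_cancel1[of k, THEN iffD1, rotated]) (use k3 in simp)
    qed
    have mn: "card X \<le> card V" using k3 by (simp add: cV)
    have n2: "card V \<ge> 2" and Vne: "V \<noteq> {}" and Xne: "X \<noteq> {}" using mN mn by auto
    have lV: "l \<le> card V"
    proof -
      have "k * 1 \<le> k * card X" using mN by (intro mult_le_mono2) simp
      then have "k \<le> card V" by (simp only: cV mult_1_right)
      then show ?thesis using kl(2) by linarith
    qed
    have npos: "real (card V) > 0" using n2 by simp
    have bn: "real (1 + r * r + r * l + l * l) / real (card V) \<le> \<theta>"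
    proof -
      have "real (1 + r * r + r * l + l * l) / \<theta> \<le> real N2" unfolding N2_def by linarith
      also have "\<dots> \<le> real (card V)" using mN mn by simp
      finally show ?thesis using \<theta>(1) npos by (simp add: field_simps)
    qed
    have degl: "(1 / 2 - \<theta>) * real (card V) ^ r \<le> real (card {T \<in> nlists V r. S \<union> set T \<in> H x})"
      if x: "x \<in> X" and S: "S \<in> [V]\<^bsup>l\<^esup>" for x S
    proof -
      have "real (1 + r * r + r * l) / real (card V) \<le> real (1 + r * r + r * l + l * l) / real (card V)"
        by (intro divide_right_mono of_nat_mono) auto
      then have "1 / 2 - \<theta> \<le> 1 / 2 - real (1 + r * r + r * l) / real (card V)" using bn by linarith
      then have "(1 / 2 - \<theta>) * real (card V) ^ r \<le> (1 / 2 - real (1 + r * r + r * l) / real (card V)) * real (card V) ^ r"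
        by (rule mult_right_mono) simp
      also have "\<dots> \<le> real (card {T \<in> nlists V r. S \<union> set T \<in> H x})"
        using H x by (intro degree_from_ext_delta[OF V n2 lr(1,2) lV _ _ S]) (auto simp: X_def)
      finally show ?thesis .
    qed
    have ll: "real (l * l) / real (card V) \<le> \<theta>"
    proof -
      have "real (l * l) / real (card V) \<le> real (1 + r * r + r * l + l * l) / real (card V)"
        by (intro divide_right_mono of_nat_mono) auto
      then show ?thesis using bn by linarith
    qed
    have th0: "0 \<le> 1 / 2 - \<theta>" using \<theta>(2) \<eta>20 by linarith
    have deg1: "(1 / 2 - \<eta>) * real (card V) ^ (k - 1) \<le> real (card {S \<in> nlists V (k - 1). insert v (set S) \<in> H x})"
      if x: "x \<in> X" and v: "v \<in> V" for x v
    proof -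
      have "(1 / 2 - \<eta>) * real (card V) ^ (k - 1) \<le> (1 / 2 - 2 * \<theta>) * real (card V) ^ (k - 1)"
        using \<theta>(2) by (intro mult_right_mono) auto
      also have "\<dots> \<le> real (card {S \<in> nlists V (k - 1). insert v (set S) \<in> H x})"
        by (rule degree1_from_degree[OF V Vne lr(5,1) th0 v ll degl[OF x]])
      finally show ?thesis .
    qed
    interpret colgraphs_half X V H k \<eta>
    proof
      show "finite X" by (simp add: X_def)
      show "finite V" by (rule V)
      show "card V = k * card X" by (rule cV)
      show "V \<noteq> {}" by (rule Vne)
      show "2 \<le> k" using k3 by simp
      show "e \<subseteq> V \<and> card e = k" if "x \<in> X" "e \<in> H x" for x e
      proof -
        have "H x \<subseteq> [V]\<^bsup>k\<^esup>" using H that(1) by (simp add: X_def kgraph_on_def)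
        then show ?thesis using that(2) by (auto simp: nsets_def)
      qed
      show "2 / 5 * real (card V) ^ (k - 1) \<le> real (card {S \<in> nlists V (k - 1). insert v (set S) \<in> H x})"
        if "x \<in> X" "v \<in> V" for x v
      proof -
        have "2 / 5 * real (card V) ^ (k - 1) \<le> (1 / 2 - \<eta>) * real (card V) ^ (k - 1)"
          using \<eta>20 by (intro mult_right_mono) auto
        then show ?thesis using deg1[OF that] by linarith
      qed
      show "0 < \<eta>" by (rule \<eta>(1))
      show "20 * real k * \<eta> \<le> 1" by (rule \<eta>(4))
    qed (rule deg1)
    from reach_or_parity show "rpm k H {1..card V div k} V"
    proof
      assume R: "\<forall>u\<in>V. \<forall>v\<in>V. reach k H X V (2 * (1 + k * 3)) (1 / 2 * (1 / 20 * \<beta>\<^sub>0 ^ k) ^ 2) u v"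
      have "rpm k H X V"
      proof (rule N1)
        show "N1 \<le> card X" using mN by simp
        show "colgraphs X V H k" by (rule colgraphs_axioms)
        show "\<forall>x\<in>X. \<forall>S\<subseteq>V. card S = k - r \<longrightarrow>
          (1 / 2 - \<theta>) * real (card V) ^ r \<le> real (card {T \<in> nlists V r. S \<union> set T \<in> H x})"
        proof (intro ballI allI impI)
          fix x S assume x: "x \<in> X" and S: "S \<subseteq> V" "card S = k - r"
          have "S \<in> [V]\<^bsup>l\<^esup>" using S finite_subset[OF S(1) V] lr(4) by (simp add: nsets_def)
          then show "(1 / 2 - \<theta>) * real (card V) ^ r \<le> real (card {T \<in> nlists V r. S \<union> set T \<in> H x})"
            by (rule degl[OF x])
        qed
        show "\<forall>u\<in>V. \<forall>v\<in>V. reach k H X V (2 * (1 + k * 3)) \<beta> u v"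
          using R unfolding \<beta>_def \<beta>\<^sub>0_def .
      qed
      then show ?thesis by (simp add: X_def)
    next
      assume "\<exists>A\<subseteq>V. \<exists>t. (\<Sum>x\<in>X. real (card {e \<in> nlists V k. (set e \<in> H x) \<noteq> (npar A e = t x)})) \<le> 13 * real k * \<eta> * m * n ^ k \<and>
        \<bar>real (card (V - A)) - real (card A)\<bar> ^ k \<le> 72 * real k * \<eta> * n ^ k"
      then obtain A t where A: "A \<subseteq> V"
        "(\<Sum>x\<in>X. real (card {e \<in> nlists V k. (set e \<in> H x) \<noteq> (npar A e = t x)})) \<le> 13 * real k * \<eta> * m * n ^ k"
        "\<bar>real (card (V - A)) - real (card A)\<bar> ^ k \<le> 72 * real k * \<eta> * n ^ k" by blast
      have "rpm k H X V"
      proof (rule rpm_if_near_parity[OF k3 \<sigma> _ A(1)])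
        have "real (200 * k * k) \<le> real (card X)" using mN by (intro of_nat_mono) (simp add: N3_def)
        then show "200 * real k * real k \<le> m" by simp
        have "13 * real k * \<eta> * (m * n ^ k) \<le> \<sigma> ^ 2 * (m * n ^ k)" using \<eta>(2) by (intro mult_right_mono) auto
        then show "(\<Sum>x\<in>X. real (card {e \<in> nlists V k. (set e \<in> H x) \<noteq> (npar A e = t x)})) \<le> \<sigma> ^ 2 * m * n ^ k"
          using A(2) by (simp add: mult.assoc)
        have "72 * real k * \<eta> * n ^ k \<le> \<sigma> ^ k * n ^ k" using \<eta>(3) by (intro mult_right_mono) auto
        then have "\<bar>real (card (V - A)) - real (card A)\<bar> ^ k \<le> (\<sigma> * n) ^ k"
          using A(3) by (simp add: power_mult_distrib)
        moreover have "(\<sigma> * n) ^ k < \<bar>real (card (V - A)) - real (card A)\<bar> ^ k"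
          if "\<not> \<bar>real (card (V - A)) - real (card A)\<bar> \<le> \<sigma> * n"
          using that \<sigma>(1) k3 by (intro power_strict_mono) auto
        ultimately show "\<bar>real (card (V - A)) - real (card A)\<bar> \<le> \<sigma> * n" by linarith
        show "\<exists>x\<in>X. \<exists>e\<in>H x. odd (card (e \<inter> B)) \<noteq> s x"
          if "B \<subseteq> V" "even (card B) \<noteq> even (card {x \<in> X. s x})" for B s
          using H k3 that by (intro ex_wrong_edge[OF V finX Xne cV lr(1) _ lV]) (auto simp: X_def)
      qed
      then show ?thesis by (simp add: X_def)
    qed
  qed
qed

theorem mainTheorem2:
  fixes k l :: nat and \<epsilon> :: real
  assumes "k \<ge> 3" and "real k / 2 \<le> real l" and "l \<le> k - 1" and "\<epsilon> > 0"
  shows "\<exists>n\<^sub>0. \<forall>(V :: 'a set) n (H :: nat \<Rightarrow> 'a set set) Hext.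
           finite V \<and> card V = n \<and> n \<ge> n\<^sub>0 \<and> k dvd n \<and>
           (\<forall>i\<in>{1..n div k}. kgraph_on V k (H i)) \<and>
           is_Hext V k l Hext \<and>
           \<not> eps_close (k + 1) \<epsilon> (T_verts (n div k) V)
               (T_graph (n div k) H) (T_graph (n div k) (\<lambda>_. Hext)) \<and>
           (\<forall>i\<in>{1..n div k}. min_deg V l (H i) > ext_delta V k l)
           \<longrightarrow> has_perfect_matching (T_verts (n div k) V) (T_graph (n div k) H)"
proof -
  have kl: "k \<le> 2 * l" "l < k" using assms(1-3) by auto
  obtain N where N: "\<And>(V :: 'a set) (H :: nat \<Rightarrow> 'a set set). finite V \<Longrightarrow> k dvd card V \<Longrightarrow> N \<le> card V \<Longrightarrow>
     (\<forall>i\<in>{1..card V div k}. kgraph_on V k (H i) \<and> min_deg V l (H i) > ext_delta V k l) \<Longrightarrow>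
     rpm k H {1..card V div k} V"
    using exact_threshold[OF assms(1) kl] by blast
  show ?thesis
  proof (intro exI[of _ N] allI impI)
    fix V :: "'a set" and n and H :: "nat \<Rightarrow> 'a set set" and Hext
    assume "finite V \<and> card V = n \<and> n \<ge> N \<and> k dvd n \<and>
           (\<forall>i\<in>{1..n div k}. kgraph_on V k (H i)) \<and>
           is_Hext V k l Hext \<and>
           \<not> eps_close (k + 1) \<epsilon> (T_verts (n div k) V)
               (T_graph (n div k) H) (T_graph (n div k) (\<lambda>_. Hext)) \<and>
           (\<forall>i\<in>{1..n div k}. min_deg V l (H i) > ext_delta V k l)"
    then have h: "finite V" "card V = n" "N \<le> card V" "k dvd card V"
      "\<forall>i\<in>{1..card V div k}. kgraph_on V k (H i) \<and> min_deg V l (H i) > ext_delta V k l" by blast+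
    have "rpm k H {1..card V div k} V" by (rule N[OF h(1,4,3,5)])
    then show "has_perfect_matching (T_verts (n div k) V) (T_graph (n div k) H)"
      unfolding h(2) by (rule has_perfect_matching_if_rpm) (use assms(1) in simp)
  qed
qed



end
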